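(* Let $R>A$ and $\varepsilon\in(0,A)$. Let $U^*\in H^3_N(\Omega)$ satisfy $L(U^* )=0$ in $\Omega$ together with the boundary conditions $U^*=\varphi_0^*$, $\partial_nU^*=\varphi_1^*$ on $S_{bsc}$, $\partial_nU^*=0$ on the lateral faces $\{|x|=A\text{ or }|y|=A,\ z\in(-A,A)\}$ of $\Omega$ and on $S_{tr}$ (exact solution with noiseless data $\varphi_0^*,\varphi_1^*$), and let $F_1^*\in H^3_N(\Omega)$ be a vector function satisfying these same boundary conditions. For $\delta\in(0,1)$ let $F_1\in H^3_N(\Omega)$ satisfy the boundary conditions with noisy data, $F_1=\varphi_0$, $\partial_nF_1=\varphi_1$ on $S_{bsc}$, $\partial_nF_1=0$ on the lateral faces of $\Omega$ and on $S_{tr}$, and assume $\|F_1-F_1^*\|_{H^2_N(\Omega)}\le\delta$. Let $V_{\min,\delta}\in H^3_{0,bsc,N}(\Omega)$ be the (existing and unique) minimizer on $H^3_{0,bsc,N}(\Omega)$ of $$J_{\delta^2}(V)=\int_\Omega|L(V+F_1)|^2\,d\mathbf x+\delta^2\|V\|^2_{H^3_N(\Omega)},$$ and denote $U_{\min,\delta}=V_{\min,\delta}+F_1$. Let $q_{\min,\delta}=\mathcal Q(U_{\min,\delta})$ and $q^*=\mathcal Q(U^* )$, where $\mathcal Q$ is the reconstruction map defined in the context. Then there exist $\delta_0\in(0,1)$ and $\alpha\in(0,1/2)$ such that for all $\delta\in(0,\delta_0)$ the estimate $$\|U_{\min,\delta}-U^*\|_{H^2_N(\Omega_\varepsilon)}\le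 B\left(1+\|U^*\|_{H^3_N(\Omega)}+\|F_1^*\|_{H^3_N(\Omega)}\right)\delta^\alpha$$ holds and, with the same $\alpha$, also $$\|q_{\min,\delta}-q^*\|_{L_2(\Omega_\varepsilon)}\le B\left(1+\|U^*\|_{H^3_N(\Omega)}+\|F_1^*\|_{H^3_N(\Omega)}\right)\delta^\alpha .$$ Here $\Omega_\varepsilon=\{(x,y,z):-A<x,y<A,\ z\in(-A,A-\varepsilon)\}$, and $B>0$ denotes (possibly different) constants depending only on $A$, $R$, the operator $L$ and the parameters $b,d,N$ (in particular not on $\delta$, $U^*$, $F_1$, $F_1^*$).
   Context: All functions are real valued. Let $A,b,d>0$, let $N>1$ be an integer, and $\Omega=\{\mathbf x=(x,y,z)\in\mathbb R^3:-A<x,y,z<A\}$. Put $S_{bsc}=\{-A<x,y<A,\ z=-A\}$, $S_{tr}=\{-A<x,y<A,\ z=A\}$, $\partial_1\Omega=\partial\Omega\setminus\{z=A\}$; $n$ is the unit normal on the boundary. For a Banach space $Z$, $Z_m$ denotes the space of $m$-vectors $D=(D_1,\dots,D_m)$ with entries in $Z$ and norm $\|D\|_{Z_m}=(\sum_j\|D_j\|_Z^2)^{1/2}$; thus $H^k_N(\Omega)$ is the space of $N$-vector functions with components in $H^k(\Omega)$. $$H^3_{0,bsc}(\Omega)=\{u\in H^3(\Omega): u|_{S_{bsc}}=0,\ \partial_nu|_{\partial_1\Omega}=0\},$$ and $H^3_{0,bsc,N}(\Omega)$ is the corresponding space of $N$-vector functions. The operator $L$: let $\Psi_1,\dots,\Psi_N$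 be the first $N$ functions obtained by Gram–Schmidt orthonormalization in $L_2(-d,d)$ of the sequence $e^{x_0},x_0e^{x_0},x_0^2e^{x_0},\dots$. The $N\times N$ matrix $M_N=(a_{mn})$, $a_{mn}=\int_{-d}^d\Psi_n'\Psi_m\,dx_0$, is invertible. For $\mathbf x\in\overline\Omega$, $x_0\in(-d,d)$ let $\mathbf x_0=(x_0,0,-A-b)$ and $r=(r_1,r_2,r_3)=\mathbf x-\mathbf x_0=(x-x_0,\,y,\,z+A+b)$. Define $N\times N$ matrices $D_j(\mathbf x)$ with entries $$(D_j)_{mn}=-\int_{-d}^d\partial_{x_0}\!\left[\frac{2r_j\Psi_n(x_0)}{|r|^2}\right]\Psi_m(x_0)\,dx_0\ (j=1,2,3),\qquad (D_0)_{mn}=\int_{-d}^d\partial_{x_0}\!\left[\frac{4\Psi_n(x_0)}{|r|^2}\right]\Psi_m(x_0)\,dx_0,$$ and $A_j=M_N^{-1}D_j$, $j=0,1,2,3$; these have entries in $C(\overline\Omega)$. For an $N$-vector function $U$, $$L(U)=\Delta U+A_1(\mathbf x)U_x+A_2(\mathbf x)U_y+A_3(\mathbf x)U_z+A_0(\mathbf x)U.$$ The reconstruction map $\mathcal Q$: for $U=(u_1,\dots,u_N)^T$ with components in $H^2$, put $u(\mathbf x,x_0)=\sum_{n=1}^Nu_n(\mathbf x)\Psi_n(x_0)$ and, taking $x_0=0$, i.e. $\mathbf x_0=(0,0,-A-b)$, $$\mathcal Q(U)(\mathbf x)=-\left[\Delta_{\mathbf x}u-\frac{2}{|\mathbf x-\mathbf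 x_0|^2}\Big((\mathbf x-\mathbf x_0)\cdot\nabla_{\mathbf x}u-2u\Big)\right]_{x_0=0}.$$ *)

theory Defs
  imports "HOL-Analysis.Analysis"
begin

section \<open>Smooth functions and weak derivatives on open subsets of R^3\<close>

definition partial :: "3 \<Rightarrow> (real^3 \<Rightarrow> real) \<Rightarrow> real^3 \<Rightarrow> real" where
  "partial i f x = frechet_derivative f (at x) (axis i 1)"

fun Ck :: "nat \<Rightarrow> (real^3 \<Rightarrow> real) \<Rightarrow> bool" where
  "Ck 0 f \<longleftrightarrow> continuous_on UNIV f"
| "Ck (Suc k) f \<longleftrightarrow> f differentiable_on UNIV \<and> (\<forall>i. Ck k (partial i f))"

definition smooth :: "(real^3 \<Rightarrow> real) \<Rightarrow> bool" where
  "smooth f \<longleftrightarrow> (\<forall>k. Ck k f)"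

definition test_function :: "(real^3) set \<Rightarrow> (real^3 \<Rightarrow> real) \<Rightarrow> bool" where
  "test_function S f \<longleftrightarrow>
     smooth f \<and> compact (closure {x. f x \<noteq> 0}) \<and> closure {x. f x \<noteq> 0} \<subseteq> S"

text \<open>Multi-indices have type \<^typ>\<open>nat^3\<close>; \<^term>\<open>axis i 1\<close> and \<^term>\<open>axis i 2\<close> are the
  multi-indices of the first and of the pure second derivative in direction \<open>i\<close>.\<close>

definition mi_order :: "nat^3 \<Rightarrow> nat" where
  "mi_order a = (\<Sum>i\<in>UNIV. a $ i)"

definition mi_partial :: "nat^3 \<Rightarrow> (real^3 \<Rightarrow> real) \<Rightarrow> real^3 \<Rightarrow> real" where
  "mi_partial a f = (partial 1 ^^ (a $ 1)) ((partial 2 ^^ (a $ 2)) ((partial 3 ^^ (a $ 3)) f))"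

definition locally_integrable :: "(real^3) set \<Rightarrow> (real^3 \<Rightarrow> real) \<Rightarrow> bool" where
  "locally_integrable S f \<longleftrightarrow> (\<forall>K. compact K \<and> K \<subseteq> S \<longrightarrow> f absolutely_integrable_on K)"

definition is_weak_deriv ::
  "(real^3) set \<Rightarrow> nat^3 \<Rightarrow> (real^3 \<Rightarrow> real) \<Rightarrow> (real^3 \<Rightarrow> real) \<Rightarrow> bool" where
  "is_weak_deriv S a u w \<longleftrightarrow> locally_integrable S u \<and> locally_integrable S w \<and>
     (\<forall>f. test_function S f \<longrightarrow>
        (LINT x|lebesgue_on S. u x * mi_partial a f x)
          = (-1) ^ mi_order a * (LINT x|lebesgue_on S. w x * f x))"

text \<open>A representative of the weak derivative, which is unique up to null sets.\<close>

definition weak_deriv :: "(real^3) set \<Rightarrow> nat^3 \<Rightarrow> (real^3 \<Rightarrow> real) \<Rightarrow> real^3 \<Rightarrow> real" where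
  "weak_deriv S a u = (SOME w. is_weak_deriv S a u w)"

definition weak_grad :: "(real^3) set \<Rightarrow> (real^3 \<Rightarrow> real) \<Rightarrow> real^3 \<Rightarrow> real^3" where
  "weak_grad S u x = (\<chi> j. weak_deriv S (axis j 1) u x)"

definition weak_laplacian :: "(real^3) set \<Rightarrow> (real^3 \<Rightarrow> real) \<Rightarrow> real^3 \<Rightarrow> real" where
  "weak_laplacian S u x = (\<Sum>j\<in>UNIV. weak_deriv S (axis j 2) u x)"

section \<open>Square integrable functions and Sobolev spaces\<close>

text \<open>Elements of the function spaces are represented by functions on the whole type; only their
  values almost everywhere on \<open>S\<close> matter. The norms are meaningful (not the default value 0 of a
  divergent integral) on the corresponding spaces.\<close>

definition L2 :: "'a::euclidean_space set \<Rightarrow> ('a \<Rightarrow> real) set" where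
  "L2 S = {u. u \<in> borel_measurable (lebesgue_on S) \<and> integrable (lebesgue_on S) (\<lambda>x. (u x)\<^sup>2)}"

definition L2_norm :: "'a::euclidean_space set \<Rightarrow> ('a \<Rightarrow> real) \<Rightarrow> real" where
  "L2_norm S u = sqrt (LINT x|lebesgue_on S. (u x)\<^sup>2)"

definition Hk :: "nat \<Rightarrow> (real^3) set \<Rightarrow> (real^3 \<Rightarrow> real) set" where
  "Hk k S = {u. u \<in> L2 S \<and> (\<forall>a. mi_order a \<le> k \<longrightarrow> (\<exists>w\<in>L2 S. is_weak_deriv S a u w))}"

definition Hk_norm :: "nat \<Rightarrow> (real^3) set \<Rightarrow> (real^3 \<Rightarrow> real) \<Rightarrow> real" where
  "Hk_norm k S u = sqrt (\<Sum>a | mi_order a \<le> k. (L2_norm S (weak_deriv S a u))\<^sup>2)"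

definition HkN :: "nat \<Rightarrow> (real^3) set \<Rightarrow> (real^3 \<Rightarrow> real^'n) set" where
  "HkN k S = {U. \<forall>n. (\<lambda>x. U x $ n) \<in> Hk k S}"

definition HkN_norm :: "nat \<Rightarrow> (real^3) set \<Rightarrow> (real^3 \<Rightarrow> real^'n) \<Rightarrow> real" where
  "HkN_norm k S U = sqrt (\<Sum>n\<in>UNIV. (Hk_norm k S (\<lambda>x. U x $ n))\<^sup>2)"

section \<open>The cube and traces on its faces\<close>

definition Om :: "real \<Rightarrow> (real^3) set" where
  "Om A = {x. \<forall>i. - A < x $ i \<and> x $ i < A}"

definition Om_eps :: "real \<Rightarrow> real \<Rightarrow> (real^3) set" where
  "Om_eps A e = {x. - A < x $ 1 \<and> x $ 1 < A \<and> - A < x $ 2 \<and> x $ 2 < A \<and>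
                    - A < x $ 3 \<and> x $ 3 < A - e}"

text \<open>For \<open>s = 1\<close> or \<open>s = -1\<close>, the pair \<open>(i, s)\<close> denotes the open face of the cube on which the
  \<open>i\<close>-th coordinate is \<open>s * A\<close>; the outward unit normal on it is \<open>s\<close> times the \<open>i\<close>-th unit vector.
  The face is parametrized isometrically by the square, so that its surface measure is
  two-dimensional Lebesgue measure.\<close>

definition face_square :: "real \<Rightarrow> (real^2) set" where
  "face_square A = {p. \<forall>k. - A < p $ k \<and> p $ k < A}"

definition face_pt :: "real \<Rightarrow> 3 \<Rightarrow> real \<Rightarrow> real^2 \<Rightarrow> real^3" where
  "face_pt A i s p =
     (if i = 1 then vector [s * A, p $ 1, p $ 2]
      else if i = 2 then vector [p $ 1, s * A, p $ 2]
      else vector [p $ 1, p $ 2, s * A])"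

text \<open>\<open>g\<close> is the trace of \<open>u \<in> H\<^sup>1\<close> on the face: the trace operator is the continuous extension to
  \<open>H\<^sup>1\<close> of the restriction of functions that are smooth up to the boundary.\<close>

definition has_trace :: "real \<Rightarrow> 3 \<Rightarrow> real \<Rightarrow> (real^3 \<Rightarrow> real) \<Rightarrow> (real^3 \<Rightarrow> real) \<Rightarrow> bool" where
  "has_trace A i s u g \<longleftrightarrow>
     u \<in> Hk 1 (Om A) \<and> (\<lambda>p. g (face_pt A i s p)) \<in> L2 (face_square A) \<and>
     (\<exists>v :: nat \<Rightarrow> real^3 \<Rightarrow> real. (\<forall>k. smooth (v k)) \<and>
        (\<lambda>k. Hk_norm 1 (Om A) (\<lambda>x. v k x - u x)) \<longlonglongrightarrow> 0 \<and>
        (\<lambda>k. L2_norm (face_square A) (\<lambda>p. v k (face_pt A i s p) - g (face_pt A i s p))) \<longlonglongrightarrow> 0)"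

definition has_normal_deriv ::
  "real \<Rightarrow> 3 \<Rightarrow> real \<Rightarrow> (real^3 \<Rightarrow> real) \<Rightarrow> (real^3 \<Rightarrow> real) \<Rightarrow> bool" where
  "has_normal_deriv A i s u g \<longleftrightarrow>
     has_trace A i s (\<lambda>x. (s *\<^sub>R axis i 1) \<bullet> weak_grad (Om A) u x) g"

text \<open>The space of functions in \<open>H\<^sup>3\<close> vanishing on the face \<open>z = -A\<close> and with vanishing normal
  derivative on all faces except \<open>z = A\<close>.\<close>

definition H3_0bsc :: "real \<Rightarrow> (real^3 \<Rightarrow> real) set" where
  "H3_0bsc A = {u. u \<in> Hk 3 (Om A) \<and> has_trace A 3 (-1) u (\<lambda>x. 0) \<and>
     (\<forall>i. \<forall>s\<in>{-1, 1}. (i, s) \<noteq> (3, 1) \<longrightarrow> has_normal_deriv A i s u (\<lambda>x. 0))}"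

definition H3_0bscN :: "real \<Rightarrow> (real^3 \<Rightarrow> real^'n) set" where
  "H3_0bscN A = {U. \<forall>n. (\<lambda>x. U x $ n) \<in> H3_0bsc A}"

text \<open>Cauchy data \<open>p0\<close>, \<open>p1\<close> on the face \<open>z = -A\<close>, zero Neumann data on the lateral faces and on
  the face \<open>z = A\<close>.\<close>

definition boundary_data ::
  "real \<Rightarrow> (real^3 \<Rightarrow> real^'n) \<Rightarrow> (real^3 \<Rightarrow> real^'n) \<Rightarrow> (real^3 \<Rightarrow> real^'n) \<Rightarrow> bool" where
  "boundary_data A p0 p1 U \<longleftrightarrow> (\<forall>n.
     has_trace A 3 (-1) (\<lambda>x. U x $ n) (\<lambda>x. p0 x $ n) \<and>
     has_normal_deriv A 3 (-1) (\<lambda>x. U x $ n) (\<lambda>x. p1 x $ n) \<and>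
     (\<forall>i\<in>{1, 2}. \<forall>s\<in>{-1, 1}. has_normal_deriv A i s (\<lambda>x. U x $ n) (\<lambda>x. 0)) \<and>
     has_normal_deriv A 3 1 (\<lambda>x. U x $ n) (\<lambda>x. 0))"

section \<open>The orthonormal system and the operator L\<close>

definition ip :: "real \<Rightarrow> (real \<Rightarrow> real) \<Rightarrow> (real \<Rightarrow> real) \<Rightarrow> real" where
  "ip d f g = (LINT t:{-d<..<d}|lborel. f t * g t)"

text \<open>Gram--Schmidt orthonormalization of \<open>t ^ k * exp t\<close>, \<open>k = 0, 1, 2, \<dots>\<close>; the index starts
  at 0.\<close>

function Psi :: "real \<Rightarrow> nat \<Rightarrow> real \<Rightarrow> real" where
  "Psi d k = (let v = (\<lambda>t. t ^ k * exp t - (\<Sum>j<k. ip d (\<lambda>s. s ^ k * exp s) (Psi d j) * Psi d j t))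
              in (\<lambda>t. v t / sqrt (ip d v v)))"
  by pat_completeness auto
termination
  by (relation "Wellfounded.measure snd") auto

declare Psi.simps [simp del]

text \<open>The number \<open>N\<close> of components is \<open>CARD('n)\<close>. The elements of the index type, in increasing
  order, stand for the indices \<open>1, \<dots>, N\<close>: \<open>Psi_ix d n\<close> is the function whose 0-based number is
  the number of elements below \<open>n\<close>.\<close>

definition Psi_ix :: "real \<Rightarrow> 'n::{finite,linorder} \<Rightarrow> real \<Rightarrow> real" where
  "Psi_ix d n = Psi d (card {j. j < n})"

text \<open>Synonyms used to attach a sort to the index type of vectors and matrices.\<close>

type_synonym 'n rvec = "real^'n"
type_synonym 'n rmat = "real^'n^'n"

definition M_mat :: "real \<Rightarrow> 'n::{finite,linorder} rmat" where
  "M_mat d = (\<chi> m n. LINT t:{-d<..<d}|lborel. deriv (Psi_ix d n) t * Psi_ix d m t)"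

definition source :: "real \<Rightarrow> real \<Rightarrow> real \<Rightarrow> real^3" where
  "source A b t = vector [t, 0, - A - b]"

definition D_mat :: "real \<Rightarrow> real \<Rightarrow> real \<Rightarrow> 3 \<Rightarrow> real^3 \<Rightarrow> 'n::{finite,linorder} rmat" where
  "D_mat A b d j x = (\<chi> m n. - (LINT t:{-d<..<d}|lborel.
     deriv (\<lambda>\<tau>. 2 * (x - source A b \<tau>) $ j * Psi_ix d n \<tau> / (norm (x - source A b \<tau>))\<^sup>2) t
       * Psi_ix d m t))"

definition D0_mat :: "real \<Rightarrow> real \<Rightarrow> real \<Rightarrow> real^3 \<Rightarrow> 'n::{finite,linorder} rmat" where
  "D0_mat A b d x = (\<chi> m n. LINT t:{-d<..<d}|lborel.
     deriv (\<lambda>\<tau>. 4 * Psi_ix d n \<tau> / (norm (x - source A b \<tau>))\<^sup>2) t * Psi_ix d m t)"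

definition A_mat :: "real \<Rightarrow> real \<Rightarrow> real \<Rightarrow> 3 \<Rightarrow> real^3 \<Rightarrow> 'n::{finite,linorder} rmat" where
  "A_mat A b d j x = matrix_inv (M_mat d) ** D_mat A b d j x"

definition A0_mat :: "real \<Rightarrow> real \<Rightarrow> real \<Rightarrow> real^3 \<Rightarrow> 'n::{finite,linorder} rmat" where
  "A0_mat A b d x = matrix_inv (M_mat d) ** D0_mat A b d x"

definition L_op ::
  "real \<Rightarrow> real \<Rightarrow> real \<Rightarrow> (real^3 \<Rightarrow> 'n::{finite,linorder} rvec) \<Rightarrow> real^3 \<Rightarrow> 'n rvec" where
  "L_op A b d U x =
     (\<chi> n. weak_laplacian (Om A) (\<lambda>y. U y $ n) x)
     + (\<Sum>j\<in>UNIV. A_mat A b d j x *v (\<chi> n. weak_deriv (Om A) (axis j 1) (\<lambda>y. U y $ n) x))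
     + A0_mat A b d x *v U x"

definition J_fun ::
  "real \<Rightarrow> real \<Rightarrow> real \<Rightarrow> real \<Rightarrow> (real^3 \<Rightarrow> 'n::{finite,linorder} rvec) \<Rightarrow> (real^3 \<Rightarrow> 'n rvec) \<Rightarrow> real"
  where
  "J_fun A b d \<delta> F V =
     (LINT x|lebesgue_on (Om A). (norm (L_op A b d (\<lambda>y. V y + F y) x))\<^sup>2)
     + \<delta>\<^sup>2 * (HkN_norm 3 (Om A) V)\<^sup>2"

section \<open>The reconstruction map\<close>

definition Q_rec ::
  "real \<Rightarrow> real \<Rightarrow> real \<Rightarrow> (real^3 \<Rightarrow> 'n::{finite,linorder} rvec) \<Rightarrow> real^3 \<Rightarrow> real" where
  "Q_rec A b d U x =
     (let u = (\<lambda>y. \<Sum>n\<in>UNIV. U y $ n * Psi_ix d n 0);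
          r = x - source A b 0
      in - (weak_laplacian (Om A) u x
            - 2 / (norm r)\<^sup>2 * (r \<bullet> weak_grad (Om A) u x - 2 * u x)))"

end

theory Submission imports Defs begin

text \<open>The functions \<open>U_ex\<close> and \<open>F1_ex\<close> have the same boundary data, so \<open>V_ex = U_ex - F1_ex\<close> competes with the
  minimizer. Since \<open>L (V_ex + F1) = L (F1 - F1_ex)\<close> has size \<open>O(\<delta>)\<close> in \<open>L\<^sub>2\<close>, the value of the functional at
  \<open>V_ex\<close> is \<open>O(\<delta>\<^sup>2)\<close>. The same bound for the minimum says that \<open>L (V_min + F1)\<close> is \<open>O(\<delta>)\<close> and that \<open>V_min\<close> is
  bounded in \<open>H\<^sup>3\<close>, uniformly in \<open>\<delta>\<close> (lemma \<open>minimizer_bounds\<close>). Therefore \<open>W = V_min - V_ex\<close> vanishes together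
  with its normal derivative on the face \<open>z = -A\<close>, has a residual \<open>L W\<close> of size \<open>O(\<delta>)\<close>, and is bounded in
  \<open>H\<^sup>3\<close>. It differs from \<open>U_min - U_ex\<close> by \<open>F1 - F1_ex\<close>, which is at most \<open>\<delta>\<close>. So the theorem amounts
  to a stability estimate, conditional on an \<open>H\<^sup>3\<close> bound, for the Cauchy problem with data on one face.

  That estimate comes from a Carleman estimate with the weight \<open>exp (2 * \<lambda> * (z - R)\<^sup>2)\<close>, which decreases
  with the distance from the face carrying the data (lemma \<open>carleman_estimate\<close>). A cutoff in \<open>z\<close> removes the
  face \<open>z = A\<close>. In the region where its derivative lives the weight is smaller, by an exponential factor in \<open>\<lambda>\<close>,
  than in the region of interest, while the residual is multiplied at worst by \<open>exp (\<lambda> * a)\<close> (lemma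
  \<open>conditional_stability\<close>). The choice \<open>\<lambda> = ln (1 / \<delta>) / a\<close> bounds both errors by a power of \<open>\<delta>\<close>
  (lemma \<open>exp_power_tradeoff\<close>). This controls \<open>W\<close> and its first derivatives; the second derivatives are
  interpolated between the first ones and the bounded third ones (lemma \<open>second_derivative_bound\<close>).
  The reconstruction map is a second-order linear differential operator with bounded coefficients, so the
  estimate of the coefficient follows (lemma \<open>Q_rec_bound\<close>).

  Every integration by parts takes place on the cube, for functions whose boundary values are known only
  through traces. A function with zero trace on a face is an \<open>H\<^sup>1\<close> limit of smooth functions whose
  restrictions to that face tend to zero, and this makes its \<open>L\<^sub>2\<close> norm over a layer of thickness \<open>\<tau>\<close> at the face \<open>O(\<tau>)\<close> (lemma \<open>has_trace_0\<close>).
  Cutoffs that exhaust the cube have derivatives of size \<open>1 / \<tau>\<close> in such layers, so their contribution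
  vanishes in the limit (lemma \<open>integration_by_parts\<close>). The tangential derivatives of \<open>w\<close> on the face \<open>z = -A\<close>
  also vanish, but there the defining approximation is one of \<open>w\<close> only; the derivative is first moved
  to the other factor (lemma \<open>tangential_integration_by_parts\<close>).

  In the conclusion, \<open>\<delta>0\<close> and \<open>\<alpha>\<close> may depend on the exact solution and on its lift. A bound
  \<open>C * \<delta> powr (2 * \<alpha>)\<close> is at most \<open>\<delta> powr \<alpha>\<close> once \<open>\<delta>\<close> is small, so both constants can be taken to be 1.\<close>

section \<open>Calculus of smooth functions\<close>

lemma partial_eq:
  assumes "(f has_derivative f') (at x)"
  shows "partial i f x = f' (axis i 1)"
  using frechet_derivative_at[OF assms] by (simp add: partial_def)

lemma Ck_Suc_imp: "Ck (Suc k) f \<Longrightarrow> Ck k f"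
proof (induction k arbitrary: f)
  case 0
  then show ?case by (simp add: differentiable_imp_continuous_on)
qed auto

lemma Ck_differentiable: "Ck (Suc k) f \<Longrightarrow> f differentiable (at x)"
  by (simp add: differentiable_on_def)

lemma smooth_differentiable: "smooth f \<Longrightarrow> f differentiable (at x)"
  unfolding smooth_def using Ck_differentiable by blast

lemma smooth_continuous: "smooth f \<Longrightarrow> continuous_on S f"
  unfolding smooth_def using Ck.simps(1) continuous_on_subset by blast

lemma smooth_partial: "smooth f \<Longrightarrow> smooth (partial i f)"
  unfolding smooth_def by (metis Ck.simps(2))

lemma partial_add:
  assumes "f differentiable (at x)" "g differentiable (at x)"
  shows "partial i (\<lambda>x. f x + g x) x = partial i f x + partial i g x"
  using assms unfolding frechet_derivative_works
  by (intro trans[OF partial_eq[OF has_derivative_add]]) (auto simp: partial_def)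

lemma partial_mult:
  assumes "f differentiable (at x)" "g differentiable (at x)"
  shows "partial i (\<lambda>x. f x * g x) x = f x * partial i g x + partial i f x * g x"
  using assms unfolding frechet_derivative_works
  by (intro trans[OF partial_eq[OF has_derivative_mult]]) (auto simp: partial_def)

lemma partial_const [simp]: "partial i (\<lambda>x. c) x = 0"
  by (intro trans[OF partial_eq[OF has_derivative_const]]) auto

lemma partial_coord: "partial i (\<lambda>x. x $ j) x = (if i = j then 1 else 0)"
proof -
  have "((\<lambda>x::real^3. x $ j) has_derivative (\<lambda>x. x $ j)) (at x)"
    by (rule bounded_linear_imp_has_derivative[OF bounded_linear_vec_nth])
  from partial_eq[OF this] show ?thesis by (auto simp: axis_def)
qed

lemma Ck_const: "Ck k (\<lambda>x. c)"
proof (induction k arbitrary: c)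
  case (Suc k)
  have "partial i (\<lambda>x. c) = (\<lambda>x. 0)" for i by (rule ext) simp
  with Suc show ?case by simp
qed simp

lemma Ck_coord: "Ck k (\<lambda>x. x $ j)"
proof (cases k)
  case 0
  then show ?thesis by (simp add: continuous_on_component)
next
  case (Suc k)
  have "partial i (\<lambda>x. x $ j) = (\<lambda>x. if i = j then 1 else 0)" for i
    by (rule ext) (rule partial_coord)
  moreover have "(\<lambda>x::real^3. x $ j) differentiable_on UNIV"
    unfolding differentiable_on_def
    using bounded_linear_imp_differentiable[OF bounded_linear_vec_nth] by blast
  ultimately show ?thesis using Suc by (simp add: Ck_const)
qed

lemma Ck_add: "Ck k f \<Longrightarrow> Ck k g \<Longrightarrow> Ck k (\<lambda>x. f x + g x)"
proof (induction k arbitrary: f g)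
  case 0
  then show ?case by (simp add: continuous_on_add)
next
  case (Suc k)
  have "partial i (\<lambda>x. f x + g x) = (\<lambda>x. partial i f x + partial i g x)" for i
    by (rule ext) (rule partial_add[OF Ck_differentiable[OF Suc.prems(1)] Ck_differentiable[OF Suc.prems(2)]])
  with Suc show ?case by (simp add: differentiable_on_add)
qed

lemma Ck_mult: "Ck k f \<Longrightarrow> Ck k g \<Longrightarrow> Ck k (\<lambda>x. f x * g x)"
proof (induction k arbitrary: f g)
  case 0
  then show ?case by (simp add: continuous_on_mult)
next
  case (Suc k)
  have "partial i (\<lambda>x. f x * g x) = (\<lambda>x. f x * partial i g x + partial i f x * g x)" for i
    by (rule ext) (rule partial_mult[OF Ck_differentiable[OF Suc.prems(1)] Ck_differentiable[OF Suc.prems(2)]])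
  moreover have "Ck k (\<lambda>x. f x * partial i g x + partial i f x * g x)" for i
    using Suc.IH Suc.prems Ck_Suc_imp by (intro Ck_add Suc.IH) auto
  ultimately show ?case using Suc.prems by (simp add: differentiable_on_mult)
qed

text \<open>Closure under differentiation is stated for a family of functions, so that no sequence of
  derivatives has to be chosen.\<close>

definition smooth_real :: "(real \<Rightarrow> real) \<Rightarrow> bool" where
  "smooth_real g \<longleftrightarrow>
     (\<exists>F. g \<in> F \<and> (\<forall>h\<in>F. \<exists>h'\<in>F. \<forall>t. (h has_real_derivative h' t) (at t)))"

lemma smooth_real_deriv:
  assumes "smooth_real g"
  obtains g' where "smooth_real g'" "\<And>t. (g has_real_derivative g' t) (at t)"
proof -
  obtain F where F: "g \<in> F" "\<forall>h\<in>F. \<exists>h'\<in>F. \<forall>t. (h has_real_derivative h' t) (at t)"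
    using assms unfolding smooth_real_def by blast
  then obtain g' where "g' \<in> F" "\<forall>t. (g has_real_derivative g' t) (at t)" by blast
  with F(2) show ?thesis by (intro that[of g']) (auto simp: smooth_real_def)
qed

lemma Ck_compose:
  "smooth_real g \<Longrightarrow> Ck k u \<Longrightarrow> Ck k (\<lambda>x. g (u x))"
proof (induction k arbitrary: g)
  case 0
  then obtain g' where "\<And>t. (g has_real_derivative g' t) (at t)"
    using smooth_real_deriv by blast
  then have "continuous_on UNIV g"
    by (meson DERIV_isCont continuous_at_imp_continuous_on)
  with 0 show ?case
    by (auto intro: continuous_on_compose2)
next
  case (Suc k)
  obtain g' where g': "smooth_real g'" "\<And>t. (g has_real_derivative g' t) (at t)"
    using Suc.prems(1) smooth_real_deriv by blast
  have d: "((\<lambda>x. g (u x)) has_derivative (\<lambda>h. g' (u x) * frechet_derivative u (at x) h)) (at x)" for x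
  proof -
    have "(u has_derivative frechet_derivative u (at x)) (at x)"
      using Ck_differentiable[OF Suc.prems(2)] frechet_derivative_works by blast
    moreover have "(g has_derivative (*) (g' (u x))) (at (u x))"
      using g'(2) by (simp add: has_field_derivative_def)
    ultimately show ?thesis using has_derivative_compose[of u] by fastforce
  qed
  have "partial i (\<lambda>x. g (u x)) = (\<lambda>x. g' (u x) * partial i u x)" for i
    by (rule ext, subst partial_eq[OF d]) (simp add: partial_def)
  moreover have "Ck k (\<lambda>x. g' (u x) * partial i u x)" for i
    using Suc.IH[OF g'(1)] Suc.prems(2) Ck_Suc_imp by (intro Ck_mult) auto
  moreover have "(\<lambda>x. g (u x)) differentiable_on UNIV"
    using d by (auto simp: differentiable_on_def differentiable_def)
  ultimately show ?case by simp
qed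

lemma smooth_const [intro]: "smooth (\<lambda>x. c)"
  and smooth_coord [intro]: "smooth (\<lambda>x. x $ j)"
  and smooth_add [intro]: "smooth f \<Longrightarrow> smooth g \<Longrightarrow> smooth (\<lambda>x. f x + g x)"
  and smooth_mult [intro]: "smooth f \<Longrightarrow> smooth g \<Longrightarrow> smooth (\<lambda>x. f x * g x)"
  and smooth_compose: "smooth_real h \<Longrightarrow> smooth f \<Longrightarrow> smooth (\<lambda>x. h (f x))"
  by (auto simp: smooth_def Ck_const Ck_coord Ck_add Ck_mult Ck_compose)

lemma smooth_minus [intro]: "smooth f \<Longrightarrow> smooth (\<lambda>x. - f x)"
  using smooth_mult[OF smooth_const[of "-1"], of f] by simp

lemma smooth_diff [intro]: "smooth f \<Longrightarrow> smooth g \<Longrightarrow> smooth (\<lambda>x. f x - g x)"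
  using smooth_add[OF _ smooth_minus, of f g] by simp

lemma smooth_power [intro]: "smooth f \<Longrightarrow> smooth (\<lambda>x. f x ^ n)"
  by (induction n) auto

lemma smooth_prod [intro]:
  "(\<And>i. i \<in> I \<Longrightarrow> smooth (f i)) \<Longrightarrow> smooth (\<lambda>x. \<Prod>i\<in>I. f i x)"
  by (induction I rule: infinite_finite_induct) auto

lemma smooth_real_exp: "smooth_real exp"
  unfolding smooth_real_def by (rule exI[of _ "{exp}"]) (auto intro: DERIV_exp)

lemma partial_chain:
  assumes "(g has_real_derivative g') (at (u x))" "u differentiable (at x)"
  shows "partial i (\<lambda>x. g (u x)) x = g' * partial i u x"
proof -
  have "(u has_derivative frechet_derivative u (at x)) (at x)"
    using assms(2) frechet_derivative_works by blast
  moreover have "(g has_derivative (*) g') (at (u x))"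
    using assms(1) by (simp add: has_field_derivative_def)
  ultimately have "((\<lambda>x. g (u x)) has_derivative (\<lambda>h. g' * frechet_derivative u (at x) h)) (at x)"
    using has_derivative_compose[of u] by fastforce
  then show ?thesis by (subst partial_eq) (auto simp: partial_def)
qed

lemma partial_coord_fun:
  assumes "(g has_real_derivative g') (at (x $ j))"
  shows "partial i (\<lambda>x. g (x $ j)) x = (if i = j then g' else 0)"
  using partial_chain[of g g' "\<lambda>x. x $ j" x i] assms
    smooth_differentiable[OF smooth_coord[of j], of x] partial_coord by simp

subsection \<open>Symmetry of second derivatives\<close>

lemma has_real_derivative_along_axis:
  assumes "f differentiable (at (y + t *\<^sub>R axis i 1))"
  shows "((\<lambda>t. f (y + t *\<^sub>R axis i 1)) has_real_derivative
            partial i f (y + t *\<^sub>R axis i 1)) (at t)"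
proof -
  have "(f has_derivative frechet_derivative f (at (y + t *\<^sub>R axis i 1))) (at (y + t *\<^sub>R axis i 1))"
    using assms frechet_derivative_works by blast
  moreover have "((\<lambda>t. y + t *\<^sub>R axis i 1) has_derivative (\<lambda>h. h *\<^sub>R axis i (1::real))) (at t)"
    by (auto intro!: derivative_eq_intros)
  ultimately have d: "((\<lambda>t. f (y + t *\<^sub>R axis i 1)) has_derivative
      (\<lambda>h. frechet_derivative f (at (y + t *\<^sub>R axis i 1)) (h *\<^sub>R axis i 1))) (at t)"
    using has_derivative_compose[of "\<lambda>t. y + t *\<^sub>R axis i 1"] by fastforce
  have "linear (frechet_derivative f (at (y + t *\<^sub>R axis i 1)))"
    using assms by (rule linear_frechet_derivative)
  then have "(\<lambda>h. frechet_derivative f (at (y + t *\<^sub>R axis i 1)) (h *\<^sub>R axis i 1))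
      = (*) (partial i f (y + t *\<^sub>R axis i 1))"
    by (intro ext) (simp add: partial_def linear_cmul mult.commute)
  with d show ?thesis by (simp add: has_field_derivative_def)
qed

text \<open>A second difference of side \<open>h\<close> is \<open>h\<^sup>2\<close> times a mixed second derivative at some point of
  the parallelogram; applying this in both orders and letting \<open>h\<close> tend to 0 gives the symmetry.\<close>

lemma second_difference:
  assumes "smooth f" "h > 0"
  shows "\<exists>s t. 0 \<le> s \<and> s \<le> h \<and> 0 \<le> t \<and> t \<le> h \<and>
     f (x + h *\<^sub>R axis i 1 + h *\<^sub>R axis j 1) - f (x + h *\<^sub>R axis i 1) - f (x + h *\<^sub>R axis j 1) + f x
     = h\<^sup>2 * partial j (partial i f) (x + s *\<^sub>R axis i 1 + t *\<^sub>R axis j 1)"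
proof -
  define \<phi> where "\<phi> s = f (x + h *\<^sub>R axis j 1 + s *\<^sub>R axis i 1) - f (x + s *\<^sub>R axis i 1)" for s
  have "(\<phi> has_real_derivative partial i f (x + h *\<^sub>R axis j 1 + s *\<^sub>R axis i 1)
          - partial i f (x + s *\<^sub>R axis i 1)) (at s)" for s
    unfolding \<phi>_def
    by (intro DERIV_diff has_real_derivative_along_axis smooth_differentiable assms)
  then obtain s where s: "0 < s" "s < h" "\<phi> h - \<phi> 0 = h * (partial i f (x + h *\<^sub>R axis j 1 + s *\<^sub>R axis i 1)
          - partial i f (x + s *\<^sub>R axis i 1))"
    using MVT2[of 0 h \<phi> "\<lambda>s. partial i f (x + h *\<^sub>R axis j 1 + s *\<^sub>R axis i 1)
          - partial i f (x + s *\<^sub>R axis i 1)"] assms(2) by auto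
  have "((\<lambda>t. partial i f (x + s *\<^sub>R axis i 1 + t *\<^sub>R axis j 1)) has_real_derivative
      partial j (partial i f) (x + s *\<^sub>R axis i 1 + t *\<^sub>R axis j 1)) (at t)" for t
    by (intro has_real_derivative_along_axis smooth_differentiable smooth_partial assms)
  then obtain t where t: "0 < t" "t < h"
    "partial i f (x + s *\<^sub>R axis i 1 + h *\<^sub>R axis j 1) - partial i f (x + s *\<^sub>R axis i 1 + 0 *\<^sub>R axis j 1)
      = h * partial j (partial i f) (x + s *\<^sub>R axis i 1 + t *\<^sub>R axis j 1)"
    using MVT2[of 0 h "\<lambda>t. partial i f (x + s *\<^sub>R axis i 1 + t *\<^sub>R axis j 1)"
       "\<lambda>t. partial j (partial i f) (x + s *\<^sub>R axis i 1 + t *\<^sub>R axis j 1)"] assms(2) by auto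
  show ?thesis
    apply (rule exI[of _ s], rule exI[of _ t])
    using s t unfolding \<phi>_def by (simp add: algebra_simps power2_eq_square)
qed

lemma partial_commute:
  assumes "smooth f"
  shows "partial i (partial j f) x = partial j (partial i f) x"
proof -
  define \<Delta> where "\<Delta> h = (f (x + h *\<^sub>R axis i 1 + h *\<^sub>R axis j 1)
     - f (x + h *\<^sub>R axis i 1) - f (x + h *\<^sub>R axis j 1) + f x) / h\<^sup>2" for h
  define D where "D n = \<Delta> (inverse (real (Suc n)))" for n
  have lim: "D \<longlonglongrightarrow> partial l (partial k f) x" if kl: "{k, l} = {i, j}" for k l
  proof -
    have "\<exists>s t. 0 \<le> s \<and> s \<le> inverse (real (Suc n)) \<and> 0 \<le> t \<and> t \<le> inverse (real (Suc n)) \<and>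
      D n = partial l (partial k f) (x + s *\<^sub>R axis k 1 + t *\<^sub>R axis l 1)" for n
    proof -
      define h where "h = inverse (real (Suc n))"
      have h: "h > 0" by (simp add: h_def)
      obtain s t where st: "0 \<le> s" "s \<le> h" "0 \<le> t" "t \<le> h"
        "f (x + h *\<^sub>R axis k 1 + h *\<^sub>R axis l 1) - f (x + h *\<^sub>R axis k 1) - f (x + h *\<^sub>R axis l 1) + f x
        = h\<^sup>2 * partial l (partial k f) (x + s *\<^sub>R axis k 1 + t *\<^sub>R axis l 1)"
        using second_difference[OF assms h] by blast
      have "D n = (f (x + h *\<^sub>R axis k 1 + h *\<^sub>R axis l 1) - f (x + h *\<^sub>R axis k 1) - f (x + h *\<^sub>R axis l 1) + f x) / h\<^sup>2"
        using kl unfolding D_def h_def[symmetric] \<Delta>_def by (auto simp: doubleton_eq_iff algebra_simps)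
      with st h show ?thesis unfolding h_def[symmetric]
        by (intro exI[of _ s] exI[of _ t]) simp
    qed
    then obtain s t where st: "\<And>n. 0 \<le> s n" "\<And>n. s n \<le> inverse (real (Suc n))"
      "\<And>n. 0 \<le> t n" "\<And>n. t n \<le> inverse (real (Suc n))"
      "\<And>n. D n = partial l (partial k f) (x + s n *\<^sub>R axis k 1 + t n *\<^sub>R axis l 1)"
      by metis
    have "s \<longlonglongrightarrow> 0" "t \<longlonglongrightarrow> 0"
      by (rule tendsto_sandwich[OF _ _ tendsto_const LIMSEQ_inverse_real_of_nat]; use st in auto)+
    then have "(\<lambda>n. x + s n *\<^sub>R axis k 1 + t n *\<^sub>R axis l 1) \<longlonglongrightarrow> x + 0 *\<^sub>R axis k 1 + 0 *\<^sub>R axis l 1"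
      by (intro tendsto_intros)
    moreover have "isCont (partial l (partial k f)) x"
      using smooth_continuous[OF smooth_partial[OF smooth_partial[OF assms]], of UNIV]
      by (simp add: continuous_on_eq_continuous_at)
    ultimately show ?thesis unfolding st(5)
      using isCont_tendsto_compose by fastforce
  qed
  show ?thesis
    using lim[of i j] lim[of j i] LIMSEQ_unique by blast
qed

lemma smooth_funpow_partial: "smooth f \<Longrightarrow> smooth ((partial i ^^ n) f)"
  by (induction n) (auto intro: smooth_partial)

lemma funpow_partial_commute:
  "smooth f \<Longrightarrow> (partial i ^^ n) (partial j f) = partial j ((partial i ^^ n) f)"
proof (induction n)
  case (Suc n)
  have "partial i (partial j ((partial i ^^ n) f)) = partial j (partial i ((partial i ^^ n) f))"
    by (rule ext) (intro partial_commute smooth_funpow_partial Suc.prems)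
  with Suc show ?case by simp
qed simp

lemma mi_partial_partial:
  "smooth f \<Longrightarrow> mi_partial a (partial j f) = partial j (mi_partial a f)"
  unfolding mi_partial_def by (simp add: funpow_partial_commute smooth_funpow_partial)

lemma mi_partial_add_axis:
  assumes "smooth f"
  shows "mi_partial (a + axis j 1) f = partial j (mi_partial a f)"
  using assms exhaust_3[of j] unfolding mi_partial_def
  by (auto simp: axis_def funpow_partial_commute smooth_funpow_partial)

lemma mi_partial_0 [simp]: "mi_partial 0 f = f"
  by (simp add: mi_partial_def)

lemma mi_partial_axis: "smooth f \<Longrightarrow> mi_partial (axis j 1) f = partial j f"
  using mi_partial_add_axis[of f 0 j] by simp

subsection \<open>Bumps and cutoffs\<close>

definition flat_exp :: "real \<Rightarrow> real" where
  "flat_exp t = (if t > 0 then exp (- (1 / t)) else 0)"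

lemma poly_times_exp_tendsto_0:
  "((\<lambda>x::real. x ^ n * poly p x * exp (- x)) \<longlongrightarrow> 0) at_top"
proof (induction p arbitrary: n)
  case (pCons a p)
  have "((\<lambda>x::real. a * (x ^ n / exp x) + x ^ Suc n * poly p x * exp (- x)) \<longlongrightarrow> a * 0 + 0) at_top"
    by (intro tendsto_add tendsto_mult_left tendsto_power_div_exp_0 pCons.IH)
  then show ?case by (simp add: exp_minus field_simps)
qed simp

lemma smooth_real_flat_exp: "smooth_real flat_exp"
proof -
  define G where "G p = (\<lambda>t::real. if t > 0 then poly p (1 / t) * exp (- (1 / t)) else 0)" for p
  have d: "(G p has_real_derivative G ([:0,0,1:] * (p - pderiv p)) t) (at t)" for p t
  proof -
    consider "t > 0" | "t < 0" | "t = 0" by linarith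
    then show ?thesis
    proof cases
      case 1
      have "((\<lambda>t. poly p (1 / t) * exp (- (1 / t))) has_real_derivative
              G ([:0,0,1:] * (p - pderiv p)) t) (at t)"
        using 1 by (auto intro!: derivative_eq_intros simp: G_def field_simps power2_eq_square)
      then show ?thesis
        by (rule has_field_derivative_transform_within[of _ _ _ _ t])
          (use 1 in \<open>auto simp: G_def dist_real_def\<close>)
    next
      case 2
      have "((\<lambda>t. 0) has_real_derivative G ([:0,0,1:] * (p - pderiv p)) t) (at t)"
        using 2 by (simp add: G_def)
      then show ?thesis
        by (rule has_field_derivative_transform_within[of _ _ _ _ "-t"])
          (use 2 in \<open>auto simp: G_def dist_real_def\<close>)
    next
      case 3
      have "((\<lambda>y. y ^ 1 * poly p y * exp (- y)) \<longlongrightarrow> 0) at_top"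
        by (rule poly_times_exp_tendsto_0)
      then have "((\<lambda>h. inverse h ^ 1 * poly p (inverse h) * exp (- inverse h)) \<longlongrightarrow> 0) (at_right 0)"
        by (rule filterlim_compose[OF _ filterlim_inverse_at_top_right])
      then have R: "((\<lambda>h. (G p h - G p 0) / h) \<longlongrightarrow> 0) (at_right 0)"
        by (rule tendsto_cong[THEN iffD1, rotated])
          (auto simp: eventually_at_right_less G_def field_simps intro!: eventually_mono[OF eventually_at_right_less[of 0]])
      have L: "((\<lambda>h. (G p h - G p 0) / h) \<longlongrightarrow> 0) (at_left 0)"
        by (rule tendsto_cong[THEN iffD1, OF _ tendsto_const])
          (auto simp: G_def intro!: eventually_mono[OF eventually_at_left_real[of "-1" 0]])
      from L R have "((\<lambda>h. (G p h - G p 0) / h) \<longlongrightarrow> 0) (at 0)"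
        by (rule filterlim_split_at)
      then show ?thesis using 3 by (simp add: has_field_derivative_iff G_def)
    qed
  qed
  have "flat_exp = G 1" by (rule ext) (simp add: flat_exp_def G_def)
  with d show ?thesis unfolding smooth_real_def
    by (intro exI[of _ "range G"]) (metis rangeE rangeI)
qed

lemma flat_exp_pos: "t > 0 \<Longrightarrow> flat_exp t > 0"
  and flat_exp_nonpos: "t \<le> 0 \<Longrightarrow> flat_exp t = 0"
  and flat_exp_nonneg: "flat_exp t \<ge> 0"
  and flat_exp_le_1: "flat_exp t \<le> 1"
  by (auto simp: flat_exp_def)

lemma flat_exp_mono: "s \<le> t \<Longrightarrow> flat_exp s \<le> flat_exp t"
  by (auto simp: flat_exp_def frac_le)

text \<open>The inner \<open>flat_exp\<close> is constantly 0 for \<open>t \<ge> 1\<close> and at least \<open>exp (-1)\<close> for \<open>t \<le> 0\<close>; the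
  outer one turns the second property into vanishing.\<close>

definition step :: "real \<Rightarrow> real" where
  "step t = flat_exp (flat_exp 1 - flat_exp (1 - t)) / flat_exp (flat_exp 1)"

lemma step_0: "t \<le> 0 \<Longrightarrow> step t = 0"
  unfolding step_def using flat_exp_mono[of 1 "1 - t"] by (simp add: flat_exp_nonpos)

lemma step_1: "t \<ge> 1 \<Longrightarrow> step t = 1"
  unfolding step_def using less_imp_neq[OF flat_exp_pos[OF flat_exp_pos[of 1]]] by (auto simp: flat_exp_nonpos)

lemma step_nonneg: "step t \<ge> 0" and step_le_1: "step t \<le> 1"
  unfolding step_def using flat_exp_pos[OF flat_exp_pos[of 1]]
    flat_exp_mono[of "flat_exp 1 - flat_exp (1 - t)" "flat_exp 1"] flat_exp_nonneg
  by (auto simp: divide_le_eq)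

lemma smooth_step: "smooth f \<Longrightarrow> smooth (\<lambda>x. step (f x))"
  unfolding step_def divide_inverse
  by (intro smooth_mult smooth_const smooth_compose[OF smooth_real_flat_exp] smooth_diff)

lemma step_derivative_bounded:
  obtains s' C where "\<And>t. (step has_real_derivative s' t) (at t)" "\<And>t. \<bar>s' t\<bar> \<le> C" "C > 0"
    "\<And>t. t < 0 \<or> t > 1 \<Longrightarrow> s' t = 0" "continuous_on UNIV s'"
proof -
  obtain g' where g': "smooth_real g'" "\<And>t. (flat_exp has_real_derivative g' t) (at t)"
    using smooth_real_deriv[OF smooth_real_flat_exp] by blast
  obtain g'' where g'': "\<And>t. (g' has_real_derivative g'' t) (at t)"
    using smooth_real_deriv[OF g'(1)] by blast
  have c: "continuous_on UNIV g'" "continuous_on UNIV flat_exp"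
    using g'' g'(2) by (meson DERIV_isCont continuous_at_imp_continuous_on)+
  define s' where "s' t = g' (flat_exp 1 - flat_exp (1 - t)) * g' (1 - t) / flat_exp (flat_exp 1)" for t
  have d: "(step has_real_derivative s' t) (at t)" for t
  proof -
    have "((\<lambda>t. flat_exp (1 - t)) has_real_derivative g' (1 - t) * (- 1)) (at t)"
      by (rule DERIV_chain2[OF g'(2)]) (auto intro!: derivative_eq_intros)
    then have "((\<lambda>t. flat_exp 1 - flat_exp (1 - t)) has_real_derivative g' (1 - t)) (at t)"
      by (auto intro!: derivative_eq_intros)
    from DERIV_cdivide[OF DERIV_chain2[OF g'(2) this]] show ?thesis
      by (simp add: step_def[abs_def] s'_def)
  qed
  have c1: "continuous_on UNIV (\<lambda>t::real. 1 - t)"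
    by (intro continuous_intros)
  have c2: "continuous_on UNIV (\<lambda>t. flat_exp 1 - flat_exp (1 - t))"
    by (rule continuous_on_diff[OF continuous_on_const continuous_on_compose2[OF c(2) c1]]) simp
  have cs: "continuous_on UNIV s'" unfolding s'_def divide_inverse
    by (rule continuous_on_mult[OF continuous_on_mult[OF continuous_on_compose2[OF c(1) c2]
          continuous_on_compose2[OF c(1) c1]] continuous_on_const]) simp_all
  have z: "s' t = 0" if "t < 0 \<or> t > 1" for t
  proof -
    have "(step has_real_derivative 0) (at t)"
    proof (cases "t < 0")
      case True
      have "step x = 0" if "dist x t < - t" for x
        using that by (intro step_0) (simp add: dist_real_def abs_if split: if_splits)
      with True show ?thesis
        by (intro has_field_derivative_transform_within[OF DERIV_const, of "- t" t UNIV 0]) simp_all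
    next
      case False
      with that have t: "t > 1" by simp
      have "step x = 1" if "dist x t < t - 1" for x
        using that by (intro step_1) (simp add: dist_real_def abs_if split: if_splits)
      with t show ?thesis
        by (intro has_field_derivative_transform_within[OF DERIV_const, of "t - 1" t UNIV 1]) simp_all
    qed
    then show ?thesis using d by (rule DERIV_unique[symmetric])
  qed
  have "bounded (s' ` {0..1})"
    by (intro compact_imp_bounded compact_continuous_image continuous_on_subset[OF cs]) auto
  then obtain C where C: "\<forall>t\<in>{0..1}. \<bar>s' t\<bar> \<le> C" by (auto simp: bounded_iff)
  show ?thesis
  proof (rule that[of s' "\<bar>C\<bar> + 1"])
    show "\<bar>s' t\<bar> \<le> \<bar>C\<bar> + 1" for t
      using C z[of t] by (cases "t < 0 \<or> t > 1") (force simp: not_less)+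
  qed (use d cs z in auto)
qed

section \<open>Square integrable functions\<close>

lemma L2_measurable: "f \<in> L2 S \<Longrightarrow> f \<in> borel_measurable (lebesgue_on S)"
  and L2_integrable_sq: "f \<in> L2 S \<Longrightarrow> integrable (lebesgue_on S) (\<lambda>x. (f x)\<^sup>2)"
  by (auto simp: L2_def)

lemma L2_mult_integrable:
  assumes "f \<in> L2 S" "g \<in> L2 S"
  shows "integrable (lebesgue_on S) (\<lambda>x. f x * g x)"
proof (rule Bochner_Integration.integrable_bound)
  show "integrable (lebesgue_on S) (\<lambda>x. (f x)\<^sup>2 + (g x)\<^sup>2)"
    using assms by (simp add: L2_def)
  show "(\<lambda>x. f x * g x) \<in> borel_measurable (lebesgue_on S)"
    using assms by (intro borel_measurable_times L2_measurable)
  have "norm (f x * g x) \<le> norm ((f x)\<^sup>2 + (g x)\<^sup>2)" for x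
  proof -
    have "2 * (\<bar>f x\<bar> * \<bar>g x\<bar>) \<le> (f x)\<^sup>2 + (g x)\<^sup>2"
      using sum_squares_bound[of "\<bar>f x\<bar>" "\<bar>g x\<bar>"] by simp
    moreover have "0 \<le> \<bar>f x\<bar> * \<bar>g x\<bar>" by simp
    ultimately have "\<bar>f x\<bar> * \<bar>g x\<bar> \<le> (f x)\<^sup>2 + (g x)\<^sup>2" by linarith
    then show ?thesis by (simp add: abs_mult)
  qed
  then show "AE x in lebesgue_on S. norm (f x * g x) \<le> norm ((f x)\<^sup>2 + (g x)\<^sup>2)" by simp
qed

lemma L2_add:
  assumes "f \<in> L2 S" "g \<in> L2 S"
  shows "(\<lambda>x. f x + g x) \<in> L2 S"
  using assms L2_mult_integrable[OF assms] borel_measurable_add[of f "lebesgue_on S" g]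
  by (simp add: L2_def power2_sum mult.assoc)

lemma L2_mult_bounded:
  assumes f: "f \<in> L2 S" and g: "g \<in> borel_measurable (lebesgue_on S)"
    and b: "\<And>x. x \<in> S \<Longrightarrow> \<bar>g x\<bar> \<le> C" and S: "S \<in> sets lebesgue"
  shows "(\<lambda>x. g x * f x) \<in> L2 S"
proof -
  have m: "(\<lambda>x. g x * f x) \<in> borel_measurable (lebesgue_on S)"
    using L2_measurable[OF f] g by (intro borel_measurable_times)
  have i: "integrable (lebesgue_on S) (\<lambda>x. C\<^sup>2 * (f x)\<^sup>2)"
    using L2_integrable_sq[OF f] by simp
  have "norm ((g x * f x)\<^sup>2) \<le> norm (C\<^sup>2 * (f x)\<^sup>2)" if "x \<in> S" for x
    using power_mono[OF b[OF that], of 2] by (simp add: power_mult_distrib mult_right_mono)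
  then have "AE x in lebesgue_on S. norm ((g x * f x)\<^sup>2) \<le> norm (C\<^sup>2 * (f x)\<^sup>2)"
    by (intro AE_I2) simp
  then have "integrable (lebesgue_on S) (\<lambda>x. (g x * f x)\<^sup>2)"
    by (rule Bochner_Integration.integrable_bound[OF i borel_measurable_power[OF m]])
  with m show ?thesis by (simp add: L2_def)
qed

lemma L2_cmult: "f \<in> L2 S \<Longrightarrow> (\<lambda>x. c * f x) \<in> L2 S"
  by (auto simp: L2_def power_mult_distrib)

lemma L2_minus: "f \<in> L2 S \<Longrightarrow> (\<lambda>x. - f x) \<in> L2 S"
  by (auto simp: L2_def)

lemma L2_diff: "f \<in> L2 S \<Longrightarrow> g \<in> L2 S \<Longrightarrow> (\<lambda>x. f x - g x) \<in> L2 S"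
  using L2_add[OF _ L2_minus, of f S g] by simp

lemma L2_zero: "(\<lambda>x. 0) \<in> L2 S"
  by (auto simp: L2_def)

lemma L2_sum: "(\<And>i. i \<in> I \<Longrightarrow> f i \<in> L2 S) \<Longrightarrow> (\<lambda>x. \<Sum>i\<in>I. f i x) \<in> L2 S"
  by (induction I rule: infinite_finite_induct) (auto intro: L2_zero L2_add)

lemma L2_cong_AE:
  assumes "f \<in> L2 S" "AE x in lebesgue_on S. f x = g x"
    "S \<in> sets lebesgue"
  shows "g \<in> L2 S"
proof -
  have "(\<lambda>x. indicator S x *\<^sub>R f x) \<in> borel_measurable lebesgue"
    using L2_measurable[OF assms(1)] assms(3)
    by (subst borel_measurable_restrict_space_iff[symmetric]) auto
  moreover have "AE x in lebesgue. indicator S x *\<^sub>R f x = indicator S x *\<^sub>R g x"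
    using assms(2,3) by (auto simp: AE_restrict_space_iff indicator_def elim!: eventually_mono)
  ultimately have "(\<lambda>x. indicator S x *\<^sub>R g x) \<in> borel_measurable lebesgue"
    by (rule borel_measurable_AE)
  then have g: "g \<in> borel_measurable (lebesgue_on S)"
    using assms(3) by (subst borel_measurable_restrict_space_iff) auto
  have "integrable (lebesgue_on S) (\<lambda>x. (f x)\<^sup>2) = integrable (lebesgue_on S) (\<lambda>x. (g x)\<^sup>2)"
  proof (rule integrable_cong_AE)
    show "AE x in lebesgue_on S. (f x)\<^sup>2 = (g x)\<^sup>2"
      using assms(2) by (rule eventually_mono) simp
  qed (use g L2_measurable[OF assms(1)] in simp_all)
  with g L2_integrable_sq[OF assms(1)] show ?thesis by (simp add: L2_def)
qed

lemma L2_norm_nonneg: "L2_norm S f \<ge> 0"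
  by (simp add: L2_norm_def)

lemma L2_norm_sq: "(L2_norm S f)\<^sup>2 = (LINT x|lebesgue_on S. (f x)\<^sup>2)"
  by (simp add: L2_norm_def)

lemma L2_norm_cong_AE:
  assumes "f \<in> borel_measurable (lebesgue_on S)" "g \<in> borel_measurable (lebesgue_on S)"
    "AE x in lebesgue_on S. f x = g x"
  shows "L2_norm S f = L2_norm S g"
  unfolding L2_norm_def
  by (intro arg_cong[where f = sqrt] integral_cong_AE) (use assms in \<open>auto elim!: eventually_mono\<close>)

lemma L2_Cauchy_Schwarz:
  assumes "f \<in> L2 S" "g \<in> L2 S"
  shows "\<bar>LINT x|lebesgue_on S. f x * g x\<bar> \<le> L2_norm S f * L2_norm S g"
proof -
  let ?I = "\<lambda>h. LINT x|lebesgue_on S. h x"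
  have "0 \<le> ?I (\<lambda>x. (f x)\<^sup>2) * t\<^sup>2 + 2 * ?I (\<lambda>x. f x * g x) * t + ?I (\<lambda>x. (g x)\<^sup>2)" for t
  proof -
    have "0 \<le> ?I (\<lambda>x. (t * f x + g x)\<^sup>2)" by simp
    also have "\<dots> = ?I (\<lambda>x. t\<^sup>2 * (f x)\<^sup>2 + (2 * t) * (f x * g x) + (g x)\<^sup>2)"
      by (intro Bochner_Integration.integral_cong refl) (simp add: power2_sum power_mult_distrib)
    also have "\<dots> = t\<^sup>2 * ?I (\<lambda>x. (f x)\<^sup>2) + (2 * t) * ?I (\<lambda>x. f x * g x) + ?I (\<lambda>x. (g x)\<^sup>2)"
      using L2_integrable_sq[OF assms(1)] L2_integrable_sq[OF assms(2)] L2_mult_integrable[OF assms]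
      by (subst Bochner_Integration.integral_add, simp, simp)+ simp
    finally show ?thesis by (simp add: algebra_simps)
  qed
  note q = this
  have "(?I (\<lambda>x. f x * g x))\<^sup>2 \<le> ?I (\<lambda>x. (f x)\<^sup>2) * ?I (\<lambda>x. (g x)\<^sup>2)"
  proof (cases "?I (\<lambda>x. (f x)\<^sup>2) = 0")
    case True
    define c G where "c = ?I (\<lambda>x. f x * g x)" and "G = ?I (\<lambda>x. (g x)\<^sup>2)"
    have "c = 0"
    proof (rule ccontr)
      assume "c \<noteq> 0"
      with q[of "- (G + 1) / (2 * c)"] True show False
        by (simp add: c_def[symmetric] G_def[symmetric])
    qed
    with True show ?thesis by (simp add: c_def)
  next
    case False
    define F c G where "F = ?I (\<lambda>x. (f x)\<^sup>2)" and "c = ?I (\<lambda>x. f x * g x)" and "G = ?I (\<lambda>x. (g x)\<^sup>2)"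
    have F: "F > 0" using False by (simp add: F_def order_less_le)
    have "0 \<le> F * (F * (- c / F)\<^sup>2 + 2 * c * (- c / F) + G)"
      using q[of "- c / F"] F by (simp add: F_def c_def G_def)
    also have "\<dots> = F * G - c\<^sup>2"
      using F by (simp add: field_simps power2_eq_square)
    finally show ?thesis by (simp add: F_def c_def G_def)
  qed
  then have "sqrt ((?I (\<lambda>x. f x * g x))\<^sup>2) \<le> sqrt (?I (\<lambda>x. (f x)\<^sup>2) * ?I (\<lambda>x. (g x)\<^sup>2))"
    by (rule real_sqrt_le_mono)
  then show ?thesis by (simp add: L2_norm_def real_sqrt_mult)
qed

lemma L2_norm_triangle:
  assumes "f \<in> L2 S" "g \<in> L2 S"
  shows "L2_norm S (\<lambda>x. f x + g x) \<le> L2_norm S f + L2_norm S g"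
proof (rule power2_le_imp_le)
  have "(L2_norm S (\<lambda>x. f x + g x))\<^sup>2 = (LINT x|lebesgue_on S. (f x)\<^sup>2 + (g x)\<^sup>2 + 2 * (f x * g x))"
    unfolding L2_norm_sq by (intro Bochner_Integration.integral_cong refl) (simp add: power2_sum)
  also have "\<dots> = (L2_norm S f)\<^sup>2 + (L2_norm S g)\<^sup>2 + 2 * (LINT x|lebesgue_on S. f x * g x)"
    unfolding L2_norm_sq
    using L2_integrable_sq[OF assms(1)] L2_integrable_sq[OF assms(2)] L2_mult_integrable[OF assms]
    by (subst Bochner_Integration.integral_add, simp, simp)+ simp
  also have "\<dots> \<le> (L2_norm S f + L2_norm S g)\<^sup>2"
    using L2_Cauchy_Schwarz[OF assms] by (simp add: power2_sum)
  finally show "(L2_norm S (\<lambda>x. f x + g x))\<^sup>2 \<le> (L2_norm S f + L2_norm S g)\<^sup>2" .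
qed (simp add: L2_norm_nonneg)

lemma L2_norm_cmult: "L2_norm S (\<lambda>x. c * f x) = \<bar>c\<bar> * L2_norm S f"
  by (simp add: L2_norm_def power_mult_distrib real_sqrt_mult)

lemma L2_norm_mult_bounded:
  assumes f: "f \<in> L2 S" and g: "g \<in> borel_measurable (lebesgue_on S)"
    and b: "\<And>x. x \<in> S \<Longrightarrow> \<bar>g x\<bar> \<le> C" and S: "S \<in> sets lebesgue" and C: "C \<ge> 0"
  shows "L2_norm S (\<lambda>x. g x * f x) \<le> C * L2_norm S f"
proof (rule power2_le_imp_le)
  have "(L2_norm S (\<lambda>x. g x * f x))\<^sup>2 \<le> (LINT x|lebesgue_on S. C\<^sup>2 * (f x)\<^sup>2)"
    unfolding L2_norm_sq
  proof (rule integral_mono)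
    show "integrable (lebesgue_on S) (\<lambda>x. (g x * f x)\<^sup>2)"
      using L2_integrable_sq[OF L2_mult_bounded[OF f g b S]] .
    show "integrable (lebesgue_on S) (\<lambda>x. C\<^sup>2 * (f x)\<^sup>2)"
      using f by (simp add: L2_def)
    show "(g x * f x)\<^sup>2 \<le> C\<^sup>2 * (f x)\<^sup>2" if "x \<in> space (lebesgue_on S)" for x
      using power_mono[OF b[of x], of 2] that by (simp add: power_mult_distrib mult_right_mono)
  qed
  then show "(L2_norm S (\<lambda>x. g x * f x))\<^sup>2 \<le> (C * L2_norm S f)\<^sup>2"
    by (simp add: L2_norm_sq power_mult_distrib)
qed (simp add: L2_norm_nonneg C)

lemma L2_norm_sum_le:
  assumes "finite I" "\<And>i. i \<in> I \<Longrightarrow> f i \<in> L2 S"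
  shows "L2_norm S (\<lambda>x. \<Sum>i\<in>I. f i x) \<le> (\<Sum>i\<in>I. L2_norm S (f i))"
  using assms
proof (induction I rule: finite_induct)
  case empty
  then show ?case by (simp add: L2_norm_def)
next
  case (insert i I)
  then have "L2_norm S (\<lambda>x. f i x + (\<Sum>i\<in>I. f i x)) \<le> L2_norm S (f i) + L2_norm S (\<lambda>x. \<Sum>i\<in>I. f i x)"
    by (intro L2_norm_triangle L2_sum) auto
  with insert show ?case by simp
qed

lemma L2_limit_integral:
  assumes "\<And>k. f k \<in> L2 S" "f0 \<in> L2 S" "g \<in> L2 S"
    and lim: "(\<lambda>k. L2_norm S (\<lambda>x. f k x - f0 x)) \<longlonglongrightarrow> 0"
  shows "(\<lambda>k. LINT x|lebesgue_on S. f k x * g x) \<longlonglongrightarrow> (LINT x|lebesgue_on S. f0 x * g x)"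
proof -
  have "(\<lambda>k. LINT x|lebesgue_on S. (f k x - f0 x) * g x) \<longlonglongrightarrow> 0"
  proof (rule tendsto_rabs_zero_cancel, rule tendsto_sandwich[OF _ _ tendsto_const])
    show "(\<lambda>k. L2_norm S (\<lambda>x. f k x - f0 x) * L2_norm S g) \<longlonglongrightarrow> 0"
      using tendsto_mult_left_zero[OF lim] by simp
    show "\<forall>\<^sub>F k in sequentially. \<bar>LINT x|lebesgue_on S. (f k x - f0 x) * g x\<bar>
        \<le> L2_norm S (\<lambda>x. f k x - f0 x) * L2_norm S g"
      using assms by (intro always_eventually allI L2_Cauchy_Schwarz L2_diff)
  qed simp
  moreover have "(LINT x|lebesgue_on S. (f k x - f0 x) * g x)
      = (LINT x|lebesgue_on S. f k x * g x) - (LINT x|lebesgue_on S. f0 x * g x)" for k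
    using L2_mult_integrable assms by (subst Bochner_Integration.integral_diff[symmetric])
      (auto simp: left_diff_distrib)
  ultimately show ?thesis by (simp add: LIM_zero_iff)
qed

lemma L2_integrable_finite:
  assumes "f \<in> L2 S" "S \<in> lmeasurable"
  shows "integrable (lebesgue_on S) f"
proof -
  have "(\<lambda>x. 1) \<in> L2 S" using assms(2)
    by (auto simp: L2_def integrable_restrict_space lmeasurable_iff_integrable fmeasurableD)
  from L2_mult_integrable[OF assms(1) this] show ?thesis by simp
qed

lemma integral_lebesgue_on_subset:
  fixes f :: "'a::euclidean_space \<Rightarrow> real"
  assumes "S \<in> sets lebesgue" "T \<in> sets lebesgue" "S \<subseteq> T"
  shows "(LINT x|lebesgue_on S. f x) = (LINT x|lebesgue_on T. indicator S x * f x)"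
    and "integrable (lebesgue_on S) f \<longleftrightarrow> integrable (lebesgue_on T) (\<lambda>x. indicator S x * f x)"
proof -
  have "(\<lambda>x. indicator T x *\<^sub>R (indicator S x * f x)) = (\<lambda>x. indicator S x *\<^sub>R f x)"
    using assms(3) by (intro ext) (auto simp: indicator_def)
  then show "(LINT x|lebesgue_on S. f x) = (LINT x|lebesgue_on T. indicator S x * f x)"
    "integrable (lebesgue_on S) f \<longleftrightarrow> integrable (lebesgue_on T) (\<lambda>x. indicator S x * f x)"
    using assms by (simp_all add: integral_restrict_space integrable_restrict_space)
qed

lemma AE_lebesgue_on_subset:
  assumes "S \<in> sets lebesgue" "T \<in> sets lebesgue" "S \<subseteq> T" "AE x in lebesgue_on T. P x"
  shows "AE x in lebesgue_on S. P x"
  using assms by (auto simp: AE_restrict_space_iff elim!: eventually_mono)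

lemma measurable_lebesgue_on_subset:
  assumes "f \<in> borel_measurable (lebesgue_on T)" "S \<subseteq> T"
  shows "f \<in> borel_measurable (lebesgue_on S)"
  using measurable_restrict_mono[OF assms] .

lemma L2_subset:
  assumes "f \<in> L2 T" "S \<subseteq> T" "S \<in> sets lebesgue" "T \<in> sets lebesgue"
  shows "f \<in> L2 S" "(LINT x|lebesgue_on S. (f x)\<^sup>2) \<le> (LINT x|lebesgue_on T. (f x)\<^sup>2)"
proof -
  have m: "indicator S \<in> borel_measurable (lebesgue_on T)"
    using assms by (intro borel_measurable_indicator) (auto simp: sets_restrict_space_iff)
  have i: "integrable (lebesgue_on T) (\<lambda>x. indicator S x * (f x)\<^sup>2)"
    using borel_measurable_times[OF m borel_measurable_power[OF L2_measurable[OF assms(1)], of 2]]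
    by (intro Bochner_Integration.integrable_bound[OF L2_integrable_sq[OF assms(1)]])
      (auto simp: indicator_def)
  then show "f \<in> L2 S"
    using assms measurable_lebesgue_on_subset[OF L2_measurable[OF assms(1)] assms(2)]
    by (simp add: L2_def integral_lebesgue_on_subset(2)[of S T])
  show "(LINT x|lebesgue_on S. (f x)\<^sup>2) \<le> (LINT x|lebesgue_on T. (f x)\<^sup>2)"
    using assms i L2_integrable_sq[OF assms(1)]
    by (subst integral_lebesgue_on_subset(1)[of S T]) (auto intro!: integral_mono simp: indicator_def)
qed

section \<open>Uniqueness of weak derivatives\<close>

lemma open_lebesgue: "open S \<Longrightarrow> S \<in> sets lebesgue"
  by (simp add: borel_open)

lemma AE_box_iff_cbox: "AE x in lebesgue. x \<in> cbox a b \<longleftrightarrow> x \<in> box a b"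
proof -
  have "AE x in lebesgue. x \<notin> cbox a b - box a b"
    using negligible_frontier_interval[of a b] by (intro AE_not_in) (simp add: negligible_iff_null_sets)
  then show ?thesis by (rule eventually_mono) (use box_subset_cbox in blast)
qed

text \<open>Boxes form an intersection-stable generator of the Borel sets, so the integral of the function over
  every Borel set, and hence over every Lebesgue set, is zero.\<close>

lemma integral_zero_boxes_imp_AE:
  fixes g :: "'a::euclidean_space \<Rightarrow> real"
  assumes g: "integrable (lebesgue_on (cbox a b)) g"
    and z: "\<And>c d. cbox c d \<subseteq> cbox a b \<Longrightarrow> (LINT x|lebesgue_on (cbox c d). g x) = 0"
  shows "AE x in lebesgue_on (cbox a b). g x = 0"
proof -
  define h where "h x = indicator (cbox a b) x * g x" for x
  have h: "integrable lebesgue h"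
    using g unfolding h_def[abs_def] by (subst (asm) integrable_restrict_space) simp_all
  have h_mult: "integrable lebesgue (\<lambda>x. indicator A x * h x)" if "A \<in> sets lebesgue" for A
    using integrable_mult_indicator[OF that h] by simp
  have hz: "(LINT x|lebesgue. indicator (cbox c d) x * h x) = 0" for c d
  proof -
    obtain c' d' where cd: "cbox c d \<inter> cbox a b = cbox c' d'"
      using Int_interval[of c d a b] by blast
    have "indicator (cbox c d) x * h x = indicator (cbox c' d') x *\<^sub>R g x" for x
      unfolding h_def cd[symmetric] by (auto simp: indicator_def)
    then have "(LINT x|lebesgue. indicator (cbox c d) x * h x) = (LINT x|lebesgue_on (cbox c' d'). g x)"
      by (subst integral_restrict_space) simp_all
    with z[of c' d'] cd show ?thesis by auto
  qed
  have borel: "(LINT x|lebesgue. indicator A x * h x) = 0" if "A \<in> sets borel" for A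
  proof -
    let ?E = "range (\<lambda>(c, d). box c d) :: 'a set set"
    have 1: "Int_stable ?E" unfolding Int_stable_def
      by (auto simp: box_Int_box)
    have "sets (borel :: 'a measure) = sigma_sets UNIV ?E"
      by (simp add: borel_eq_box)
    with that have 2: "A \<in> sigma_sets UNIV ?E" by auto
    have 3: "?E \<subseteq> Pow UNIV" by simp
    from 1 3 2 show ?thesis
    proof (induction rule: sigma_sets_induct_disjoint)
      case (basic A)
      then obtain c d where A: "A = box c d" by auto
      have "(LINT x|lebesgue. indicator A x * h x) = (LINT x|lebesgue. indicator (cbox c d) x * h x)"
      proof (rule integral_cong_AE)
        show "AE x in lebesgue. indicator A x * h x = indicator (cbox c d) x * h x"
          using AE_box_iff_cbox[of c d] by (rule eventually_mono) (auto simp: A indicator_def)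
      qed (auto intro!: borel_measurable_integrable h_mult simp: A borel_open)
      with hz show ?case by simp
    next
      case empty
      then show ?case by simp
    next
      case (compl A)
      then have A: "A \<in> sets lebesgue"
        using \<open>sets borel = sigma_sets UNIV ?E\<close> by (metis sets_completionI_sets sets_lborel)
      have "(LINT x|lebesgue. indicator (UNIV - A) x * h x)
          = (LINT x|lebesgue. h x - indicator A x * h x)"
        by (intro Bochner_Integration.integral_cong) (auto simp: indicator_def)
      also have "\<dots> = (LINT x|lebesgue. h x)"
        using compl A by (simp add: Bochner_Integration.integral_diff[OF h h_mult])
      also have "\<dots> = (LINT x|lebesgue. indicator (cbox a b) x * h x)"
        by (intro Bochner_Integration.integral_cong) (auto simp: h_def indicator_def)
      finally show ?case using hz by simp
    next
      case (union A)
      then have A: "A i \<in> sets lebesgue" for i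
        using \<open>sets borel = sigma_sets UNIV ?E\<close> by (metis sets_completionI_sets sets_lborel range_subsetD)
      have "(LINT x:(\<Union>i. A i)|lebesgue. h x) = (\<Sum>i. LINT x:A i|lebesgue. h x)"
        using union A by (intro lebesgue_integral_countable_add)
          (auto simp: set_integrable_def disjoint_family_on_def h_mult)
      also have "\<dots> = 0" using union by (simp add: set_lebesgue_integral_def)
      finally show ?case by (simp add: set_lebesgue_integral_def)
    qed
  qed
  have "(LINT x:A|lebesgue. h x) = 0" if "A \<in> sets lebesgue" for A
  proof -
    from that obtain S N N' where SN: "A = S \<union> N" "N \<subseteq> N'" "N' \<in> null_sets lborel" "S \<in> sets lborel"
      by (auto elim: sets_completionE)
    have "AE x in lebesgue. x \<notin> N'"
      using SN(3) by (intro AE_not_in) (simp add: null_sets_completionI)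
    then have "AE x in lebesgue. indicator A x * h x = indicator S x * h x"
      by (rule AE_mp) (use SN(1,2) in \<open>auto simp: indicator_def\<close>)
    moreover have "A \<in> sets lebesgue" "S \<in> sets lebesgue" using that SN by auto
    ultimately have "(LINT x|lebesgue. indicator A x * h x) = (LINT x|lebesgue. indicator S x * h x)"
      using h_mult by (intro integral_cong_AE) (auto intro: borel_measurable_integrable)
    then show ?thesis using borel SN(4) by (simp add: set_lebesgue_integral_def)
  qed
  then have "AE x in lebesgue. h x = 0"
    using density_unique_real[OF h integrable_zero] by (simp add: set_lebesgue_integral_def)
  then show ?thesis
    by (auto simp: AE_restrict_space_iff h_def elim!: eventually_mono)
qed

text \<open>The products of flat exponentials are test functions increasing to the indicator of a box,
  so a function orthogonal to all test functions has mean zero on every box.\<close>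

lemma weak_zero_imp_AE_zero:
  assumes S: "open S" and g: "locally_integrable S g"
    and z: "\<And>f. test_function S f \<Longrightarrow> (LINT x|lebesgue_on S. g x * f x) = 0"
  shows "AE x in lebesgue_on S. g x = 0"
proof -
  have box: "(LINT x|lebesgue_on (cbox a b). g x) = 0" if ab: "cbox a b \<subseteq> S" for a b
  proof -
    define \<phi> where "\<phi> n x = (\<Prod>i\<in>UNIV. flat_exp (real n * (x $ i - a $ i)) * flat_exp (real n * (b $ i - x $ i)))"
      for n :: nat and x :: "real^3"
    have sm: "smooth (\<phi> n)" for n unfolding \<phi>_def
      by (intro smooth_prod smooth_mult smooth_compose[OF smooth_real_flat_exp] smooth_const smooth_diff smooth_coord)
    have zero: "\<phi> n x = 0" if "x \<notin> box a b" for n x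
    proof -
      from that obtain i where "x $ i \<le> a $ i \<or> b $ i \<le> x $ i"
        by (auto simp: mem_box_cart not_less)
      then have "flat_exp (real n * (x $ i - a $ i)) * flat_exp (real n * (b $ i - x $ i)) = 0"
        by (auto intro!: flat_exp_nonpos mult_nonneg_nonpos)
      then show ?thesis unfolding \<phi>_def by (intro prod_zero) auto
    qed
    have sub: "closure {x. \<phi> n x \<noteq> 0} \<subseteq> cbox a b" for n
      using zero box_subset_cbox by (intro closure_minimal) blast+
    then have "test_function S (\<phi> n)" for n
      unfolding test_function_def using sm ab
      by (metis bounded_cbox bounded_subset closed_closure compact_eq_bounded_closed subset_trans)
    then have "(LINT x|lebesgue_on S. g x * \<phi> n x) = 0" for n by (rule z)
    moreover have "(LINT x|lebesgue_on (cbox a b). g x * \<phi> n x) = (LINT x|lebesgue_on S. g x * \<phi> n x)" for n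
    proof -
      have "indicator (cbox a b) x * (g x * \<phi> n x) = g x * \<phi> n x" for x
        using zero[of x n] box_subset_cbox[of a b] by (cases "x \<in> cbox a b") auto
      note e = this
      show ?thesis
        unfolding integral_lebesgue_on_subset(1)[OF fmeasurableD[OF lmeasurable_cbox] open_lebesgue[OF S] ab] e ..
    qed
    ultimately have i0: "(LINT x|lebesgue_on (cbox a b). g x * \<phi> n x) = 0" for n by simp
    have gi: "integrable (lebesgue_on (cbox a b)) g"
      using g ab unfolding locally_integrable_def
      by (intro absolutely_integrable_imp_integrable) auto
    have "\<bar>flat_exp s\<bar> \<le> 1" for s using flat_exp_le_1 flat_exp_nonneg by simp
    then have ab1: "\<bar>\<phi> n x\<bar> \<le> 1" for n x
      unfolding \<phi>_def abs_prod abs_mult by (intro prod_le_1 conjI mult_nonneg_nonneg mult_le_one) auto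
    have lim: "(\<lambda>n. \<phi> n x) \<longlonglongrightarrow> indicator (box a b) x" for x
    proof (cases "x \<in> box a b")
      case True
      have fe: "(\<lambda>n. flat_exp (real n * c)) \<longlonglongrightarrow> 1" if "c > 0" for c
      proof -
        have "(\<lambda>n. exp (- (inverse (real n) * inverse c))) \<longlonglongrightarrow> exp (- (0 * inverse c))"
          by (intro tendsto_intros lim_inverse_n)
        then have "(\<lambda>n. exp (- (inverse (real n) * inverse c))) \<longlonglongrightarrow> 1"
          by (simp only: mult_zero_left minus_zero exp_zero)
        then show ?thesis
          by (rule Lim_transform_eventually)
            (use that in \<open>auto simp: flat_exp_def field_simps eventually_at_top_linorder intro!: exI[of _ 1]\<close>)
      qed
      have "(\<lambda>n. \<phi> n x) \<longlonglongrightarrow> (\<Prod>i\<in>(UNIV::3 set). 1 * 1)"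
        unfolding \<phi>_def by (intro tendsto_prod tendsto_mult fe) (use True in \<open>auto simp: mem_box_cart\<close>)
      with True show ?thesis by simp
    next
      case False
      then show ?thesis by (simp add: zero)
    qed
    have "(\<lambda>n. LINT x|lebesgue_on (cbox a b). g x * \<phi> n x) \<longlonglongrightarrow> (LINT x|lebesgue_on (cbox a b). g x * indicator (box a b) x)"
    proof (rule integral_dominated_convergence[where w = "\<lambda>x. \<bar>g x\<bar>"])
      have cm: "continuous_on (cbox a b) (\<phi> n)" for n using sm smooth_continuous by blast
      then have pm: "\<phi> n \<in> borel_measurable (lebesgue_on (cbox a b))" for n
        by (intro continuous_imp_measurable_on_sets_lebesgue) auto
      then show "(\<lambda>x. g x * \<phi> n x) \<in> borel_measurable (lebesgue_on (cbox a b))" for n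
        using gi by (intro borel_measurable_times) auto
      show "(\<lambda>x. g x * indicator (box a b) x) \<in> borel_measurable (lebesgue_on (cbox a b))"
        using gi by (intro borel_measurable_times borel_measurable_indicator)
          (auto simp: sets_restrict_space_iff box_subset_cbox)
      show "AE x in lebesgue_on (cbox a b). norm (g x * \<phi> n x) \<le> \<bar>g x\<bar>" for n
        using ab1 by (intro AE_I2) (simp add: abs_mult mult_left_le)
    qed (use gi lim in \<open>auto intro!: tendsto_mult\<close>)
    with i0 have "(LINT x|lebesgue_on (cbox a b). g x * indicator (box a b) x) = 0"
      by (simp add: LIMSEQ_const_iff)
    moreover have "AE x in lebesgue_on (cbox a b). g x * indicator (box a b) x = g x"
    proof -
      have "AE x in lebesgue. x \<in> cbox a b \<longrightarrow> g x * indicator (box a b) x = g x"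
        using AE_box_iff_cbox[of a b] by (rule eventually_mono) (auto simp: indicator_def)
      then show ?thesis by (subst AE_restrict_space_iff) auto
    qed
    moreover have "(LINT x|lebesgue_on (cbox a b). g x * indicator (box a b) x) = (LINT x|lebesgue_on (cbox a b). g x)"
      using gi calculation(2)
      by (intro integral_cong_AE borel_measurable_times borel_measurable_indicator)
        (auto simp: sets_restrict_space_iff box_subset_cbox)
    ultimately show ?thesis by simp
  qed
  obtain \<D> where D: "countable \<D>" "\<D> \<subseteq> Pow S" "\<And>X. X \<in> \<D> \<Longrightarrow> \<exists>a b. X = cbox a b" "\<Union>\<D> = S"
    using open_countable_Union_open_cbox[OF S] by metis
  have "AE x in lebesgue. x \<in> X \<longrightarrow> g x = 0" if X: "X \<in> \<D>" for X
  proof -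
    from D(3)[OF X] obtain a b where ab: "X = cbox a b" by blast
    have "AE x in lebesgue_on (cbox a b). g x = 0"
    proof (rule integral_zero_boxes_imp_AE)
      show "integrable (lebesgue_on (cbox a b)) g"
        using g ab D(2) X unfolding locally_integrable_def
        by (intro absolutely_integrable_imp_integrable) auto
      show "(LINT x|lebesgue_on (cbox c d). g x) = 0" if "cbox c d \<subseteq> cbox a b" for c d
        using that ab D(2) X by (intro box) auto
    qed
    then show ?thesis unfolding ab by (subst (asm) AE_restrict_space_iff) auto
  qed
  then have "AE x in lebesgue. \<forall>X\<in>\<D>. x \<in> X \<longrightarrow> g x = 0"
    using D(1) by (subst AE_ball_countable) auto
  then have "AE x in lebesgue. x \<in> S \<longrightarrow> g x = 0"
    by (rule AE_mp) (use D(4) in auto)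
  then show ?thesis using open_lebesgue[OF S] by (subst AE_restrict_space_iff) auto
qed

section \<open>Weak derivatives\<close>

text \<open>The entries of the multi-index \<open>axis i 1\<close> are to stay in this form.\<close>

declare One_nat_def [simp del]

lemma integrable_mult_bounded:
  assumes f: "integrable (lebesgue_on S) f" and g: "g \<in> borel_measurable (lebesgue_on S)"
    and b: "\<And>x. x \<in> S \<Longrightarrow> \<bar>g x\<bar> \<le> (C::real)"
  shows "integrable (lebesgue_on S) (\<lambda>x. f x * g x :: real)"
proof -
  have "integrable (lebesgue_on S) (\<lambda>x. C * f x)" using f by simp
  then show ?thesis
  proof (rule Bochner_Integration.integrable_bound)
    show "(\<lambda>x. f x * g x) \<in> borel_measurable (lebesgue_on S)"
      using f g by (intro borel_measurable_times) auto
    have "norm (f x * g x) \<le> norm (C * f x)" if "x \<in> S" for x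
    proof -
      have "\<bar>f x\<bar> * \<bar>g x\<bar> \<le> \<bar>f x\<bar> * \<bar>C\<bar>" by (rule mult_left_mono) (use b[OF that] in auto)
      then show ?thesis by (simp add: abs_mult mult.commute)
    qed
    then show "AE x in lebesgue_on S. norm (f x * g x) \<le> norm (C * f x)"
      by (intro AE_I2) simp
  qed
qed

lemma test_function_smooth: "test_function S f \<Longrightarrow> smooth f"
  by (simp add: test_function_def)

lemma integrable_mult_test:
  assumes w: "locally_integrable S w" and f: "test_function S f" and S: "S \<in> sets lebesgue"
  shows "integrable (lebesgue_on S) (\<lambda>x. w x * f x)"
proof -
  define K where "K = closure {x. f x \<noteq> 0}"
  have K: "compact K" "K \<subseteq> S" using f by (auto simp: test_function_def K_def)
  then have Kl: "K \<in> sets lebesgue" by (simp add: lmeasurable_compact fmeasurableD)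
  have c: "continuous_on K f" using f smooth_continuous test_function_smooth by blast
  have "bounded (f ` K)" using compact_imp_bounded compact_continuous_image c K by blast
  then obtain C where C: "\<And>x. x \<in> K \<Longrightarrow> \<bar>f x\<bar> \<le> C" by (auto simp: bounded_iff)
  have "integrable (lebesgue_on K) w"
    using w K Kl by (intro absolutely_integrable_imp_integrable) (auto simp: locally_integrable_def)
  then have "integrable (lebesgue_on K) (\<lambda>x. w x * f x)"
    using c Kl C by (intro integrable_mult_bounded continuous_imp_measurable_on_sets_lebesgue)
  then have "integrable (lebesgue_on S) (\<lambda>x. indicator K x * (w x * f x))"
    by (rule integral_lebesgue_on_subset(2)[OF Kl S K(2), THEN iffD1])
  moreover have "indicator K x * (w x * f x) = w x * f x" for x
    using closure_subset[of "{x. f x \<noteq> 0}"] by (auto simp: K_def indicator_def)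
  ultimately show ?thesis by simp
qed

lemma partial_eq_0_outside:
  assumes "x \<notin> closure {x. f x \<noteq> 0}"
  shows "partial i f x = 0"
proof -
  have "(f has_derivative (\<lambda>h. 0)) (at x)"
  proof (rule has_derivative_transform_within_open[of "\<lambda>x. 0" _ _ UNIV "- closure {x. f x \<noteq> 0}"])
    show "0 = f y" if "y \<in> - closure {x. f x \<noteq> 0}" for y
      using that closure_subset[of "{x. f x \<noteq> 0}"] by auto
  qed (use assms in auto)
  then show ?thesis using partial_eq by fastforce
qed

lemma test_function_partial:
  assumes "test_function S f"
  shows "test_function S (partial i f)"
proof -
  have "closure {x. partial i f x \<noteq> 0} \<subseteq> closure {x. f x \<noteq> 0}"
    using partial_eq_0_outside[of _ f i] by (intro closure_minimal) auto
  with assms show ?thesis unfolding test_function_def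
    by (meson closed_closure compact_closure bounded_subset compact_eq_bounded_closed order_trans smooth_partial)
qed

lemma test_function_mi_partial: "test_function S f \<Longrightarrow> test_function S (mi_partial a f)"
proof -
  have "test_function S f \<Longrightarrow> test_function S ((partial i ^^ n) f)" for f i n
    by (induction n) (auto intro: test_function_partial)
  then show "test_function S f \<Longrightarrow> test_function S (mi_partial a f)"
    by (simp add: mi_partial_def)
qed

lemma weak_deriv_unique:
  assumes S: "open S" and w: "is_weak_deriv S a u w" "is_weak_deriv S a u w'"
  shows "AE x in lebesgue_on S. w x = w' x"
proof -
  have li: "locally_integrable S w" "locally_integrable S w'"
    using w by (auto simp: is_weak_deriv_def)
  have "AE x in lebesgue_on S. w x - w' x = 0"
  proof (rule weak_zero_imp_AE_zero[OF S])
    show "locally_integrable S (\<lambda>x. w x - w' x)"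
      using li unfolding locally_integrable_def by (auto intro: set_integral_diff)
    fix f assume f: "test_function S f"
    have "(LINT x|lebesgue_on S. (w x - w' x) * f x)
        = (LINT x|lebesgue_on S. w x * f x) - (LINT x|lebesgue_on S. w' x * f x)"
      using integrable_mult_test[OF li(1) f open_lebesgue[OF S]] integrable_mult_test[OF li(2) f open_lebesgue[OF S]]
      by (simp add: left_diff_distrib)
    also have "(-1) ^ mi_order a * \<dots> = 0"
      using w f by (simp add: is_weak_deriv_def right_diff_distrib)
    finally show "(LINT x|lebesgue_on S. (w x - w' x) * f x) = 0" by simp
  qed
  then show ?thesis by (rule eventually_mono) simp
qed

lemma locally_integrable_cong_AE:
  assumes "locally_integrable S u" "AE x in lebesgue_on S. u x = u' x" "S \<in> sets lebesgue"
  shows "locally_integrable S u'"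
  unfolding locally_integrable_def set_integrable_def
proof safe
  fix K assume K: "compact K" "K \<subseteq> S"
  have i: "integrable lebesgue (\<lambda>x. indicator K x *\<^sub>R u x)"
    using assms K by (auto simp: locally_integrable_def set_integrable_def)
  have "AE x in lebesgue. x \<in> S \<longrightarrow> u x = u' x"
    using assms by (simp add: AE_restrict_space_iff)
  then have ae: "AE x in lebesgue. indicator K x *\<^sub>R u x = indicator K x *\<^sub>R u' x"
    by (rule eventually_mono) (use K in \<open>auto simp: indicator_def\<close>)
  have "(\<lambda>x. indicator K x *\<^sub>R u' x) \<in> borel_measurable lebesgue"
    using i by (intro borel_measurable_AE[OF _ ae]) auto
  then show "integrable lebesgue (\<lambda>x. indicator K x *\<^sub>R u' x)"
    using i ae integrable_cong_AE by blast
qed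

lemma is_weak_deriv_cong_AE:
  assumes w: "is_weak_deriv S a u w" and ae: "AE x in lebesgue_on S. u x = u' x" and S: "S \<in> sets lebesgue"
  shows "is_weak_deriv S a u' w"
proof -
  have li: "locally_integrable S u" "locally_integrable S u'"
    using w locally_integrable_cong_AE[OF _ ae S] by (auto simp: is_weak_deriv_def)
  have "(LINT x|lebesgue_on S. u x * mi_partial a f x) = (LINT x|lebesgue_on S. u' x * mi_partial a f x)"
    if "test_function S f" for f
    using integrable_mult_test[OF li(1) test_function_mi_partial[OF that] S]
      integrable_mult_test[OF li(2) test_function_mi_partial[OF that] S]
    by (intro integral_cong_AE) (auto intro: eventually_mono[OF ae])
  with w li show ?thesis by (simp add: is_weak_deriv_def)
qed

lemma weak_deriv_cong_AE:
  assumes ae: "AE x in lebesgue_on S. u x = u' x" and S: "S \<in> sets lebesgue"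
  shows "is_weak_deriv S a u = is_weak_deriv S a u'" "weak_deriv S a u = weak_deriv S a u'"
proof -
  have "AE x in lebesgue_on S. u' x = u x"
    using ae by (rule eventually_mono) simp
  then show "is_weak_deriv S a u = is_weak_deriv S a u'"
    using is_weak_deriv_cong_AE[OF _ ae S] is_weak_deriv_cong_AE[OF _ _ S, of a u' _ u] by blast
  then show "weak_deriv S a u = weak_deriv S a u'" by (simp add: weak_deriv_def)
qed

lemma is_weak_deriv_lincomb:
  assumes "is_weak_deriv S a u w" "is_weak_deriv S a u' w'" and S: "S \<in> sets lebesgue"
  shows "is_weak_deriv S a (\<lambda>x. c * u x + c' * u' x) (\<lambda>x. c * w x + c' * w' x)"
  unfolding is_weak_deriv_def
proof safe
  have li: "locally_integrable S u" "locally_integrable S u'" "locally_integrable S w" "locally_integrable S w'"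
    using assms by (auto simp: is_weak_deriv_def)
  have "locally_integrable S (\<lambda>x. c * u x + c' * u' x)"
    if "locally_integrable S u" "locally_integrable S u'" for u u'
    using that unfolding locally_integrable_def by (auto intro!: set_integral_add)
  then show "locally_integrable S (\<lambda>x. c * u x + c' * u' x)" "locally_integrable S (\<lambda>x. c * w x + c' * w' x)"
    using li by blast+
  fix f assume f: "test_function S f"
  note i = integrable_mult_test[OF _ f S] integrable_mult_test[OF _ test_function_mi_partial[OF f] S]
  have sp: "(LINT x|lebesgue_on S. (c * u x + c' * u' x) * g x)
      = c * (LINT x|lebesgue_on S. u x * g x) + c' * (LINT x|lebesgue_on S. u' x * g x)"
    if "integrable (lebesgue_on S) (\<lambda>x. u x * g x)" "integrable (lebesgue_on S) (\<lambda>x. u' x * g x)" for u u' g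
    using that by (simp add: distrib_right mult.assoc)
  show "(LINT x|lebesgue_on S. (c * u x + c' * u' x) * mi_partial a f x)
      = (- 1) ^ mi_order a * (LINT x|lebesgue_on S. (c * w x + c' * w' x) * f x)"
    using assms f by (simp add: sp i li is_weak_deriv_def distrib_left)
qed

lemma is_weak_deriv_diff:
  "is_weak_deriv S a u w \<Longrightarrow> is_weak_deriv S a u' w' \<Longrightarrow> S \<in> sets lebesgue \<Longrightarrow>
    is_weak_deriv S a (\<lambda>x. u x - u' x) (\<lambda>x. w x - w' x)"
  using is_weak_deriv_lincomb[of S a u w u' w' 1 "-1"] by simp

lemma is_weak_deriv_0: "locally_integrable S u \<Longrightarrow> is_weak_deriv S 0 u u"
  by (simp add: is_weak_deriv_def mi_order_def)

lemma mi_order_add_axis: "mi_order (a + axis i 1) = Suc (mi_order a)"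
  by (simp add: mi_order_def sum.distrib axis_def)

lemma mi_order_simps [simp]: "mi_order 0 = 0" "mi_order (axis i 1) = 1"
  using mi_order_add_axis[of 0 i] by (simp_all add: mi_order_def)

text \<open>Testing with \<open>f\<close> on the lower level is testing with \<open>partial i f\<close> on the upper one. In this way the
  derivatives of an \<open>H\<^sup>3\<close> function are themselves Sobolev functions.\<close>

lemma is_weak_deriv_next:
  assumes "is_weak_deriv S a u v" "is_weak_deriv S (a + axis i 1) u w"
  shows "is_weak_deriv S (axis i 1) v w"
  unfolding is_weak_deriv_def
proof safe
  show "locally_integrable S v" "locally_integrable S w"
    using assms by (auto simp: is_weak_deriv_def)
  fix f assume f: "test_function S f"
  have s: "smooth f" using f by (rule test_function_smooth)
  have "(-1) ^ mi_order a * (LINT x|lebesgue_on S. v x * partial i f x)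
      = (LINT x|lebesgue_on S. u x * mi_partial a (partial i f) x)"
    using assms(1) test_function_partial[OF f] by (simp add: is_weak_deriv_def)
  also have "\<dots> = (LINT x|lebesgue_on S. u x * mi_partial (a + axis i 1) f x)"
    unfolding mi_partial_partial[OF s] mi_partial_add_axis[OF s] ..
  also have "\<dots> = (-1) ^ mi_order a * (- (LINT x|lebesgue_on S. w x * f x))"
    using assms(2) f by (simp add: is_weak_deriv_def mi_order_add_axis)
  finally have "(LINT x|lebesgue_on S. v x * partial i f x) = - (LINT x|lebesgue_on S. w x * f x)"
    by (subst (asm) mult_left_cancel) simp_all
  then show "(LINT x|lebesgue_on S. v x * mi_partial (axis i 1) f x)
      = (- 1) ^ mi_order (axis i 1) * (LINT x|lebesgue_on S. w x * f x)"
    by (simp add: mi_partial_axis s)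
qed

lemma is_weak_deriv_subset:
  assumes "is_weak_deriv T a u w" "S \<subseteq> T" and S: "S \<in> sets lebesgue" and T: "T \<in> sets lebesgue"
  shows "is_weak_deriv S a u w"
  unfolding is_weak_deriv_def
proof safe
  show "locally_integrable S u" "locally_integrable S w"
    using assms(1,2) by (auto simp: is_weak_deriv_def locally_integrable_def)
  fix f assume f: "test_function S f"
  have fT: "test_function T f" using f assms(2) by (auto simp: test_function_def)
  have eq: "(LINT x|lebesgue_on S. v x * g x) = (LINT x|lebesgue_on T. v x * g x)" if "test_function S g" for v g
  proof -
    have "g x = 0" if "x \<notin> S" for x
      using that \<open>test_function S g\<close> closure_subset[of "{x. g x \<noteq> 0}"] by (auto simp: test_function_def)
    then have e: "indicator S x * (v x * g x) = v x * g x" for x by (auto simp: indicator_def)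
    show ?thesis unfolding integral_lebesgue_on_subset(1)[OF S T assms(2)] e ..
  qed
  show "(LINT x|lebesgue_on S. u x * mi_partial a f x) = (- 1) ^ mi_order a * (LINT x|lebesgue_on S. w x * f x)"
    using assms(1) fT unfolding eq[OF f] eq[OF test_function_mi_partial[OF f]]
    by (simp add: is_weak_deriv_def)
qed

lemma L2_locally_integrable:
  assumes "u \<in> L2 S" "S \<in> sets lebesgue"
  shows "locally_integrable S u"
  unfolding locally_integrable_def
proof safe
  fix K assume K: "compact K" "K \<subseteq> S"
  then have Kl: "K \<in> lmeasurable" by (simp add: lmeasurable_compact)
  then have "integrable (lebesgue_on K) u"
    by (intro L2_integrable_finite[OF L2_subset(1)[OF assms(1) K(2) fmeasurableD assms(2)]])
  then show "u absolutely_integrable_on K"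
    using Kl by (simp add: set_integrable_def integrable_restrict_space fmeasurableD)
qed

section \<open>Sobolev spaces\<close>

lemma is_weak_deriv_weak_deriv:
  "is_weak_deriv S a u w \<Longrightarrow> is_weak_deriv S a u (weak_deriv S a u)"
  unfolding weak_deriv_def by (rule someI[of "is_weak_deriv S a u"])

lemma weak_deriv_AE_eq:
  "open S \<Longrightarrow> is_weak_deriv S a u w \<Longrightarrow> AE x in lebesgue_on S. weak_deriv S a u x = w x"
  using weak_deriv_unique is_weak_deriv_weak_deriv by blast

lemma Hk_L2: "u \<in> Hk k S \<Longrightarrow> u \<in> L2 S"
  by (simp add: Hk_def)

lemma Hk_weak_deriv:
  assumes "open S" "u \<in> Hk k S" "mi_order a \<le> k"
  shows "is_weak_deriv S a u (weak_deriv S a u)" "weak_deriv S a u \<in> L2 S"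
proof -
  obtain w where w: "w \<in> L2 S" "is_weak_deriv S a u w"
    using assms unfolding Hk_def by blast
  then show 1: "is_weak_deriv S a u (weak_deriv S a u)"
    by (intro is_weak_deriv_weak_deriv)
  show "weak_deriv S a u \<in> L2 S"
    by (rule L2_cong_AE[OF w(1) weak_deriv_unique[OF assms(1) w(2) 1] open_lebesgue[OF assms(1)]])
qed

lemma Hk_lincomb:
  assumes "S \<in> sets lebesgue" "u \<in> Hk k S" "v \<in> Hk k S"
  shows "(\<lambda>x. c * u x + c' * v x) \<in> Hk k S"
  unfolding Hk_def
proof safe
  show "(\<lambda>x. c * u x + c' * v x) \<in> L2 S"
    using assms by (intro L2_add L2_cmult Hk_L2)
  fix a assume "mi_order a \<le> k"
  then obtain w w' where "w \<in> L2 S" "is_weak_deriv S a u w" "w' \<in> L2 S" "is_weak_deriv S a v w'"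
    using assms unfolding Hk_def by blast
  then show "\<exists>w\<in>L2 S. is_weak_deriv S a (\<lambda>x. c * u x + c' * v x) w"
    using assms(1) by (intro bexI[of _ "\<lambda>x. c * w x + c' * w' x"] is_weak_deriv_lincomb L2_add L2_cmult)
qed

lemma Hk_add: "S \<in> sets lebesgue \<Longrightarrow> u \<in> Hk k S \<Longrightarrow> v \<in> Hk k S \<Longrightarrow> (\<lambda>x. u x + v x) \<in> Hk k S"
  and Hk_diff: "S \<in> sets lebesgue \<Longrightarrow> u \<in> Hk k S \<Longrightarrow> v \<in> Hk k S \<Longrightarrow> (\<lambda>x. u x - v x) \<in> Hk k S"
  using Hk_lincomb[of S u k v 1 1] Hk_lincomb[of S u k v 1 "-1"] by auto

lemma Hk_mono: "j \<le> k \<Longrightarrow> u \<in> Hk k S \<Longrightarrow> u \<in> Hk j S"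
  by (auto simp: Hk_def)

lemma weak_deriv_lincomb_AE:
  assumes "open S" "u \<in> Hk k S" "v \<in> Hk k S" "mi_order a \<le> k"
  shows "AE x in lebesgue_on S. weak_deriv S a (\<lambda>x. c * u x + c' * v x) x
    = c * weak_deriv S a u x + c' * weak_deriv S a v x"
  using assms by (intro weak_deriv_AE_eq is_weak_deriv_lincomb Hk_weak_deriv(1)[of S _ k] open_lebesgue)

lemma weak_deriv_diff_AE:
  assumes "open S" "u \<in> Hk k S" "v \<in> Hk k S" "mi_order a \<le> k"
  shows "AE x in lebesgue_on S. weak_deriv S a (\<lambda>x. u x - v x) x = weak_deriv S a u x - weak_deriv S a v x"
  using weak_deriv_lincomb_AE[OF assms, of 1 "-1"] by simp

lemma finite_mi_order: "finite {a. mi_order a \<le> k}"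
proof -
  have "{a. mi_order a \<le> k} \<subseteq> (\<lambda>(p,q,r). vector [p,q,r]) ` ({..k} \<times> {..k} \<times> {..k})"
  proof
    fix a :: "nat^3" assume "a \<in> {a. mi_order a \<le> k}"
    then have "a $ 1 \<le> k \<and> a $ 2 \<le> k \<and> a $ 3 \<le> k" by (simp add: mi_order_def sum_3)
    moreover have "a = vector [a $ 1, a $ 2, a $ 3]" by (simp add: vec_eq_iff forall_3)
    ultimately show "a \<in> (\<lambda>(p,q,r). vector [p,q,r]) ` ({..k} \<times> {..k} \<times> {..k})"
      by (intro image_eqI[of _ _ "(a $ 1, a $ 2, a $ 3)"]) auto
  qed
  then show ?thesis by (rule finite_subset) simp
qed

lemma Hk_norm_nonneg: "Hk_norm k S u \<ge> 0"
  by (simp add: Hk_norm_def sum_nonneg)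

lemma L2_norm_le_Hk_norm:
  assumes "mi_order a \<le> k"
  shows "L2_norm S (weak_deriv S a u) \<le> Hk_norm k S u"
  unfolding Hk_norm_def
proof (rule real_le_rsqrt)
  show "(L2_norm S (weak_deriv S a u))\<^sup>2 \<le> (\<Sum>a | mi_order a \<le> k. (L2_norm S (weak_deriv S a u))\<^sup>2)"
    using assms finite_mi_order by (intro member_le_sum) auto
qed

lemma Hk_norm_le_sum:
  "Hk_norm k S u \<le> (\<Sum>a | mi_order a \<le> k. L2_norm S (weak_deriv S a u))"
  unfolding Hk_norm_def using L2_set_le_sum[of "{a. mi_order a \<le> k}" "\<lambda>a. L2_norm S (weak_deriv S a u)"]
  by (simp add: L2_set_def L2_norm_nonneg)

lemma Hk_norm_triangle:
  assumes S: "open S" and u: "u \<in> Hk k S" and v: "v \<in> Hk k S"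
  shows "Hk_norm k S (\<lambda>x. u x + v x) \<le> Hk_norm k S u + Hk_norm k S v"
    and "Hk_norm k S (\<lambda>x. u x - v x) \<le> Hk_norm k S u + Hk_norm k S v"
proof -
  have *: "Hk_norm k S (\<lambda>x. 1 * u x + c * v x) \<le> Hk_norm k S u + Hk_norm k S v" if c: "\<bar>c\<bar> = 1" for c
  proof -
    have "L2_norm S (weak_deriv S a (\<lambda>x. 1 * u x + c * v x))
        \<le> L2_norm S (weak_deriv S a u) + L2_norm S (weak_deriv S a v)" if a: "mi_order a \<le> k" for a
    proof -
      have uv: "(\<lambda>x. 1 * u x + c * v x) \<in> Hk k S"
        by (intro Hk_lincomb open_lebesgue assms)
      note [intro] = Hk_weak_deriv(2)[OF S _ a]
      have "L2_norm S (weak_deriv S a (\<lambda>x. 1 * u x + c * v x))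
          = L2_norm S (\<lambda>x. 1 * weak_deriv S a u x + c * weak_deriv S a v x)"
        using weak_deriv_lincomb_AE[OF S u v a, of 1 c] u v uv
        by (intro L2_norm_cong_AE L2_measurable L2_add L2_cmult) auto
      also have "\<dots> \<le> L2_norm S (\<lambda>x. 1 * weak_deriv S a u x) + L2_norm S (\<lambda>x. c * weak_deriv S a v x)"
        using u v by (intro L2_norm_triangle L2_cmult) auto
      finally show ?thesis using c by (simp add: L2_norm_cmult)
    qed
    then have "L2_set (\<lambda>a. L2_norm S (weak_deriv S a (\<lambda>x. 1 * u x + c * v x))) {a. mi_order a \<le> k}
       \<le> L2_set (\<lambda>a. L2_norm S (weak_deriv S a u) + L2_norm S (weak_deriv S a v)) {a. mi_order a \<le> k}"
      by (intro L2_set_mono) (auto simp: L2_norm_nonneg)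
    also have "\<dots> \<le> L2_set (\<lambda>a. L2_norm S (weak_deriv S a u)) {a. mi_order a \<le> k}
        + L2_set (\<lambda>a. L2_norm S (weak_deriv S a v)) {a. mi_order a \<le> k}"
      by (rule L2_set_triangle_ineq)
    finally show ?thesis by (simp add: L2_set_def Hk_norm_def)
  qed
  show "Hk_norm k S (\<lambda>x. u x + v x) \<le> Hk_norm k S u + Hk_norm k S v"
    "Hk_norm k S (\<lambda>x. u x - v x) \<le> Hk_norm k S u + Hk_norm k S v"
    using *[of 1] *[of "-1"] by simp_all
qed

lemma HkN_norm_nonneg: "HkN_norm k S U \<ge> 0"
  by (simp add: HkN_norm_def sum_nonneg)

lemma HkN_norm_triangle:
  assumes S: "open S" and u: "U \<in> HkN k S" and v: "V \<in> HkN k S"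
  shows "HkN_norm k S (\<lambda>x. U x + V x) \<le> HkN_norm k S U + HkN_norm k S V"
    and "HkN_norm k S (\<lambda>x. U x - V x) \<le> HkN_norm k S U + HkN_norm k S V"
proof -
  let ?u = "\<lambda>n. Hk_norm k S (\<lambda>x. U x $ n)" and ?v = "\<lambda>n. Hk_norm k S (\<lambda>x. V x $ n)"
  have "L2_set (\<lambda>n. ?u n + ?v n) UNIV \<le> L2_set ?u UNIV + L2_set ?v UNIV"
    by (rule L2_set_triangle_ineq)
  moreover have "L2_set (\<lambda>n. Hk_norm k S (\<lambda>x. (U x + V x) $ n)) UNIV \<le> L2_set (\<lambda>n. ?u n + ?v n) UNIV"
    "L2_set (\<lambda>n. Hk_norm k S (\<lambda>x. (U x - V x) $ n)) UNIV \<le> L2_set (\<lambda>n. ?u n + ?v n) UNIV"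
    using Hk_norm_triangle[OF S] u v by (auto intro!: L2_set_mono simp: HkN_def Hk_norm_nonneg)
  ultimately show "HkN_norm k S (\<lambda>x. U x + V x) \<le> HkN_norm k S U + HkN_norm k S V"
    "HkN_norm k S (\<lambda>x. U x - V x) \<le> HkN_norm k S U + HkN_norm k S V"
    unfolding L2_set_def HkN_norm_def by - (rule order_trans[rotated], assumption, assumption)+
qed

lemma Hk_norm_le_HkN_norm: "Hk_norm k S (\<lambda>x. U x $ n) \<le> HkN_norm k S U"
  unfolding HkN_norm_def by (rule real_le_rsqrt) (intro member_le_sum, auto)

lemma HkN_norm_le_sum: "HkN_norm k S U \<le> (\<Sum>n\<in>UNIV. Hk_norm k S (\<lambda>x. U x $ n))"
  unfolding HkN_norm_def using L2_set_le_sum[of UNIV "\<lambda>n. Hk_norm k S (\<lambda>x. U x $ n)"]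
  by (simp add: L2_set_def Hk_norm_nonneg)

lemma Hk_subset:
  assumes "u \<in> Hk k T" "S \<subseteq> T" "S \<in> sets lebesgue" "T \<in> sets lebesgue"
  shows "u \<in> Hk k S"
  unfolding Hk_def
proof safe
  show "u \<in> L2 S" using L2_subset[OF Hk_L2[OF assms(1)] assms(2-4)] by simp
  fix a assume "mi_order a \<le> k"
  then obtain w where "w \<in> L2 T" "is_weak_deriv T a u w"
    using assms unfolding Hk_def by blast
  then show "\<exists>w\<in>L2 S. is_weak_deriv S a u w"
    using is_weak_deriv_subset[OF _ assms(2-4)] L2_subset[OF _ assms(2-4)] by blast
qed

section \<open>Integration by parts on the cube\<close>

lemma prod_Basis_cart: "(\<Prod>b\<in>(Basis::(real^'n) set). f b) = (\<Prod>i\<in>UNIV. f (axis i 1))"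
proof -
  have B: "(Basis::(real^'n) set) = (\<lambda>i. axis i 1) ` UNIV" by (auto simp: Basis_vec_def)
  have "inj (\<lambda>i::'n. axis i (1::real))" by (auto simp: inj_on_def axis_eq_axis)
  then show ?thesis unfolding B by (subst prod.reindex) auto
qed

lemma emeasure_lborel_box_cart:
  fixes l u :: "real^'n"
  assumes "\<And>i. l $ i \<le> u $ i"
  shows "emeasure lborel (box l u) = ennreal (\<Prod>i\<in>UNIV. u $ i - l $ i)"
proof -
  have "l \<bullet> b \<le> u \<bullet> b" if "b \<in> Basis" for b
    using that assms by (auto simp: Basis_vec_def inner_axis)
  then show ?thesis by (simp add: emeasure_lborel_box prod_Basis_cart inner_axis)
qed

lemma face_pt_nth:
  "face_pt 1 1 t p $ 1 = t" "face_pt 1 1 t p $ 2 = p $ 1" "face_pt 1 1 t p $ 3 = p $ 2"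
  "face_pt 1 2 t p $ 1 = p $ 1" "face_pt 1 2 t p $ 2 = t" "face_pt 1 2 t p $ 3 = p $ 2"
  "face_pt 1 3 t p $ 1 = p $ 1" "face_pt 1 3 t p $ 2 = p $ 2" "face_pt 1 3 t p $ 3 = t"
  by (simp_all add: face_pt_def)

lemma face_pt_scale: "face_pt A i s p = face_pt 1 i (s * A) p"
  by (simp add: face_pt_def)

lemma face_pt_nth_self: "face_pt 1 i t p $ i = t"
  using exhaust_3[of i] by (auto simp: face_pt_nth)

lemma face_pt_line: "face_pt 1 i t p = face_pt 1 i 0 p + t *\<^sub>R axis i 1"
  using exhaust_3[of i] by (auto simp: vec_eq_iff forall_3 face_pt_nth axis_def)

lemma face_pt_measurable [measurable]:
  "(\<lambda>(p, t). face_pt 1 i t p) \<in> borel \<rightarrow>\<^sub>M borel"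
proof -
  have v: "vector [a, b, c] = a *\<^sub>R axis 1 1 + b *\<^sub>R axis 2 1 + c *\<^sub>R (axis 3 1 :: real^3)" for a b c :: real
    by (simp add: vec_eq_iff forall_3 axis_def)
  have "continuous_on UNIV (\<lambda>z::(real^2) \<times> real. face_pt 1 i (snd z) (fst z))"
    unfolding face_pt_def v
    by (cases "i = 1"; cases "i = 2") (auto intro!: continuous_intros)
  then show ?thesis by (simp add: case_prod_beta' borel_measurable_continuous_onI)
qed

lemma mem_box_cart': "(x::real^'n) \<in> box a b \<longleftrightarrow> (\<forall>i. a $ i < x $ i \<and> x $ i < b $ i)"
  by (simp add: mem_box_cart)

text \<open>The coordinates of a face and the normal coordinate together parametrize the space without
  changing the measure.\<close>

lemma lborel_face: "distr (lborel \<Otimes>\<^sub>M lborel) borel (\<lambda>(p, t). face_pt 1 i t p) = lborel"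
proof (rule lborel_eqI[symmetric])
  fix l u :: "real^3" assume le: "\<And>b. b \<in> Basis \<Longrightarrow> l \<bullet> b \<le> u \<bullet> b"
  have le': "l $ j \<le> u $ j" for j
    using le[of "axis j 1"] by (auto simp: inner_axis Basis_vec_def)
  define q :: "real^3 \<Rightarrow> real^2" where
    "q v = (if i = 1 then vector [v $ 2, v $ 3] else if i = 2 then vector [v $ 1, v $ 3] else vector [v $ 1, v $ 2])" for v
  have pre: "(\<lambda>(p, t). face_pt 1 i t p) -` box l u
      = box (q l) (q u) \<times> {l $ i<..<u $ i}"
    using exhaust_3[of i]
    by (auto simp: mem_box_cart' forall_3 forall_2 face_pt_nth q_def)
  have q_le: "q l $ j \<le> q u $ j" for j
    using exhaust_2[of j] le' by (auto simp: q_def)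
  have "emeasure (distr (lborel \<Otimes>\<^sub>M lborel) borel (\<lambda>(p, t). face_pt 1 i t p)) (box l u)
      = emeasure (lborel \<Otimes>\<^sub>M lborel) (box (q l) (q u) \<times> {l $ i<..<u $ i})"
    by (subst emeasure_distr) (auto simp: pre space_pair_measure lborel_prod)
  also have "\<dots> = emeasure lborel (box (q l) (q u)) * emeasure lborel {l $ i<..<u $ i}"
    by (intro lborel.emeasure_pair_measure_Times) auto
  also have "\<dots> = ennreal (\<Prod>j\<in>UNIV. q u $ j - q l $ j) * ennreal (u $ i - l $ i)"
    using le' q_le by (simp add: emeasure_lborel_box_cart)
  also have "\<dots> = ennreal ((\<Prod>j\<in>UNIV. q u $ j - q l $ j) * (u $ i - l $ i))"
    using le' q_le by (intro ennreal_mult[symmetric] prod_nonneg) auto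
  also have "(\<Prod>j\<in>UNIV. q u $ j - q l $ j) * (u $ i - l $ i) = (\<Prod>j\<in>UNIV. u $ j - l $ j)"
  proof -
    have 2: "prod f (UNIV::2 set) = f 1 * f 2" for f :: "2 \<Rightarrow> real"
      unfolding UNIV_2 by simp
    have 3: "prod g (UNIV::3 set) = g 1 * (g 2 * g 3)" for g :: "3 \<Rightarrow> real"
      unfolding UNIV_3 by simp
    consider "i = 1" | "i = 2" | "i = 3" using exhaust_3 by blast
    then show ?thesis unfolding 2 3 by cases (simp_all add: q_def)
  qed
  also have "ennreal (\<Prod>j\<in>UNIV. u $ j - l $ j) = (\<Prod>b\<in>Basis. (u - l) \<bullet> b)"
    by (simp add: prod_Basis_cart inner_axis)
  finally show "emeasure (distr (lborel \<Otimes>\<^sub>M lborel) borel (\<lambda>(p, t). face_pt 1 i t p)) (box l u)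
      = (\<Prod>b\<in>Basis. (u - l) \<bullet> b)" .
qed simp

lemma open_Om: "open (Om A)"
proof -
  have "Om A = box (\<chi> i. - A) (\<chi> i. A)" by (auto simp: Om_def mem_box_cart)
  then show ?thesis by (simp add: open_box)
qed

lemma Om_subset_cbox: "Om A \<subseteq> cbox (\<chi> i. - A) (\<chi> i. A)"
  by (auto simp: Om_def mem_box_cart less_imp_le)

lemma Om_lmeasurable: "Om A \<in> lmeasurable"
proof -
  have "Om A = box (\<chi> i. - A) (\<chi> i. A)" by (auto simp: Om_def mem_box_cart)
  then show ?thesis by simp
qed

lemma Om_lebesgue: "Om A \<in> sets lebesgue"
  using Om_lmeasurable by (rule fmeasurableD)

lemma continuous_bounded_on_Om:
  assumes "continuous_on UNIV (f :: real^3 \<Rightarrow> real)"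
  obtains C where "C > 0" "\<And>x. x \<in> Om A \<Longrightarrow> \<bar>f x\<bar> \<le> C"
proof -
  have "bounded (f ` cbox (\<chi> i. - A) (\<chi> i. A))"
    by (intro compact_imp_bounded compact_continuous_image continuous_on_subset[OF assms]) auto
  then obtain C where "\<forall>x\<in>cbox (\<chi> i. - A) (\<chi> i. A). \<bar>f x\<bar> \<le> C" by (auto simp: bounded_iff)
  then show ?thesis using Om_subset_cbox[of A] by (intro that[of "\<bar>C\<bar> + 1"]) force+
qed

lemma smooth_bounded_on_Om:
  assumes "smooth f" obtains C where "C > 0" "\<And>x. x \<in> Om A \<Longrightarrow> \<bar>f x\<bar> \<le> C"
  using continuous_bounded_on_Om[OF smooth_continuous[OF assms]] by blast

lemma continuous_measurable_Om: "continuous_on UNIV f \<Longrightarrow> f \<in> borel_measurable (lebesgue_on (Om A))"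
  using Om_lebesgue continuous_imp_measurable_on_sets_lebesgue continuous_on_subset by blast

lemma smooth_measurable_Om: "smooth f \<Longrightarrow> f \<in> borel_measurable (lebesgue_on (Om A))"
  by (intro continuous_measurable_Om smooth_continuous)

lemma const_L2_Om: "(\<lambda>x. c) \<in> L2 (Om A)"
  using Om_lmeasurable[of A]
  by (auto simp: L2_def integrable_restrict_space lmeasurable_iff_integrable fmeasurableD)

lemma continuous_L2_Om:
  assumes "continuous_on UNIV f" shows "f \<in> L2 (Om A)"
proof -
  obtain C where "\<And>x. x \<in> Om A \<Longrightarrow> \<bar>f x\<bar> \<le> C" using continuous_bounded_on_Om[OF assms] by blast
  then have "(\<lambda>x. f x * 1) \<in> L2 (Om A)"
    by (intro L2_mult_bounded[OF const_L2_Om continuous_measurable_Om[OF assms] _ Om_lebesgue])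
  then show ?thesis by simp
qed

lemma smooth_L2_Om: "smooth f \<Longrightarrow> f \<in> L2 (Om A)"
  by (intro continuous_L2_Om smooth_continuous)

lemma L2_Om_integrable: "f \<in> L2 (Om A) \<Longrightarrow> integrable (lebesgue_on (Om A)) f"
  using L2_integrable_finite Om_lmeasurable by blast

lemma Om_face_pt: "face_pt 1 i t p \<in> Om A \<longleftrightarrow> p \<in> face_square A \<and> - A < t \<and> t < A"
  using exhaust_3[of i] by (auto simp: Om_def face_square_def forall_3 forall_2 face_pt_nth)

lemma face_square_borel: "face_square A \<in> sets borel"
proof -
  have "face_square A = box (\<chi> i. - A) (\<chi> i. A)" by (auto simp: face_square_def mem_box_cart)
  then show ?thesis by simp
qed

text \<open>The fundamental theorem of calculus along the lines normal to a face, integrated over the face.\<close>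

lemma integral_slab_partial:
  assumes F: "smooth F" and ab: "- A \<le> a" "a \<le> b" "b \<le> A"
  shows "(LINT x|lebesgue_on (Om A). indicator {a..b} (x $ i) * partial i F x)
    = (LINT p|lebesgue_on (face_square A). F (face_pt 1 i b p) - F (face_pt 1 i a p))"
proof -
  define g where "g x = indicator (Om A) x *\<^sub>R (indicator {a..b} (x $ i) * partial i F x)" for x
  have cP: "continuous_on UNIV (partial i F)" using F by (intro smooth_continuous smooth_partial)
  have bP: "partial i F \<in> borel_measurable borel" by (intro borel_measurable_continuous_onI cP)
  have Omb: "Om A \<in> sets borel" using open_Om by (rule borel_open)
  have "(\<lambda>x::real^3. x $ i) \<in> borel_measurable borel" by simp
  then have gb: "g \<in> borel_measurable borel" unfolding g_def
    using bP Omb by measurable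
  have "integrable (lebesgue_on (Om A)) (\<lambda>x. indicator {a..b} (x $ i) * partial i F x)"
  proof -
    have "(\<lambda>x. partial i F x * indicator {a..b} (x $ i)) \<in> borel_measurable borel" using bP by simp
    then have "(\<lambda>x. indicator {a..b} (x $ i)) \<in> borel_measurable (lebesgue_on (Om A))"
      by (intro measurable_restrict_space1 measurable_completion) simp
    from integrable_mult_bounded[OF L2_Om_integrable[OF continuous_L2_Om[OF cP]] this, of 1]
    show ?thesis by (simp add: mult.commute indicator_def)
  qed
  then have "integrable lebesgue g"
    unfolding g_def using Om_lebesgue by (subst (asm) integrable_restrict_space) auto
  then have gi: "integrable lborel g"
    using gb by (simp add: integrable_completion)
  define T :: "(real^2) \<times> real \<Rightarrow> real^3" where "T = (\<lambda>(p, t). face_pt 1 i t p)"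
  have T: "T (p, t) = face_pt 1 i t p" for p t by (simp add: T_def)
  have Tm: "T \<in> lborel \<Otimes>\<^sub>M lborel \<rightarrow>\<^sub>M borel" using face_pt_measurable by (simp add: T_def lborel_prod)
  have Td: "distr (lborel \<Otimes>\<^sub>M lborel) borel T = lborel" by (simp only: T_def lborel_face)
  have "(LINT x|lebesgue_on (Om A). indicator {a..b} (x $ i) * partial i F x) = (LINT x|lebesgue. g x)"
    unfolding g_def using Om_lebesgue by (subst integral_restrict_space) auto
  also have "\<dots> = (LINT x|lborel. g x)"
    using gb by (simp add: integral_completion)
  also have "\<dots> = (LINT x|(distr (lborel \<Otimes>\<^sub>M lborel) borel T). g x)"
    by (simp only: Td)
  also have "\<dots> = (LINT z|(lborel \<Otimes>\<^sub>M lborel). g (T z))"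
    using gb Tm by (intro integral_distr)
  also have "\<dots> = (LINT p|lborel. LINT t|lborel. g (T (p, t)))"
  proof (rule lborel_pair.integral_fst'[symmetric])
    have "integrable (distr (lborel \<Otimes>\<^sub>M lborel) borel T) g" using gi by (simp only: Td)
    then show "integrable (lborel \<Otimes>\<^sub>M lborel) (\<lambda>z. g (T z))"
      using integrable_distr_eq[OF Tm gb] by simp
  qed
  also have "\<dots> = (LINT p|lborel. indicator (face_square A) p *\<^sub>R (F (face_pt 1 i b p) - F (face_pt 1 i a p)))"
  proof (rule Bochner_Integration.integral_cong[OF refl])
    fix p :: "real^2"
    show "(LINT t|lborel. g (T (p, t))) = indicator (face_square A) p *\<^sub>R (F (face_pt 1 i b p) - F (face_pt 1 i a p))"
    proof (cases "p \<in> face_square A")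
      case True
      have d: "((\<lambda>t. F (face_pt 1 i t p)) has_real_derivative partial i F (face_pt 1 i t p)) (at t)" for t
        using has_real_derivative_along_axis[OF smooth_differentiable[OF F], of "face_pt 1 i 0 p" i t]
        by (simp only: face_pt_line[symmetric])
      have "continuous_on UNIV (\<lambda>t. face_pt 1 i 0 p + t *\<^sub>R axis i (1::real))" by (intro continuous_intros)
      then have c: "continuous_on UNIV (\<lambda>t. partial i F (face_pt 1 i t p))"
        unfolding face_pt_line[symmetric] by (rule continuous_on_compose2[OF cP]) simp
      have "(LINT t|lborel. g (T (p, t))) = (LINT t|lborel. partial i F (face_pt 1 i t p) * indicator {a..b} t)"
      proof (rule integral_cong_AE)
        have "(\<lambda>t. face_pt 1 i t p) \<in> borel \<rightarrow>\<^sub>M borel"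
          by (subst face_pt_line) (intro borel_measurable_continuous_onI continuous_intros)
        from measurable_compose[OF this gb] show "(\<lambda>t. g (T (p, t))) \<in> borel_measurable lborel" by (simp add: T)
        show "(\<lambda>t. partial i F (face_pt 1 i t p) * indicator {a..b} t) \<in> borel_measurable lborel"
          using borel_measurable_continuous_onI[OF c] by simp
        have "AE t in lborel. t \<noteq> - A" "AE t in lborel. t \<noteq> A"
          by (rule AE_lborel_singleton)+
        then show "AE t in lborel. g (T (p, t)) = partial i F (face_pt 1 i t p) * indicator {a..b} t"
          by eventually_elim (use True ab in \<open>auto simp: T g_def Om_face_pt face_pt_nth_self indicator_def\<close>)
      qed
      also have "\<dots> = F (face_pt 1 i b p) - F (face_pt 1 i a p)"
        using ab(2) d c by (intro integral_FTC_Icc_real) (auto simp: continuous_on_eq_continuous_at)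
      finally show ?thesis using True by simp
    next
      case False
      then show ?thesis by (simp add: T g_def Om_face_pt)
    qed
  qed
  also have "\<dots> = (LINT p|lebesgue_on (face_square A). F (face_pt 1 i b p) - F (face_pt 1 i a p))"
  proof -
    have "continuous_on UNIV (\<lambda>p. F (face_pt 1 i t p))" for t
    proof (rule continuous_on_compose2[OF smooth_continuous[OF F, of UNIV]])
      have v: "vector [a, b, c] = a *\<^sub>R axis 1 1 + b *\<^sub>R axis 2 1 + c *\<^sub>R (axis 3 1 :: real^3)" for a b c :: real
        by (simp add: vec_eq_iff forall_3 axis_def)
      show "continuous_on UNIV (face_pt 1 i t)"
        unfolding face_pt_def[abs_def] v by (cases "i = 1"; cases "i = 2") (auto intro!: continuous_intros)
    qed simp
    from borel_measurable_continuous_onI[OF this]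
    have "(\<lambda>p. indicator (face_square A) p *\<^sub>R (F (face_pt 1 i b p) - F (face_pt 1 i a p))) \<in> borel_measurable lborel"
      using face_square_borel by simp
    then show ?thesis using face_square_borel
      by (subst integral_restrict_space) (auto simp: integral_completion)
  qed
  finally show ?thesis .
qed

lemma smooth_is_weak_deriv:
  assumes v: "smooth v" and A: "A > 0"
  shows "is_weak_deriv (Om A) (axis i 1) v (partial i v)"
  unfolding is_weak_deriv_def
proof safe
  show "locally_integrable (Om A) v" "locally_integrable (Om A) (partial i v)"
    using v by (intro L2_locally_integrable smooth_L2_Om Om_lebesgue smooth_partial; assumption)+
  fix f assume f: "test_function (Om A) f"
  have sf: "smooth f" using f by (rule test_function_smooth)
  have vf: "smooth (\<lambda>x. v x * f x)" using v sf by (rule smooth_mult)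
  have z: "f x = 0" if "x \<notin> Om A" for x
    using f that closure_subset[of "{x. f x \<noteq> 0}"] by (auto simp: test_function_def)
  have "(LINT x|lebesgue_on (Om A). v x * partial i f x) + (LINT x|lebesgue_on (Om A). partial i v x * f x)
      = (LINT x|lebesgue_on (Om A). v x * partial i f x + partial i v x * f x)"
    using v sf by (intro Bochner_Integration.integral_add[symmetric] L2_mult_integrable smooth_L2_Om smooth_partial)
  also have "\<dots> = (LINT x|lebesgue_on (Om A). indicator {-A..A} (x $ i) * partial i (\<lambda>x. v x * f x) x)"
    using v sf by (intro Bochner_Integration.integral_cong)
      (auto simp: partial_mult smooth_differentiable Om_def less_imp_le)
  also have "\<dots> = (LINT p|lebesgue_on (face_square A). 0)"
    using A z by (subst integral_slab_partial[OF vf]) (auto simp: Om_face_pt)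
  finally show "(LINT x|lebesgue_on (Om A). v x * mi_partial (axis i 1) f x)
      = (- 1) ^ mi_order (axis i 1) * (LINT x|lebesgue_on (Om A). partial i v x * f x)"
    by (simp add: mi_partial_axis[OF sf])
qed

subsection \<open>Smooth approximation and boundary layers\<close>

text \<open>\<open>g j\<close> is the \<open>j\<close>-th derivative of the limit \<open>h\<close>.\<close>

definition H1_limit :: "real \<Rightarrow> (real^3 \<Rightarrow> real) \<Rightarrow> (3 \<Rightarrow> real^3 \<Rightarrow> real) \<Rightarrow> bool" where
  "H1_limit A h g \<longleftrightarrow> h \<in> L2 (Om A) \<and> (\<forall>j. g j \<in> L2 (Om A)) \<and>
     (\<exists>v. (\<forall>k. smooth (v k)) \<and> (\<lambda>k. L2_norm (Om A) (\<lambda>x. v k x - h x)) \<longlonglongrightarrow> 0 \<and>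
        (\<forall>j. (\<lambda>k. L2_norm (Om A) (\<lambda>x. partial j (v k) x - g j x)) \<longlonglongrightarrow> 0))"

lemma H1_limit_const: "H1_limit A (\<lambda>x. c) (\<lambda>j x. 0)"
  unfolding H1_limit_def
  by (intro conjI exI[of _ "\<lambda>k x. c"] allI) (auto simp: const_L2_Om L2_norm_def smooth_const)

definition in_layer :: "real \<Rightarrow> 3 \<Rightarrow> real \<Rightarrow> real \<Rightarrow> real^3 \<Rightarrow> real" where
  "in_layer A i s \<tau> x = indicator {A - \<tau>..} (s * x $ i)"

lemma in_layer_bounds: "\<bar>in_layer A i s \<tau> x\<bar> \<le> 1" "in_layer A i s \<tau> x \<ge> 0" "in_layer A i s \<tau> x * in_layer A i s \<tau> x = in_layer A i s \<tau> x"
  by (auto simp: in_layer_def indicator_def)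

lemma in_layer_measurable: "in_layer A i s \<tau> \<in> borel_measurable (lebesgue_on (Om B))"
  unfolding in_layer_def[abs_def] by (intro measurable_restrict_space1 measurable_completion) simp

lemma in_layer_L2: "f \<in> L2 (Om A) \<Longrightarrow> (\<lambda>x. in_layer B i s \<tau> x * f x) \<in> L2 (Om A)"
  by (rule L2_mult_bounded[OF _ in_layer_measurable in_layer_bounds(1) Om_lebesgue])

lemma L2_norm_in_layer_le:
  assumes "f \<in> L2 (Om A)"
  shows "L2_norm (Om A) (\<lambda>x. in_layer B i s \<tau> x * f x) \<le> L2_norm (Om A) f"
proof -
  have "L2_norm (Om A) (\<lambda>x. in_layer B i s \<tau> x * f x) \<le> 1 * L2_norm (Om A) f"
    by (rule L2_norm_mult_bounded[OF assms in_layer_measurable in_layer_bounds(1) Om_lebesgue]) simp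
  then show ?thesis by simp
qed

text \<open>Vanishing on the face \<open>(i, s)\<close> in the sense that the \<open>L\<^sub>2\<close> norm over the layer of thickness \<open>\<tau>\<close> is
  \<open>O(\<tau>)\<close>, whereas that of a nonzero constant has order \<open>sqrt \<tau>\<close>; this is what makes the derivative of a cutoff
  harmless.\<close>

definition vanishes_at :: "real \<Rightarrow> 3 \<Rightarrow> real \<Rightarrow> (real^3 \<Rightarrow> real) \<Rightarrow> bool" where
  "vanishes_at A i s h \<longleftrightarrow>
    (\<exists>K. \<forall>\<tau>. 0 < \<tau> \<and> \<tau> \<le> A \<longrightarrow> L2_norm (Om A) (\<lambda>x. in_layer A i s \<tau> x * h x) \<le> K * \<tau>)"

text \<open>The function \<open>(s * x $ i - (A - \<tau>)) * (v x)\<^sup>2\<close> vanishes on the inner boundary of the layer and equals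
  \<open>\<tau> * (v x)\<^sup>2\<close> on the face. Integrating its normal derivative over the layer expresses the integral of
  \<open>v\<^sup>2\<close> through the face and the product of \<open>v\<close> with its derivative; the product is split by Young's inequality.\<close>

lemma layer_estimate_smooth:
  assumes v: "smooth v" and A: "0 < \<tau>" "\<tau> \<le> A" and s: "s = 1 \<or> s = -1"
  shows "(L2_norm (Om A) (\<lambda>x. in_layer A i s \<tau> x * v x))\<^sup>2
    \<le> 2 * \<tau> * (L2_norm (face_square A) (\<lambda>p. v (face_pt A i s p)))\<^sup>2
      + (2 * \<tau> * L2_norm (Om A) (partial i v))\<^sup>2"
proof -
  let ?I = "\<lambda>f. LINT x|lebesgue_on (Om A). f x"
  let ?c = "in_layer A i s \<tau>"
  define F where "F x = (s * x $ i - (A - \<tau>)) * v x ^ 2" for x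
  have sF: "smooth F" unfolding F_def using v by (intro smooth_mult smooth_diff smooth_power smooth_const smooth_coord)
  have dv: "v differentiable (at x)" for x using smooth_differentiable[OF v] .
  have pF: "partial i F x = s * v x ^ 2 + 2 * (s * x $ i - (A - \<tau>)) * (v x * partial i v x)" for x
  proof -
    have "((\<lambda>t. s * t - (A - \<tau>)) has_real_derivative s) (at (x $ i))"
      by (auto intro!: derivative_eq_intros)
    from partial_coord_fun[where i = i, OF this] have "partial i (\<lambda>x. s * x $ i - (A - \<tau>)) x = s" by simp
    moreover have "partial i (\<lambda>x. v x ^ 2) x = 2 * (v x * partial i v x)"
      using partial_mult[OF dv dv] by (simp add: power2_eq_square)
    moreover have "partial i F x = (s * x $ i - (A - \<tau>)) * partial i (\<lambda>x. v x ^ 2) x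
        + partial i (\<lambda>x. s * x $ i - (A - \<tau>)) x * v x ^ 2"
      unfolding F_def using v
      by (intro partial_mult smooth_differentiable smooth_power smooth_diff smooth_mult smooth_const smooth_coord)
    ultimately show ?thesis by (simp add: algebra_simps)
  qed
  have sq2: "s * s = 1" using s by auto
  have L: "(\<lambda>x. ?c x * f x) \<in> L2 (Om A)" if "smooth f" for f
    using that by (intro in_layer_L2 smooth_L2_Om)
  note Lv = L[OF v] and Lp = L[OF smooth_partial[OF v, of i]]
  have "s * ?I (\<lambda>x. ?c x * partial i F x) = \<tau> * (L2_norm (face_square A) (\<lambda>p. v (face_pt A i s p)))\<^sup>2"
  proof (cases "s = 1")
    case True
    have "?I (\<lambda>x. ?c x * partial i F x) = ?I (\<lambda>x. indicator {A - \<tau>..A} (x $ i) * partial i F x)"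
      using True by (intro Bochner_Integration.integral_cong) (auto simp: in_layer_def indicator_def Om_def less_imp_le)
    also have "\<dots> = (LINT p|lebesgue_on (face_square A). F (face_pt 1 i A p) - F (face_pt 1 i (A - \<tau>) p))"
      using A by (intro integral_slab_partial[OF sF]) auto
    also have "\<dots> = (LINT p|lebesgue_on (face_square A). \<tau> * (v (face_pt A i s p))\<^sup>2)"
      using True by (simp add: F_def face_pt_nth_self face_pt_scale[of A])
    finally show ?thesis using True by (simp add: L2_norm_sq)
  next
    case False
    with s have s': "s = - 1" by simp
    have "?I (\<lambda>x. ?c x * partial i F x) = ?I (\<lambda>x. indicator {- A..- A + \<tau>} (x $ i) * partial i F x)"
      using s' by (intro Bochner_Integration.integral_cong) (auto simp: in_layer_def indicator_def Om_def less_imp_le)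
    also have "\<dots> = (LINT p|lebesgue_on (face_square A). F (face_pt 1 i (- A + \<tau>) p) - F (face_pt 1 i (- A) p))"
      using A by (intro integral_slab_partial[OF sF]) auto
    also have "\<dots> = (LINT p|lebesgue_on (face_square A). - \<tau> * (v (face_pt A i s p))\<^sup>2)"
      using s' by (simp add: F_def face_pt_nth_self face_pt_scale[of A])
    finally show ?thesis using s' by (simp add: L2_norm_sq)
  qed
  moreover have "(L2_norm (Om A) (\<lambda>x. ?c x * v x))\<^sup>2 / 2 - 2 * \<tau>\<^sup>2 * (L2_norm (Om A) (\<lambda>x. ?c x * partial i v x))\<^sup>2
      \<le> s * ?I (\<lambda>x. ?c x * partial i F x)"
  proof -
    have "?I (\<lambda>x. (?c x * v x)\<^sup>2 / 2 - 2 * \<tau>\<^sup>2 * (?c x * partial i v x)\<^sup>2) \<le> ?I (\<lambda>x. s * (?c x * partial i F x))"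
    proof (rule integral_mono)
      show "integrable (lebesgue_on (Om A)) (\<lambda>x. (?c x * v x)\<^sup>2 / 2 - 2 * \<tau>\<^sup>2 * (?c x * partial i v x)\<^sup>2)"
        using L2_integrable_sq[OF Lv] L2_integrable_sq[OF Lp] by simp
      show "integrable (lebesgue_on (Om A)) (\<lambda>x. s * (?c x * partial i F x))"
        using L2_Om_integrable[OF L[OF smooth_partial[OF sF, of i]]] by simp
      fix x assume "x \<in> space (lebesgue_on (Om A))"
      then have x: "x \<in> Om A" by simp
      show "(?c x * v x)\<^sup>2 / 2 - 2 * \<tau>\<^sup>2 * (?c x * partial i v x)\<^sup>2 \<le> s * (?c x * partial i F x)"
      proof (cases "?c x = 0")
        case False
        then have c1: "?c x = 1" and r: "A - \<tau> \<le> s * x $ i" by (auto simp: in_layer_def indicator_def split: if_splits)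
        define r where "r = s * x $ i - (A - \<tau>)"
        have "s * x $ i \<le> A" using x s by (auto simp: Om_def less_imp_le minus_le_iff)
        then have r01: "0 \<le> r" "r \<le> \<tau>" using r by (auto simp: r_def)
        have "(r * partial i v x)\<^sup>2 \<le> (\<tau> * partial i v x)\<^sup>2"
          using power_mono[OF r01(2,1), of 2] by (simp add: power_mult_distrib mult_right_mono)
        moreover have "0 \<le> (v x / 2 + s * (r * partial i v x))\<^sup>2" by simp
        moreover have "(v x / 2 + s * (r * partial i v x))\<^sup>2
            = (v x)\<^sup>2 / 4 + s * (v x * (r * partial i v x)) + (s * s) * (r * partial i v x)\<^sup>2"
          by (simp add: power2_eq_square algebra_simps)
        moreover have "s * partial i F x = (s * s) * (v x)\<^sup>2 + 2 * (s * (v x * (r * partial i v x)))"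
          unfolding pF r_def[symmetric] by (simp add: power2_eq_square algebra_simps)
        ultimately show ?thesis using c1 sq2 by (simp add: power_mult_distrib)
      qed simp
    qed
    then show ?thesis
      using L2_integrable_sq[OF Lv] L2_integrable_sq[OF Lp] by (simp add: L2_norm_sq)
  qed
  moreover have "(L2_norm (Om A) (\<lambda>x. ?c x * partial i v x))\<^sup>2 \<le> (L2_norm (Om A) (partial i v))\<^sup>2"
    by (rule power_mono[OF L2_norm_in_layer_le[OF smooth_L2_Om[OF smooth_partial[OF v]]] L2_norm_nonneg])
  then have "2 * \<tau>\<^sup>2 * (L2_norm (Om A) (\<lambda>x. ?c x * partial i v x))\<^sup>2 \<le> 2 * \<tau>\<^sup>2 * (L2_norm (Om A) (partial i v))\<^sup>2"
    by (intro mult_left_mono) auto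
  ultimately show ?thesis by (simp add: power_mult_distrib)
qed

lemma L2_norm_limit:
  assumes "\<And>k. f k \<in> L2 S" "f0 \<in> L2 S" "(\<lambda>k. L2_norm S (\<lambda>x. f k x - f0 x)) \<longlonglongrightarrow> 0"
  shows "(\<lambda>k. L2_norm S (f k)) \<longlonglongrightarrow> L2_norm S f0"
proof -
  have "\<bar>L2_norm S (f k) - L2_norm S f0\<bar> \<le> L2_norm S (\<lambda>x. f k x - f0 x)" for k
  proof -
    have "L2_norm S (\<lambda>x. (f k x - f0 x) + f0 x) \<le> L2_norm S (\<lambda>x. f k x - f0 x) + L2_norm S f0"
      using assms by (intro L2_norm_triangle L2_diff)
    moreover have "L2_norm S (\<lambda>x. (-1) * (f k x - f0 x) + f k x) \<le> L2_norm S (\<lambda>x. (-1) * (f k x - f0 x)) + L2_norm S (f k)"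
      using assms by (intro L2_norm_triangle L2_cmult L2_diff)
    ultimately show ?thesis unfolding L2_norm_cmult by simp
  qed
  then have "(\<lambda>k. L2_norm S (f k) - L2_norm S f0) \<longlonglongrightarrow> 0"
    by (intro Lim_null_comparison[OF _ assms(3)] always_eventually) simp
  then show ?thesis by (simp add: LIM_zero_iff)
qed

text \<open>The layer estimate for the approximations passes to the limit, where the term on the face drops out.
  What is left bounds the squared norm by a multiple of \<open>\<tau>\<^sup>2\<close>.\<close>

lemma has_trace_0:
  assumes h: "has_trace A i s h (\<lambda>x. 0)" and A: "A > 0" and s: "s = 1 \<or> s = -1"
  shows "H1_limit A h (\<lambda>j. weak_deriv (Om A) (axis j 1) h)" "vanishes_at A i s h"
proof -
  let ?g = "\<lambda>j. weak_deriv (Om A) (axis j 1) h"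
  from h obtain v where v: "\<And>k. smooth (v k)"
      "(\<lambda>k. Hk_norm 1 (Om A) (\<lambda>x. v k x - h x)) \<longlonglongrightarrow> 0"
      "(\<lambda>k. L2_norm (face_square A) (\<lambda>p. v k (face_pt A i s p))) \<longlonglongrightarrow> 0"
    and h1: "h \<in> Hk 1 (Om A)"
    by (auto simp: has_trace_def)
  have g: "is_weak_deriv (Om A) (axis j 1) h (?g j)" "?g j \<in> L2 (Om A)" for j
    using Hk_weak_deriv[OF open_Om h1] by simp_all
  have hL: "h \<in> L2 (Om A)" using h1 by (rule Hk_L2)
  have vL: "v k \<in> L2 (Om A)" "partial j (v k) \<in> L2 (Om A)" for j k
    using v(1) by (auto intro: smooth_L2_Om smooth_partial)
  have 1: "L2_norm (Om A) (\<lambda>x. v k x - h x) \<le> Hk_norm 1 (Om A) (\<lambda>x. v k x - h x)" for k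
  proof -
    have w: "is_weak_deriv (Om A) 0 (\<lambda>x. v k x - h x) (\<lambda>x. v k x - h x)"
      by (intro is_weak_deriv_0 L2_locally_integrable L2_diff vL hL Om_lebesgue)
    have e: "AE x in lebesgue_on (Om A). v k x - h x = weak_deriv (Om A) 0 (\<lambda>x. v k x - h x) x"
      by (rule weak_deriv_unique[OF open_Om w is_weak_deriv_weak_deriv[OF w]])
    have "L2_norm (Om A) (\<lambda>x. v k x - h x) = L2_norm (Om A) (weak_deriv (Om A) 0 (\<lambda>x. v k x - h x))"
      using e by (intro L2_norm_cong_AE L2_measurable L2_cong_AE[OF L2_diff[OF vL(1) hL] e Om_lebesgue] L2_diff vL hL)
    then show ?thesis using L2_norm_le_Hk_norm[of 0 1] by simp
  qed
  have 2: "L2_norm (Om A) (\<lambda>x. partial j (v k) x - ?g j x) \<le> Hk_norm 1 (Om A) (\<lambda>x. v k x - h x)" for j k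
  proof -
    have w: "is_weak_deriv (Om A) (axis j 1) (\<lambda>x. v k x - h x) (\<lambda>x. partial j (v k) x - ?g j x)"
      by (intro is_weak_deriv_diff smooth_is_weak_deriv v A g Om_lebesgue)
    have e: "AE x in lebesgue_on (Om A). partial j (v k) x - ?g j x = weak_deriv (Om A) (axis j 1) (\<lambda>x. v k x - h x) x"
      by (rule weak_deriv_unique[OF open_Om w is_weak_deriv_weak_deriv[OF w]])
    have "L2_norm (Om A) (\<lambda>x. partial j (v k) x - ?g j x) = L2_norm (Om A) (weak_deriv (Om A) (axis j 1) (\<lambda>x. v k x - h x))"
      using e by (intro L2_norm_cong_AE L2_measurable L2_cong_AE[OF L2_diff[OF vL(2) g(2)] e Om_lebesgue] L2_diff vL g(2))
    then show ?thesis using L2_norm_le_Hk_norm[of "axis j 1" 1] by simp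
  qed
  have c1: "(\<lambda>k. L2_norm (Om A) (\<lambda>x. v k x - h x)) \<longlonglongrightarrow> 0"
    using 1 by (intro Lim_null_comparison[OF _ v(2)] always_eventually) (simp add: L2_norm_nonneg)
  have c2: "(\<lambda>k. L2_norm (Om A) (\<lambda>x. partial j (v k) x - ?g j x)) \<longlonglongrightarrow> 0" for j
    using 2 by (intro Lim_null_comparison[OF _ v(2)] always_eventually) (simp add: L2_norm_nonneg)
  show "H1_limit A h ?g"
    unfolding H1_limit_def using hL g(2) v(1) c1 c2 by (intro conjI exI[of _ v] allI)
  show "vanishes_at A i s h"
    unfolding vanishes_at_def
  proof (intro exI[of _ "2 * L2_norm (Om A) (?g i)"] allI impI)
    fix \<tau> assume \<tau>: "0 < \<tau> \<and> \<tau> \<le> A"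
    let ?c = "in_layer A i s \<tau>"
    have lim1: "(\<lambda>k. L2_norm (Om A) (\<lambda>x. ?c x * v k x)) \<longlonglongrightarrow> L2_norm (Om A) (\<lambda>x. ?c x * h x)"
    proof (rule L2_norm_limit)
      have "L2_norm (Om A) (\<lambda>x. ?c x * v k x - ?c x * h x) \<le> L2_norm (Om A) (\<lambda>x. v k x - h x)" for k
        using L2_norm_in_layer_le[OF L2_diff[OF vL(1)[of k] hL], of A i s \<tau>]
        by (simp add: right_diff_distrib)
      then show "(\<lambda>k. L2_norm (Om A) (\<lambda>x. ?c x * v k x - ?c x * h x)) \<longlonglongrightarrow> 0"
        by (intro Lim_null_comparison[OF _ c1] always_eventually) (simp add: L2_norm_nonneg)
    qed (intro in_layer_L2 vL hL)+
    have lim2: "(\<lambda>k. 2 * \<tau> * (L2_norm (face_square A) (\<lambda>p. v k (face_pt A i s p)))\<^sup>2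
        + (2 * \<tau> * L2_norm (Om A) (partial i (v k)))\<^sup>2) \<longlonglongrightarrow> 2 * \<tau> * 0\<^sup>2 + (2 * \<tau> * L2_norm (Om A) (?g i))\<^sup>2"
      by (intro tendsto_intros v(3) L2_norm_limit[OF vL(2) g(2) c2])
    have "(L2_norm (Om A) (\<lambda>x. ?c x * h x))\<^sup>2 \<le> 2 * \<tau> * 0\<^sup>2 + (2 * \<tau> * L2_norm (Om A) (?g i))\<^sup>2"
      by (rule LIMSEQ_le[OF tendsto_power[OF lim1] lim2]) (use layer_estimate_smooth[OF v(1)] \<tau> s in blast)
    then have "(L2_norm (Om A) (\<lambda>x. ?c x * h x))\<^sup>2 \<le> (2 * \<tau> * L2_norm (Om A) (?g i))\<^sup>2"
      by simp
    then have "L2_norm (Om A) (\<lambda>x. ?c x * h x) \<le> 2 * \<tau> * L2_norm (Om A) (?g i)"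
      by (rule power2_le_imp_le) (use \<tau> in \<open>simp add: L2_norm_nonneg\<close>)
    then show "L2_norm (Om A) (\<lambda>x. ?c x * h x) \<le> 2 * L2_norm (Om A) (?g i) * \<tau>"
      by (simp add: mult_ac)
  qed
qed

lemma vanishes_at_mult:
  assumes "vanishes_at A i s h" "h \<in> L2 (Om A)" "smooth \<rho>"
  shows "vanishes_at A i s (\<lambda>x. \<rho> x * h x)"
proof -
  obtain K where K: "\<And>\<tau>. 0 < \<tau> \<and> \<tau> \<le> A \<Longrightarrow> L2_norm (Om A) (\<lambda>x. in_layer A i s \<tau> x * h x) \<le> K * \<tau>"
    using assms(1) unfolding vanishes_at_def by blast
  obtain C where C: "C > 0" "\<And>x. x \<in> Om A \<Longrightarrow> \<bar>\<rho> x\<bar> \<le> C" using smooth_bounded_on_Om[OF assms(3)] by blast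
  have "L2_norm (Om A) (\<lambda>x. in_layer A i s \<tau> x * (\<rho> x * h x)) \<le> (C * K) * \<tau>" if t: "0 < \<tau> \<and> \<tau> \<le> A" for \<tau>
  proof -
    have "L2_norm (Om A) (\<lambda>x. \<rho> x * (in_layer A i s \<tau> x * h x)) \<le> C * L2_norm (Om A) (\<lambda>x. in_layer A i s \<tau> x * h x)"
      using C by (intro L2_norm_mult_bounded[OF in_layer_L2[OF assms(2)] smooth_measurable_Om[OF assms(3)] _ Om_lebesgue]) auto
    also have "\<dots> \<le> C * (K * \<tau>)" using K[OF t] C by (intro mult_left_mono) auto
    finally show ?thesis by (simp add: mult_ac)
  qed
  then show ?thesis unfolding vanishes_at_def by (intro exI[of _ "C * K"] allI impI)
qed

lemma vanishes_at_zero_near: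
  assumes h: "h \<in> L2 (Om A)" and t0: "\<tau>0 > 0" and z: "\<And>x. x \<in> Om A \<Longrightarrow> s * x $ i \<ge> A - \<tau>0 \<Longrightarrow> h x = 0"
  shows "vanishes_at A i s h"
  unfolding vanishes_at_def
proof (intro exI[of _ "L2_norm (Om A) h / \<tau>0"] allI impI)
  fix \<tau> assume t: "0 < \<tau> \<and> \<tau> \<le> A"
  show "L2_norm (Om A) (\<lambda>x. in_layer A i s \<tau> x * h x) \<le> L2_norm (Om A) h / \<tau>0 * \<tau>"
  proof (cases "\<tau> \<le> \<tau>0")
    case True
    have "L2_norm (Om A) (\<lambda>x. in_layer A i s \<tau> x * h x) = L2_norm (Om A) (\<lambda>x. 0)"
      unfolding L2_norm_def using z True
      by (intro arg_cong[where f = sqrt] Bochner_Integration.integral_cong) (auto simp: in_layer_def indicator_def)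
    then show ?thesis using t t0 by (simp add: L2_norm_def)
  next
    case False
    have "L2_norm (Om A) (\<lambda>x. in_layer A i s \<tau> x * h x) \<le> L2_norm (Om A) h"
      by (rule L2_norm_in_layer_le[OF h])
    also have "\<dots> \<le> L2_norm (Om A) h * (\<tau> / \<tau>0)"
      using mult_left_mono[of 1 "\<tau> / \<tau>0" "L2_norm (Om A) h"] False t0 by (simp add: L2_norm_nonneg)
    finally show ?thesis by simp
  qed
qed

subsection \<open>Cutoffs exhausting the cube\<close>

text \<open>A smooth function that is 1 on most of \<open>(- A, A)\<close> and vanishes at distance at most \<open>1 / (m + 2)\<close> from its
  ends; its derivative lives at distance at most \<open>2 / (m + 2)\<close> from them and has size \<open>m\<close>.\<close>

definition plateau :: "real \<Rightarrow> nat \<Rightarrow> real \<Rightarrow> real" where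
  "plateau A m t = step (real (m + 2) * (A - t) - 1) * step (real (m + 2) * (A + t) - 1)"

lemma smooth_plateau: "smooth (\<lambda>x. plateau A m (x $ j))"
  unfolding plateau_def by (intro smooth_mult smooth_step smooth_diff smooth_add smooth_const smooth_coord)

lemma plateau_bounds: "0 \<le> plateau A m t" "plateau A m t \<le> 1"
  unfolding plateau_def by (auto intro!: mult_nonneg_nonneg mult_le_one step_nonneg step_le_1)

lemma plateau_0:
  assumes "t \<ge> A - 1 / real (m + 2) \<or> t \<le> - A + 1 / real (m + 2)"
  shows "plateau A m t = 0"
proof -
  have n: "real (m + 2) > 0" by simp
  have "real (m + 2) * (A - t) - 1 \<le> 0 \<or> real (m + 2) * (A + t) - 1 \<le> 0"
  proof (cases "t \<ge> A - 1 / real (m + 2)")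
    case True
    then have "A - t \<le> 1 / real (m + 2)" by simp
    then show ?thesis using n by (simp add: field_simps)
  next
    case False
    with assms have "A + t \<le> 1 / real (m + 2)" by simp
    then show ?thesis using n by (simp add: field_simps)
  qed
  then show ?thesis unfolding plateau_def by (auto simp: step_0)
qed

lemma plateau_tendsto:
  assumes "- A < t" "t < A"
  shows "(\<lambda>m. plateau A m t) \<longlonglongrightarrow> 1"
proof (rule tendsto_eventually)
  define c where "c = min (A - t) (A + t)"
  have c: "c > 0" using assms by (simp add: c_def)
  obtain M :: nat where M: "real M > 2 / c" using reals_Archimedean2 by blast
  have "plateau A m t = 1" if "m \<ge> M" for m
  proof -
    have "real (m + 2) * c \<ge> 2"
    proof -
      have "2 / c \<le> real (m + 2)" using M that by (smt (verit) of_nat_mono le_add1 of_nat_add)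
      then show ?thesis using c by (simp add: field_simps)
    qed
    moreover have "real (m + 2) * c \<le> real (m + 2) * (A - t)" "real (m + 2) * c \<le> real (m + 2) * (A + t)"
      by (intro mult_left_mono; simp add: c_def)+
    ultimately have "real (m + 2) * (A - t) - 1 \<ge> 1" "real (m + 2) * (A + t) - 1 \<ge> 1" by linarith+
    then show ?thesis unfolding plateau_def by (simp only: step_1)
  qed
  then show "\<forall>\<^sub>F m in sequentially. plateau A m t = 1"
    by (auto simp: eventually_sequentially)
qed

lemma plateau_derivative:
  obtains P C where "C > 0" "\<And>A m t. (plateau A m has_real_derivative P A m t) (at t)"
    "\<And>A m t. \<bar>P A m t\<bar> \<le> C * real (m + 2) *
       (indicator {A - 2 / real (m + 2)..} t + indicator {A - 2 / real (m + 2)..} (- t))"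
proof -
  obtain s' C where s': "\<And>t. (step has_real_derivative s' t) (at t)" "\<And>t. \<bar>s' t\<bar> \<le> C" "C > 0"
    "\<And>t. t < 0 \<or> t > 1 \<Longrightarrow> s' t = 0" using step_derivative_bounded by metis
  define P where "P A m t = step (real (m + 2) * (A - t) - 1) * (s' (real (m + 2) * (A + t) - 1) * real (m + 2))
     + s' (real (m + 2) * (A - t) - 1) * (- real (m + 2)) * step (real (m + 2) * (A + t) - 1)" for A m t
  show ?thesis
  proof (rule that[of C P])
    fix A m t
    have 1: "((\<lambda>t. real (m + 2) * (A - t) - 1) has_real_derivative - real (m + 2)) (at t)"
      by (auto intro!: derivative_eq_intros)
    have 2: "((\<lambda>t. real (m + 2) * (A + t) - 1) has_real_derivative real (m + 2)) (at t)"
      by (auto intro!: derivative_eq_intros)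
    show "(plateau A m has_real_derivative P A m t) (at t)"
      unfolding plateau_def[abs_def] P_def
      using DERIV_mult[OF DERIV_chain2[OF s'(1) 1] DERIV_chain2[OF s'(1) 2]]
      by (simp add: algebra_simps)
    have n: "real (m + 2) > 0" by simp
    have b: "\<bar>s' (real (m + 2) * u - 1)\<bar> \<le> C * indicator {A - 2 / real (m + 2)..} (A - u)" for u
    proof (cases "u \<le> 2 / real (m + 2)")
      case True
      then show ?thesis using s'(2) by (simp add: indicator_def)
    next
      case False
      then have "real (m + 2) * u - 1 > 1" using n by (simp add: field_simps)
      then show ?thesis using s'(3,4) by (simp add: indicator_def)
    qed
    have "\<bar>P A m t\<bar> \<le> \<bar>step (real (m + 2) * (A - t) - 1)\<bar> * (\<bar>s' (real (m + 2) * (A + t) - 1)\<bar> * real (m + 2))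
       + \<bar>s' (real (m + 2) * (A - t) - 1)\<bar> * real (m + 2) * \<bar>step (real (m + 2) * (A + t) - 1)\<bar>"
      unfolding P_def by (rule order_trans[OF abs_triangle_ineq]) (simp add: abs_mult add_ac)
    also have "\<dots> \<le> 1 * (\<bar>s' (real (m + 2) * (A + t) - 1)\<bar> * real (m + 2))
       + \<bar>s' (real (m + 2) * (A - t) - 1)\<bar> * real (m + 2) * 1"
      using step_nonneg step_le_1 by (intro add_mono mult_mono) auto
    also have "\<dots> \<le> (C * indicator {A - 2 / real (m + 2)..} (- t)) * real (m + 2)
        + (C * indicator {A - 2 / real (m + 2)..} t) * real (m + 2)"
      using b[of "A + t"] b[of "A - t"] by (simp only: mult_1_left mult_1_right)
        (intro add_mono mult_right_mono, simp_all)
    finally show "\<bar>P A m t\<bar> \<le> C * real (m + 2) *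
       (indicator {A - 2 / real (m + 2)..} t + indicator {A - 2 / real (m + 2)..} (- t))"
      by (simp only: algebra_simps)
  qed (use s' in auto)
qed

definition cutoff :: "real \<Rightarrow> nat \<Rightarrow> real^3 \<Rightarrow> real" where
  "cutoff A m x = (\<Prod>j\<in>UNIV. plateau A m (x $ j))"

lemma smooth_cutoff: "smooth (cutoff A m)"
  unfolding cutoff_def[abs_def] by (intro smooth_prod smooth_plateau)

lemma cutoff_bounds: "\<bar>cutoff A m x\<bar> \<le> 1"
  unfolding cutoff_def abs_prod using plateau_bounds by (intro prod_le_1) auto

lemma cutoff_tendsto:
  assumes "x \<in> Om A" shows "(\<lambda>m. cutoff A m x) \<longlonglongrightarrow> 1"
proof -
  have "(\<lambda>m. cutoff A m x) \<longlonglongrightarrow> (\<Prod>j\<in>(UNIV::3 set). 1)"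
    unfolding cutoff_def using assms by (intro tendsto_prod plateau_tendsto) (auto simp: Om_def)
  then show ?thesis by simp
qed

lemma test_function_cutoff:
  assumes "smooth \<phi>"
  shows "test_function (Om A) (\<lambda>x. cutoff A m x * \<phi> x)"
proof -
  define l u :: "real^3" where "l = (\<chi> i. - A + 1 / real (m + 2))" and "u = (\<chi> i. A - 1 / real (m + 2))"
  have "cutoff A m x = 0" if "x \<notin> cbox l u" for x
  proof -
    from that have "\<exists>j. x $ j < - A + 1 / real (m + 2) \<or> A - 1 / real (m + 2) < x $ j"
      by (auto simp: mem_box_cart l_def u_def not_le)
    then obtain j where "x $ j \<ge> A - 1 / real (m + 2) \<or> x $ j \<le> - A + 1 / real (m + 2)"
      by (meson less_imp_le)
    then show ?thesis unfolding cutoff_def using plateau_0 by (intro prod_zero) auto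
  qed
  then have s: "closure {x. cutoff A m x * \<phi> x \<noteq> 0} \<subseteq> cbox l u"
    by (intro closure_minimal) auto
  have "0 < 1 / real (m + 2)" by simp
  then have "cbox l u \<subseteq> Om A"
  proof -
    assume n: "0 < 1 / real (m + 2)"
    show ?thesis
    proof
      fix x assume "x \<in> cbox l u"
      then have "- A + 1 / real (m + 2) \<le> x $ i \<and> x $ i \<le> A - 1 / real (m + 2)" for i
        unfolding mem_box_cart l_def u_def by simp
      with n have "- A < x $ i \<and> x $ i < A" for i by (smt (verit))
      then show "x \<in> Om A" by (simp add: Om_def)
    qed
  qed
  moreover have "compact (closure {x. cutoff A m x * \<phi> x \<noteq> 0})"
    using s by (meson bounded_cbox bounded_subset closed_closure compact_eq_bounded_closed)
  ultimately show ?thesis unfolding test_function_def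
    using s assms by (auto intro: smooth_mult smooth_cutoff)
qed

lemma partial_prod_coord_0:
  assumes "i \<notin> J"
  shows "partial i (\<lambda>x. \<Prod>j\<in>J. plateau A m (x $ j)) x = 0"
  using assms
proof (induction J rule: infinite_finite_induct)
  case (insert j J)
  obtain P where P: "\<And>A m t. (plateau A m has_real_derivative P A m t) (at t)"
    using plateau_derivative by metis
  have "partial i (\<lambda>x. plateau A m (x $ j) * (\<Prod>j\<in>J. plateau A m (x $ j))) x
     = plateau A m (x $ j) * partial i (\<lambda>x. \<Prod>j\<in>J. plateau A m (x $ j)) x
       + partial i (\<lambda>x. plateau A m (x $ j)) x * (\<Prod>j\<in>J. plateau A m (x $ j))"
    by (intro partial_mult smooth_differentiable smooth_plateau smooth_prod)
  also have "partial i (\<lambda>x. plateau A m (x $ j)) x = 0"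
    using partial_coord_fun[where i = i, OF P] insert.prems by auto
  finally show ?case using insert by simp
qed auto

lemma partial_cutoff_bound:
  obtains C where "C > 0" "\<And>A m i x. \<bar>partial i (cutoff A m) x\<bar>
     \<le> C * real (m + 2) * (in_layer A i 1 (2 / real (m + 2)) x + in_layer A i (-1) (2 / real (m + 2)) x)"
proof -
  obtain P C where P: "C > 0" "\<And>A m t. (plateau A m has_real_derivative P A m t) (at t)"
    "\<And>A m t. \<bar>P A m t\<bar> \<le> C * real (m + 2) *
       (indicator {A - 2 / real (m + 2)..} t + indicator {A - 2 / real (m + 2)..} (- t))"
    using plateau_derivative by metis
  show ?thesis
  proof (rule that[OF P(1)])
    fix A m i and x :: "real^3"
    have e: "cutoff A m = (\<lambda>x. plateau A m (x $ i) * (\<Prod>j\<in>UNIV - {i}. plateau A m (x $ j)))"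
      unfolding cutoff_def by (rule ext) (rule prod.remove, auto)
    have "partial i (cutoff A m) x = plateau A m (x $ i) * partial i (\<lambda>x. \<Prod>j\<in>UNIV - {i}. plateau A m (x $ j)) x
       + partial i (\<lambda>x. plateau A m (x $ i)) x * (\<Prod>j\<in>UNIV - {i}. plateau A m (x $ j))"
      unfolding e by (intro partial_mult smooth_differentiable smooth_plateau smooth_prod)
    also have "partial i (\<lambda>x. \<Prod>j\<in>UNIV - {i}. plateau A m (x $ j)) x = 0"
      by (rule partial_prod_coord_0) simp
    also have "partial i (\<lambda>x. plateau A m (x $ i)) x = P A m (x $ i)"
      using partial_coord_fun[where i = i, OF P(2)] by simp
    finally have "\<bar>partial i (cutoff A m) x\<bar> = \<bar>P A m (x $ i)\<bar> * \<bar>\<Prod>j\<in>UNIV - {i}. plateau A m (x $ j)\<bar>"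
      by (simp add: abs_mult)
    also have "\<dots> \<le> \<bar>P A m (x $ i)\<bar> * 1"
      using plateau_bounds by (intro mult_left_mono) (auto simp: abs_prod intro!: prod_le_1)
    finally show "\<bar>partial i (cutoff A m) x\<bar>
     \<le> C * real (m + 2) * (in_layer A i 1 (2 / real (m + 2)) x + in_layer A i (-1) (2 / real (m + 2)) x)"
      using P(3)[of A m "x $ i"] by (simp add: in_layer_def)
  qed
qed

lemma L2_norm_layer_tendsto_0:
  assumes f: "f \<in> L2 (Om A)" and s: "s = 1 \<or> s = -1"
  shows "(\<lambda>m. L2_norm (Om A) (\<lambda>x. in_layer A i s (2 / real (m + 2)) x * f x)) \<longlonglongrightarrow> 0"
proof -
  have "(\<lambda>m. LINT x|lebesgue_on (Om A). (in_layer A i s (2 / real (m + 2)) x * f x)\<^sup>2)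
      \<longlonglongrightarrow> (LINT x|lebesgue_on (Om A). 0)"
  proof (rule integral_dominated_convergence[where w = "\<lambda>x. (f x)\<^sup>2"])
    show "integrable (lebesgue_on (Om A)) (\<lambda>x. (f x)\<^sup>2)" by (rule L2_integrable_sq[OF f])
    show "(\<lambda>x. (in_layer A i s (2 / real (m + 2)) x * f x)\<^sup>2) \<in> borel_measurable (lebesgue_on (Om A))" for m
      using L2_integrable_sq[OF in_layer_L2[OF f]] by (rule borel_measurable_integrable)
    show "AE x in lebesgue_on (Om A). norm ((in_layer A i s (2 / real (m + 2)) x * f x)\<^sup>2) \<le> (f x)\<^sup>2" for m
      by (rule AE_I2) (simp add: in_layer_def indicator_def)
    show "AE x in lebesgue_on (Om A). (\<lambda>m. (in_layer A i s (2 / real (m + 2)) x * f x)\<^sup>2) \<longlonglongrightarrow> 0"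
    proof (rule AE_I2)
      fix x assume "x \<in> space (lebesgue_on (Om A))"
      then have "s * x $ i < A" using s by (auto simp: Om_def minus_less_iff)
      then have c: "A - s * x $ i > 0" by simp
      obtain M :: nat where M: "real M > 2 / (A - s * x $ i)" using reals_Archimedean2 by blast
      have "in_layer A i s (2 / real (m + 2)) x = 0" if "m \<ge> M" for m
      proof -
        have "2 / (A - s * x $ i) < real (m + 2)" using M that by (smt (verit) of_nat_mono le_add1 of_nat_add)
        then have "2 / real (m + 2) < A - s * x $ i" using c by (simp add: field_simps)
        then show ?thesis by (simp add: in_layer_def indicator_def)
      qed
      then show "(\<lambda>m. (in_layer A i s (2 / real (m + 2)) x * f x)\<^sup>2) \<longlonglongrightarrow> 0"
        by (intro tendsto_eventually) (auto simp: eventually_sequentially intro!: exI[of _ M])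
    qed
  qed simp
  from tendsto_real_sqrt[OF this] show ?thesis by (simp add: L2_norm_def)
qed

lemma cutoff_dominated:
  assumes X: "integrable (lebesgue_on (Om A)) X"
    and c: "\<And>m. c m \<in> borel_measurable (lebesgue_on (Om A))" "\<And>m x. \<bar>c m x\<bar> \<le> 1"
    and lim: "\<And>x. x \<in> Om A \<Longrightarrow> (\<lambda>m. c m x) \<longlonglongrightarrow> (1::real)"
  shows "(\<lambda>m. LINT x|lebesgue_on (Om A). c m x * X x) \<longlonglongrightarrow> (LINT x|lebesgue_on (Om A). X x)"
proof (rule integral_dominated_convergence[where w = "\<lambda>x. \<bar>X x\<bar>"])
  show "X \<in> borel_measurable (lebesgue_on (Om A))" using X by simp
  then show "(\<lambda>x. c m x * X x) \<in> borel_measurable (lebesgue_on (Om A))" for m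
    using c(1) by (intro borel_measurable_times)
  show "integrable (lebesgue_on (Om A)) (\<lambda>x. \<bar>X x\<bar>)" using X by simp
  show "AE x in lebesgue_on (Om A). (\<lambda>m. c m x * X x) \<longlonglongrightarrow> X x"
    by (rule AE_I2) (use tendsto_mult[OF lim tendsto_const] in fastforce)
  show "AE x in lebesgue_on (Om A). norm (c m x * X x) \<le> \<bar>X x\<bar>" for m
    by (rule AE_I2) (use c(2) in \<open>simp add: abs_mult mult_left_le_one_le\<close>)
qed

subsection \<open>Integration by parts up to the boundary\<close>

lemma L2_smooth_mult: "smooth \<rho> \<Longrightarrow> f \<in> L2 (Om A) \<Longrightarrow> (\<lambda>x. \<rho> x * f x) \<in> L2 (Om A)"
  by (metis L2_mult_bounded Om_lebesgue smooth_bounded_on_Om smooth_measurable_Om)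

text \<open>The smooth approximations of \<open>h\<close>, multiplied by cutoffs \<open>H\<^sub>m\<close>, are test functions for the weak
  derivative of \<open>f\<close>. In the resulting identity for \<open>\<rho> * h * H\<^sub>m\<close> the term with the derivative of \<open>H\<^sub>m\<close>, which has size \<open>m\<close>, lives in layers of
  thickness \<open>2 / m\<close>, where the vanishing factor has norm \<open>O(1 / m)\<close> and the other factor has norm
  tending to 0.\<close>

lemma integration_by_parts:
  assumes A: "A > 0" and f: "is_weak_deriv (Om A) (axis i 1) f fi" "f \<in> L2 (Om A)" "fi \<in> L2 (Om A)"
    and h: "H1_limit A h g" and \<rho>: "smooth \<rho>"
    and van: "vanishes_at A i 1 (\<lambda>x. \<rho> x * h x)" "vanishes_at A i (-1) (\<lambda>x. \<rho> x * h x)"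
  shows "(LINT x|lebesgue_on (Om A). \<rho> x * (fi x * h x))
     = - (LINT x|lebesgue_on (Om A). \<rho> x * (f x * g i x))
       - (LINT x|lebesgue_on (Om A). partial i \<rho> x * (f x * h x))"
proof -
  let ?I = "\<lambda>f. LINT x|lebesgue_on (Om A). f x"
  from h obtain v where v: "\<And>k. smooth (v k)" "(\<lambda>k. L2_norm (Om A) (\<lambda>x. v k x - h x)) \<longlonglongrightarrow> 0"
     "(\<lambda>k. L2_norm (Om A) (\<lambda>x. partial i (v k) x - g i x)) \<longlonglongrightarrow> 0"
    and hL: "h \<in> L2 (Om A)" "g i \<in> L2 (Om A)"
    unfolding H1_limit_def by blast
  have vL: "v k \<in> L2 (Om A)" "partial i (v k) \<in> L2 (Om A)" for k
    using v(1) by (auto intro: smooth_L2_Om smooth_partial)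
  note sp = smooth_partial
  define X where "X x = \<rho> x * (f x * g i x) + (\<rho> x * (fi x * h x) + partial i \<rho> x * (f x * h x))" for x
  have i1: "integrable (lebesgue_on (Om A)) (\<lambda>x. \<sigma> x * (a x * b x))"
    if "smooth \<sigma>" "a \<in> L2 (Om A)" "b \<in> L2 (Om A)" for \<sigma> a b
    using L2_mult_integrable[OF L2_smooth_mult[OF that(1,2)] that(3)] by (simp add: mult.assoc)
  have Xi: "integrable (lebesgue_on (Om A)) X"
    unfolding X_def using f hL \<rho> sp[OF \<rho>] by (intro Bochner_Integration.integrable_add i1)
  have eq: "?I (\<lambda>x. cutoff A m x * X x) = - ?I (\<lambda>x. f x * (partial i (cutoff A m) x * (\<rho> x * h x)))" for m
  proof -
    let ?H = "cutoff A m"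
    define K where "K x = ?H x * \<rho> x" for x
    have sK: "smooth K" unfolding K_def[abs_def] by (intro smooth_mult smooth_cutoff \<rho>)
    have pK: "partial i K x = ?H x * partial i \<rho> x + partial i ?H x * \<rho> x" for x
      unfolding K_def[abs_def] by (intro partial_mult smooth_differentiable smooth_cutoff \<rho>)
    have tv: "test_function (Om A) (\<lambda>x. K x * v k x)" for k
      using test_function_cutoff[OF smooth_mult[OF \<rho> v(1)], of A m k] by (simp add: K_def mult.assoc)
    have "?I (\<lambda>x. partial i (v k) x * (K x * f x)) + ?I (\<lambda>x. v k x * (partial i K x * f x))
        = - ?I (\<lambda>x. v k x * (K x * fi x))" for k
    proof -
      have "?I (\<lambda>x. f x * partial i (\<lambda>x. K x * v k x) x) = - ?I (\<lambda>x. fi x * (K x * v k x))"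
      proof -
        have "?I (\<lambda>x. f x * mi_partial (axis i 1) (\<lambda>x. K x * v k x) x)
            = (-1) ^ mi_order (axis i 1) * ?I (\<lambda>x. fi x * (K x * v k x))"
          using f(1) tv[of k] unfolding is_weak_deriv_def by blast
        then show ?thesis by (simp add: mi_partial_axis[OF test_function_smooth[OF tv]])
      qed
      moreover have "f x * partial i (\<lambda>x. K x * v k x) x
          = partial i (v k) x * (K x * f x) + v k x * (partial i K x * f x)" for x
        using partial_mult[OF smooth_differentiable[OF sK] smooth_differentiable[OF v(1)], where i = i]
        by (simp add: algebra_simps)
      moreover have "?I (\<lambda>x. partial i (v k) x * (K x * f x) + v k x * (partial i K x * f x))
         = ?I (\<lambda>x. partial i (v k) x * (K x * f x)) + ?I (\<lambda>x. v k x * (partial i K x * f x))"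
        using f(2) vL sK sp[OF sK]
        by (intro Bochner_Integration.integral_add L2_mult_integrable L2_smooth_mult)
      ultimately show ?thesis by (simp add: mult_ac)
    qed
    moreover have "(\<lambda>k. ?I (\<lambda>x. partial i (v k) x * (K x * f x)) + ?I (\<lambda>x. v k x * (partial i K x * f x)))
        \<longlonglongrightarrow> ?I (\<lambda>x. g i x * (K x * f x)) + ?I (\<lambda>x. h x * (partial i K x * f x))"
      by (intro tendsto_add L2_limit_integral vL hL v L2_smooth_mult sK sp f)
    moreover have "(\<lambda>k. - ?I (\<lambda>x. v k x * (K x * fi x))) \<longlonglongrightarrow> - ?I (\<lambda>x. h x * (K x * fi x))"
      by (intro tendsto_minus L2_limit_integral vL hL v L2_smooth_mult sK f)
    ultimately have "?I (\<lambda>x. g i x * (K x * f x)) + ?I (\<lambda>x. h x * (partial i K x * f x)) = - ?I (\<lambda>x. h x * (K x * fi x))"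
      using LIMSEQ_unique by auto
    moreover have "?I (\<lambda>x. ?H x * X x + f x * (partial i ?H x * (\<rho> x * h x)))
        = ?I (\<lambda>x. g i x * (K x * f x) + h x * (partial i K x * f x) + h x * (K x * fi x))"
      by (intro Bochner_Integration.integral_cong refl) (simp add: X_def pK K_def algebra_simps)
    moreover have "\<dots> = ?I (\<lambda>x. g i x * (K x * f x)) + ?I (\<lambda>x. h x * (partial i K x * f x)) + ?I (\<lambda>x. h x * (K x * fi x))"
      by (subst Bochner_Integration.integral_add Bochner_Integration.integral_add,
         intro Bochner_Integration.integrable_add L2_mult_integrable L2_smooth_mult hL sK sp f,
         intro L2_mult_integrable L2_smooth_mult hL sK sp f)+ simp
    moreover have "?I (\<lambda>x. ?H x * X x + f x * (partial i ?H x * (\<rho> x * h x)))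
        = ?I (\<lambda>x. ?H x * X x) + ?I (\<lambda>x. f x * (partial i ?H x * (\<rho> x * h x)))"
    proof (rule Bochner_Integration.integral_add)
      show "integrable (lebesgue_on (Om A)) (\<lambda>x. ?H x * X x)"
        using integrable_mult_bounded[OF Xi smooth_measurable_Om[OF smooth_cutoff] cutoff_bounds] by (simp add: mult.commute)
    qed (intro L2_mult_integrable L2_smooth_mult hL sp f smooth_cutoff \<rho>)
    ultimately show ?thesis by simp
  qed
  obtain C where C: "C > 0" "\<And>A m i x. \<bar>partial i (cutoff A m) x\<bar>
     \<le> C * real (m + 2) * (in_layer A i 1 (2 / real (m + 2)) x + in_layer A i (-1) (2 / real (m + 2)) x)"
    using partial_cutoff_bound by blast
  obtain K1 where K1: "\<And>\<tau>. 0 < \<tau> \<and> \<tau> \<le> A \<Longrightarrow> L2_norm (Om A) (\<lambda>x. in_layer A i 1 \<tau> x * (\<rho> x * h x)) \<le> K1 * \<tau>"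
    using van(1) unfolding vanishes_at_def by blast
  obtain K2 where K2: "\<And>\<tau>. 0 < \<tau> \<and> \<tau> \<le> A \<Longrightarrow> L2_norm (Om A) (\<lambda>x. in_layer A i (-1) \<tau> x * (\<rho> x * h x)) \<le> K2 * \<tau>"
    using van(2) unfolding vanishes_at_def by blast
  have \<rho>h: "(\<lambda>x. \<rho> x * h x) \<in> L2 (Om A)" by (intro L2_smooth_mult \<rho> hL)
  define c where "c s m = in_layer A i s (2 / real (m + 2))" for s m
  have cL: "(\<lambda>x. c s m x * a x) \<in> L2 (Om A)" if "a \<in> L2 (Om A)" for s m a
    unfolding c_def by (rule in_layer_L2[OF that])
  have absL: "(\<lambda>x. \<bar>a x\<bar>) \<in> L2 (Om A)" if "a \<in> L2 (Om A)" for a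
    using that by (auto simp: L2_def)
  have absn: "L2_norm (Om A) (\<lambda>x. \<bar>a x\<bar>) = L2_norm (Om A) a" for a by (simp add: L2_norm_def)
  have lay: "?I (\<lambda>x. \<bar>c s m x * f x\<bar> * \<bar>c s m x * (\<rho> x * h x)\<bar>)
     \<le> L2_norm (Om A) (\<lambda>x. c s m x * f x) * L2_norm (Om A) (\<lambda>x. c s m x * (\<rho> x * h x))" for s m
    using L2_Cauchy_Schwarz[OF absL[OF cL[OF f(2)]] absL[OF cL[OF \<rho>h]], of s m s m] unfolding absn
    by linarith
  have bound: "\<bar>?I (\<lambda>x. f x * (partial i (cutoff A m) x * (\<rho> x * h x)))\<bar>
      \<le> 2 * C * (K1 * L2_norm (Om A) (\<lambda>x. c 1 m x * f x) + K2 * L2_norm (Om A) (\<lambda>x. c (-1) m x * f x))"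
    if m: "2 / real (m + 2) \<le> A" for m
  proof -
    let ?n = "real (m + 2)"
    let ?Y = "\<lambda>s x. \<bar>c s m x * f x\<bar> * \<bar>c s m x * (\<rho> x * h x)\<bar>"
    have Yi: "integrable (lebesgue_on (Om A)) (?Y s)" for s
      by (intro L2_mult_integrable absL cL f \<rho>h)
    have "\<bar>?I (\<lambda>x. f x * (partial i (cutoff A m) x * (\<rho> x * h x)))\<bar>
        \<le> ?I (\<lambda>x. \<bar>f x * (partial i (cutoff A m) x * (\<rho> x * h x))\<bar>)"
      by (rule integral_abs_bound)
    also have "\<dots> \<le> ?I (\<lambda>x. C * ?n * (?Y 1 x + ?Y (-1) x))"
    proof (rule integral_mono)
      show "integrable (lebesgue_on (Om A)) (\<lambda>x. \<bar>f x * (partial i (cutoff A m) x * (\<rho> x * h x))\<bar>)"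
        by (intro integrable_abs L2_mult_integrable L2_smooth_mult hL sp f smooth_cutoff \<rho>)
      show "integrable (lebesgue_on (Om A)) (\<lambda>x. C * ?n * (?Y 1 x + ?Y (-1) x))"
        by (intro integrable_mult_right Bochner_Integration.integrable_add Yi)
      fix x
      have y: "?Y s x = c s m x * (\<bar>f x\<bar> * \<bar>\<rho> x * h x\<bar>)" for s
        by (simp add: c_def in_layer_def indicator_def abs_mult)
      have "\<bar>f x * (partial i (cutoff A m) x * (\<rho> x * h x))\<bar> = \<bar>partial i (cutoff A m) x\<bar> * (\<bar>f x\<bar> * \<bar>\<rho> x * h x\<bar>)"
        by (simp add: abs_mult)
      also have "\<dots> \<le> (C * ?n * (c 1 m x + c (-1) m x)) * (\<bar>f x\<bar> * \<bar>\<rho> x * h x\<bar>)"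
        unfolding c_def by (intro mult_right_mono C) simp
      finally show "\<bar>f x * (partial i (cutoff A m) x * (\<rho> x * h x))\<bar> \<le> C * ?n * (?Y 1 x + ?Y (-1) x)"
        unfolding y by (simp only: algebra_simps)
    qed
    also have "\<dots> = C * ?n * (?I (?Y 1) + ?I (?Y (-1)))"
      using Yi by (simp only: integral_mult_right_zero Bochner_Integration.integral_add)
    also have "\<dots> \<le> C * ?n * (L2_norm (Om A) (\<lambda>x. c 1 m x * f x) * (K1 * (2 / ?n))
         + L2_norm (Om A) (\<lambda>x. c (-1) m x * f x) * (K2 * (2 / ?n)))"
      using K1[of "2 / ?n"] K2[of "2 / ?n"] m C(1) unfolding c_def[symmetric]
      by (intro mult_left_mono add_mono order_trans[OF lay]) (simp_all add: L2_norm_nonneg)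
    also have "\<dots> = 2 * C * (K1 * L2_norm (Om A) (\<lambda>x. c 1 m x * f x) + K2 * L2_norm (Om A) (\<lambda>x. c (-1) m x * f x))"
    proof -
      have "C * n * (a * (K1 * (2 / n)) + b * (K2 * (2 / n))) = 2 * C * (K1 * a + K2 * b)" if "n > 0" for n a b :: real
        using that by (simp add: field_simps)
      then show ?thesis by simp
    qed
    finally show ?thesis .
  qed
  have lim0: "(\<lambda>m. ?I (\<lambda>x. f x * (partial i (cutoff A m) x * (\<rho> x * h x)))) \<longlonglongrightarrow> 0"
  proof (rule Lim_null_comparison)
    have "(\<lambda>m. 2 * C * (K1 * L2_norm (Om A) (\<lambda>x. c 1 m x * f x) + K2 * L2_norm (Om A) (\<lambda>x. c (-1) m x * f x)))
       \<longlonglongrightarrow> 2 * C * (K1 * 0 + K2 * 0)"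
      unfolding c_def by (intro tendsto_intros L2_norm_layer_tendsto_0 f(2)) auto
    then show "(\<lambda>m. 2 * C * (K1 * L2_norm (Om A) (\<lambda>x. c 1 m x * f x) + K2 * L2_norm (Om A) (\<lambda>x. c (-1) m x * f x)))
       \<longlonglongrightarrow> 0" by simp
    obtain M :: nat where M: "real M > 2 / A" using reals_Archimedean2 by blast
    have "2 / real (m + 2) \<le> A" if "m \<ge> M" for m
    proof -
      have "2 / A < real (m + 2)" using M that by (smt (verit) of_nat_mono le_add1 of_nat_add)
      then show ?thesis using A by (simp add: field_simps)
    qed
    then show "\<forall>\<^sub>F m in sequentially. norm (?I (\<lambda>x. f x * (partial i (cutoff A m) x * (\<rho> x * h x))))
      \<le> 2 * C * (K1 * L2_norm (Om A) (\<lambda>x. c 1 m x * f x) + K2 * L2_norm (Om A) (\<lambda>x. c (-1) m x * f x))"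
      using bound by (auto simp: eventually_sequentially intro!: exI[of _ M])
  qed
  have "(\<lambda>m. ?I (\<lambda>x. cutoff A m x * X x)) \<longlonglongrightarrow> ?I X"
    by (rule cutoff_dominated[OF Xi smooth_measurable_Om[OF smooth_cutoff] cutoff_bounds cutoff_tendsto])
  moreover have "(\<lambda>m. ?I (\<lambda>x. cutoff A m x * X x)) \<longlonglongrightarrow> 0"
    unfolding eq using tendsto_minus[OF lim0] by simp
  ultimately have "?I X = 0" by (rule LIMSEQ_unique)
  moreover have "?I X = ?I (\<lambda>x. \<rho> x * (f x * g i x)) + (?I (\<lambda>x. \<rho> x * (fi x * h x)) + ?I (\<lambda>x. partial i \<rho> x * (f x * h x)))"
    unfolding X_def using i1[OF \<rho> f(2) hL(2)] i1[OF \<rho> f(3) hL(1)] i1[OF sp[OF \<rho>] f(2) hL(1)]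
    by (simp only: Bochner_Integration.integral_add Bochner_Integration.integrable_add)
  ultimately show ?thesis by simp
qed

lemma partial_zero_near:
  assumes z: "\<And>x. x \<in> Om A \<Longrightarrow> s * x $ i \<ge> A - \<tau> \<Longrightarrow> \<rho> x = 0" and t: "\<tau> > 0"
    and x: "x \<in> Om A" "s * x $ i \<ge> A - \<tau> / 2"
  shows "partial j \<rho> x = 0"
proof -
  have "continuous_on UNIV (\<lambda>x::real^3. s * x $ i)" by (intro continuous_intros)
  then have "open {x::real^3. A - \<tau> < s * x $ i}"
    by (intro open_Collect_less) (auto intro: continuous_on_const)
  then have o: "open (Om A \<inter> {x. A - \<tau> < s * x $ i})" using open_Om by blast
  have "(\<rho> has_derivative (\<lambda>h. 0)) (at x)"
  proof (rule has_derivative_transform_within_open[of "\<lambda>x. 0" _ _ UNIV "Om A \<inter> {x. A - \<tau> < s * x $ i}"])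
    show "x \<in> Om A \<inter> {x. A - \<tau> < s * x $ i}" using x t by auto
  qed (use o z in auto)
  then show ?thesis using partial_eq by fastforce
qed

definition zero_near :: "real \<Rightarrow> 3 \<Rightarrow> real \<Rightarrow> (real^3 \<Rightarrow> real) \<Rightarrow> bool" where
  "zero_near A i s \<rho> \<longleftrightarrow> (\<exists>\<tau>>0. \<forall>x\<in>Om A. s * x $ i \<ge> A - \<tau> \<longrightarrow> \<rho> x = 0)"

lemma zero_near_partial: "zero_near A i s \<rho> \<Longrightarrow> zero_near A i s (partial j \<rho>)"
proof -
  assume "zero_near A i s \<rho>"
  then obtain \<tau> where t: "\<tau> > 0" and z: "\<And>x. x \<in> Om A \<Longrightarrow> s * x $ i \<ge> A - \<tau> \<Longrightarrow> \<rho> x = 0"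
    unfolding zero_near_def by blast
  show ?thesis unfolding zero_near_def
    by (intro exI[of _ "\<tau> / 2"] conjI ballI impI partial_zero_near[OF z t]) (use t in auto)
qed

lemma zero_near_mult: "zero_near A i s \<rho> \<Longrightarrow> zero_near A i s (\<lambda>x. \<rho> x * f x)"
  "zero_near A i s \<rho> \<Longrightarrow> zero_near A i s (\<lambda>x. f x * \<rho> x)"
  unfolding zero_near_def by (metis mult_zero_left, metis mult_zero_right)

lemma vanishes_at_cases:
  assumes "vanishes_at A i s h \<or> zero_near A i s \<rho>" "h \<in> L2 (Om A)" "smooth \<rho>"
  shows "vanishes_at A i s (\<lambda>x. \<rho> x * h x)"
  using assms(1)
proof
  assume "zero_near A i s \<rho>"
  then obtain \<tau> where t: "\<tau> > 0" and z: "\<And>x. x \<in> Om A \<Longrightarrow> s * x $ i \<ge> A - \<tau> \<Longrightarrow> \<rho> x = 0"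
    unfolding zero_near_def by blast
  show ?thesis
    by (rule vanishes_at_zero_near[OF L2_smooth_mult[OF assms(3,2)] t]) (simp add: z)
qed (intro vanishes_at_mult assms)

text \<open>Against a smooth function, the derivatives can be moved one at a time: \<open>\<partial>\<^sub>t\<close> off \<open>u\<close>, then \<open>\<partial>\<^sub>i\<close> onto \<open>u\<close>,
  which only needs the vanishing of \<open>u\<close> itself, then \<open>\<partial>\<^sub>t\<close> back.\<close>

lemma tangential_derivative_smooth:
  assumes A: "A > 0" and u: "is_weak_deriv (Om A) (axis t 1) u ut" "is_weak_deriv (Om A) (axis t 1) ui uti"
    "u \<in> L2 (Om A)" "ui \<in> L2 (Om A)" "ut \<in> L2 (Om A)" "uti \<in> L2 (Om A)"
    and lim: "H1_limit A u g" "g i = ui" and \<Psi>: "smooth \<Psi>"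
    and zt: "zero_near A t 1 \<Psi>" "zero_near A t (-1) \<Psi>"
    and zi: "vanishes_at A i 1 u \<or> zero_near A i 1 \<Psi>" "vanishes_at A i (-1) u \<or> zero_near A i (-1) \<Psi>"
  shows "(LINT x|lebesgue_on (Om A). partial i \<Psi> x * ut x) = - (LINT x|lebesgue_on (Om A). \<Psi> x * uti x)"
proof -
  have s: "smooth (partial j \<Psi>)" for j using \<Psi> by (rule smooth_partial)
  have one: "(\<lambda>x. 1) \<in> L2 (Om A)" by (rule const_L2_Om)
  have pc: "partial i (\<lambda>x. 1) = (\<lambda>x. 0)" by (rule ext) simp
  have 1: "(LINT x|lebesgue_on (Om A). partial i \<Psi> x * ut x) = - (LINT x|lebesgue_on (Om A). partial t (partial i \<Psi>) x * u x)"
    using integration_by_parts[OF A u(1,3,5) H1_limit_const[of A 1] s[of i]]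
      vanishes_at_cases[OF disjI2 one s[of i]] zt[THEN zero_near_partial] by simp
  have 3: "(LINT x|lebesgue_on (Om A). \<Psi> x * uti x) = - (LINT x|lebesgue_on (Om A). partial t \<Psi> x * ui x)"
    using integration_by_parts[OF A u(2,4,6) H1_limit_const[of A 1] \<Psi>]
      vanishes_at_cases[OF disjI2 one \<Psi>] zt by simp
  have "is_weak_deriv (Om A) (axis i 1) (\<lambda>x. 1) (\<lambda>x. 0)"
    using smooth_is_weak_deriv[OF smooth_const A, of i 1] unfolding pc .
  then have 2: "(LINT x|lebesgue_on (Om A). partial t \<Psi> x * ui x) = - (LINT x|lebesgue_on (Om A). partial i (partial t \<Psi>) x * u x)"
    using integration_by_parts[OF A _ one const_L2_Om lim(1) s[of t]] lim(2)
      vanishes_at_cases[OF _ u(3) s[of t]] zi zero_near_partial[of A i _ \<Psi> t] by fastforce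
  show ?thesis using 1 2 3 partial_commute[OF \<Psi>, of t i] by simp
qed

text \<open>If \<open>u\<close> vanishes on a face then so does its tangential derivative. This derivative is not known
  to have a trace there, but integration by parts against limits of smooth functions is still
  possible, because the tangential derivative can be moved to the smooth factor and back.\<close>

lemma tangential_integration_by_parts:
  assumes A: "A > 0" and it: "i \<noteq> t"
    and u: "is_weak_deriv (Om A) (axis t 1) u ut" "is_weak_deriv (Om A) (axis t 1) ui uti"
    "u \<in> L2 (Om A)" "ui \<in> L2 (Om A)" "ut \<in> L2 (Om A)" "uti \<in> L2 (Om A)"
    and lim: "H1_limit A u g" "g i = ui" and f: "H1_limit A f gf" and \<rho>: "smooth \<rho>"
    and zi: "vanishes_at A i 1 u \<or> zero_near A i 1 \<rho>" "vanishes_at A i (-1) u \<or> zero_near A i (-1) \<rho>"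
  shows "(LINT x|lebesgue_on (Om A). \<rho> x * (uti x * f x))
    = - (LINT x|lebesgue_on (Om A). \<rho> x * (ut x * gf i x)) - (LINT x|lebesgue_on (Om A). partial i \<rho> x * (ut x * f x))"
proof -
  let ?I = "\<lambda>f. LINT x|lebesgue_on (Om A). f x"
  from f obtain v where v: "\<And>k. smooth (v k)" "(\<lambda>k. L2_norm (Om A) (\<lambda>x. v k x - f x)) \<longlonglongrightarrow> 0"
     "(\<lambda>k. L2_norm (Om A) (\<lambda>x. partial i (v k) x - gf i x)) \<longlonglongrightarrow> 0"
    and fL: "f \<in> L2 (Om A)" "gf i \<in> L2 (Om A)"
    unfolding H1_limit_def by blast
  have vL: "v k \<in> L2 (Om A)" "partial i (v k) \<in> L2 (Om A)" for k
    using v(1) by (auto intro: smooth_L2_Om smooth_partial)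
  note sp = smooth_partial
  define Y where "Y x = \<rho> x * (ut x * gf i x) + (partial i \<rho> x * (ut x * f x) + \<rho> x * (uti x * f x))" for x
  have i1: "integrable (lebesgue_on (Om A)) (\<lambda>x. \<sigma> x * (a x * b x))"
    if "smooth \<sigma>" "a \<in> L2 (Om A)" "b \<in> L2 (Om A)" for \<sigma> a b
    using L2_mult_integrable[OF L2_smooth_mult[OF that(1,2)] that(3)] by (simp add: mult.assoc)
  have Yi: "integrable (lebesgue_on (Om A)) Y"
    unfolding Y_def by (intro Bochner_Integration.integrable_add i1 \<rho> sp u fL)
  have eq: "?I (\<lambda>x. plateau A m (x $ t) * Y x) = 0" for m
  proof -
    define p where "p x = plateau A m (x $ t)" for x :: "real^3"
    have sm: "smooth p" unfolding p_def[abs_def] by (rule smooth_plateau)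
    have zp: "zero_near A t s p" if "s = 1 \<or> s = -1" for s
      unfolding zero_near_def p_def using that
      by (intro exI[of _ "1 / real (m + 2)"] conjI ballI impI plateau_0) auto
    obtain P where P: "\<And>A m t. (plateau A m has_real_derivative P A m t) (at t)"
      using plateau_derivative by metis
    have pp: "partial i p x = 0" for x
      unfolding p_def[abs_def] using partial_coord_fun[where i = i, OF P] it by simp
    define K where "K x = p x * \<rho> x" for x
    have sK: "smooth K" unfolding K_def[abs_def] by (intro smooth_mult sm \<rho>)
    have pK: "partial i K x = p x * partial i \<rho> x" for x
      unfolding K_def[abs_def] using partial_mult[OF smooth_differentiable[OF sm] smooth_differentiable[OF \<rho>], where i = i] pp by simp
    have zK: "zero_near A t 1 K" "zero_near A t (-1) K"
      unfolding K_def[abs_def] by (intro zero_near_mult(1) zp; simp)+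
    have zi': "vanishes_at A i 1 u \<or> zero_near A i 1 K" "vanishes_at A i (-1) u \<or> zero_near A i (-1) K"
      using zi zero_near_mult(2)[of A i _ \<rho> p] unfolding K_def[abs_def] by blast+
    have "?I (\<lambda>x. partial i (v k) x * (K x * ut x)) + ?I (\<lambda>x. v k x * (partial i K x * ut x))
        = - ?I (\<lambda>x. v k x * (K x * uti x))" for k
    proof -
      have "?I (\<lambda>x. partial i (\<lambda>x. K x * v k x) x * ut x) = - ?I (\<lambda>x. (K x * v k x) * uti x)"
        using zi' zK zero_near_mult(1)[of A _ _ K "v k"]
        by (intro tangential_derivative_smooth[OF A u lim smooth_mult[OF sK v(1)]]) blast+
      moreover have "partial i (\<lambda>x. K x * v k x) x * ut x
          = partial i (v k) x * (K x * ut x) + v k x * (partial i K x * ut x)" for x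
        using partial_mult[OF smooth_differentiable[OF sK] smooth_differentiable[OF v(1)], where i = i]
        by (simp add: algebra_simps)
      moreover have "?I (\<lambda>x. partial i (v k) x * (K x * ut x) + v k x * (partial i K x * ut x))
         = ?I (\<lambda>x. partial i (v k) x * (K x * ut x)) + ?I (\<lambda>x. v k x * (partial i K x * ut x))"
        by (intro Bochner_Integration.integral_add L2_mult_integrable L2_smooth_mult u vL sK sp[OF sK])
      ultimately show ?thesis by (simp add: mult_ac)
    qed
    moreover have "(\<lambda>k. ?I (\<lambda>x. partial i (v k) x * (K x * ut x)) + ?I (\<lambda>x. v k x * (partial i K x * ut x)))
        \<longlonglongrightarrow> ?I (\<lambda>x. gf i x * (K x * ut x)) + ?I (\<lambda>x. f x * (partial i K x * ut x))"
      by (intro tendsto_add L2_limit_integral vL fL v L2_smooth_mult sK sp u)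
    moreover have "(\<lambda>k. - ?I (\<lambda>x. v k x * (K x * uti x))) \<longlonglongrightarrow> - ?I (\<lambda>x. f x * (K x * uti x))"
      by (intro tendsto_minus L2_limit_integral vL fL v L2_smooth_mult sK u)
    ultimately have "?I (\<lambda>x. gf i x * (K x * ut x)) + ?I (\<lambda>x. f x * (partial i K x * ut x)) = - ?I (\<lambda>x. f x * (K x * uti x))"
      using LIMSEQ_unique by auto
    moreover have "?I (\<lambda>x. p x * Y x)
        = ?I (\<lambda>x. gf i x * (K x * ut x) + f x * (partial i K x * ut x) + f x * (K x * uti x))"
      by (intro Bochner_Integration.integral_cong refl) (simp add: Y_def pK K_def algebra_simps)
    moreover have "\<dots> = ?I (\<lambda>x. gf i x * (K x * ut x)) + ?I (\<lambda>x. f x * (partial i K x * ut x)) + ?I (\<lambda>x. f x * (K x * uti x))"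
      by (subst Bochner_Integration.integral_add Bochner_Integration.integral_add,
         intro Bochner_Integration.integrable_add L2_mult_integrable L2_smooth_mult fL sK sp u,
         intro L2_mult_integrable L2_smooth_mult fL sK sp u)+ simp
    ultimately show ?thesis by (simp add: p_def)
  qed
  have "(\<lambda>m. ?I (\<lambda>x. plateau A m (x $ t) * Y x)) \<longlonglongrightarrow> ?I Y"
    using plateau_bounds
    by (intro cutoff_dominated[OF Yi smooth_measurable_Om[OF smooth_plateau]] plateau_tendsto) (auto simp: Om_def abs_le_iff intro: order_trans)
  then have "?I Y = 0" unfolding eq using LIMSEQ_unique tendsto_const by blast
  moreover have "?I Y = ?I (\<lambda>x. \<rho> x * (ut x * gf i x)) + (?I (\<lambda>x. partial i \<rho> x * (ut x * f x)) + ?I (\<lambda>x. \<rho> x * (uti x * f x)))"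
    unfolding Y_def using i1[OF \<rho> u(5) fL(2)] i1[OF \<rho> u(6) fL(1)] i1[OF sp[OF \<rho>] u(5) fL(1)]
    by (simp only: Bochner_Integration.integral_add Bochner_Integration.integrable_add)
  ultimately show ?thesis by simp
qed

section \<open>Traces\<close>

lemma has_trace_cong_AE:
  assumes tr: "has_trace A i s u g" and ae: "AE x in lebesgue_on (Om A). u x = u' x" and u': "u' \<in> Hk 1 (Om A)"
  shows "has_trace A i s u' g"
proof -
  have "Hk_norm 1 (Om A) (\<lambda>x. v x - u x) = Hk_norm 1 (Om A) (\<lambda>x. v x - u' x)" for v
  proof -
    have "AE x in lebesgue_on (Om A). v x - u x = v x - u' x" using ae by (rule eventually_mono) simp
    then show ?thesis unfolding Hk_norm_def using weak_deriv_cong_AE(2)[OF _ Om_lebesgue] by metis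
  qed
  with tr u' show ?thesis by (simp add: has_trace_def)
qed

lemma Hk_norm_cmult:
  assumes "open S" "u \<in> Hk k S"
  shows "Hk_norm k S (\<lambda>x. c * u x) = \<bar>c\<bar> * Hk_norm k S u"
proof -
  have cu: "(\<lambda>x. c * u x) \<in> Hk k S" using Hk_lincomb[OF open_lebesgue[OF assms(1)] assms(2,2), of c 0] by simp
  have "L2_norm S (weak_deriv S a (\<lambda>x. c * u x)) = \<bar>c\<bar> * L2_norm S (weak_deriv S a u)" if a: "mi_order a \<le> k" for a
  proof -
    have "L2_norm S (weak_deriv S a (\<lambda>x. c * u x)) = L2_norm S (\<lambda>x. c * weak_deriv S a u x)"
      using weak_deriv_lincomb_AE[OF assms(1) assms(2,2) a, of c 0] Hk_weak_deriv(2)[OF assms(1) cu a]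
        Hk_weak_deriv(2)[OF assms a]
      by (intro L2_norm_cong_AE L2_measurable L2_cmult) simp_all
    then show ?thesis by (simp add: L2_norm_cmult)
  qed
  then have "(\<Sum>a | mi_order a \<le> k. (L2_norm S (weak_deriv S a (\<lambda>x. c * u x)))\<^sup>2)
     = \<bar>c\<bar>\<^sup>2 * (\<Sum>a | mi_order a \<le> k. (L2_norm S (weak_deriv S a u))\<^sup>2)"
    unfolding sum_distrib_left by (intro sum.cong) (auto simp: power_mult_distrib)
  then show ?thesis unfolding Hk_norm_def by (simp add: real_sqrt_mult)
qed

lemma continuous_face_pt: "continuous_on UNIV (face_pt A i s)"
proof -
  have v: "vector [a, b, c] = a *\<^sub>R axis 1 1 + b *\<^sub>R axis 2 1 + c *\<^sub>R (axis 3 1 :: real^3)" for a b c :: real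
    by (simp add: vec_eq_iff forall_3 axis_def)
  show ?thesis
    unfolding face_pt_def[abs_def] v by (cases "i = 1"; cases "i = 2") (auto intro!: continuous_intros)
qed

lemma smooth_face_L2:
  assumes "smooth v" shows "(\<lambda>p. v (face_pt A i s p)) \<in> L2 (face_square A)"
proof -
  let ?f = "\<lambda>p. v (face_pt A i s p)"
  have c: "continuous_on UNIV ?f"
    by (rule continuous_on_compose2[OF smooth_continuous[OF assms, of UNIV] continuous_face_pt]) simp
  have sq: "face_square A = box (\<chi> i. - A) (\<chi> i. A)" by (auto simp: face_square_def mem_box_cart)
  then have fl: "face_square A \<in> lmeasurable" by simp
  have "bounded (?f ` cbox (\<chi> i. - A) (\<chi> i. A))"
    by (intro compact_imp_bounded compact_continuous_image continuous_on_subset[OF c]) auto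
  then obtain C where "\<forall>x\<in>cbox (\<chi> i. - A) (\<chi> i. A). \<bar>?f x\<bar> \<le> C" by (auto simp: bounded_iff)
  then have b: "\<bar>?f x\<bar> \<le> C" if "x \<in> face_square A" for x
    using that box_subset_cbox[of "(\<chi> i. - A)::real^2" "\<chi> i. A"] unfolding sq by blast
  have 1: "(\<lambda>x. 1) \<in> L2 (face_square A)"
    using fl by (auto simp: L2_def integrable_restrict_space lmeasurable_iff_integrable fmeasurableD)
  have "?f \<in> borel_measurable (lebesgue_on (face_square A))"
    using fl by (intro continuous_imp_measurable_on_sets_lebesgue continuous_on_subset[OF c]) (auto simp: fmeasurableD)
  from L2_mult_bounded[OF 1 this b fmeasurableD[OF fl]] show ?thesis by simp
qed

lemma smooth_Hk1:
  assumes "smooth v" "A > 0" shows "v \<in> Hk 1 (Om A)"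
  unfolding Hk_def
proof safe
  show "v \<in> L2 (Om A)" using assms by (intro smooth_L2_Om)
  fix a :: "nat^3" assume a: "mi_order a \<le> 1"
  show "\<exists>w\<in>L2 (Om A). is_weak_deriv (Om A) a v w"
  proof (cases "a = 0")
    case True
    then show ?thesis using assms by (intro bexI[of _ v]) (auto intro!: is_weak_deriv_0 L2_locally_integrable smooth_L2_Om Om_lebesgue)
  next
    case False
    then obtain i where i: "a $ i > 0" by (auto simp: vec_eq_iff)
    have "a = (a - axis i 1) + axis i 1" using i by (auto simp: vec_eq_iff axis_def)
    then obtain a' where a': "a = a' + axis i 1" by blast
    with a have "mi_order a' = 0" by (simp add: mi_order_add_axis)
    then have "a' = 0" by (simp add: mi_order_def vec_eq_iff)
    with a' have "a = axis i 1" by simp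
    then show ?thesis using assms
      by (intro bexI[of _ "partial i v"]) (auto intro: smooth_is_weak_deriv smooth_L2_Om smooth_partial)
  qed
qed

lemma has_trace_lincomb:
  assumes A: "A > 0" and u: "has_trace A i s u g" and u': "has_trace A i s u' g'"
  shows "has_trace A i s (\<lambda>x. c * u x + c' * u' x) (\<lambda>x. c * g x + c' * g' x)"
proof -
  let ?F = "\<lambda>h p. h (face_pt A i s p)"
  from u obtain v where v: "\<And>k. smooth (v k)" "(\<lambda>k. Hk_norm 1 (Om A) (\<lambda>x. v k x - u x)) \<longlonglongrightarrow> 0"
      "(\<lambda>k. L2_norm (face_square A) (\<lambda>p. ?F (v k) p - ?F g p)) \<longlonglongrightarrow> 0"
    and u1: "u \<in> Hk 1 (Om A)" and g: "?F g \<in> L2 (face_square A)"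
    unfolding has_trace_def by blast
  from u' obtain v' where v': "\<And>k. smooth (v' k)" "(\<lambda>k. Hk_norm 1 (Om A) (\<lambda>x. v' k x - u' x)) \<longlonglongrightarrow> 0"
      "(\<lambda>k. L2_norm (face_square A) (\<lambda>p. ?F (v' k) p - ?F g' p)) \<longlonglongrightarrow> 0"
    and u1': "u' \<in> Hk 1 (Om A)" and g': "?F g' \<in> L2 (face_square A)"
    unfolding has_trace_def by blast
  define V where "V k x = c * v k x + c' * v' k x" for k x
  have "smooth (V k)" for k unfolding V_def[abs_def] by (intro smooth_add smooth_mult smooth_const v v')
  moreover have "(\<lambda>k. Hk_norm 1 (Om A) (\<lambda>x. V k x - (c * u x + c' * u' x))) \<longlonglongrightarrow> 0"
  proof (rule Lim_null_comparison)
    show "(\<lambda>k. \<bar>c\<bar> * Hk_norm 1 (Om A) (\<lambda>x. v k x - u x) + \<bar>c'\<bar> * Hk_norm 1 (Om A) (\<lambda>x. v' k x - u' x)) \<longlonglongrightarrow> 0"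
      using tendsto_add[OF tendsto_mult_left[OF v(2)] tendsto_mult_left[OF v'(2)]] by simp
    have "Hk_norm 1 (Om A) (\<lambda>x. V k x - (c * u x + c' * u' x))
       \<le> \<bar>c\<bar> * Hk_norm 1 (Om A) (\<lambda>x. v k x - u x) + \<bar>c'\<bar> * Hk_norm 1 (Om A) (\<lambda>x. v' k x - u' x)" for k
    proof -
      have h: "(\<lambda>x. v k x - u x) \<in> Hk 1 (Om A)" "(\<lambda>x. v' k x - u' x) \<in> Hk 1 (Om A)"
        by (intro Hk_diff Om_lebesgue smooth_Hk1 v v' A u1 u1')+
      have h': "(\<lambda>x. c * (v k x - u x)) \<in> Hk 1 (Om A)" "(\<lambda>x. c' * (v' k x - u' x)) \<in> Hk 1 (Om A)"
        using Hk_lincomb[OF Om_lebesgue h(1,1), of c 0] Hk_lincomb[OF Om_lebesgue h(2,2), of c' 0] by simp_all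
      have "(\<lambda>x. V k x - (c * u x + c' * u' x)) = (\<lambda>x. c * (v k x - u x) + c' * (v' k x - u' x))"
        by (rule ext) (simp add: V_def algebra_simps)
      then show ?thesis
        using Hk_norm_triangle(1)[OF open_Om h'] unfolding Hk_norm_cmult[OF open_Om h(1)] Hk_norm_cmult[OF open_Om h(2)] by simp
    qed
    then show "\<forall>\<^sub>F k in sequentially. norm (Hk_norm 1 (Om A) (\<lambda>x. V k x - (c * u x + c' * u' x)))
       \<le> \<bar>c\<bar> * Hk_norm 1 (Om A) (\<lambda>x. v k x - u x) + \<bar>c'\<bar> * Hk_norm 1 (Om A) (\<lambda>x. v' k x - u' x)"
      by (simp add: Hk_norm_nonneg)
  qed
  moreover have "(\<lambda>k. L2_norm (face_square A) (\<lambda>p. ?F (V k) p - (c * ?F g p + c' * ?F g' p))) \<longlonglongrightarrow> 0"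
  proof (rule Lim_null_comparison)
    show "(\<lambda>k. \<bar>c\<bar> * L2_norm (face_square A) (\<lambda>p. ?F (v k) p - ?F g p)
       + \<bar>c'\<bar> * L2_norm (face_square A) (\<lambda>p. ?F (v' k) p - ?F g' p)) \<longlonglongrightarrow> 0"
      using tendsto_add[OF tendsto_mult_left[OF v(3)] tendsto_mult_left[OF v'(3)]] by simp
    have "L2_norm (face_square A) (\<lambda>p. ?F (V k) p - (c * ?F g p + c' * ?F g' p))
       \<le> \<bar>c\<bar> * L2_norm (face_square A) (\<lambda>p. ?F (v k) p - ?F g p) + \<bar>c'\<bar> * L2_norm (face_square A) (\<lambda>p. ?F (v' k) p - ?F g' p)" for k
    proof -
      have "L2_norm (face_square A) (\<lambda>p. c * (?F (v k) p - ?F g p) + c' * (?F (v' k) p - ?F g' p))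
         \<le> L2_norm (face_square A) (\<lambda>p. c * (?F (v k) p - ?F g p)) + L2_norm (face_square A) (\<lambda>p. c' * (?F (v' k) p - ?F g' p))"
        by (intro L2_norm_triangle L2_cmult L2_diff smooth_face_L2 v v' g g')
      moreover have "(\<lambda>p. ?F (V k) p - (c * ?F g p + c' * ?F g' p)) = (\<lambda>p. c * (?F (v k) p - ?F g p) + c' * (?F (v' k) p - ?F g' p))"
        by (rule ext) (simp add: V_def algebra_simps)
      ultimately show ?thesis by (simp add: L2_norm_cmult)
    qed
    then show "\<forall>\<^sub>F k in sequentially. norm (L2_norm (face_square A) (\<lambda>p. ?F (V k) p - (c * ?F g p + c' * ?F g' p)))
       \<le> \<bar>c\<bar> * L2_norm (face_square A) (\<lambda>p. ?F (v k) p - ?F g p) + \<bar>c'\<bar> * L2_norm (face_square A) (\<lambda>p. ?F (v' k) p - ?F g' p)"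
      by (simp add: L2_norm_nonneg)
  qed
  ultimately show ?thesis
    unfolding has_trace_def
    by (intro conjI Hk_lincomb Om_lebesgue u1 u1' L2_add L2_cmult g g' exI[of _ V] allI)
qed

lemma has_normal_deriv_iff:
  "has_normal_deriv A i s u g \<longleftrightarrow> has_trace A i s (\<lambda>x. s * weak_deriv (Om A) (axis i 1) u x) g"
  by (simp add: has_normal_deriv_def weak_grad_def inner_axis' )

lemma has_normal_deriv_diff:
  assumes A: "A > 0" and u: "u \<in> Hk 1 (Om A)" "has_normal_deriv A i s u g"
    and u': "u' \<in> Hk 1 (Om A)" "has_normal_deriv A i s u' g'"
  shows "has_normal_deriv A i s (\<lambda>x. u x - u' x) (\<lambda>x. g x - g' x)"
  unfolding has_normal_deriv_iff
proof (rule has_trace_cong_AE)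
  let ?D = "weak_deriv (Om A) (axis i 1)"
  have t: "has_trace A i s (\<lambda>x. s * ?D u x) g" "has_trace A i s (\<lambda>x. s * ?D u' x) g'"
    using u u' unfolding has_normal_deriv_iff by auto
  show 1: "has_trace A i s (\<lambda>x. s * ?D u x - s * ?D u' x) (\<lambda>x. g x - g' x)"
    using has_trace_lincomb[OF A t, of 1 "-1"] by simp
  show ae: "AE x in lebesgue_on (Om A). s * ?D u x - s * ?D u' x = s * ?D (\<lambda>x. u x - u' x) x"
  proof -
    have "AE x in lebesgue_on (Om A). ?D (\<lambda>x. u x - u' x) x = ?D u x - ?D u' x"
      by (rule weak_deriv_diff_AE[OF open_Om u(1) u'(1)]) simp
    then show ?thesis by (rule eventually_mono) (simp add: right_diff_distrib)
  qed
  have h: "(\<lambda>x. s * ?D u x - s * ?D u' x) \<in> Hk 1 (Om A)" using 1 by (simp add: has_trace_def)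
  show "(\<lambda>x. s * ?D (\<lambda>x. u x - u' x) x) \<in> Hk 1 (Om A)"
    using h weak_deriv_cong_AE(1)[OF ae Om_lebesgue] L2_cong_AE[OF Hk_L2[OF h] ae Om_lebesgue]
    unfolding Hk_def by simp
qed

section \<open>Integral identities for functions with vanishing Cauchy data\<close>

abbreviation "D1 A w i \<equiv> weak_deriv (Om A) (axis i 1) w"
abbreviation "D2 A w i j \<equiv> weak_deriv (Om A) (axis i 1 + axis j 1) w"
abbreviation "D3 A w i j k \<equiv> weak_deriv (Om A) (axis i 1 + axis j 1 + axis k 1) w"

lemma D2_commute: "D2 A w i j = D2 A w j i"
  by (simp add: add.commute)

lemma axis_2: "axis j (2::nat) = axis j 1 + axis j 1"
  by (simp add: vec_eq_iff axis_def)

lemma Hk3_derivs: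
  assumes "w \<in> Hk 3 (Om A)"
  shows "w \<in> L2 (Om A)" "D1 A w i \<in> L2 (Om A)" "D2 A w i j \<in> L2 (Om A)" "D3 A w i j k \<in> L2 (Om A)"
    "is_weak_deriv (Om A) (axis i 1) w (D1 A w i)"
    "is_weak_deriv (Om A) (axis j 1) (D1 A w i) (D2 A w i j)"
    "is_weak_deriv (Om A) (axis k 1) (D2 A w i j) (D3 A w i j k)"
proof -
  note d = Hk_weak_deriv[OF open_Om assms]
  show "w \<in> L2 (Om A)" using assms by (rule Hk_L2)
  show "D1 A w i \<in> L2 (Om A)" "D2 A w i j \<in> L2 (Om A)" "D3 A w i j k \<in> L2 (Om A)"
    "is_weak_deriv (Om A) (axis i 1) w (D1 A w i)"
    by (intro d; simp add: mi_order_add_axis)+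
  show "is_weak_deriv (Om A) (axis j 1) (D1 A w i) (D2 A w i j)"
    by (rule is_weak_deriv_next[OF d(1) d(1)]) (simp_all add: mi_order_add_axis)
  show "is_weak_deriv (Om A) (axis k 1) (D2 A w i j) (D3 A w i j k)"
    by (rule is_weak_deriv_next[OF d(1) d(1)]) (simp_all add: mi_order_add_axis)
qed

text \<open>The normal derivative on some face is prescribed for every direction, so every first derivative is an
  \<open>H\<^sup>1\<close> limit of smooth functions.\<close>

lemma H3_0bsc_traces:
  assumes w: "w \<in> H3_0bsc A" and A: "A > 0"
  shows "w \<in> Hk 3 (Om A)" "H1_limit A w (D1 A w)" "H1_limit A (D1 A w j) (D2 A w j)"
    "vanishes_at A 3 (-1) w" "\<And>i s. s = 1 \<or> s = -1 \<Longrightarrow> (i, s) \<noteq> (3, 1) \<Longrightarrow> vanishes_at A i s (D1 A w i)"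
proof -
  show h3: "w \<in> Hk 3 (Om A)" using w by (simp add: H3_0bsc_def)
  have "has_trace A 3 (-1) w (\<lambda>x. 0)" using w by (simp add: H3_0bsc_def)
  from has_trace_0[OF this A] show "H1_limit A w (D1 A w)" "vanishes_at A 3 (-1) w" by auto
  have tr: "has_trace A i s (D1 A w i) (\<lambda>x. 0)" if "s = 1 \<or> s = -1" "(i, s) \<noteq> (3, 1)" for i s
  proof -
    have "has_normal_deriv A i s w (\<lambda>x. 0)" using w that by (auto simp: H3_0bsc_def)
    then have "has_trace A i s (\<lambda>x. s * D1 A w i x) (\<lambda>x. 0)" by (simp only: has_normal_deriv_iff)
    from has_trace_lincomb[OF A this this, of s 0] have "has_trace A i s (\<lambda>x. (s * s) * D1 A w i x) (\<lambda>x. 0)"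
      by (simp add: mult.assoc)
    moreover have "s * s = 1" using that by auto
    ultimately show ?thesis by simp
  qed
  show "vanishes_at A i s (D1 A w i)" if "s = 1 \<or> s = -1" "(i, s) \<noteq> (3, 1)" for i s
    using has_trace_0(2)[OF tr[OF that] A] that by blast
  have lim: "H1_limit A (D1 A w j) (\<lambda>i. weak_deriv (Om A) (axis i 1) (D1 A w j))"
    using has_trace_0(1)[OF tr[of "-1" j] A] by simp
  have e: "AE x in lebesgue_on (Om A). weak_deriv (Om A) (axis i 1) (D1 A w j) x = D2 A w j i x" for i
    by (rule weak_deriv_AE_eq[OF open_Om Hk3_derivs(6)[OF h3]])
  have "L2_norm (Om A) (\<lambda>x. v x - weak_deriv (Om A) (axis i 1) (D1 A w j) x) = L2_norm (Om A) (\<lambda>x. v x - D2 A w j i x)"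
    if "v \<in> L2 (Om A)" for i v
    using lim that Hk3_derivs(3)[OF h3, of j i]
    by (intro L2_norm_cong_AE L2_measurable L2_diff) (auto simp: H1_limit_def intro: eventually_mono[OF e])
  note n = this
  from lim obtain v where v: "\<And>k. smooth (v k)" "(\<lambda>k. L2_norm (Om A) (\<lambda>x. v k x - D1 A w j x)) \<longlonglongrightarrow> 0"
    "\<And>i. (\<lambda>k. L2_norm (Om A) (\<lambda>x. partial i (v k) x - weak_deriv (Om A) (axis i 1) (D1 A w j) x)) \<longlonglongrightarrow> 0"
    unfolding H1_limit_def by blast
  show "H1_limit A (D1 A w j) (D2 A w j)"
    unfolding H1_limit_def
    using v(1,2) v(3)[unfolded n[OF smooth_L2_Om[OF smooth_partial[OF v(1)]]]]
    by (intro conjI allI exI[of _ v] Hk3_derivs[OF h3])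
qed

text \<open>Integral identities are stated as integrands of mean zero, so that they can be combined linearly with
  integrability carried along.\<close>

definition zero_mean :: "real \<Rightarrow> (real^3 \<Rightarrow> real) \<Rightarrow> bool" where
  "zero_mean A f \<longleftrightarrow> integrable (lebesgue_on (Om A)) f \<and> (LINT x|lebesgue_on (Om A). f x) = 0"

lemma zero_mean_add: "zero_mean A f \<Longrightarrow> zero_mean A g \<Longrightarrow> zero_mean A (\<lambda>x. f x + g x)"
  and zero_mean_cmult: "zero_mean A f \<Longrightarrow> zero_mean A (\<lambda>x. c * f x)"
  by (auto simp: zero_mean_def)

lemma integrable_smooth_mult2:
  assumes "smooth \<sigma>" "a \<in> L2 (Om A)" "b \<in> L2 (Om A)"
  shows "integrable (lebesgue_on (Om A)) (\<lambda>x. \<sigma> x * (a x * b x))"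
  using L2_mult_integrable[OF L2_smooth_mult[OF assms(1,2)] assms(3)] by (simp add: mult.assoc)

lemma zero_mean_parts:
  assumes A: "A > 0" and f: "is_weak_deriv (Om A) (axis i 1) f fi" "f \<in> L2 (Om A)" "fi \<in> L2 (Om A)"
    and h: "H1_limit A h g" and \<rho>: "smooth \<rho>"
    and van: "vanishes_at A i 1 h \<or> zero_near A i 1 \<rho>" "vanishes_at A i (-1) h \<or> zero_near A i (-1) \<rho>"
  shows "zero_mean A (\<lambda>x. \<rho> x * (fi x * h x) + \<rho> x * (f x * g i x) + partial i \<rho> x * (f x * h x))"
proof -
  have hL: "h \<in> L2 (Om A)" "g i \<in> L2 (Om A)" using h by (auto simp: H1_limit_def)
  have i: "integrable (lebesgue_on (Om A)) (\<lambda>x. \<rho> x * (fi x * h x))"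
    "integrable (lebesgue_on (Om A)) (\<lambda>x. \<rho> x * (f x * g i x))"
    "integrable (lebesgue_on (Om A)) (\<lambda>x. partial i \<rho> x * (f x * h x))"
    by (intro integrable_smooth_mult2 smooth_partial \<rho> f hL)+
  show ?thesis unfolding zero_mean_def
    using i integration_by_parts[OF A f h \<rho> vanishes_at_cases[OF van(1) hL(1) \<rho>] vanishes_at_cases[OF van(2) hL(1) \<rho>]]
    by simp
qed

lemma zero_mean_tangential:
  assumes A: "A > 0" and it: "i \<noteq> t"
    and u: "is_weak_deriv (Om A) (axis t 1) u ut" "is_weak_deriv (Om A) (axis t 1) ui uti"
    "u \<in> L2 (Om A)" "ui \<in> L2 (Om A)" "ut \<in> L2 (Om A)" "uti \<in> L2 (Om A)"
    and lim: "H1_limit A u g" "g i = ui" and f: "H1_limit A f gf" and \<rho>: "smooth \<rho>"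
    and zi: "vanishes_at A i 1 u \<or> zero_near A i 1 \<rho>" "vanishes_at A i (-1) u \<or> zero_near A i (-1) \<rho>"
  shows "zero_mean A (\<lambda>x. \<rho> x * (uti x * f x) + \<rho> x * (ut x * gf i x) + partial i \<rho> x * (ut x * f x))"
proof -
  have fL: "f \<in> L2 (Om A)" "gf i \<in> L2 (Om A)" using f by (auto simp: H1_limit_def)
  have "integrable (lebesgue_on (Om A)) (\<lambda>x. \<rho> x * (uti x * f x))"
    "integrable (lebesgue_on (Om A)) (\<lambda>x. \<rho> x * (ut x * gf i x))"
    "integrable (lebesgue_on (Om A)) (\<lambda>x. partial i \<rho> x * (ut x * f x))"
    by (intro integrable_smooth_mult2 smooth_partial \<rho> u fL)+
  then show ?thesis unfolding zero_mean_def
    using tangential_integration_by_parts[OF A it u lim f \<rho> zi] by simp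
qed

text \<open>Weights depend on the third coordinate only and vanish near the face on which no data are
  given.\<close>

definition weight :: "real \<Rightarrow> (real \<Rightarrow> real) \<Rightarrow> (real \<Rightarrow> real) \<Rightarrow> bool" where
  "weight A r r' \<longleftrightarrow> smooth (\<lambda>x. r (x $ 3)) \<and> (\<forall>t. (r has_real_derivative r' t) (at t)) \<and>
     zero_near A 3 1 (\<lambda>x. r (x $ 3))"

lemma weight_partial:
  "weight A r r' \<Longrightarrow> partial i (\<lambda>x. r (x $ 3)) = (\<lambda>x. if i = 3 then r' (x $ 3) else 0)"
  unfolding weight_def by (rule ext) (rule partial_coord_fun, blast)

lemma weight_smooth: "weight A r r' \<Longrightarrow> smooth (\<lambda>x. r (x $ 3))" "weight A r r' \<Longrightarrow> smooth (\<lambda>x. r' (x $ 3))"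
proof -
  assume w: "weight A r r'"
  then show "smooth (\<lambda>x. r (x $ 3))" by (simp add: weight_def)
  from smooth_partial[OF this, of 3] show "smooth (\<lambda>x. r' (x $ 3))"
    by (simp add: weight_partial[OF w])
qed

lemma weight_mult:
  assumes r: "smooth (\<lambda>x. r (x $ 3))" "\<And>t. (r has_real_derivative r' t) (at t)" and k: "weight A k k'"
  shows "weight A (\<lambda>t. r t * k t) (\<lambda>t. r' t * k t + r t * k' t)"
  unfolding weight_def
proof (intro conjI allI)
  show "smooth (\<lambda>x. r (x $ 3) * k (x $ 3))" using r(1) weight_smooth(1)[OF k] by (rule smooth_mult)
  show "zero_near A 3 1 (\<lambda>x. r (x $ 3) * k (x $ 3))" using k unfolding weight_def by (intro zero_near_mult(2)) blast
  fix t
  have "(k has_real_derivative k' t) (at t)" using k by (simp add: weight_def)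
  from DERIV_mult[OF r(2) this] show "((\<lambda>t. r t * k t) has_real_derivative r' t * k t + r t * k' t) (at t)"
    by (simp add: algebra_simps)
qed

context
  fixes A :: real and w :: "real^3 \<Rightarrow> real" and r r' :: "real \<Rightarrow> real"
  assumes A: "A > 0" and w: "w \<in> H3_0bsc A" and r: "weight A r r'"
begin

private lemmas h3 = H3_0bsc_traces(1)[OF w A]
private lemmas lim = H3_0bsc_traces(2,3)[OF w A]
private lemmas d = Hk3_derivs[OF h3]
private lemmas sr = weight_smooth[OF r]
private lemmas pr = weight_partial[OF r]

private lemma zr: "zero_near A 3 1 (\<lambda>x. r (x $ 3))" using r by (simp add: weight_def)

private lemma van: "i \<noteq> 3 \<Longrightarrow> vanishes_at A i 1 (D1 A w i)" "vanishes_at A i (-1) (D1 A w i)"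
  using H3_0bsc_traces(5)[OF w A] by simp_all

private lemma van': "vanishes_at A i 1 (D1 A w i) \<or> zero_near A i 1 (\<lambda>x. r (x $ 3))"
  using van(1) zr by (cases "i = 3") auto

text \<open>Multiplication of the Laplacian by \<open>\<partial>\<^sub>3 w\<close>. For \<open>j = 1, 2\<close> the term \<open>w\<^sub>j\<^sub>j w\<^sub>3\<close> is integrated by parts twice, the
  first time in direction \<open>j\<close>, using the Neumann condition on the lateral faces, and the second time in
  direction 3, using that tangential derivatives vanish on the face \<open>z = -A\<close>.\<close>

lemma multiplier_identity_z:
  "zero_mean A (\<lambda>x. r (x $ 3) * ((D2 A w 1 1 x + D2 A w 2 2 x + D2 A w 3 3 x) * D1 A w 3 x)
     + r' (x $ 3) * ((D1 A w 3 x)\<^sup>2 - (D1 A w 1 x)\<^sup>2 - (D1 A w 2 x)\<^sup>2) / 2)"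
proof -
  have a: "zero_mean A (\<lambda>x. r (x $ 3) * (D2 A w 3 j x * D1 A w j x) + r (x $ 3) * (D1 A w 3 x * D2 A w j j x)
     + partial j (\<lambda>x. r (x $ 3)) x * (D1 A w 3 x * D1 A w j x))" for j
    by (rule zero_mean_parts[OF A d(6) d(2,3) lim(2) sr(1) van' disjI1[OF van(2)]])
  have b: "zero_mean A (\<lambda>x. r (x $ 3) * (D2 A w 3 j x * D1 A w j x) + r (x $ 3) * (D1 A w j x * D2 A w j 3 x)
     + partial 3 (\<lambda>x. r (x $ 3)) x * (D1 A w j x * D1 A w j x))" if j: "3 \<noteq> j" for j
    by (rule zero_mean_tangential[OF A j d(5,6,1,2,2,3) lim(1) refl lim(2) sr(1) disjI2[OF zr] disjI1[OF H3_0bsc_traces(4)[OF w A]]])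
  have ne: "3 \<noteq> (1::3)" "3 \<noteq> (2::3)" by simp_all
  note z = zero_mean_add[OF zero_mean_add[OF zero_mean_cmult[OF a[of 3], of "1/2"]
      zero_mean_add[OF a[of 1] zero_mean_cmult[OF b[OF ne(1)], of "-1/2"]]]
      zero_mean_add[OF a[of 2] zero_mean_cmult[OF b[OF ne(2)], of "-1/2"]]]
  have "(\<lambda>x. r (x $ 3) * ((D2 A w 1 1 x + D2 A w 2 2 x + D2 A w 3 3 x) * D1 A w 3 x)
     + r' (x $ 3) * ((D1 A w 3 x)\<^sup>2 - (D1 A w 1 x)\<^sup>2 - (D1 A w 2 x)\<^sup>2) / 2)
   = (\<lambda>x. 1 / 2 * (r (x $ 3) * (D2 A w 3 3 x * D1 A w 3 x) + r (x $ 3) * (D1 A w 3 x * D2 A w 3 3 x)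
     + partial 3 (\<lambda>x. r (x $ 3)) x * (D1 A w 3 x * D1 A w 3 x))
     + ((r (x $ 3) * (D2 A w 3 1 x * D1 A w 1 x) + r (x $ 3) * (D1 A w 3 x * D2 A w 1 1 x)
     + partial 1 (\<lambda>x. r (x $ 3)) x * (D1 A w 3 x * D1 A w 1 x)) + - 1 / 2 *
     (r (x $ 3) * (D2 A w 3 1 x * D1 A w 1 x) + r (x $ 3) * (D1 A w 1 x * D2 A w 1 3 x)
     + partial 3 (\<lambda>x. r (x $ 3)) x * (D1 A w 1 x * D1 A w 1 x)))
     + ((r (x $ 3) * (D2 A w 3 2 x * D1 A w 2 x) + r (x $ 3) * (D1 A w 3 x * D2 A w 2 2 x)
     + partial 2 (\<lambda>x. r (x $ 3)) x * (D1 A w 3 x * D1 A w 2 x)) + - 1 / 2 *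
     (r (x $ 3) * (D2 A w 3 2 x * D1 A w 2 x) + r (x $ 3) * (D1 A w 2 x * D2 A w 2 3 x)
     + partial 3 (\<lambda>x. r (x $ 3)) x * (D1 A w 2 x * D1 A w 2 x))))"
    unfolding pr D2_commute[where i = 1 and j = 3] D2_commute[where i = 2 and j = 3]
    by (rule ext) (simp add: field_simps power2_eq_square)
  with z show ?thesis by simp
qed

lemma multiplier_identity_0:
  "zero_mean A (\<lambda>x. r (x $ 3) * ((D2 A w 1 1 x + D2 A w 2 2 x + D2 A w 3 3 x) * w x)
     + r (x $ 3) * ((D1 A w 1 x)\<^sup>2 + (D1 A w 2 x)\<^sup>2 + (D1 A w 3 x)\<^sup>2) + r' (x $ 3) * (w x * D1 A w 3 x))"
proof -
  have a: "zero_mean A (\<lambda>x. r (x $ 3) * (D1 A w j x * D1 A w j x) + r (x $ 3) * (w x * D2 A w j j x)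
     + partial j (\<lambda>x. r (x $ 3)) x * (w x * D1 A w j x))" for j
    by (rule zero_mean_parts[OF A d(5) d(1,2) lim(2) sr(1) van' disjI1[OF van(2)]])
  note z = zero_mean_add[OF zero_mean_add[OF a[of 1] a[of 2]] a[of 3]]
  have "(\<lambda>x. r (x $ 3) * ((D2 A w 1 1 x + D2 A w 2 2 x + D2 A w 3 3 x) * w x)
     + r (x $ 3) * ((D1 A w 1 x)\<^sup>2 + (D1 A w 2 x)\<^sup>2 + (D1 A w 3 x)\<^sup>2) + r' (x $ 3) * (w x * D1 A w 3 x))
    = (\<lambda>x. (r (x $ 3) * (D1 A w 1 x * D1 A w 1 x) + r (x $ 3) * (w x * D2 A w 1 1 x)
     + partial 1 (\<lambda>x. r (x $ 3)) x * (w x * D1 A w 1 x)) + (r (x $ 3) * (D1 A w 2 x * D1 A w 2 x) + r (x $ 3) * (w x * D2 A w 2 2 x)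
     + partial 2 (\<lambda>x. r (x $ 3)) x * (w x * D1 A w 2 x)) + (r (x $ 3) * (D1 A w 3 x * D1 A w 3 x) + r (x $ 3) * (w x * D2 A w 3 3 x)
     + partial 3 (\<lambda>x. r (x $ 3)) x * (w x * D1 A w 3 x)))"
    unfolding pr by (rule ext) (simp add: field_simps power2_eq_square)
  with z show ?thesis by simp
qed

lemma square_identity:
  "zero_mean A (\<lambda>x. r (x $ 3) * (w x * D1 A w 3 x) + r' (x $ 3) * (w x)\<^sup>2 / 2)"
proof -
  have a: "zero_mean A (\<lambda>x. r (x $ 3) * (D1 A w 3 x * w x) + r (x $ 3) * (w x * D1 A w 3 x)
     + partial 3 (\<lambda>x. r (x $ 3)) x * (w x * w x))"
    by (rule zero_mean_parts[OF A d(5) d(1,2) lim(1) sr(1) disjI2[OF zr] disjI1[OF H3_0bsc_traces(4)[OF w A]]])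
  have "(\<lambda>x. r (x $ 3) * (w x * D1 A w 3 x) + r' (x $ 3) * (w x)\<^sup>2 / 2)
     = (\<lambda>x. 1/2 * (r (x $ 3) * (D1 A w 3 x * w x) + r (x $ 3) * (w x * D1 A w 3 x)
     + partial 3 (\<lambda>x. r (x $ 3)) x * (w x * w x)))"
    unfolding pr by (rule ext) (simp add: field_simps power2_eq_square)
  with zero_mean_cmult[OF a, of "1/2"] show ?thesis by simp
qed

text \<open>The product \<open>w\<^sub>i\<^sub>i\<^sub>j w\<^sub>j\<close> is integrated by parts in direction \<open>i\<close>. On each face normal to \<open>i\<close> away from the
  top, \<open>w\<^sub>i\<close> vanishes and hence, if \<open>j \<noteq> i\<close>, so does its tangential derivative \<open>w\<^sub>i\<^sub>j\<close>.\<close>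

lemma second_derivative_identity:
  "zero_mean A (\<lambda>x. r (x $ 3) * (D3 A w i i j x * D1 A w j x) + r (x $ 3) * (D2 A w i j x * D2 A w i j x)
     + (if i = 3 then r' (x $ 3) else 0) * (D2 A w i j x * D1 A w j x))"
proof (cases "i = j")
  case True
  have "zero_mean A (\<lambda>x. r (x $ 3) * (D3 A w i i i x * D1 A w i x) + r (x $ 3) * (D2 A w i i x * D2 A w i i x)
     + partial i (\<lambda>x. r (x $ 3)) x * (D2 A w i i x * D1 A w i x))"
    by (rule zero_mean_parts[OF A d(7) d(3,4) lim(2) sr(1) van' disjI1[OF van(2)]])
  with True show ?thesis unfolding pr by simp
next
  case False
  have "zero_mean A (\<lambda>x. r (x $ 3) * (D3 A w i i j x * D1 A w j x) + r (x $ 3) * (D2 A w i j x * D2 A w j i x)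
     + partial i (\<lambda>x. r (x $ 3)) x * (D2 A w i j x * D1 A w j x))"
    by (rule zero_mean_tangential[OF A False d(6,7,2,3,3,4) lim(2) refl lim(2) sr(1) van' disjI1[OF van(2)]])
  then show ?thesis unfolding pr D2_commute[where i = j and j = i] .
qed

end

section \<open>The Carleman estimate\<close>

text \<open>Here \<open>z\<close> stands for \<open>z - R\<close>, \<open>E\<close> for the weight, \<open>\<kappa>\<close> for a cutoff with derivative \<open>k\<close>, \<open>w1\<close>, \<open>w2\<close>, \<open>w3\<close>
  for the first derivatives and \<open>g\<close> for the Laplacian of \<open>w\<close>. The right-hand side without the term of \<open>C\<close>
  is a linear combination of multiplier identities, with integral zero. The bracket after \<open>l\<close> provides the
  square of the full gradient, since the one after \<open>K\<close> controls only \<open>w3\<close> and \<open>w\<close>.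
  With \<open>p = 4 l z w3 + b w\<close>, the bracket after \<open>K\<close> is
  \<open>E \<kappa> (2 p\<^sup>2 + 2 g p + 8 l (w3 + 2 l z w)\<^sup>2 + 32 l\<^sup>3 z\<^sup>2 w\<^sup>2)\<close> up to terms with \<open>k\<close>. The two middle
  squares dominate all terms of the wrong sign.\<close>

lemma carleman_pointwise:
  fixes l z E \<kappa> k w w1 w2 w3 g z0 Z K b N C :: real
  assumes l: "l \<ge> 1" and z0: "z0 > 0" "z0 \<le> \<bar>z\<bar>" and Z: "\<bar>z\<bar> \<le> Z" and E: "E \<ge> 0" "\<kappa> \<ge> 0"
  defines "b \<equiv> 2 * l + 8 * l^2 * z^2" and "N \<equiv> w1^2 + w2^2 + w3^2" and "K \<equiv> 1 + 1 / z0^2"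
    and "C \<equiv> 1 + 1 / z0^2 + 2 + (1 + 1 / z0^2) * (4 * Z + (2 + 8 * Z^2) + 4 * Z * (2 + 8 * Z^2))"
  shows "E * \<kappa> * (l * N + l^3 * w^2) \<le>
     l * ((E * \<kappa>) * (g * w) + (E * \<kappa>) * N + (4 * l * z * E * \<kappa> + E * k) * (w * w3))
   + K * (2 * ((4 * l * z * E * \<kappa>) * (g * w3)
            + ((4 * l * E + 4 * l * z * (4 * l * z * E)) * \<kappa> + 4 * l * z * E * k) * (w3^2 - w1^2 - w2^2) / 2)
       + 2 * ((b * E * \<kappa>) * (g * w) + (b * E * \<kappa>) * N
            + ((16 * l^2 * z * E + b * (4 * l * z * E)) * \<kappa> + b * E * k) * (w * w3))
       + ((8 * l * z * b * E * \<kappa>) * (w * w3)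
            + (((8 * l * b + 128 * l^3 * z^2) * E + 8 * l * z * b * (4 * l * z * E)) * \<kappa> + 8 * l * z * b * E * k) * w^2 / 2))
   + C * (E * \<kappa> * g^2 + l^3 * (E * \<bar>k\<bar> * (w^2 + N)))"
proof -
  define p where "p = 4 * l * z * w3 + b * w"
  define L1 where "L1 = 8 * l * (w3 + 2 * l * z * w)^2 + 32 * l^3 * z^2 * w^2"
  define M where "M = 4 * l * z * (w3^2 - w1^2 - w2^2) + 2 * b * (w * w3) + 4 * l * z * b * w^2"
  define T where "T = w^2 + N"
  have id: "2 * ((4 * l * z * E * \<kappa>) * (g * w3)
            + ((4 * l * E + 4 * l * z * (4 * l * z * E)) * \<kappa> + 4 * l * z * E * k) * (w3^2 - w1^2 - w2^2) / 2)
       + 2 * ((b * E * \<kappa>) * (g * w) + (b * E * \<kappa>) * N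
            + ((16 * l^2 * z * E + b * (4 * l * z * E)) * \<kappa> + b * E * k) * (w * w3))
       + ((8 * l * z * b * E * \<kappa>) * (w * w3)
            + (((8 * l * b + 128 * l^3 * z^2) * E + 8 * l * z * b * (4 * l * z * E)) * \<kappa> + 8 * l * z * b * E * k) * w^2 / 2)
     = E * \<kappa> * (2 * p^2 + L1 + 2 * g * p) + E * k * M"
    unfolding p_def L1_def M_def N_def b_def
    by (simp add: field_simps power2_eq_square power3_eq_cube)
  have l3: "l \<le> l^3" "l^2 \<le> l^3" using l power_increasing[of 1 3 l] power_increasing[of 2 3 l] by simp_all
  have l0: "l > 0" "l^3 \<ge> 0" using l by auto
  have N0: "N \<ge> 0" "T \<ge> 0" by (simp_all add: N_def T_def)
  have ww3: "\<bar>w * w3\<bar> \<le> T / 2"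
  proof -
    have "2 * \<bar>w * w3\<bar> \<le> w^2 + w3^2" using sum_squares_bound[of "\<bar>w\<bar>" "\<bar>w3\<bar>"] by (simp add: abs_mult)
    also have "\<dots> \<le> T" by (simp add: T_def N_def)
    finally show ?thesis by simp
  qed
  have a: "- (g^2) \<le> 2 * p^2 + 2 * g * p"
  proof -
    have "0 \<le> (g + p)^2 + p^2" by simp
    then show ?thesis by (simp add: power2_eq_square algebra_simps)
  qed
  have bb: "0 \<le> L1 + 4 * l^2 * z * (w * w3)"
  proof -
    have "0 \<le> l * (8 * (w3 + 9/4 * (l * z * w))^2 + 47/2 * (l * z * w)^2)" using l0 by simp
    also have "\<dots> = L1 + 4 * l^2 * z * (w * w3)"
      unfolding L1_def by (simp add: field_simps power2_eq_square power3_eq_cube)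
    finally show ?thesis .
  qed
  have c: "32 * (l^3 * w^2) \<le> L1 / z0^2"
  proof -
    have "z0^2 \<le> z^2" using z0 power_mono[of z0 "\<bar>z\<bar>" 2] by simp
    then have "(32 * l^3 * w^2) * z0^2 \<le> (32 * l^3 * w^2) * z^2" using l0 by (intro mult_left_mono) auto
    also have "\<dots> \<le> L1" unfolding L1_def using l0 by (simp add: mult_ac)
    finally show ?thesis using z0 by (simp add: field_simps)
  qed
  have d: "- (g^2) / 2 - l^3 * w^2 / 2 \<le> l * g * w"
  proof -
    have "0 \<le> (g + l * w)^2" by simp
    then have "- (g^2) - l^2 * w^2 \<le> 2 * (l * g * w)" by (simp add: power2_eq_square algebra_simps)
    moreover have "l^2 * w^2 \<le> l^3 * w^2" using l3 by (intro mult_right_mono) auto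
    ultimately show ?thesis by simp
  qed
  have Z0: "Z \<ge> 0" using Z by simp
  have z2: "z^2 \<le> Z^2" using Z power_mono[of "\<bar>z\<bar>" Z 2] by simp
  define C' where "C' = 4 * Z + (2 + 8 * Z^2) + 4 * Z * (2 + 8 * Z^2)"
  have C'0: "C' \<ge> 0" using Z0 by (simp add: C'_def)
  have b0: "0 \<le> b" "b \<le> (2 + 8 * Z^2) * l^2"
  proof -
    show "0 \<le> b" using l0 by (simp add: b_def)
    have "l \<le> l^2" using l by (simp add: power2_eq_square)
    moreover have "l^2 * z^2 \<le> l^2 * Z^2" using z2 by (intro mult_left_mono) auto
    ultimately show "b \<le> (2 + 8 * Z^2) * l^2" by (simp add: b_def algebra_simps)
  qed
  have e: "\<bar>M\<bar> \<le> C' * (l^3 * T)"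
  proof -
    have 1: "\<bar>4 * l * z * (w3^2 - w1^2 - w2^2)\<bar> \<le> 4 * Z * (l^3 * T)"
    proof -
      have "\<bar>w3^2 - w1^2 - w2^2\<bar> \<le> T" by (simp add: T_def N_def abs_le_iff)
      then have "l * \<bar>w3^2 - w1^2 - w2^2\<bar> \<le> l^3 * T" using mult_mono[OF l3(1)] l0 by simp
      then have m: "\<bar>z\<bar> * (l * \<bar>w3^2 - w1^2 - w2^2\<bar>) \<le> Z * (l^3 * T)"
        using mult_mono[OF Z _ Z0] l0 by simp
      have e: "\<bar>4 * l * z * v\<bar> = 4 * (\<bar>z\<bar> * (l * \<bar>v\<bar>))" for v
        using l0 by (simp add: abs_mult)
      show ?thesis unfolding e mult.assoc[of 4 Z] using m by linarith
    qed
    have 2: "\<bar>2 * b * (w * w3)\<bar> \<le> (2 + 8 * Z^2) * (l^3 * T)"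
    proof -
      have "\<bar>2 * b * (w * w3)\<bar> = (2 * b) * \<bar>w * w3\<bar>" using b0 by (simp add: abs_mult)
      also have "\<dots> \<le> (2 * b) * (T / 2)" using ww3 b0 by (intro mult_left_mono) auto
      also have "\<dots> \<le> ((2 + 8 * Z^2) * l^3) * T"
        using b0 l3 N0 mult_left_mono[OF l3(2), of "2 + 8 * Z^2"] by (simp add: mult_right_mono)
      finally show ?thesis by simp
    qed
    have 3: "\<bar>4 * l * z * b * w^2\<bar> \<le> 4 * Z * (2 + 8 * Z^2) * (l^3 * T)"
    proof -
      have "l * b \<le> l * ((2 + 8 * Z^2) * l^2)" using b0 l0 by (intro mult_left_mono) auto
      then have "l * b \<le> (2 + 8 * Z^2) * l^3" by (simp add: power2_eq_square power3_eq_cube mult_ac)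
      moreover have "w^2 \<le> T" using N0 by (simp add: T_def)
      ultimately have "(l * b) * w^2 \<le> ((2 + 8 * Z^2) * l^3) * T"
        by (rule mult_mono) (use l0 in auto)
      then have m: "\<bar>z\<bar> * ((l * b) * w^2) \<le> Z * (((2 + 8 * Z^2) * l^3) * T)"
        using mult_mono[OF Z _ Z0] l0 b0 by simp
      have "\<bar>4 * l * z * b * w^2\<bar> = 4 * (\<bar>z\<bar> * ((l * b) * w^2))"
        using l0 b0 by (simp add: abs_mult mult_ac)
      also have "\<dots> \<le> 4 * (Z * (((2 + 8 * Z^2) * l^3) * T))" using m by linarith
      also have "\<dots> = 4 * Z * (2 + 8 * Z^2) * (l^3 * T)" by (simp only: mult.assoc)
      finally show ?thesis .
    qed
    have "\<bar>M\<bar> \<le> \<bar>4 * l * z * (w3^2 - w1^2 - w2^2)\<bar> + \<bar>2 * b * (w * w3)\<bar> + \<bar>4 * l * z * b * w^2\<bar>"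
      unfolding M_def by linarith
    also have "\<dots> \<le> C' * (l^3 * T)" using 1 2 3 unfolding C'_def by (simp only: distrib_right)
    finally show ?thesis .
  qed
  have f: "\<bar>l * (w * w3)\<bar> \<le> l^3 * T"
  proof -
    have "\<bar>w * w3\<bar> \<le> T" using ww3 N0 by simp
    then have "l * \<bar>w * w3\<bar> \<le> l^3 * T" using mult_mono[OF l3(1)] l0 by simp
    then show ?thesis using l0 by (simp add: abs_mult)
  qed
  have K1: "K \<ge> 1" using z0 by (simp add: K_def)
  have Ce: "C = K + 2 + K * C'" unfolding C_def K_def C'_def by simp
  have main: "l * N + l^3 * w^2 \<le> l * (g * w) + l * N + 4 * l^2 * z * (w * w3)
      + K * (2 * p^2 + L1 + 2 * g * p) + (K + 1) * g^2"
  proof -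
    have "K * (- (g^2)) \<le> K * (2 * p^2 + 2 * g * p)" using a K1 by (intro mult_left_mono) auto
    moreover have "K * L1 = L1 + L1 / z0^2" by (simp add: K_def algebra_simps)
    moreover have "0 \<le> l^3 * w^2" "0 \<le> g^2" using l0 by auto
    moreover have "l * (g * w) = l * g * w" by simp
    moreover have "K * (2 * p^2 + L1 + 2 * g * p) = K * (2 * p^2 + 2 * g * p) + K * L1"
      "(K + 1) * g^2 = - (K * (- (g^2))) + g^2" by (simp_all add: algebra_simps)
    ultimately show ?thesis using bb c d by linarith
  qed
  have kpart: "0 \<le> l * (E * k * (w * w3)) + K * (E * k * M) + (1 + K * C') * (l^3 * (E * \<bar>k\<bar> * T))"
  proof -
    have "\<bar>k * (l * (w * w3) + K * M)\<bar> \<le> \<bar>k\<bar> * ((1 + K * C') * (l^3 * T))"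
    proof -
      have "\<bar>l * (w * w3) + K * M\<bar> \<le> \<bar>l * (w * w3)\<bar> + K * \<bar>M\<bar>" using K1 by (metis abs_mult abs_of_nonneg abs_triangle_ineq order_trans zero_le_one)
      also have "\<dots> \<le> l^3 * T + K * (C' * (l^3 * T))" using f e K1 by (intro add_mono mult_left_mono) auto
      finally have "\<bar>l * (w * w3) + K * M\<bar> \<le> (1 + K * C') * (l^3 * T)" by (simp add: algebra_simps)
      then show ?thesis unfolding abs_mult by (rule mult_left_mono) simp
    qed
    then have "0 \<le> k * (l * (w * w3) + K * M) + \<bar>k\<bar> * ((1 + K * C') * (l^3 * T))" by linarith
    then have "0 \<le> E * (k * (l * (w * w3) + K * M) + \<bar>k\<bar> * ((1 + K * C') * (l^3 * T)))" using E by (intro mult_nonneg_nonneg)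
    also have "\<dots> = l * (E * k * (w * w3)) + K * (E * k * M) + (1 + K * C') * (l^3 * (E * \<bar>k\<bar> * T))" by (simp add: algebra_simps)
    finally show ?thesis .
  qed
  have "E * \<kappa> * (l * N + l^3 * w^2) \<le> E * \<kappa> * (l * (g * w) + l * N + 4 * l^2 * z * (w * w3)
      + K * (2 * p^2 + L1 + 2 * g * p) + (K + 1) * g^2)"
    using main E by (intro mult_left_mono) auto
  moreover have "0 \<le> (1 + K * C') * (E * \<kappa> * g^2) + (K + 1) * (l^3 * (E * \<bar>k\<bar> * T))"
    using E K1 C'0 l0 N0 by (intro add_nonneg_nonneg mult_nonneg_nonneg) auto
  moreover have "l * ((E * \<kappa>) * (g * w) + (E * \<kappa>) * N + (4 * l * z * E * \<kappa> + E * k) * (w * w3))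
     = E * \<kappa> * (l * (g * w) + l * N + 4 * l^2 * z * (w * w3)) + l * (E * k * (w * w3))"
    by (simp add: algebra_simps power2_eq_square)
  moreover have "E * \<kappa> * (l * (g * w) + l * N + 4 * l^2 * z * (w * w3)
      + K * (2 * p^2 + L1 + 2 * g * p) + (K + 1) * g^2)
     = E * \<kappa> * (l * (g * w) + l * N + 4 * l^2 * z * (w * w3)) + K * (E * \<kappa> * (2 * p^2 + L1 + 2 * g * p))
       + (K + 1) * (E * \<kappa> * g^2)"
    by (simp add: algebra_simps)
  moreover have "C * (E * \<kappa> * g^2 + l^3 * (E * \<bar>k\<bar> * T)) = (K + 1) * (E * \<kappa> * g^2) + (1 + K * C') * (E * \<kappa> * g^2)
      + (1 + K * C') * (l^3 * (E * \<bar>k\<bar> * T)) + (K + 1) * (l^3 * (E * \<bar>k\<bar> * T))"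
    unfolding Ce by (simp add: algebra_simps)
  moreover have "K * (E * \<kappa> * (2 * p^2 + L1 + 2 * g * p) + E * k * M)
      = K * (E * \<kappa> * (2 * p^2 + L1 + 2 * g * p)) + K * (E * k * M)" by (rule distrib_left)
  ultimately show ?thesis using kpart unfolding id T_def[symmetric] by linarith
qed

definition carleman_weight :: "real \<Rightarrow> real \<Rightarrow> real \<Rightarrow> real" where
  "carleman_weight R l t = exp (2 * l * (t - R)\<^sup>2)"

abbreviation "laplacian A w x \<equiv> D2 A w 1 1 x + D2 A w 2 2 x + D2 A w 3 3 x"
abbreviation "grad_sq A w x \<equiv> (D1 A w 1 x)\<^sup>2 + (D1 A w 2 x)\<^sup>2 + (D1 A w 3 x)\<^sup>2"

lemma weak_laplacian_eq: "weak_laplacian (Om A) w x = laplacian A w x"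
  by (simp add: weak_laplacian_def axis_2 sum_3)

lemma smooth_carleman_weight: "smooth (\<lambda>x. carleman_weight R l (x $ 3))"
  unfolding carleman_weight_def
  by (intro smooth_compose[OF smooth_real_exp] smooth_mult smooth_const smooth_power smooth_diff smooth_coord)

text \<open>The pointwise inequality is integrated over the cube. The coefficients in it that accompany first
  derivatives or \<open>w\<^sup>2\<close> are the derivatives of the weights with which the multiplier identities are applied.\<close>

lemma carleman_estimate:
  assumes A: "A > 0" and R: "R > A"
  shows "\<exists>C>0. \<forall>l\<ge>1. \<forall>w\<in>H3_0bsc A. \<forall>\<kappa> \<kappa>'. weight A \<kappa> \<kappa>' \<longrightarrow> (\<forall>t. \<kappa> t \<ge> 0) \<longrightarrow>
    (LINT x|lebesgue_on (Om A). carleman_weight R l (x $ 3) * \<kappa> (x $ 3) * (l * grad_sq A w x + l^3 * (w x)\<^sup>2))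
    \<le> C * (LINT x|lebesgue_on (Om A). carleman_weight R l (x $ 3) * \<kappa> (x $ 3) * (laplacian A w x)\<^sup>2)
      + C * l^3 * (LINT x|lebesgue_on (Om A). carleman_weight R l (x $ 3) * \<bar>\<kappa>' (x $ 3)\<bar> * ((w x)\<^sup>2 + grad_sq A w x))"
proof -
  define z0 Z where "z0 = R - A" and "Z = R + A"
  define K C where "K = 1 + 1 / z0^2" and "C = 1 + 1 / z0^2 + 2 + (1 + 1 / z0^2) * (4 * Z + (2 + 8 * Z^2) + 4 * Z * (2 + 8 * Z^2))"
  have z0: "z0 > 0" and Z: "Z > 0" using A R by (auto simp: z0_def Z_def)
  have C: "C > 0" unfolding C_def using z0 Z by (intro add_pos_nonneg mult_nonneg_nonneg) auto
  show ?thesis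
  proof (intro exI[of _ C] conjI C allI impI ballI)
    fix l :: real and w and \<kappa> \<kappa>' :: "real \<Rightarrow> real"
    assume l: "l \<ge> 1" and w: "w \<in> H3_0bsc A" and k: "weight A \<kappa> \<kappa>'" and k0: "\<forall>t. \<kappa> t \<ge> 0"
    let ?I = "\<lambda>f. LINT x|lebesgue_on (Om A). f x"
    define E where "E = carleman_weight R l"
    define e b q where "e t = 4 * l * (t - R) * E t" and "b t = 2 * l + 8 * l^2 * (t - R)^2"
      and "q t = 8 * l * (t - R) * b t" for t
    have dE: "(E has_real_derivative e t) (at t)" for t
      unfolding E_def e_def carleman_weight_def[abs_def]
      by (auto intro!: derivative_eq_intros simp: power2_eq_square algebra_simps)
    have db: "(b has_real_derivative 16 * l^2 * (t - R)) (at t)" for t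
      unfolding b_def[abs_def] by (auto intro!: derivative_eq_intros simp: power2_eq_square algebra_simps)
    have dq: "(q has_real_derivative 8 * l * b t + 128 * l^3 * (t - R)^2) (at t)" for t
      unfolding q_def[abs_def]
      by (rule DERIV_cong, rule DERIV_mult[OF _ db]) (auto intro!: derivative_eq_intros simp: power2_eq_square power3_eq_cube algebra_simps)
    have sE: "smooth (\<lambda>x. E (x $ 3))" unfolding E_def by (rule smooth_carleman_weight)
    have sb: "smooth (\<lambda>x. b (x $ 3))" unfolding b_def
      by (intro smooth_add smooth_mult smooth_const smooth_power smooth_diff smooth_coord)
    have sq: "smooth (\<lambda>x. q (x $ 3))" unfolding q_def
      by (intro smooth_mult smooth_const smooth_diff smooth_coord sb)
    have se: "smooth (\<lambda>x. e (x $ 3))" unfolding e_def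
      by (intro smooth_mult smooth_const smooth_diff smooth_coord sE)
    have de: "(e has_real_derivative 4 * l * E t + 4 * l * (t - R) * e t) (at t)" for t
      unfolding e_def[abs_def] by (rule DERIV_cong, rule DERIV_mult[OF _ dE])
        (auto intro!: derivative_eq_intros simp: e_def algebra_simps)
    have dbE: "((\<lambda>t. b t * E t) has_real_derivative 16 * l^2 * (t - R) * E t + b t * e t) (at t)" for t
      using DERIV_mult[OF db dE] by (simp add: algebra_simps)
    have dqE: "((\<lambda>t. q t * E t) has_real_derivative (8 * l * b t + 128 * l^3 * (t - R)^2) * E t + q t * e t) (at t)" for t
      using DERIV_mult[OF dq dE] by (simp add: algebra_simps)
    note w0 = weight_mult[OF sE dE k]
    note w1 = weight_mult[OF se de k]
    note w2 = weight_mult[OF smooth_mult[OF sb sE] dbE k]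
    note w3 = weight_mult[OF smooth_mult[OF sq sE] dqE k]
    note h = Hk3_derivs[OF H3_0bsc_traces(1)[OF w A]]
    note zm = zero_mean_add[OF zero_mean_cmult[OF multiplier_identity_0[OF A w w0], of l]
       zero_mean_cmult[OF zero_mean_add[OF zero_mean_add[OF
        zero_mean_cmult[OF multiplier_identity_z[OF A w w1], of 2]
        zero_mean_cmult[OF multiplier_identity_0[OF A w w2], of 2]]
        square_identity[OF A w w3]], of K]]
    define Q where "Q = (\<lambda>x. l * (E (x $ 3) * \<kappa> (x $ 3) * (laplacian A w x * w x) + E (x $ 3) * \<kappa> (x $ 3) * grad_sq A w x +
         (e (x $ 3) * \<kappa> (x $ 3) + E (x $ 3) * \<kappa>' (x $ 3)) * (w x * D1 A w 3 x)) +
      K * (2 * (e (x $ 3) * \<kappa> (x $ 3) * (laplacian A w x * D1 A w 3 x) +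
             ((4 * l * E (x $ 3) + 4 * l * (x $ 3 - R) * e (x $ 3)) * \<kappa> (x $ 3) + e (x $ 3) * \<kappa>' (x $ 3)) *
              ((D1 A w 3 x)\<^sup>2 - (D1 A w 1 x)\<^sup>2 - (D1 A w 2 x)\<^sup>2) / 2) +
         2 * (b (x $ 3) * E (x $ 3) * \<kappa> (x $ 3) * (laplacian A w x * w x) + b (x $ 3) * E (x $ 3) * \<kappa> (x $ 3) * grad_sq A w x +
             ((16 * l^2 * (x $ 3 - R) * E (x $ 3) + b (x $ 3) * e (x $ 3)) * \<kappa> (x $ 3) + b (x $ 3) * E (x $ 3) * \<kappa>' (x $ 3)) * (w x * D1 A w 3 x)) +
         (q (x $ 3) * E (x $ 3) * \<kappa> (x $ 3) * (w x * D1 A w 3 x) +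
          (((8 * l * b (x $ 3) + 128 * l^3 * (x $ 3 - R)^2) * E (x $ 3) + q (x $ 3) * e (x $ 3)) * \<kappa> (x $ 3) + q (x $ 3) * E (x $ 3) * \<kappa>' (x $ 3)) *
          (w x)\<^sup>2 / 2)))"
    have Q: "zero_mean A Q" using zm unfolding Q_def .
    have sk: "smooth (\<lambda>x. E (x $ 3) * \<kappa> (x $ 3))" using sE weight_smooth(1)[OF k] by (rule smooth_mult)
    have sk': "smooth (\<lambda>x. E (x $ 3) * \<kappa>' (x $ 3))" using sE weight_smooth(2)[OF k] by (rule smooth_mult)
    have E0: "E t \<ge> 0" for t by (simp add: E_def carleman_weight_def)
    have isq: "integrable (lebesgue_on (Om A)) (\<lambda>x. \<sigma> x * (f x)\<^sup>2)" if "smooth \<sigma>" "f \<in> L2 (Om A)" for \<sigma> f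
      using integrable_smooth_mult2[OF that(1) that(2) that(2)] by (simp add: power2_eq_square)
    have lapL: "laplacian A w \<in> L2 (Om A)" by (intro L2_add h)
    have iG: "integrable (lebesgue_on (Om A)) (\<lambda>x. E (x $ 3) * \<kappa> (x $ 3) * (laplacian A w x)\<^sup>2)"
      by (rule isq[OF sk lapL])
    have iR: "integrable (lebesgue_on (Om A)) (\<lambda>x. E (x $ 3) * \<bar>\<kappa>' (x $ 3)\<bar> * ((w x)\<^sup>2 + grad_sq A w x))"
    proof -
      have "integrable (lebesgue_on (Om A)) (\<lambda>x. E (x $ 3) * \<kappa>' (x $ 3) * (w x)\<^sup>2 + (E (x $ 3) * \<kappa>' (x $ 3) * (D1 A w 1 x)\<^sup>2
         + E (x $ 3) * \<kappa>' (x $ 3) * (D1 A w 2 x)\<^sup>2 + E (x $ 3) * \<kappa>' (x $ 3) * (D1 A w 3 x)\<^sup>2))"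
        by (intro Bochner_Integration.integrable_add isq sk' h)
      then have "integrable (lebesgue_on (Om A)) (\<lambda>x. \<bar>E (x $ 3) * \<kappa>' (x $ 3) * ((w x)\<^sup>2 + grad_sq A w x)\<bar>)"
        by (intro integrable_abs) (simp add: algebra_simps)
      moreover have "\<bar>E (x $ 3) * \<kappa>' (x $ 3) * ((w x)\<^sup>2 + grad_sq A w x)\<bar> = E (x $ 3) * \<bar>\<kappa>' (x $ 3)\<bar> * ((w x)\<^sup>2 + grad_sq A w x)" for x
        using E0 by (simp add: abs_mult)
      ultimately show ?thesis by simp
    qed
    have iL: "integrable (lebesgue_on (Om A)) (\<lambda>x. E (x $ 3) * \<kappa> (x $ 3) * (l * grad_sq A w x + l^3 * (w x)\<^sup>2))"
    proof -
      have "integrable (lebesgue_on (Om A)) (\<lambda>x. l * (E (x $ 3) * \<kappa> (x $ 3) * (D1 A w 1 x)\<^sup>2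
         + E (x $ 3) * \<kappa> (x $ 3) * (D1 A w 2 x)\<^sup>2 + E (x $ 3) * \<kappa> (x $ 3) * (D1 A w 3 x)\<^sup>2) + l^3 * (E (x $ 3) * \<kappa> (x $ 3) * (w x)\<^sup>2))"
        by (intro Bochner_Integration.integrable_add integrable_mult_right isq sk h)
      then show ?thesis by (simp add: algebra_simps)
    qed
    have "?I (\<lambda>x. E (x $ 3) * \<kappa> (x $ 3) * (l * grad_sq A w x + l^3 * (w x)\<^sup>2))
       \<le> ?I (\<lambda>x. Q x + C * (E (x $ 3) * \<kappa> (x $ 3) * (laplacian A w x)\<^sup>2 + l^3 * (E (x $ 3) * \<bar>\<kappa>' (x $ 3)\<bar> * ((w x)\<^sup>2 + grad_sq A w x))))"
    proof (rule integral_mono[OF iL])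
      show "integrable (lebesgue_on (Om A)) (\<lambda>x. Q x + C * (E (x $ 3) * \<kappa> (x $ 3) * (laplacian A w x)\<^sup>2 + l^3 * (E (x $ 3) * \<bar>\<kappa>' (x $ 3)\<bar> * ((w x)\<^sup>2 + grad_sq A w x))))"
        using Q iG iR unfolding zero_mean_def by (intro Bochner_Integration.integrable_add integrable_mult_right) auto
      fix x assume "x \<in> space (lebesgue_on (Om A))"
      then have "- A < x $ 3" "x $ 3 < A" by (simp_all add: Om_def)
      then have zz: "z0 \<le> \<bar>x $ 3 - R\<bar>" "\<bar>x $ 3 - R\<bar> \<le> Z" using R by (auto simp: z0_def Z_def)
      show "E (x $ 3) * \<kappa> (x $ 3) * (l * grad_sq A w x + l^3 * (w x)\<^sup>2)
        \<le> Q x + C * (E (x $ 3) * \<kappa> (x $ 3) * (laplacian A w x)\<^sup>2 + l^3 * (E (x $ 3) * \<bar>\<kappa>' (x $ 3)\<bar> * ((w x)\<^sup>2 + grad_sq A w x)))"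
        using carleman_pointwise[OF l z0 zz E0[of "x $ 3"] k0[rule_format, of "x $ 3"], of "D1 A w 1 x" "D1 A w 2 x" "D1 A w 3 x" "w x" "laplacian A w x" "\<kappa>' (x $ 3)"]
        unfolding Q_def e_def q_def b_def K_def C_def by simp
    qed
    also have "\<dots> = ?I Q + C * (?I (\<lambda>x. E (x $ 3) * \<kappa> (x $ 3) * (laplacian A w x)\<^sup>2) + l^3 * ?I (\<lambda>x. E (x $ 3) * \<bar>\<kappa>' (x $ 3)\<bar> * ((w x)\<^sup>2 + grad_sq A w x)))"
      using Q iG iR unfolding zero_mean_def
      by (simp only: Bochner_Integration.integral_add Bochner_Integration.integrable_add integrable_mult_right integral_mult_right_zero)
    finally show "?I (\<lambda>x. carleman_weight R l (x $ 3) * \<kappa> (x $ 3) * (l * grad_sq A w x + l^3 * (w x)\<^sup>2))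
    \<le> C * ?I (\<lambda>x. carleman_weight R l (x $ 3) * \<kappa> (x $ 3) * (laplacian A w x)\<^sup>2)
      + C * l^3 * ?I (\<lambda>x. carleman_weight R l (x $ 3) * \<bar>\<kappa>' (x $ 3)\<bar> * ((w x)\<^sup>2 + grad_sq A w x))"
      using Q unfolding zero_mean_def E_def by (simp add: distrib_left)
  qed
qed

section \<open>The coefficients of the operator\<close>

lemma Psi_C1: "\<exists>\<psi>. (\<forall>t. (Psi d k has_real_derivative \<psi> t) (at t)) \<and> continuous_on UNIV \<psi>"
proof (induction k rule: less_induct)
  case (less k)
  then have "\<exists>\<psi>. \<forall>j<k. (\<forall>t. (Psi d j has_real_derivative \<psi> j t) (at t)) \<and> continuous_on UNIV (\<psi> j)"
    by (intro choice_iff'[THEN iffD1]) blast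
  then obtain \<psi> where \<psi>: "\<And>j t. j < k \<Longrightarrow> (Psi d j has_real_derivative \<psi> j t) (at t)"
    "\<And>j. j < k \<Longrightarrow> continuous_on UNIV (\<psi> j)" by blast
  define c where "c j = ip d (\<lambda>s. s ^ k * exp s) (Psi d j)" for j
  define v where "v t = t ^ k * exp t - (\<Sum>j<k. c j * Psi d j t)" for t
  define s where "s = sqrt (ip d v v)"
  have P: "Psi d k = (\<lambda>t. v t / s)"
    unfolding s_def v_def[abs_def] c_def by (subst Psi.simps) (simp add: Let_def)
  define v' where "v' t = (t ^ k * exp t + (real k * t ^ (k - 1)) * exp t) - (\<Sum>j<k. c j * \<psi> j t)" for t
  have "(v has_real_derivative v' t) (at t)" for t
    unfolding v_def[abs_def] v'_def
    by (auto intro!: derivative_eq_intros \<psi> simp: algebra_simps One_nat_def)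
  then have "(Psi d k has_real_derivative v' t / s) (at t)" for t
    unfolding P by (rule DERIV_cdivide)
  moreover have "continuous_on UNIV (\<lambda>t. v' t / s)"
    unfolding v'_def divide_inverse by (intro continuous_intros \<psi>) auto
  ultimately show ?case by (intro exI[of _ "\<lambda>t. v' t / s"] conjI allI)
qed

definition source_dist_sq :: "real \<Rightarrow> real \<Rightarrow> real^3 \<Rightarrow> real \<Rightarrow> real" where
  "source_dist_sq A b x t = (x $ 1 - t)\<^sup>2 + (x $ 2)\<^sup>2 + (x $ 3 + A + b)\<^sup>2"

lemma source_dist_sq: "(norm (x - source A b t))\<^sup>2 = source_dist_sq A b x t"
  unfolding power2_norm_eq_inner source_dist_sq_def source_def
  by (simp add: inner_vec_def sum_3 power2_eq_square algebra_simps)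

lemma source_dist_sq_pos: "x $ 3 \<ge> - A \<Longrightarrow> b > 0 \<Longrightarrow> source_dist_sq A b x t > 0"
  unfolding source_dist_sq_def by (intro add_nonneg_pos) auto

text \<open>The derivative with respect to the source position of \<open>n \<Psi> / |r|\<^sup>2\<close>, where \<open>n\<close> is affine in
  that position with slope \<open>m\<close>.\<close>

definition kernel_deriv ::
  "real \<Rightarrow> real \<Rightarrow> real \<Rightarrow> (real^3 \<Rightarrow> real \<Rightarrow> real) \<Rightarrow> (real \<Rightarrow> real) \<Rightarrow> (real \<Rightarrow> real) \<Rightarrow> real^3 \<Rightarrow> real \<Rightarrow> real" where
  "kernel_deriv A b m n \<Psi> \<psi> x t =
     ((m * \<Psi> t + n x t * \<psi> t) * source_dist_sq A b x t + n x t * \<Psi> t * (2 * (x $ 1 - t)))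
       / (source_dist_sq A b x t)\<^sup>2"

text \<open>The entries of the coefficient matrices are integrals of this form. The integrand is bounded because the
  source stays at distance at least \<open>b\<close> from the cube.\<close>

lemma kernel_coefficient:
  fixes n :: "real^3 \<Rightarrow> real \<Rightarrow> real" and A d :: real
  assumes b: "b > 0" and \<Psi>: "\<And>t. (\<Psi> has_real_derivative \<psi> t) (at t)" "continuous_on UNIV \<psi>"
    and n: "\<And>x t. (n x has_real_derivative m) (at t)" "continuous_on UNIV (\<lambda>(x, t). n x t)"
    and \<Phi>: "continuous_on UNIV \<Phi>"
  defines "F \<equiv> \<lambda>x. LINT t:{-d<..<d}|lborel. deriv (\<lambda>\<tau>. n x \<tau> * \<Psi> \<tau> / (norm (x - source A b \<tau>))\<^sup>2) t * \<Phi> t"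
  shows "F \<in> borel_measurable (lebesgue_on (Om A))" "\<exists>C. \<forall>x\<in>Om A. \<bar>F x\<bar> \<le> C"
proof -
  have c\<Psi>: "continuous_on UNIV \<Psi>" using \<Psi>(1) by (meson DERIV_isCont continuous_at_imp_continuous_on)
  define g where "g = kernel_deriv A b m n \<Psi> \<psi>"
  have dv: "deriv (\<lambda>\<tau>. n x \<tau> * \<Psi> \<tau> / (norm (x - source A b \<tau>))\<^sup>2) t = g x t" if x: "x $ 3 \<ge> - A" for x t
  proof (rule DERIV_imp_deriv)
    have p: "source_dist_sq A b x t \<noteq> 0" using source_dist_sq_pos[OF x b, of t] by simp
    have d1: "((\<lambda>t. source_dist_sq A b x t) has_real_derivative - (2 * (x $ 1 - t))) (at t)"
      unfolding source_dist_sq_def by (auto intro!: derivative_eq_intros simp: algebra_simps)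
    have d2: "((\<lambda>t. n x t * \<Psi> t) has_real_derivative m * \<Psi> t + n x t * \<psi> t) (at t)"
      using DERIV_mult[OF n(1) \<Psi>(1), of x t] by (simp add: algebra_simps)
    show "((\<lambda>\<tau>. n x \<tau> * \<Psi> \<tau> / (norm (x - source A b \<tau>))\<^sup>2) has_real_derivative g x t) (at t)"
      unfolding source_dist_sq g_def kernel_deriv_def
      by (rule DERIV_cong[OF DERIV_divide[OF d2 d1 p]]) (simp only: power2_eq_square mult_minus_right diff_minus_eq_add)
  qed
  let ?\<phi> = "\<lambda>x t. indicator {-d<..<d} t *\<^sub>R (g x t * \<Phi> t)"
  have Fg: "F x = (LINT t|lborel. ?\<phi> x t)" if "x \<in> Om A" for x
    using that dv[of x] by (simp add: F_def set_lebesgue_integral_def Om_def less_imp_le)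
  have csq: "continuous_on UNIV (\<lambda>z. source_dist_sq A b (fst z) (snd z))"
    unfolding source_dist_sq_def by (intro continuous_intros)
  have cn: "continuous_on UNIV (\<lambda>z. n (fst z) (snd z))" using n(2) by (simp add: case_prod_beta')
  have cs: "continuous_on UNIV (\<lambda>z. f (snd z))" if "continuous_on UNIV f" for f :: "real \<Rightarrow> real"
    by (rule continuous_on_compose2[OF that continuous_on_snd[OF continuous_on_id]]) simp
  have cnum: "continuous_on UNIV (\<lambda>z. ((m * \<Psi> (snd z) + n (fst z) (snd z) * \<psi> (snd z)) * source_dist_sq A b (fst z) (snd z)
       + n (fst z) (snd z) * \<Psi> (snd z) * (2 * (fst z $ 1 - snd z))) * \<Phi> (snd z))"
    by (intro continuous_intros csq cn cs[OF c\<Psi>] cs[OF \<Psi>(2)] cs[OF \<Phi>])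
  have gq: "g x t * \<Phi> t = ((m * \<Psi> t + n x t * \<psi> t) * source_dist_sq A b x t
       + n x t * \<Psi> t * (2 * (x $ 1 - t))) * \<Phi> t / (source_dist_sq A b x t)\<^sup>2" for x t
    by (simp add: g_def kernel_deriv_def)
  have gm: "(\<lambda>z. g (fst z) (snd z) * \<Phi> (snd z)) \<in> borel_measurable borel"
    unfolding gq by (intro borel_measurable_divide borel_measurable_power borel_measurable_continuous_onI cnum csq)
  have "(\<lambda>(x, t). ?\<phi> x t) \<in> borel_measurable (borel \<Otimes>\<^sub>M lborel)"
  proof -
    have "(\<lambda>z::(real^3) \<times> real. indicator {-d<..<d} (snd z) *\<^sub>R (g (fst z) (snd z) * \<Phi> (snd z))) \<in> borel_measurable borel"
      by (intro borel_measurable_scaleR gm borel_measurable_indicator' measurable_compose[OF _ borel_measurable_indicator])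
        (auto simp: borel_prod[symmetric])
    then show ?thesis by (simp add: case_prod_beta' borel_prod[symmetric] cong: measurable_cong_sets)
  qed
  then have "(\<lambda>x. LINT t|lborel. ?\<phi> x t) \<in> borel_measurable borel"
    by (intro lborel.borel_measurable_lebesgue_integral)
  then have "(\<lambda>x. LINT t|lborel. ?\<phi> x t) \<in> borel_measurable (lebesgue_on (Om A))"
    by (intro measurable_restrict_space1 measurable_completion) simp
  then show "F \<in> borel_measurable (lebesgue_on (Om A))"
    by (rule measurable_cong[THEN iffD1, rotated]) (simp add: Fg)
  let ?K = "cbox (\<chi> i. - A) (\<chi> i. A) \<times> {-d..d} :: ((real^3) \<times> real) set"
  have "compact ?K" by (intro compact_Times) auto
  moreover have "continuous_on ?K (\<lambda>z. g (fst z) (snd z) * \<Phi> (snd z))"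
    unfolding gq
  proof (intro continuous_on_divide continuous_on_power continuous_on_subset[OF cnum] continuous_on_subset[OF csq])
    show "\<forall>z\<in>?K. (source_dist_sq A b (fst z) (snd z))\<^sup>2 \<noteq> 0"
      using source_dist_sq_pos[OF _ b] by (auto simp: mem_box_cart less_imp_neq[THEN not_sym])
  qed auto
  ultimately have "bounded ((\<lambda>z. g (fst z) (snd z) * \<Phi> (snd z)) ` ?K)"
    using compact_continuous_image compact_imp_bounded by blast
  then obtain C where "\<forall>y\<in>(\<lambda>z. g (fst z) (snd z) * \<Phi> (snd z)) ` ?K. norm y \<le> C"
    unfolding bounded_iff by blast
  then have C: "\<bar>g (fst z) (snd z) * \<Phi> (snd z)\<bar> \<le> C" if "z \<in> ?K" for z
    using that by fastforce
  have "\<bar>F x\<bar> \<le> (LINT t|lborel. indicator {-d<..<d} t * \<bar>C\<bar>)" if x: "x \<in> Om A" for x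
  proof -
    have xK: "x \<in> cbox (\<chi> i. - A) (\<chi> i. A)" using x Om_subset_cbox by blast
    have i: "integrable lborel (\<lambda>t. indicator {-d<..<d} t * \<bar>C\<bar>)"
      by (intro integrable_mult_left integrable_real_indicator emeasure_bounded_finite) auto
    have "\<bar>F x\<bar> \<le> (LINT t|lborel. \<bar>?\<phi> x t\<bar>)" unfolding Fg[OF x] by (rule integral_abs_bound)
    also have "\<dots> \<le> (LINT t|lborel. indicator {-d<..<d} t * \<bar>C\<bar>)"
    proof (rule integral_mono')
      show "\<bar>?\<phi> x t\<bar> \<le> indicator {-d<..<d} t * \<bar>C\<bar>" for t
        using C[of "(x, t)"] xK by (auto simp: indicator_def)
    qed (use i in auto)
    finally show ?thesis .
  qed
  then show "\<exists>C. \<forall>x\<in>Om A. \<bar>F x\<bar> \<le> C" by blast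
qed

lemma Psi_ix_C1:
  obtains \<psi> where "\<And>t. (Psi_ix d n has_real_derivative \<psi> t) (at t)" "continuous_on UNIV \<psi>"
  unfolding Psi_ix_def using Psi_C1 by metis

lemma Psi_ix_continuous: "continuous_on UNIV (Psi_ix d n)"
proof -
  obtain \<psi> where "\<And>t. (Psi_ix d n has_real_derivative \<psi> t) (at t)" using Psi_ix_C1[where d = d and n = n] by blast
  then show ?thesis by (meson DERIV_isCont continuous_at_imp_continuous_on)
qed

lemma D_mat_entries:
  assumes b: "b > 0"
  shows "(\<lambda>x. (D_mat A b d j x :: 'n::{finite,linorder} rmat) $ m $ n) \<in> borel_measurable (lebesgue_on (Om A))"
    "\<exists>C. \<forall>x\<in>Om A. \<bar>(D_mat A b d j x :: 'n rmat) $ m $ n\<bar> \<le> C"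
proof -
  obtain \<psi> where \<psi>: "\<And>t. (Psi_ix d n has_real_derivative \<psi> t) (at t)" "continuous_on UNIV \<psi>" using Psi_ix_C1[where d = d and n = n] by blast
  define n' where "n' x t = 2 * (x - source A b t) $ j" for x :: "real^3" and t
  have n'_eq: "n' x t = 2 * x $ j - 2 * (if j = 1 then t else if j = 2 then 0 else - A - b)" for x t
    using exhaust_3[of j] by (auto simp: n'_def source_def)
  have 1: "(n' x has_real_derivative (if j = 1 then - 2 else 0)) (at t)" for x t
    unfolding n'_eq[abs_def] by (cases "j = 1"; cases "j = 2") (auto intro!: derivative_eq_intros)
  have 2: "continuous_on UNIV (\<lambda>(x, t). n' x t)"
    unfolding n'_eq case_prod_beta' by (cases "j = 1"; cases "j = 2") (auto intro!: continuous_intros)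
  note k = kernel_coefficient[OF b \<psi> 1 2 Psi_ix_continuous[of d m], where d = d and A = A]
  show "(\<lambda>x. (D_mat A b d j x :: 'n rmat) $ m $ n) \<in> borel_measurable (lebesgue_on (Om A))"
    using borel_measurable_uminus[OF k(1)] by (simp add: D_mat_def n'_def)
  show "\<exists>C. \<forall>x\<in>Om A. \<bar>(D_mat A b d j x :: 'n rmat) $ m $ n\<bar> \<le> C"
    using k(2) by (simp add: D_mat_def n'_def)
qed

lemma D0_mat_entries:
  assumes b: "b > 0"
  shows "(\<lambda>x. (D0_mat A b d x :: 'n::{finite,linorder} rmat) $ m $ n) \<in> borel_measurable (lebesgue_on (Om A))"
    "\<exists>C. \<forall>x\<in>Om A. \<bar>(D0_mat A b d x :: 'n rmat) $ m $ n\<bar> \<le> C"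
proof -
  obtain \<psi> where \<psi>: "\<And>t. (Psi_ix d n has_real_derivative \<psi> t) (at t)" "continuous_on UNIV \<psi>" using Psi_ix_C1[where d = d and n = n] by blast
  have 1: "((\<lambda>t. 4) has_real_derivative 0) (at t)" for t :: real by simp
  have 2: "continuous_on UNIV (\<lambda>(x, t). 4 :: real)" by (simp add: case_prod_beta')
  note k = kernel_coefficient[where n = "\<lambda>x t. 4", OF b \<psi> 1 2 Psi_ix_continuous[of d m], where d = d and A = A]
  show "(\<lambda>x. (D0_mat A b d x :: 'n rmat) $ m $ n) \<in> borel_measurable (lebesgue_on (Om A))"
    using k(1) by (simp add: D0_mat_def)
  show "\<exists>C. \<forall>x\<in>Om A. \<bar>(D0_mat A b d x :: 'n rmat) $ m $ n\<bar> \<le> C"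
    using k(2) by (simp add: D0_mat_def)
qed

lemma constant_matrix_mult_entries:
  fixes M :: "real^'n^'n" and D :: "real^3 \<Rightarrow> real^'n^'n"
  assumes "\<And>m n. (\<lambda>x. D x $ m $ n) \<in> borel_measurable (lebesgue_on S)" "\<And>m n. \<exists>C. \<forall>x\<in>S. \<bar>D x $ m $ n\<bar> \<le> C"
  shows "(\<lambda>x. (M ** D x) $ m $ n) \<in> borel_measurable (lebesgue_on S)" "\<exists>C. \<forall>x\<in>S. \<forall>m n. \<bar>(M ** D x) $ m $ n\<bar> \<le> C"
proof -
  have e: "(M ** D x) $ m $ n = (\<Sum>k\<in>UNIV. M $ m $ k * D x $ k $ n)" for x m n
    by (simp add: matrix_matrix_mult_def)
  show "(\<lambda>x. (M ** D x) $ m $ n) \<in> borel_measurable (lebesgue_on S)"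
    unfolding e by (intro borel_measurable_sum borel_measurable_times borel_measurable_const assms(1))
  obtain C where C: "\<And>m n x. x \<in> S \<Longrightarrow> \<bar>D x $ m $ n\<bar> \<le> C m n" using assms(2) by metis
  define B where "B m n = (\<Sum>k\<in>UNIV. \<bar>M $ m $ k\<bar> * C k n)" for m n
  have "\<bar>(M ** D x) $ m $ n\<bar> \<le> (\<Sum>m\<in>UNIV. \<Sum>n\<in>UNIV. \<bar>B m n\<bar>)" if x: "x \<in> S" for x m n
  proof -
    have "\<bar>(M ** D x) $ m $ n\<bar> \<le> (\<Sum>k\<in>UNIV. \<bar>M $ m $ k * D x $ k $ n\<bar>)" unfolding e by (rule sum_abs)
    also have "\<dots> \<le> B m n" unfolding B_def abs_mult by (intro sum_mono mult_left_mono C x) simp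
    also have "\<dots> \<le> (\<Sum>n\<in>UNIV. \<bar>B m n\<bar>)" by (rule order_trans[OF abs_ge_self]) (intro member_le_sum, auto)
    also have "\<dots> \<le> (\<Sum>m\<in>UNIV. \<Sum>n\<in>UNIV. \<bar>B m n\<bar>)"
      by (rule member_le_sum[of m UNIV "\<lambda>m. \<Sum>n\<in>UNIV. \<bar>B m n\<bar>"]) (auto intro: sum_nonneg)
    finally show ?thesis .
  qed
  then show "\<exists>C. \<forall>x\<in>S. \<forall>m n. \<bar>(M ** D x) $ m $ n\<bar> \<le> C" by blast
qed

lemma A_mat_entries:
  assumes b: "b > 0"
  shows "(\<lambda>x. (A_mat A b d j x :: 'n::{finite,linorder} rmat) $ m $ n) \<in> borel_measurable (lebesgue_on (Om A))"
    "(\<lambda>x. (A0_mat A b d x :: 'n rmat) $ m $ n) \<in> borel_measurable (lebesgue_on (Om A))"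
    "\<exists>C>0. \<forall>x\<in>Om A. \<forall>j m n. \<bar>(A_mat A b d j x :: 'n rmat) $ m $ n\<bar> \<le> C \<and> \<bar>(A0_mat A b d x :: 'n rmat) $ m $ n\<bar> \<le> C"
proof -
  show "(\<lambda>x. (A_mat A b d j x :: 'n rmat) $ m $ n) \<in> borel_measurable (lebesgue_on (Om A))"
    unfolding A_mat_def by (rule constant_matrix_mult_entries(1)[OF D_mat_entries[OF b]])
  show "(\<lambda>x. (A0_mat A b d x :: 'n rmat) $ m $ n) \<in> borel_measurable (lebesgue_on (Om A))"
    unfolding A0_mat_def by (rule constant_matrix_mult_entries(1)[OF D0_mat_entries[OF b]])
  have D: "\<exists>C. \<forall>x\<in>Om A. \<forall>m n. \<bar>(A_mat A b d j x :: 'n rmat) $ m $ n\<bar> \<le> C" for j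
    unfolding A_mat_def by (rule constant_matrix_mult_entries(2)[OF D_mat_entries[OF b]])
  have D0: "\<exists>C. \<forall>x\<in>Om A. \<forall>m n. \<bar>(A0_mat A b d x :: 'n rmat) $ m $ n\<bar> \<le> C"
    unfolding A0_mat_def by (rule constant_matrix_mult_entries(2)[OF D0_mat_entries[OF b]])
  obtain C0 where C0: "\<And>x m n. x \<in> Om A \<Longrightarrow> \<bar>(A0_mat A b d x :: 'n rmat) $ m $ n\<bar> \<le> C0" using D0 by metis
  obtain C where C: "\<And>j x m n. x \<in> Om A \<Longrightarrow> \<bar>(A_mat A b d j x :: 'n rmat) $ m $ n\<bar> \<le> C j" using D by metis
  have Cj: "C j \<le> (\<Sum>j\<in>UNIV. \<bar>C j\<bar>)" for j
    by (rule order_trans[OF abs_ge_self]) (intro member_le_sum, auto)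
  have S0: "0 \<le> (\<Sum>j\<in>UNIV. \<bar>C j\<bar>)" by (simp add: sum_nonneg)
  show "\<exists>C>0. \<forall>x\<in>Om A. \<forall>j m n. \<bar>(A_mat A b d j x :: 'n rmat) $ m $ n\<bar> \<le> C \<and> \<bar>(A0_mat A b d x :: 'n rmat) $ m $ n\<bar> \<le> C"
  proof (intro exI[of _ "1 + \<bar>C0\<bar> + (\<Sum>j\<in>UNIV. \<bar>C j\<bar>)"] conjI ballI allI)
    fix x j m n assume x: "x \<in> Om A"
    show "\<bar>(A_mat A b d j x :: 'n rmat) $ m $ n\<bar> \<le> 1 + \<bar>C0\<bar> + (\<Sum>j\<in>UNIV. \<bar>C j\<bar>)"
      using C[OF x, of j m n] Cj[of j] by linarith
    show "\<bar>(A0_mat A b d x :: 'n rmat) $ m $ n\<bar> \<le> 1 + \<bar>C0\<bar> + (\<Sum>j\<in>UNIV. \<bar>C j\<bar>)"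
      using C0[OF x, of m n] S0 by linarith
  qed (use S0 in linarith)
qed

section \<open>The operator\<close>

lemma L_op_nth:
  "L_op A b d U x $ n = laplacian A (\<lambda>y. U y $ n) x
     + (\<Sum>j\<in>UNIV. \<Sum>m\<in>UNIV. A_mat A b d j x $ n $ m * D1 A (\<lambda>y. U y $ m) j x)
     + (\<Sum>m\<in>UNIV. A0_mat A b d x $ n $ m * U x $ m)"
  by (simp add: L_op_def weak_laplacian_eq matrix_vector_mult_def sum_component)

definition first_order_sq :: "real \<Rightarrow> (real^3 \<Rightarrow> real^'n) \<Rightarrow> real^3 \<Rightarrow> real" where
  "first_order_sq A U x = (\<Sum>m\<in>UNIV. (U x $ m)\<^sup>2 + grad_sq A (\<lambda>y. U y $ m) x)"

lemma HkN_nth: "U \<in> HkN k S \<Longrightarrow> (\<lambda>x. U x $ n) \<in> Hk k S"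
  by (simp add: HkN_def)

lemma L2_norm_le_HkN_norm:
  assumes "mi_order a \<le> k"
  shows "L2_norm S (weak_deriv S a (\<lambda>x. U x $ n)) \<le> HkN_norm k S U"
  using L2_norm_le_Hk_norm[OF assms] Hk_norm_le_HkN_norm order_trans by blast

lemma L2_norm_weak_deriv_0:
  assumes "open S" "u \<in> L2 S"
  shows "L2_norm S (weak_deriv S 0 u) = L2_norm S u"
proof -
  have w: "is_weak_deriv S 0 u u"
    by (intro is_weak_deriv_0 L2_locally_integrable assms open_lebesgue)
  have e: "AE x in lebesgue_on S. u x = weak_deriv S 0 u x"
    by (rule weak_deriv_unique[OF assms(1) w is_weak_deriv_weak_deriv[OF w]])
  show ?thesis
    using e by (intro L2_norm_cong_AE[symmetric] L2_measurable L2_cong_AE[OF assms(2) e open_lebesgue[OF assms(1)]] assms)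
qed

lemma first_order_sq_integral:
  assumes U: "U \<in> HkN 3 (Om A)" and k: "k \<ge> 1"
  shows "integrable (lebesgue_on (Om A)) (first_order_sq A U)"
    "(LINT x|lebesgue_on (Om A). first_order_sq A U x) \<le> 4 * CARD('n) * (HkN_norm k (Om A) (U :: real^3 \<Rightarrow> real^'n))\<^sup>2"
proof -
  let ?H = "HkN_norm k (Om A) U" and ?I = "\<lambda>f. LINT x|lebesgue_on (Om A). f x"
  note h = Hk3_derivs[OF HkN_nth[OF U]]
  note sq = L2_integrable_sq[OF h(1)] L2_integrable_sq[OF h(2)]
  have i: "integrable (lebesgue_on (Om A)) (\<lambda>x. (U x $ m)\<^sup>2 + grad_sq A (\<lambda>y. U y $ m) x)" for m
    by (intro Bochner_Integration.integrable_add sq)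
  then show "integrable (lebesgue_on (Om A)) (first_order_sq A U)"
    unfolding first_order_sq_def[abs_def] by (intro Bochner_Integration.integrable_sum)
  have s1: "?I (\<lambda>x. (D1 A (\<lambda>y. U y $ m) j x)\<^sup>2) \<le> ?H\<^sup>2" for m j
    unfolding L2_norm_sq[symmetric] using k by (intro power_mono L2_norm_le_HkN_norm L2_norm_nonneg) simp
  have s0: "?I (\<lambda>x. (U x $ m)\<^sup>2) \<le> ?H\<^sup>2" for m
    unfolding L2_norm_sq[symmetric] L2_norm_weak_deriv_0[OF open_Om h(1), symmetric]
    by (intro power_mono L2_norm_le_HkN_norm L2_norm_nonneg) simp
  have "?I (first_order_sq A U) = (\<Sum>m\<in>UNIV. ?I (\<lambda>x. (U x $ m)\<^sup>2 + grad_sq A (\<lambda>y. U y $ m) x))"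
    unfolding first_order_sq_def[abs_def] by (intro Bochner_Integration.integral_sum i)
  also have "\<dots> = (\<Sum>m\<in>UNIV. ?I (\<lambda>x. (U x $ m)\<^sup>2) + (?I (\<lambda>x. (D1 A (\<lambda>y. U y $ m) 1 x)\<^sup>2)
      + ?I (\<lambda>x. (D1 A (\<lambda>y. U y $ m) 2 x)\<^sup>2) + ?I (\<lambda>x. (D1 A (\<lambda>y. U y $ m) 3 x)\<^sup>2)))"
    by (simp only: Bochner_Integration.integral_add Bochner_Integration.integrable_add sq)
  also have "\<dots> \<le> (\<Sum>m\<in>(UNIV::'n set). ?H\<^sup>2 + (?H\<^sup>2 + ?H\<^sup>2 + ?H\<^sup>2))"
    by (intro sum_mono add_mono s0 s1)
  finally show "?I (first_order_sq A U) \<le> 4 * CARD('n) * ?H\<^sup>2" by simp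
qed

lemma square_sum_le: "finite I \<Longrightarrow> (\<Sum>i\<in>I. f i)\<^sup>2 \<le> real (card I) * (\<Sum>i\<in>I. (f i :: real)\<^sup>2)"
  using sum_squared_le_sum_of_squares[of f I] by (simp add: mult.commute)

lemma lower_order_bound:
  fixes U :: "real^3 \<Rightarrow> 'n::{finite,linorder} rvec" and C :: real
  assumes C: "\<And>j m n. \<bar>(A_mat A b d j x :: 'n rmat) $ m $ n\<bar> \<le> C \<and> \<bar>(A0_mat A b d x :: 'n rmat) $ m $ n\<bar> \<le> C"
  shows "(L_op A b d U x $ n - laplacian A (\<lambda>y. U y $ n) x)\<^sup>2 \<le> 4 * CARD('n) * C\<^sup>2 * first_order_sq A U x"
proof -
  define y where "y m = \<bar>D1 A (\<lambda>y. U y $ m) 1 x\<bar> + \<bar>D1 A (\<lambda>y. U y $ m) 2 x\<bar> + \<bar>D1 A (\<lambda>y. U y $ m) 3 x\<bar> + \<bar>U x $ m\<bar>" for m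
  have C0: "C \<ge> 0" using C[of 1 n n] by (meson abs_ge_zero order_trans)
  have e: "L_op A b d U x $ n - laplacian A (\<lambda>y. U y $ n) x
     = (\<Sum>m\<in>UNIV. A_mat A b d 1 x $ n $ m * D1 A (\<lambda>y. U y $ m) 1 x + A_mat A b d 2 x $ n $ m * D1 A (\<lambda>y. U y $ m) 2 x
        + A_mat A b d 3 x $ n $ m * D1 A (\<lambda>y. U y $ m) 3 x + A0_mat A b d x $ n $ m * U x $ m)"
    unfolding L_op_nth sum_3 by (simp add: sum.distrib)
  have l: "\<bar>L_op A b d U x $ n - laplacian A (\<lambda>y. U y $ n) x\<bar> \<le> (\<Sum>m\<in>UNIV. C * y m)"
    unfolding e
  proof (rule order_trans[OF sum_abs sum_mono])
    fix m
    have p: "\<bar>c * v\<bar> \<le> C * \<bar>v\<bar>" if "\<bar>c\<bar> \<le> C" for c v :: real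
      using that by (simp add: abs_mult mult_right_mono)
    note q = p[OF conjunct1[OF C]] p[OF conjunct2[OF C]]
    show "\<bar>A_mat A b d 1 x $ n $ m * D1 A (\<lambda>y. U y $ m) 1 x + A_mat A b d 2 x $ n $ m * D1 A (\<lambda>y. U y $ m) 2 x
        + A_mat A b d 3 x $ n $ m * D1 A (\<lambda>y. U y $ m) 3 x + A0_mat A b d x $ n $ m * U x $ m\<bar> \<le> C * y m"
      unfolding y_def distrib_left
      by (intro order_trans[OF abs_triangle_ineq] add_mono q)
  qed
  have "(L_op A b d U x $ n - laplacian A (\<lambda>y. U y $ n) x)\<^sup>2 \<le> (\<Sum>m\<in>UNIV. C * y m)\<^sup>2"
    using power_mono[OF l abs_ge_zero, of 2] unfolding power2_abs .
  also have "\<dots> = C\<^sup>2 * (\<Sum>m\<in>UNIV. y m)\<^sup>2" by (simp add: sum_distrib_left[symmetric] power_mult_distrib)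
  also have "\<dots> \<le> C\<^sup>2 * (CARD('n) * (\<Sum>m\<in>UNIV. (y m)\<^sup>2))"
    by (intro mult_left_mono square_sum_le) auto
  also have "\<dots> \<le> C\<^sup>2 * (CARD('n) * (\<Sum>m\<in>UNIV. 4 * ((U x $ m)\<^sup>2 + grad_sq A (\<lambda>y. U y $ m) x)))"
  proof (intro mult_left_mono sum_mono)
    fix m
    have "(a1 + a2 + a3 + a4)\<^sup>2 \<le> 4 * (a4\<^sup>2 + (a1\<^sup>2 + a2\<^sup>2 + a3\<^sup>2))" for a1 a2 a3 a4 :: real
    proof -
      have "0 \<le> (a1 - a2)\<^sup>2 + (a1 - a3)\<^sup>2 + (a1 - a4)\<^sup>2 + (a2 - a3)\<^sup>2 + (a2 - a4)\<^sup>2 + (a3 - a4)\<^sup>2" by simp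
      then show ?thesis by (simp add: power2_eq_square algebra_simps)
    qed
    from this[of "\<bar>D1 A (\<lambda>y. U y $ m) 1 x\<bar>" "\<bar>D1 A (\<lambda>y. U y $ m) 2 x\<bar>" "\<bar>D1 A (\<lambda>y. U y $ m) 3 x\<bar>" "\<bar>U x $ m\<bar>"]
    show "(y m)\<^sup>2 \<le> 4 * ((U x $ m)\<^sup>2 + grad_sq A (\<lambda>y. U y $ m) x)" by (simp add: y_def)
  qed auto
  also have "\<dots> = 4 * CARD('n) * C\<^sup>2 * first_order_sq A U x"
    unfolding first_order_sq_def sum_distrib_left[symmetric] by (simp only: of_nat_mult of_nat_numeral mult_ac)
  finally show ?thesis .
qed

lemma L_op_L2:
  fixes U :: "real^3 \<Rightarrow> 'n::{finite,linorder} rvec"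
  assumes b: "b > 0" and U: "U \<in> HkN 3 (Om A)"
  shows "(\<lambda>x. L_op A b d U x $ n) \<in> L2 (Om A)"
proof -
  obtain C where C: "\<And>x j m n. x \<in> Om A \<Longrightarrow> \<bar>(A_mat A b d j x :: 'n rmat) $ m $ n\<bar> \<le> C"
    "\<And>x m n. x \<in> Om A \<Longrightarrow> \<bar>(A0_mat A b d x :: 'n rmat) $ m $ n\<bar> \<le> C"
    using A_mat_entries(3)[OF b] by metis
  show ?thesis unfolding L_op_nth
    by (intro L2_add L2_sum Hk3_derivs[OF HkN_nth[OF U]] L2_mult_bounded[OF _ _ _ Om_lebesgue, where C = C] A_mat_entries[OF b] C)
qed

lemma weak_deriv_lincomb_HkN_AE:
  fixes U V :: "real^3 \<Rightarrow> real^'n"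
  assumes "U \<in> HkN k (Om A)" "V \<in> HkN k (Om A)"
  shows "AE x in lebesgue_on (Om A). \<forall>n. \<forall>a\<in>{a. mi_order a \<le> k}.
      weak_deriv (Om A) a (\<lambda>y. (U y + c *\<^sub>R V y) $ n) x
        = weak_deriv (Om A) a (\<lambda>y. U y $ n) x + c * weak_deriv (Om A) a (\<lambda>y. V y $ n) x"
proof (intro eventually_all_finite eventually_ball_finite finite_mi_order ballI)
  fix n and a :: "nat^3" assume "a \<in> {a. mi_order a \<le> k}"
  then have "mi_order a \<le> k" by simp
  from weak_deriv_lincomb_AE[OF open_Om HkN_nth[OF assms(1)] HkN_nth[OF assms(2)] this, of 1 n c n]
  show "AE x in lebesgue_on (Om A). weak_deriv (Om A) a (\<lambda>y. (U y + c *\<^sub>R V y) $ n) x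
        = weak_deriv (Om A) a (\<lambda>y. U y $ n) x + c * weak_deriv (Om A) a (\<lambda>y. V y $ n) x" by simp
qed

lemma L_op_lincomb_AE:
  fixes U V :: "real^3 \<Rightarrow> 'n::{finite,linorder} rvec"
  assumes "U \<in> HkN 3 (Om A)" "V \<in> HkN 3 (Om A)"
  shows "AE x in lebesgue_on (Om A). L_op A b d (\<lambda>y. U y + c *\<^sub>R V y) x = L_op A b d U x + c *\<^sub>R L_op A b d V x"
  using weak_deriv_lincomb_HkN_AE[OF assms, of c]
proof eventually_elim
  case (elim x)
  have d1: "D1 A (\<lambda>y. (U y + c *\<^sub>R V y) $ n) j x = D1 A (\<lambda>y. U y $ n) j x + c * D1 A (\<lambda>y. V y $ n) j x" for n j
    by (rule elim[rule_format]) (simp add: mi_order_add_axis)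
  have d2: "D2 A (\<lambda>y. (U y + c *\<^sub>R V y) $ n) i j x = D2 A (\<lambda>y. U y $ n) i j x + c * D2 A (\<lambda>y. V y $ n) i j x" for n i j
    by (rule elim[rule_format]) (simp add: mi_order_add_axis)
  show ?case
    unfolding vec_eq_iff L_op_nth d1 d2
    by (simp add: L_op_nth algebra_simps sum.distrib sum_distrib_left)
qed

lemma norm_sq_component: "(norm (v :: real^'n))\<^sup>2 = (\<Sum>n\<in>UNIV. (v $ n)\<^sup>2)"
  by (simp add: norm_vec_def L2_set_def sum_nonneg)

lemma L_op_norm_sq_integrable:
  fixes U :: "real^3 \<Rightarrow> 'n::{finite,linorder} rvec"
  assumes "b > 0" "U \<in> HkN 3 (Om A)"
  shows "integrable (lebesgue_on (Om A)) (\<lambda>x. (norm (L_op A b d U x))\<^sup>2)"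
  unfolding norm_sq_component by (intro Bochner_Integration.integrable_sum L2_integrable_sq L_op_L2 assms)

text \<open>The operator differs from the componentwise Laplacian by terms of first order with bounded coefficients.\<close>

lemma L_op_bounds:
  assumes b: "b > 0"
  shows "\<exists>K>0. \<forall>U\<in>HkN 3 (Om A).
    (\<forall>x\<in>Om A. (\<Sum>n\<in>UNIV. (laplacian A (\<lambda>y. U y $ n) x)\<^sup>2)
       \<le> 2 * (norm (L_op A b d U x :: 'n::{finite,linorder} rvec))\<^sup>2 + K * first_order_sq A U x) \<and>
    (LINT x|lebesgue_on (Om A). (norm (L_op A b d U x))\<^sup>2) \<le> K * (HkN_norm 2 (Om A) U)\<^sup>2"
proof -
  obtain C :: real where C0: "C > 0" and C_all: "\<forall>x\<in>Om A. \<forall>j m n.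
      \<bar>(A_mat A b d j x :: 'n rmat) $ m $ n\<bar> \<le> C \<and> \<bar>(A0_mat A b d x :: 'n rmat) $ m $ n\<bar> \<le> C"
    using A_mat_entries(3)[OF b, of A d] by (elim exE conjE)
  have C: "\<bar>(A_mat A b d j x :: 'n rmat) $ m $ n\<bar> \<le> C \<and> \<bar>(A0_mat A b d x :: 'n rmat) $ m $ n\<bar> \<le> C"
    if "x \<in> Om A" for x j m n using C_all that by blast
  define c1 where "c1 = 4 * real CARD('n) * C\<^sup>2"
  define K where "K = 6 * real CARD('n) * 3 + 2 * real CARD('n) * c1 * (4 * real CARD('n)) + 2 * real CARD('n) * c1"
  have c1: "c1 > 0" using C0 by (simp add: c1_def)
  have K0: "K > 0" unfolding K_def using c1 by (intro add_pos_pos) auto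
  show ?thesis
  proof (intro exI[of _ K] conjI K0 ballI)
    fix U :: "real^3 \<Rightarrow> 'n rvec" assume U: "U \<in> HkN 3 (Om A)"
    let ?l = "\<lambda>n x. laplacian A (\<lambda>y. U y $ n) x" and ?L = "\<lambda>n x. L_op A b d U x $ n"
    note h = Hk3_derivs[OF HkN_nth[OF U]]
    have lo: "(?L n x - ?l n x)\<^sup>2 \<le> c1 * first_order_sq A U x" if "x \<in> Om A" for x n
      using lower_order_bound[OF C[OF that], of U n] by (simp add: c1_def)
    have sq: "u\<^sup>2 \<le> 2 * v\<^sup>2 + 2 * (u - v)\<^sup>2" for u v :: real
    proof -
      have "0 \<le> (u - 2 * v)\<^sup>2" by simp
      then show ?thesis by (simp add: power2_eq_square algebra_simps)
    qed
    have S0: "first_order_sq A U x \<ge> 0" for x unfolding first_order_sq_def by (intro sum_nonneg) simp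
    fix x assume x: "x \<in> Om A"
    have "(\<Sum>n\<in>UNIV. (?l n x)\<^sup>2) \<le> (\<Sum>n\<in>(UNIV::'n set). 2 * (?L n x)\<^sup>2 + 2 * (c1 * first_order_sq A U x))"
    proof (rule sum_mono)
      fix n
      show "(?l n x)\<^sup>2 \<le> 2 * (?L n x)\<^sup>2 + 2 * (c1 * first_order_sq A U x)"
        using sq[of "?l n x" "?L n x"] lo[OF x, of n] by (simp add: power2_commute)
    qed
    also have "\<dots> = 2 * (norm (L_op A b d U x))\<^sup>2 + 2 * real CARD('n) * c1 * first_order_sq A U x"
      by (simp add: norm_sq_component sum.distrib sum_distrib_left)
    also have "2 * real CARD('n) * c1 * first_order_sq A U x \<le> K * first_order_sq A U x"
      using c1 S0 by (intro mult_right_mono) (auto simp: K_def)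
    finally show "(\<Sum>n\<in>UNIV. (?l n x)\<^sup>2) \<le> 2 * (norm (L_op A b d U x))\<^sup>2 + K * first_order_sq A U x" by simp
  next
    fix U :: "real^3 \<Rightarrow> 'n rvec" assume U: "U \<in> HkN 3 (Om A)"
    let ?l = "\<lambda>n x. laplacian A (\<lambda>y. U y $ n) x" and ?L = "\<lambda>n x. L_op A b d U x $ n"
    let ?I = "\<lambda>f. LINT x|lebesgue_on (Om A). f x" and ?H = "HkN_norm 2 (Om A) U"
    note h = Hk3_derivs[OF HkN_nth[OF U]]
    let ?B = "\<lambda>n x. 6 * ((D2 A (\<lambda>y. U y $ n) 1 1 x)\<^sup>2 + (D2 A (\<lambda>y. U y $ n) 2 2 x)\<^sup>2 + (D2 A (\<lambda>y. U y $ n) 3 3 x)\<^sup>2)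
        + 2 * (c1 * first_order_sq A U x)"
    have Bi: "integrable (lebesgue_on (Om A)) (?B n)" for n
      by (intro Bochner_Integration.integrable_add integrable_mult_right L2_integrable_sq h first_order_sq_integral(1)[OF U, of 1]) simp
    have "?I (\<lambda>x. (?L n x)\<^sup>2) \<le> 18 * ?H\<^sup>2 + 2 * (c1 * (4 * real CARD('n) * ?H\<^sup>2))" for n
    proof -
      have "?I (\<lambda>x. (?L n x)\<^sup>2) \<le> ?I (?B n)"
      proof (rule integral_mono[OF L2_integrable_sq[OF L_op_L2[OF b U]] Bi])
        fix x assume "x \<in> space (lebesgue_on (Om A))"
        then have "(?L n x - ?l n x)\<^sup>2 \<le> c1 * first_order_sq A U x"
          using lower_order_bound[OF C, of x U n] by (simp add: c1_def)
        moreover have "(u)\<^sup>2 \<le> 6 * (a\<^sup>2 + b\<^sup>2 + c\<^sup>2) + 2 * (u - (a + b + c))\<^sup>2" for u a b c :: real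
        proof -
          have "0 \<le> (u - 2 * (a + b + c))\<^sup>2 + 2 * ((a - b)\<^sup>2 + (a - c)\<^sup>2 + (b - c)\<^sup>2)" by simp
          then show ?thesis by (simp add: power2_eq_square algebra_simps)
        qed
        note this[of "?L n x" "D2 A (\<lambda>y. U y $ n) 1 1 x" "D2 A (\<lambda>y. U y $ n) 2 2 x" "D2 A (\<lambda>y. U y $ n) 3 3 x"]
        ultimately show "(?L n x)\<^sup>2 \<le> ?B n x" by linarith
      qed
      also have "\<dots> = 6 * (?I (\<lambda>x. (D2 A (\<lambda>y. U y $ n) 1 1 x)\<^sup>2) + ?I (\<lambda>x. (D2 A (\<lambda>y. U y $ n) 2 2 x)\<^sup>2) + ?I (\<lambda>x. (D2 A (\<lambda>y. U y $ n) 3 3 x)\<^sup>2))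
          + 2 * (c1 * ?I (first_order_sq A U))"
        using L2_integrable_sq[OF h(3)] first_order_sq_integral(1)[OF U, of 1]
        by (simp only: Bochner_Integration.integral_add Bochner_Integration.integrable_add integrable_mult_right integral_mult_right_zero order_refl)
      also have "\<dots> \<le> 6 * (?H\<^sup>2 + ?H\<^sup>2 + ?H\<^sup>2) + 2 * (c1 * (4 * real CARD('n) * ?H\<^sup>2))"
      proof -
        have 1: "?I (\<lambda>x. (D2 A (\<lambda>y. U y $ n) j j x)\<^sup>2) \<le> ?H\<^sup>2" for j
          unfolding L2_norm_sq[symmetric]
          by (intro power_mono L2_norm_le_HkN_norm L2_norm_nonneg) (simp add: mi_order_add_axis)
        have 2: "?I (first_order_sq A U) \<le> 4 * real CARD('n) * ?H\<^sup>2"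
          using first_order_sq_integral(2)[OF U, of 2] by simp
        show ?thesis using c1 by (intro add_mono mult_left_mono 1 2) auto
      qed
      finally show ?thesis by simp
    qed
    then have "(\<Sum>n\<in>UNIV. ?I (\<lambda>x. (?L n x)\<^sup>2)) \<le> (\<Sum>n\<in>(UNIV::'n set). 18 * ?H\<^sup>2 + 2 * (c1 * (4 * real CARD('n) * ?H\<^sup>2)))"
      by (intro sum_mono)
    also have "\<dots> = (18 * real CARD('n) + 2 * real CARD('n) * c1 * (4 * real CARD('n))) * ?H\<^sup>2"
      by (simp add: algebra_simps)
    also have "\<dots> \<le> K * ?H\<^sup>2"
      using c1 by (intro mult_right_mono) (auto simp: K_def)
    finally show "?I (\<lambda>x. (norm (L_op A b d U x))\<^sup>2) \<le> K * ?H\<^sup>2"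
      unfolding norm_sq_component
      by (subst Bochner_Integration.integral_sum) (auto intro: L2_integrable_sq L_op_L2[OF b U])
  qed
qed

section \<open>Conditional stability\<close>

text \<open>A smooth cutoff in the third coordinate that descends from 1 to 0 between the heights \<open>A - c - h\<close> and
  \<open>A - c\<close>.\<close>

lemma step_weight:
  assumes c: "c > 0" and h: "h > 0"
  obtains \<kappa> \<kappa>' C where "weight A \<kappa> \<kappa>'" "\<And>t. 0 \<le> \<kappa> t" "\<And>t. \<kappa> t \<le> 1" "\<And>t. t \<le> A - c - h \<Longrightarrow> \<kappa> t = 1"
    "\<And>t. t \<ge> A - c \<Longrightarrow> \<kappa> t = 0" "\<And>t. \<bar>\<kappa>' t\<bar> \<le> C" "C > 0"
    "\<And>t. t < A - c - h \<or> t > A - c \<Longrightarrow> \<kappa>' t = 0"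
proof -
  obtain s' C where s': "\<And>t. (step has_real_derivative s' t) (at t)" "\<And>t. \<bar>s' t\<bar> \<le> C" "C > 0"
    "\<And>t. t < 0 \<or> t > 1 \<Longrightarrow> s' t = 0" using step_derivative_bounded by metis
  define \<kappa> where "\<kappa> t = step (1 / h * (A - c - t))" for t
  define \<kappa>' where "\<kappa>' t = s' (1 / h * (A - c - t)) * (- (1 / h))" for t
  show ?thesis
  proof (rule that[of \<kappa> \<kappa>' "C * (1 / h)"])
    have "((\<lambda>t. 1 / h * (A - c - t)) has_real_derivative - (1 / h)) (at t)" for t
      using h by (auto intro!: derivative_eq_intros)
    then have d: "(\<kappa> has_real_derivative \<kappa>' t) (at t)" for t
      unfolding \<kappa>_def[abs_def] \<kappa>'_def by (rule DERIV_chain2[OF s'(1)])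
    show "weight A \<kappa> \<kappa>'"
      unfolding weight_def
    proof (intro conjI allI d)
      show "smooth (\<lambda>x. \<kappa> (x $ 3))" unfolding \<kappa>_def
        by (intro smooth_step smooth_mult smooth_diff smooth_const smooth_coord)
      show "zero_near A 3 1 (\<lambda>x. \<kappa> (x $ 3))" unfolding zero_near_def \<kappa>_def
        using c h by (intro exI[of _ c] conjI ballI impI step_0) (auto simp: field_simps)
    qed
    show "0 \<le> \<kappa> t" "\<kappa> t \<le> 1" for t unfolding \<kappa>_def by (rule step_nonneg, rule step_le_1)
    show "\<kappa> t = 1" if "t \<le> A - c - h" for t unfolding \<kappa>_def using that h by (intro step_1) (simp add: field_simps)
    show "\<kappa> t = 0" if "t \<ge> A - c" for t unfolding \<kappa>_def using that h by (intro step_0) (simp add: field_simps)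
    show "\<bar>\<kappa>' t\<bar> \<le> C * (1 / h)" for t
      unfolding \<kappa>'_def abs_mult using s'(2,3) h by (intro mult_mono) auto
    show "C * (1 / h) > 0" using s'(3) h by simp
    show "\<kappa>' t = 0" if "t < A - c - h \<or> t > A - c" for t
      unfolding \<kappa>'_def using that h s'(4)[of "1 / h * (A - c - t)"] by (auto simp: field_simps)
  qed
qed

definition below :: "real \<Rightarrow> real \<Rightarrow> real^3 \<Rightarrow> real" where
  "below A h x = indicator {..A - h} (x $ 3)"

lemma below_measurable: "below A h \<in> borel_measurable (lebesgue_on S)"
  unfolding below_def[abs_def] by (intro measurable_restrict_space1 measurable_completion) simp

lemma below_bounds: "0 \<le> below A h x" "\<bar>below A h x\<bar> \<le> 1" "below A h x * below A h x = below A h x"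
  by (auto simp: below_def indicator_def)

lemma integrable_below: "integrable (lebesgue_on (Om A)) f \<Longrightarrow> integrable (lebesgue_on (Om A)) (\<lambda>x. below B h x * f x)"
  using integrable_mult_bounded[OF _ below_measurable below_bounds(2)] by (simp add: mult.commute)

lemma first_order_sq_nonneg: "first_order_sq A U x \<ge> 0"
  unfolding first_order_sq_def by (intro sum_nonneg) simp

lemma H3_0bscN_HkN: "W \<in> H3_0bscN A \<Longrightarrow> W \<in> HkN 3 (Om A)"
  by (simp add: H3_0bscN_def H3_0bsc_def HkN_def)

text \<open>For large \<open>l\<close> the lower order terms of the operator are absorbed by the left-hand side of the
  Carleman estimate. What remains on the right is the residual, with the largest value of the weight,
  and the cutoff region near the top, where the weight is smaller than on the region of interest.\<close>

lemma conditional_stability: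
  assumes A: "A > 0" and b: "b > 0" and R: "R > A" and e: "0 < e"
  shows "\<exists>C>0. \<exists>l0\<ge>1. \<forall>l\<ge>l0. \<forall>W::real^3 \<Rightarrow> 'n::{finite,linorder} rvec. W \<in> H3_0bscN A \<longrightarrow>
    (LINT x|lebesgue_on (Om A). below A (e / 2) x * first_order_sq A W x)
    \<le> C * (exp (l * (2 * (R + A)\<^sup>2)) * (LINT x|lebesgue_on (Om A). (norm (L_op A b d W x))\<^sup>2)
      + l^3 * exp (- (l * (2 * (R - A + e / 2)\<^sup>2 - 2 * (R - A + e / 4)\<^sup>2))) * (LINT x|lebesgue_on (Om A). first_order_sq A W x))"
proof -
  obtain C0 where C0: "C0 > 0" and carl: "\<forall>l\<ge>1. \<forall>w\<in>H3_0bsc A. \<forall>\<kappa> \<kappa>'. weight A \<kappa> \<kappa>' \<longrightarrow> (\<forall>t. \<kappa> t \<ge> 0) \<longrightarrow>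
    (LINT x|lebesgue_on (Om A). carleman_weight R l (x $ 3) * \<kappa> (x $ 3) * (l * grad_sq A w x + l^3 * (w x)\<^sup>2))
    \<le> C0 * (LINT x|lebesgue_on (Om A). carleman_weight R l (x $ 3) * \<kappa> (x $ 3) * (laplacian A w x)\<^sup>2)
      + C0 * l^3 * (LINT x|lebesgue_on (Om A). carleman_weight R l (x $ 3) * \<bar>\<kappa>' (x $ 3)\<bar> * ((w x)\<^sup>2 + grad_sq A w x))"
    using carleman_estimate[OF A R] by (elim exE conjE)
  obtain K where K: "K > 0" and Kb: "\<forall>U::real^3 \<Rightarrow> 'n rvec \<in> HkN 3 (Om A).
    (\<forall>x\<in>Om A. (\<Sum>n\<in>UNIV. (laplacian A (\<lambda>y. U y $ n) x)\<^sup>2)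
       \<le> 2 * (norm (L_op A b d U x))\<^sup>2 + K * first_order_sq A U x) \<and>
    (LINT x|lebesgue_on (Om A). (norm (L_op A b d U x))\<^sup>2) \<le> K * (HkN_norm 2 (Om A) U)\<^sup>2"
    using L_op_bounds[OF b, of A d] by (elim exE conjE)
  have e8: "e / 8 > 0" using e by simp
  obtain \<kappa> \<kappa>' C1 where kap: "weight A \<kappa> \<kappa>'" "\<And>t. 0 \<le> \<kappa> t" "\<And>t. \<kappa> t \<le> 1" "\<And>t. t \<le> A - e / 8 - e / 8 \<Longrightarrow> \<kappa> t = 1"
    "\<And>t. \<bar>\<kappa>' t\<bar> \<le> C1" "C1 > 0" "\<And>t. t < A - e / 8 - e / 8 \<or> t > A - e / 8 \<Longrightarrow> \<kappa>' t = 0"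
    using step_weight[OF e8 e8, of A] by metis
  define p q a where "p = 2 * (R - A + e / 2)\<^sup>2" and "q = 2 * (R - A + e / 4)\<^sup>2" and "a = 2 * (R + A)\<^sup>2"
  define l0 where "l0 = 1 + 2 * C0 * K"
  define C where "C = 4 * C0 + 2 * C0 * C1"
  have "C > 0" "l0 \<ge> 1" using C0 kap(6) K by (auto simp: C_def l0_def intro!: add_pos_pos)
  show ?thesis
  proof (rule exI[of _ C], rule conjI[OF \<open>C > 0\<close>], rule exI[of _ l0], intro conjI allI impI)
    fix l :: real and W :: "real^3 \<Rightarrow> 'n rvec"
    assume ll: "l \<ge> l0" and W: "W \<in> H3_0bscN A"
    have l: "l \<ge> 1" "2 * C0 * K \<le> l" using ll C0 K by (auto simp: l0_def intro: order_trans[rotated])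
    let ?I = "\<lambda>f. LINT x|lebesgue_on (Om A). f x"
    let ?E = "\<lambda>x::real^3. carleman_weight R l (x $ 3)" and ?k = "\<lambda>x::real^3. \<kappa> (x $ 3)" and ?k' = "\<lambda>x::real^3. \<kappa>' (x $ 3)"
    let ?w = "\<lambda>n y. W y $ n"
    let ?S = "first_order_sq A W" and ?N = "\<lambda>x. (norm (L_op A b d W x))\<^sup>2"
    have W3: "W \<in> HkN 3 (Om A)" using W by (rule H3_0bscN_HkN)
    have wn: "?w n \<in> H3_0bsc A" for n using W by (simp add: H3_0bscN_def)
    note h = Hk3_derivs[OF HkN_nth[OF W3]]
    have E0: "?E x > 0" for x by (simp add: carleman_weight_def)
    have sE: "smooth ?E" by (rule smooth_carleman_weight)
    have sk: "smooth (\<lambda>x. ?E x * ?k x)" "smooth (\<lambda>x. ?E x * ?k' x)"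
      using sE weight_smooth[OF kap(1)] by (auto intro: smooth_mult)
    have bI: "integrable (lebesgue_on (Om A)) (\<lambda>x. \<sigma> x * f x)" if s: "smooth \<sigma>" and f: "integrable (lebesgue_on (Om A)) f" for \<sigma> f
    proof -
      obtain B where "\<And>x. x \<in> Om A \<Longrightarrow> \<bar>\<sigma> x\<bar> \<le> B" using smooth_bounded_on_Om[OF s] by blast
      from integrable_mult_bounded[OF f smooth_measurable_Om[OF s] this] show ?thesis by (simp add: mult.commute)
    qed
    have Si: "integrable (lebesgue_on (Om A)) ?S" by (rule first_order_sq_integral(1)[OF W3, of 1]) simp
    have Ni: "integrable (lebesgue_on (Om A)) ?N" by (rule L_op_norm_sq_integrable[OF b W3])
    have absk: "integrable (lebesgue_on (Om A)) (\<lambda>x. ?E x * \<bar>?k' x\<bar> * f x)" if f: "integrable (lebesgue_on (Om A)) f" and f0: "\<And>x. f x \<ge> 0" for f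
    proof -
      have "\<bar>?E x * ?k' x * f x\<bar> = ?E x * \<bar>?k' x\<bar> * f x" for x using E0[of x] f0[of x] by (simp add: abs_mult)
      with integrable_abs[OF bI[OF sk(2) f]] show ?thesis by simp
    qed
    have sqi: "integrable (lebesgue_on (Om A)) (\<lambda>x. (?w n x)\<^sup>2)" "integrable (lebesgue_on (Om A)) (grad_sq A (?w n))"
      "integrable (lebesgue_on (Om A)) (\<lambda>x. (laplacian A (?w n) x)\<^sup>2)" for n
      by (intro Bochner_Integration.integrable_add L2_integrable_sq L2_add h)+
    have wgi: "integrable (lebesgue_on (Om A)) (\<lambda>x. (?w n x)\<^sup>2 + grad_sq A (?w n) x)" for n
      by (intro Bochner_Integration.integrable_add sqi)
    have step1: "l * ?I (\<lambda>x. ?E x * ?k x * ((?w n x)\<^sup>2 + grad_sq A (?w n) x))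
       \<le> C0 * ?I (\<lambda>x. ?E x * ?k x * (laplacian A (?w n) x)\<^sup>2)
        + C0 * l^3 * ?I (\<lambda>x. ?E x * \<bar>?k' x\<bar> * ((?w n x)\<^sup>2 + grad_sq A (?w n) x))" for n
    proof -
      have "l * ?I (\<lambda>x. ?E x * ?k x * ((?w n x)\<^sup>2 + grad_sq A (?w n) x)) = ?I (\<lambda>x. l * (?E x * ?k x * ((?w n x)\<^sup>2 + grad_sq A (?w n) x)))"
        by simp
      also have "\<dots> \<le> ?I (\<lambda>x. ?E x * ?k x * (l * grad_sq A (?w n) x + l^3 * (?w n x)\<^sup>2))"
      proof (rule integral_mono)
        show "integrable (lebesgue_on (Om A)) (\<lambda>x. l * (?E x * ?k x * ((?w n x)\<^sup>2 + grad_sq A (?w n) x)))"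
          by (intro integrable_mult_right bI[OF sk(1)] wgi)
        show "integrable (lebesgue_on (Om A)) (\<lambda>x. ?E x * ?k x * (l * grad_sq A (?w n) x + l^3 * (?w n x)\<^sup>2))"
          by (intro bI[OF sk(1)] Bochner_Integration.integrable_add integrable_mult_right sqi)
        fix x
        have "l \<le> l^3" using l power_increasing[of 1 3 l] by simp
        then have "l * (?w n x)\<^sup>2 \<le> l^3 * (?w n x)\<^sup>2" by (intro mult_right_mono) auto
        then have "l * ((?w n x)\<^sup>2 + grad_sq A (?w n) x) \<le> l * grad_sq A (?w n) x + l^3 * (?w n x)\<^sup>2"
          by (simp add: distrib_left)
        then have "?E x * ?k x * (l * ((?w n x)\<^sup>2 + grad_sq A (?w n) x)) \<le> ?E x * ?k x * (l * grad_sq A (?w n) x + l^3 * (?w n x)\<^sup>2)"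
          using E0[of x] kap(2) by (intro mult_left_mono mult_nonneg_nonneg) auto
        then show "l * (?E x * ?k x * ((?w n x)\<^sup>2 + grad_sq A (?w n) x)) \<le> ?E x * ?k x * (l * grad_sq A (?w n) x + l^3 * (?w n x)\<^sup>2)"
          by (simp only: mult_ac)
      qed
      also have "\<dots> \<le> C0 * ?I (\<lambda>x. ?E x * ?k x * (laplacian A (?w n) x)\<^sup>2)
        + C0 * l^3 * ?I (\<lambda>x. ?E x * \<bar>?k' x\<bar> * ((?w n x)\<^sup>2 + grad_sq A (?w n) x))"
        using carl l(1) wn[of n] kap(1,2) by blast
      finally show ?thesis .
    qed
    have sumI: "(\<Sum>n\<in>UNIV. ?I (\<lambda>x. \<sigma> x * ((?w n x)\<^sup>2 + grad_sq A (?w n) x))) = ?I (\<lambda>x. \<sigma> x * ?S x)"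
      if "\<And>n. integrable (lebesgue_on (Om A)) (\<lambda>x. \<sigma> x * ((?w n x)\<^sup>2 + grad_sq A (?w n) x))" for \<sigma>
      unfolding first_order_sq_def sum_distrib_left using that by (intro Bochner_Integration.integral_sum[symmetric])
    have "l * ?I (\<lambda>x. ?E x * ?k x * ?S x) = (\<Sum>n\<in>UNIV. l * ?I (\<lambda>x. ?E x * ?k x * ((?w n x)\<^sup>2 + grad_sq A (?w n) x)))"
      unfolding sum_distrib_left[symmetric] by (subst sumI) (intro bI[OF sk(1)] wgi, rule refl)
    also have "\<dots> \<le> (\<Sum>n\<in>UNIV. C0 * ?I (\<lambda>x. ?E x * ?k x * (laplacian A (?w n) x)\<^sup>2)
        + C0 * l^3 * ?I (\<lambda>x. ?E x * \<bar>?k' x\<bar> * ((?w n x)\<^sup>2 + grad_sq A (?w n) x)))"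
      by (intro sum_mono step1)
    also have "\<dots> = C0 * (\<Sum>n\<in>UNIV. ?I (\<lambda>x. ?E x * ?k x * (laplacian A (?w n) x)\<^sup>2)) + C0 * l^3 * ?I (\<lambda>x. ?E x * \<bar>?k' x\<bar> * ?S x)"
      unfolding sum.distrib sum_distrib_left[symmetric] by (subst sumI) (intro absk wgi add_nonneg_nonneg zero_le_power2, rule refl)
    also have "(\<Sum>n\<in>UNIV. ?I (\<lambda>x. ?E x * ?k x * (laplacian A (?w n) x)\<^sup>2)) = ?I (\<lambda>x. ?E x * ?k x * (\<Sum>n\<in>UNIV. (laplacian A (?w n) x)\<^sup>2))"
      unfolding sum_distrib_left by (intro Bochner_Integration.integral_sum[symmetric] bI[OF sk(1)] sqi)
    also have "\<dots> \<le> ?I (\<lambda>x. ?E x * ?k x * (2 * ?N x + K * ?S x))"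
    proof (rule integral_mono)
      show "integrable (lebesgue_on (Om A)) (\<lambda>x. ?E x * ?k x * (\<Sum>n\<in>UNIV. (laplacian A (?w n) x)\<^sup>2))"
        by (intro bI[OF sk(1)] Bochner_Integration.integrable_sum sqi)
      show "integrable (lebesgue_on (Om A)) (\<lambda>x. ?E x * ?k x * (2 * ?N x + K * ?S x))"
        by (intro bI[OF sk(1)] Bochner_Integration.integrable_add integrable_mult_right Ni Si)
      fix x assume "x \<in> space (lebesgue_on (Om A))"
      then have "(\<Sum>n\<in>UNIV. (laplacian A (?w n) x)\<^sup>2) \<le> 2 * ?N x + K * ?S x"
        using Kb W3 by simp
      then show "?E x * ?k x * (\<Sum>n\<in>UNIV. (laplacian A (?w n) x)\<^sup>2) \<le> ?E x * ?k x * (2 * ?N x + K * ?S x)"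
        using E0[of x] kap(2) by (intro mult_left_mono mult_nonneg_nonneg) auto
    qed
    also have "\<dots> = 2 * ?I (\<lambda>x. ?E x * ?k x * ?N x) + K * ?I (\<lambda>x. ?E x * ?k x * ?S x)"
    proof -
      have "?I (\<lambda>x. ?E x * ?k x * (2 * ?N x + K * ?S x)) = ?I (\<lambda>x. 2 * (?E x * ?k x * ?N x) + K * (?E x * ?k x * ?S x))"
        by (intro Bochner_Integration.integral_cong refl) (simp add: algebra_simps)
      then show ?thesis using bI[OF sk(1) Ni] bI[OF sk(1) Si]
        by (simp only: Bochner_Integration.integral_add integrable_mult_right integral_mult_right_zero)
    qed
    finally have main: "l * ?I (\<lambda>x. ?E x * ?k x * ?S x) \<le> C0 * (2 * ?I (\<lambda>x. ?E x * ?k x * ?N x) + K * ?I (\<lambda>x. ?E x * ?k x * ?S x))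
        + C0 * l^3 * ?I (\<lambda>x. ?E x * \<bar>?k' x\<bar> * ?S x)" using C0 by simp
    define X Y Z where "X = ?I (\<lambda>x. ?E x * ?k x * ?S x)" and "Y = ?I (\<lambda>x. ?E x * ?k x * ?N x)" and "Z = ?I (\<lambda>x. ?E x * \<bar>?k' x\<bar> * ?S x)"
    have X0: "X \<ge> 0" unfolding X_def
      by (intro Bochner_Integration.integral_nonneg mult_nonneg_nonneg less_imp_le[OF E0] kap(2) first_order_sq_nonneg)
    have "X \<le> 4 * C0 * Y + 2 * C0 * l^3 * Z"
    proof -
      have "2 * C0 * K * X \<le> l * X" using l(2) X0 by (rule mult_right_mono)
      then have "l * X \<le> 4 * C0 * Y + 2 * (C0 * l^3 * Z)"
        using main unfolding X_def[symmetric] Y_def[symmetric] Z_def[symmetric] by (simp add: algebra_simps)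
      moreover have "X \<le> l * X" using l(1) X0 by (simp add: mult_le_cancel_right1)
      ultimately show ?thesis by simp
    qed
    moreover have "Y \<le> exp (l * a) * ?I ?N"
    proof -
      have "Y \<le> ?I (\<lambda>x. exp (l * a) * ?N x)" unfolding Y_def
      proof (rule integral_mono[OF bI[OF sk(1) Ni]])
        fix x assume "x \<in> space (lebesgue_on (Om A))"
        then have "- A < x $ 3" "x $ 3 < A" by (simp_all add: Om_def)
        then have "\<bar>x $ 3 - R\<bar> \<le> R + A" using R by auto
        then have "(x $ 3 - R)\<^sup>2 \<le> (R + A)\<^sup>2" using power_mono[of "\<bar>x $ 3 - R\<bar>" "R + A" 2] by simp
        then have "?E x \<le> exp (l * a)" using l(1) by (simp add: carleman_weight_def a_def)
        then have "?E x * ?k x \<le> exp (l * a) * 1" using kap(2,3) E0[of x] by (intro mult_mono) auto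
        then show "?E x * ?k x * ?N x \<le> exp (l * a) * ?N x" by (intro mult_right_mono) auto
      qed (use Ni in simp)
      then show ?thesis by simp
    qed
    moreover have "Z \<le> C1 * exp (l * q) * ?I ?S"
    proof -
      have "Z \<le> ?I (\<lambda>x. C1 * exp (l * q) * ?S x)" unfolding Z_def
      proof (rule integral_mono[OF absk[OF Si first_order_sq_nonneg]])
        fix x assume "x \<in> space (lebesgue_on (Om A))"
        then have xA: "x $ 3 < A" by (simp add: Om_def)
        have "?E x * \<bar>?k' x\<bar> \<le> C1 * exp (l * q)"
        proof (cases "x $ 3 < A - e / 8 - e / 8")
          case True
          then show ?thesis using kap(7)[of "x $ 3"] kap(6) by simp
        next
          case False
          then have "\<bar>x $ 3 - R\<bar> \<le> R - A + e / 4" using xA R by auto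
          then have "(x $ 3 - R)\<^sup>2 \<le> (R - A + e / 4)\<^sup>2" using power_mono[of "\<bar>x $ 3 - R\<bar>" "R - A + e / 4" 2] by simp
          then have "?E x \<le> exp (l * q)" using l(1) by (simp add: carleman_weight_def q_def)
          then have "?E x * \<bar>?k' x\<bar> \<le> exp (l * q) * C1" using kap(5) by (intro mult_mono) auto
          then show ?thesis by (simp add: mult.commute)
        qed
        then show "?E x * \<bar>?k' x\<bar> * ?S x \<le> C1 * exp (l * q) * ?S x"
          by (intro mult_right_mono first_order_sq_nonneg)
      qed (use Si in simp)
      then show ?thesis by simp
    qed
    moreover have "exp (l * p) * ?I (\<lambda>x. below A (e / 2) x * ?S x) \<le> X"
    proof -
      have "?I (\<lambda>x. exp (l * p) * (below A (e / 2) x * ?S x)) \<le> X" unfolding X_def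
      proof (rule integral_mono[OF _ bI[OF sk(1) Si]])
        show "integrable (lebesgue_on (Om A)) (\<lambda>x. exp (l * p) * (below A (e / 2) x * ?S x))"
          by (intro integrable_mult_right integrable_below Si)
        fix x :: "real^3"
        show "exp (l * p) * (below A (e / 2) x * ?S x) \<le> ?E x * ?k x * ?S x"
        proof (cases "x $ 3 \<le> A - e / 2")
          case True
          then have "R - A + e / 2 \<le> \<bar>x $ 3 - R\<bar>" by linarith
          then have "(R - A + e / 2)\<^sup>2 \<le> (x $ 3 - R)\<^sup>2" using power_mono[of "R - A + e / 2" "\<bar>x $ 3 - R\<bar>" 2] R e by simp
          then have "exp (l * p) \<le> ?E x" using l(1) by (simp add: carleman_weight_def p_def)
          moreover have "?k x = 1" using True e by (intro kap(4)) simp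
          ultimately show ?thesis using True by (simp add: below_def mult_right_mono first_order_sq_nonneg)
        next
          case False
          then show ?thesis using E0[of x] kap(2) first_order_sq_nonneg[of A W x] by (simp add: below_def)
        qed
      qed
      then show ?thesis by simp
    qed
    ultimately have fin: "exp (l * p) * ?I (\<lambda>x. below A (e / 2) x * ?S x)
       \<le> 4 * C0 * (exp (l * a) * ?I ?N) + 2 * C0 * l^3 * (C1 * exp (l * q) * ?I ?S)"
    proof -
      assume "X \<le> 4 * C0 * Y + 2 * C0 * l^3 * Z" "Y \<le> exp (l * a) * ?I ?N" "Z \<le> C1 * exp (l * q) * ?I ?S"
        "exp (l * p) * ?I (\<lambda>x. below A (e / 2) x * ?S x) \<le> X"
      moreover have "4 * C0 * Y \<le> 4 * C0 * (exp (l * a) * ?I ?N)" using calculation(2) C0 by (intro mult_left_mono) auto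
      moreover have "2 * C0 * l^3 * Z \<le> 2 * C0 * l^3 * (C1 * exp (l * q) * ?I ?S)" using calculation(3) C0 l by (intro mult_left_mono) auto
      ultimately show ?thesis by linarith
    qed
    have I0: "?I ?N \<ge> 0" "?I ?S \<ge> 0" using first_order_sq_nonneg[of A W] by auto
    have "?I (\<lambda>x. below A (e / 2) x * ?S x) = exp (- (l * p)) * (exp (l * p) * ?I (\<lambda>x. below A (e / 2) x * ?S x))"
      by (simp add: exp_minus)
    also have "\<dots> \<le> exp (- (l * p)) * (4 * C0 * (exp (l * a) * ?I ?N) + 2 * C0 * l^3 * (C1 * exp (l * q) * ?I ?S))"
      using fin by (intro mult_left_mono) auto
    also have "\<dots> = exp (- (l * p)) * (4 * C0 * (exp (l * a) * ?I ?N)) + 2 * C0 * C1 * (l^3 * exp (- (l * (p - q))) * ?I ?S)"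
      by (simp add: algebra_simps exp_add[symmetric] exp_diff exp_minus field_simps)
    also have "\<dots> \<le> 1 * (4 * C0 * (exp (l * a) * ?I ?N)) + 2 * C0 * C1 * (l^3 * exp (- (l * (p - q))) * ?I ?S)"
      using C0 I0 l by (intro add_mono mult_right_mono order_refl) (auto simp: p_def)
    also have "\<dots> \<le> C * (exp (l * a) * ?I ?N + l^3 * exp (- (l * (p - q))) * ?I ?S)"
    proof -
      have "0 \<le> exp (l * a) * ?I ?N" "0 \<le> l^3 * exp (- (l * (p - q))) * ?I ?S" using I0 l by auto
      then have "0 \<le> 2 * C0 * C1 * (exp (l * a) * ?I ?N)" "0 \<le> 4 * C0 * (l^3 * exp (- (l * (p - q))) * ?I ?S)"
        using C0 kap(6) by (auto intro!: mult_nonneg_nonneg)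
      then show ?thesis unfolding C_def by (simp only: distrib_left distrib_right)
    qed
    finally show "?I (\<lambda>x. below A (e / 2) x * ?S x)
    \<le> C * (exp (l * (2 * (R + A)\<^sup>2)) * ?I ?N + l^3 * exp (- (l * (2 * (R - A + e / 2)\<^sup>2 - 2 * (R - A + e / 4)\<^sup>2))) * ?I ?S)"
      unfolding p_def q_def a_def .
  qed (rule \<open>l0 \<ge> 1\<close>)
qed

text \<open>The second derivatives are interpolated between the first and the third ones: by
  \<open>second_derivative_identity\<close> and the Cauchy-Schwarz inequality, the square of the second derivative is at most
  the product of the first derivative with the \<open>H\<^sup>3\<close> norm.\<close>

lemma second_derivative_bound:
  assumes A: "A > 0" and e: "e > 0"
  shows "\<exists>C>0. \<forall>w\<in>H3_0bsc A. \<forall>i j.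
    (LINT x|lebesgue_on (Om A). below A e x * (D2 A w i j x)\<^sup>2)
    \<le> C * (Hk_norm 3 (Om A) w * sqrt (LINT x|lebesgue_on (Om A). below A (e / 2) x * (D1 A w j x)\<^sup>2))"
proof -
  have e2: "e / 2 > 0" using e by simp
  obtain r r' C1 where r: "weight A r r'" "\<And>t. 0 \<le> r t" "\<And>t. r t \<le> 1" "\<And>t. t \<le> A - e / 2 - e / 2 \<Longrightarrow> r t = 1"
    "\<And>t. t \<ge> A - e / 2 \<Longrightarrow> r t = 0" "\<And>t. \<bar>r' t\<bar> \<le> C1" "C1 > 0" "\<And>t. t < A - e / 2 - e / 2 \<or> t > A - e / 2 \<Longrightarrow> r' t = 0"
    using step_weight[OF e2 e2, of A] by metis
  show ?thesis
  proof (intro exI[of _ "1 + C1"] conjI ballI allI)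
    fix w and i j :: 3 assume w: "w \<in> H3_0bsc A"
    let ?I = "\<lambda>f. LINT x|lebesgue_on (Om A). f x"
    note h3 = H3_0bsc_traces(1)[OF w A]
    note d = Hk3_derivs[OF h3]
    let ?D1 = "D1 A w j" and ?D2 = "D2 A w i j" and ?D3 = "D3 A w i i j" and ?H = "Hk_norm 3 (Om A) w"
    note s = weight_smooth[OF r(1)]
    let ?r = "\<lambda>x::real^3. r (x $ 3)" and ?r' = "\<lambda>x::real^3. if i = 3 then r' (x $ 3) else 0"
    have sr': "smooth ?r'" using s(2) smooth_const[of 0] by (cases "i = 3") auto
    define m where "m = L2_norm (Om A) (\<lambda>x. below A (e / 2) x * ?D1 x)"
    have bL: "(\<lambda>x. below A (e / 2) x * ?D1 x) \<in> L2 (Om A)"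
      by (rule L2_mult_bounded[OF d(2) below_measurable below_bounds(2) Om_lebesgue])
    have m: "m = sqrt (?I (\<lambda>x. below A (e / 2) x * (?D1 x)\<^sup>2))"
      unfolding m_def L2_norm_def
      by (intro arg_cong[where f = sqrt] Bochner_Integration.integral_cong) (auto simp: below_def indicator_def)
    have rb: "?r x * ?D1 x = ?r x * (below A (e / 2) x * ?D1 x)" "?r' x * ?D1 x = ?r' x * (below A (e / 2) x * ?D1 x)" for x
      using r(5)[of "x $ 3"] r(8)[of "x $ 3"] by (auto simp: below_def indicator_def)
    have n1: "L2_norm (Om A) (\<lambda>x. ?r x * ?D1 x) \<le> 1 * m"
      unfolding rb(1) m_def using r(2,3)
      by (intro L2_norm_mult_bounded[OF bL smooth_measurable_Om[OF s(1)] _ Om_lebesgue]) auto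
    have n2: "L2_norm (Om A) (\<lambda>x. ?r' x * ?D1 x) \<le> C1 * m"
      unfolding rb(2) m_def using r(6,7)
      by (intro L2_norm_mult_bounded[OF bL smooth_measurable_Om[OF sr'] _ Om_lebesgue]) auto
    have h3n: "L2_norm (Om A) ?D3 \<le> ?H" "L2_norm (Om A) ?D2 \<le> ?H"
      by (intro L2_norm_le_Hk_norm; simp add: mi_order_add_axis)+
    have i: "integrable (lebesgue_on (Om A)) (\<lambda>x. ?r x * (?D3 x * ?D1 x))" "integrable (lebesgue_on (Om A)) (\<lambda>x. ?r x * (?D2 x * ?D2 x))"
      "integrable (lebesgue_on (Om A)) (\<lambda>x. ?r' x * (?D2 x * ?D1 x))"
      by (intro integrable_smooth_mult2 s(1) sr' d)+
    have "?I (\<lambda>x. ?r x * (?D3 x * ?D1 x) + ?r x * (?D2 x * ?D2 x) + ?r' x * (?D2 x * ?D1 x)) = 0"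
      using second_derivative_identity[OF A w r(1), of i j] by (simp add: zero_mean_def)
    then have id: "?I (\<lambda>x. ?r x * (?D2 x * ?D2 x)) = - ?I (\<lambda>x. ?r x * (?D3 x * ?D1 x)) - ?I (\<lambda>x. ?r' x * (?D2 x * ?D1 x))"
      using i by (simp only: Bochner_Integration.integral_add Bochner_Integration.integrable_add)
    have c1: "\<bar>?I (\<lambda>x. ?r x * (?D3 x * ?D1 x))\<bar> \<le> ?H * (1 * m)"
    proof -
      have "\<bar>?I (\<lambda>x. ?D3 x * (?r x * ?D1 x))\<bar> \<le> L2_norm (Om A) ?D3 * L2_norm (Om A) (\<lambda>x. ?r x * ?D1 x)"
        by (intro L2_Cauchy_Schwarz L2_smooth_mult s(1) d)
      also have "\<dots> \<le> ?H * (1 * m)" by (intro mult_mono h3n n1 L2_norm_nonneg Hk_norm_nonneg)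
      finally show ?thesis by (simp add: mult_ac)
    qed
    have c2: "\<bar>?I (\<lambda>x. ?r' x * (?D2 x * ?D1 x))\<bar> \<le> ?H * (C1 * m)"
    proof -
      have "\<bar>?I (\<lambda>x. ?D2 x * (?r' x * ?D1 x))\<bar> \<le> L2_norm (Om A) ?D2 * L2_norm (Om A) (\<lambda>x. ?r' x * ?D1 x)"
        by (intro L2_Cauchy_Schwarz L2_smooth_mult sr' d)
      also have "\<dots> \<le> ?H * (C1 * m)" by (intro mult_mono h3n n2 L2_norm_nonneg Hk_norm_nonneg)
      finally show ?thesis by (simp only: mult.left_commute)
    qed
    have "?I (\<lambda>x. below A e x * (?D2 x)\<^sup>2) \<le> ?I (\<lambda>x. ?r x * (?D2 x * ?D2 x))"
    proof (rule integral_mono[OF integrable_below[OF L2_integrable_sq[OF d(3)]] i(2)])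
      fix x
      show "below A e x * (?D2 x)\<^sup>2 \<le> ?r x * (?D2 x * ?D2 x)"
        using r(2)[of "x $ 3"] r(4)[of "x $ 3"] by (auto simp: below_def indicator_def power2_eq_square)
    qed
    also have "\<dots> \<le> ?H * (1 * m) + ?H * (C1 * m)" using id c1 c2 by linarith
    also have "\<dots> = (1 + C1) * (?H * m)" by (simp add: algebra_simps)
    finally show "?I (\<lambda>x. below A e x * (?D2 x)\<^sup>2) \<le> (1 + C1) * (?H * sqrt (?I (\<lambda>x. below A (e / 2) x * (?D1 x)\<^sup>2)))"
      unfolding m .
  qed (use r(7) in simp)
qed

text \<open>With \<open>l = ln (1 / \<delta>) / a\<close> the first term becomes \<open>K * \<delta>\<close> and the second one a power of \<open>\<delta>\<close>; half of the
  exponential decay in \<open>l\<close> compensates the factor \<open>l^3\<close>.\<close>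

lemma exp_power_tradeoff:
  fixes a c C K M l0 :: real
  assumes a: "a > 0" and c: "c > 0" and C: "C > 0" and l0: "l0 \<ge> 1" and K: "K \<ge> 0" and M: "M \<ge> 0"
  obtains \<beta> C' \<delta>1 where "0 < \<beta>" "\<beta> \<le> 1" "C' > 0" "0 < \<delta>1" "\<delta>1 < 1"
    "\<And>\<delta>. 0 < \<delta> \<Longrightarrow> \<delta> < \<delta>1 \<Longrightarrow> \<exists>l\<ge>l0. C * (exp (l * a) * (K * \<delta>\<^sup>2) + l^3 * exp (- (l * c)) * M) \<le> C' * \<delta> powr \<beta>"
proof -
  define \<beta> where "\<beta> = min 1 (c / (2 * a))"
  define B where "B = (2 / c)^3 * 27"
  define C' where "C' = C * (K + B * M) + 1"
  have B: "B > 0" using c by (simp add: B_def)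
  show ?thesis
  proof (rule that[of \<beta> C' "exp (- (a * l0))"])
    show "0 < \<beta>" "\<beta> \<le> 1" using a c by (auto simp: \<beta>_def)
    show "C' > 0" using C K M B by (auto simp: C'_def intro!: add_nonneg_pos)
    show "exp (- (a * l0)) < 1" using a l0 by simp
    fix \<delta> :: real assume \<delta>: "0 < \<delta>" "\<delta> < exp (- (a * l0))"
    define l where "l = - ln \<delta> / a"
    have "ln \<delta> < - (a * l0)" using \<delta> ln_less_cancel_iff[of \<delta> "exp (- (a * l0))"] by simp
    then have l: "l \<ge> l0" using a by (simp add: l_def field_simps)
    have "exp (- (a * l0)) < 1" using a l0 by simp
    then have \<delta>1: "\<delta> < 1" using \<delta> by linarith
    have ea: "exp (l * a) = 1 / \<delta>" using a \<delta> by (simp add: l_def exp_minus inverse_eq_divide)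
    have "exp (- (l * (c / 2))) = \<delta> powr (c / (2 * a))" using a \<delta> by (simp add: l_def powr_def field_simps)
    also have "\<dots> \<le> \<delta> powr \<beta>" using \<delta> \<delta>1 by (intro powr_mono') (auto simp: \<beta>_def)
    finally have ec: "exp (- (l * (c / 2))) \<le> \<delta> powr \<beta>" .
    have l3: "l^3 * exp (- (l * (c / 2))) \<le> B"
    proof -
      define x where "x = l * (c / 2)"
      have x0: "x \<ge> 0" using l l0 c by (simp add: x_def)
      have "x / 3 \<le> exp (x / 3)" using exp_ge_add_one_self[of "x / 3"] by linarith
      then have "(x / 3)^3 \<le> (exp (x / 3))^3" using x0 by (intro power_mono) auto
      also have "\<dots> = exp x" by (simp add: exp_of_nat_mult[symmetric])
      finally have "x^3 \<le> 27 * exp x" by (simp add: power_divide)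
      moreover have "l^3 = (2 / c)^3 * x^3" using c by (simp add: x_def power_mult_distrib[symmetric])
      ultimately have "l^3 \<le> B * exp x" using c by (simp add: B_def mult.assoc mult_left_mono)
      then have "l^3 * exp (- x) \<le> B * exp x * exp (- x)" by (intro mult_right_mono) auto
      also have "\<dots> = B" by (simp add: exp_minus)
      finally show ?thesis unfolding x_def .
    qed
    have 1: "exp (l * a) * (K * \<delta>\<^sup>2) \<le> K * \<delta> powr \<beta>"
    proof -
      have "exp (l * a) * (K * \<delta>\<^sup>2) = K * \<delta> powr 1" using \<delta> by (simp add: ea power2_eq_square)
      also have "\<dots> \<le> K * \<delta> powr \<beta>" using \<delta> \<delta>1 K by (intro mult_left_mono powr_mono') (auto simp: \<beta>_def)
      finally show ?thesis .
    qed
    have 2: "l^3 * exp (- (l * c)) * M \<le> B * M * \<delta> powr \<beta>"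
    proof -
      have "l^3 * exp (- (l * c)) = (l^3 * exp (- (l * (c / 2)))) * exp (- (l * (c / 2)))"
        by (simp add: mult.assoc exp_add[symmetric])
      also have "\<dots> \<le> B * \<delta> powr \<beta>" using l3 ec B by (intro mult_mono) auto
      finally have "l^3 * exp (- (l * c)) * M \<le> B * \<delta> powr \<beta> * M" using M by (intro mult_right_mono)
      then show ?thesis by (simp add: mult_ac)
    qed
    have "C * (exp (l * a) * (K * \<delta>\<^sup>2) + l^3 * exp (- (l * c)) * M) \<le> C * (K * \<delta> powr \<beta> + B * M * \<delta> powr \<beta>)"
      using 1 2 C by (intro mult_left_mono add_mono) auto
    also have "\<dots> = (C * (K + B * M)) * \<delta> powr \<beta>" by (simp add: algebra_simps)
    also have "\<dots> \<le> C' * \<delta> powr \<beta>" by (intro mult_right_mono) (auto simp: C'_def)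
    finally show "\<exists>l\<ge>l0. C * (exp (l * a) * (K * \<delta>\<^sup>2) + l^3 * exp (- (l * c)) * M) \<le> C' * \<delta> powr \<beta>"
      using l by blast
  qed simp
qed

section \<open>Interior norms\<close>

lemma Om_eps_box: "Om_eps A e = box (vector [- A, - A, - A]) (vector [A, A, A - e])"
  by (auto simp: Om_eps_def mem_box_cart forall_3)

lemma open_Om_eps: "open (Om_eps A e)"
  by (simp add: Om_eps_box open_box)

lemma Om_eps_lebesgue: "Om_eps A e \<in> sets lebesgue"
  by (rule open_lebesgue[OF open_Om_eps])

lemma Om_eps_subset: "e > 0 \<Longrightarrow> Om_eps A e \<subseteq> Om A"
  by (auto simp: Om_eps_def Om_def forall_3)

lemma L2_norm_cong_AE_L2:
  assumes "f \<in> L2 S" "AE x in lebesgue_on S. f x = g x" "S \<in> sets lebesgue"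
  shows "L2_norm S f = L2_norm S g"
  using assms L2_cong_AE[OF assms] by (intro L2_norm_cong_AE L2_measurable)

text \<open>By uniqueness, weak derivatives on the smaller domain are restrictions of those on the cube.\<close>

lemma weak_deriv_Om_eps:
  assumes e: "e > 0" and u: "u \<in> Hk k (Om A)" and a: "mi_order a \<le> k"
  shows "weak_deriv (Om A) a u \<in> L2 (Om_eps A e)"
    "L2_norm (Om_eps A e) (weak_deriv (Om_eps A e) a u) = L2_norm (Om_eps A e) (weak_deriv (Om A) a u)"
proof -
  note d = Hk_weak_deriv[OF open_Om u a]
  note sub = Om_eps_subset[OF e, of A] Om_eps_lebesgue[of A e] Om_lebesgue[of A]
  show L: "weak_deriv (Om A) a u \<in> L2 (Om_eps A e)" by (rule L2_subset(1)[OF d(2) sub])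
  have w: "is_weak_deriv (Om_eps A e) a u (weak_deriv (Om A) a u)" by (rule is_weak_deriv_subset[OF d(1) sub])
  have "AE x in lebesgue_on (Om_eps A e). weak_deriv (Om A) a u x = weak_deriv (Om_eps A e) a u x"
    by (rule weak_deriv_unique[OF open_Om_eps w is_weak_deriv_weak_deriv[OF w]])
  from L2_norm_cong_AE_L2[OF L this sub(2)]
  show "L2_norm (Om_eps A e) (weak_deriv (Om_eps A e) a u) = L2_norm (Om_eps A e) (weak_deriv (Om A) a u)" by simp
qed

lemma L2_norm_Om_eps_le:
  assumes e: "e > 0" and f: "f \<in> L2 (Om A)"
  shows "(L2_norm (Om_eps A e) f)\<^sup>2 \<le> (LINT x|lebesgue_on (Om A). below A e x * (f x)\<^sup>2)"
proof -
  note sub = Om_eps_lebesgue[of A e] Om_lebesgue[of A] Om_eps_subset[OF e, of A]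
  have i: "integrable (lebesgue_on (Om_eps A e)) (\<lambda>x. (f x)\<^sup>2)"
    using L2_integrable_sq[OF L2_subset(1)[OF f sub(3,1,2)]] .
  have "(L2_norm (Om_eps A e) f)\<^sup>2 = (LINT x|lebesgue_on (Om A). indicator (Om_eps A e) x * (f x)\<^sup>2)"
    unfolding L2_norm_sq by (rule integral_lebesgue_on_subset(1)[OF sub])
  also have "\<dots> \<le> (LINT x|lebesgue_on (Om A). below A e x * (f x)\<^sup>2)"
  proof (rule integral_mono)
    show "integrable (lebesgue_on (Om A)) (\<lambda>x. indicator (Om_eps A e) x * (f x)\<^sup>2)"
      using i integral_lebesgue_on_subset(2)[OF sub] by (rule iffD1[rotated])
    show "integrable (lebesgue_on (Om A)) (\<lambda>x. below A e x * (f x)\<^sup>2)"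
      by (intro integrable_below L2_integrable_sq f)
    show "indicator (Om_eps A e) x * (f x)\<^sup>2 \<le> below A e x * (f x)\<^sup>2" for x
      by (intro mult_right_mono) (auto simp: below_def indicator_def Om_eps_def)
  qed
  finally show ?thesis .
qed

lemma HkN_norm_Om_eps_mono:
  assumes e: "e > 0" and U: "U \<in> HkN k (Om A)"
  shows "HkN_norm k (Om_eps A e) U \<le> HkN_norm k (Om A) U"
  unfolding HkN_norm_def
proof (intro real_sqrt_le_mono sum_mono power_mono Hk_norm_nonneg)
  fix n
  show "Hk_norm k (Om_eps A e) (\<lambda>x. U x $ n) \<le> Hk_norm k (Om A) (\<lambda>x. U x $ n)"
    unfolding Hk_norm_def
  proof (intro real_sqrt_le_mono sum_mono)
    fix a :: "nat^3" assume "a \<in> {a. mi_order a \<le> k}"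
    then have a: "mi_order a \<le> k" by simp
    note d = Hk_weak_deriv[OF open_Om HkN_nth[OF U] a]
    show "(L2_norm (Om_eps A e) (weak_deriv (Om_eps A e) a (\<lambda>x. U x $ n)))\<^sup>2 \<le> (L2_norm (Om A) (weak_deriv (Om A) a (\<lambda>x. U x $ n)))\<^sup>2"
      unfolding weak_deriv_Om_eps(2)[OF e HkN_nth[OF U] a] L2_norm_sq
      by (rule L2_subset(2)[OF d(2) Om_eps_subset[OF e] Om_eps_lebesgue Om_lebesgue])
  qed
qed

lemma mi_order_Suc:
  assumes "mi_order a = Suc k"
  obtains a' i where "a = a' + axis i 1" "mi_order a' = k"
proof -
  obtain i where i: "a $ i > 0" using assms by (metis gr0I mi_order_def nat.simps(3) sum.neutral)
  have e: "a = (a - axis i 1) + axis i 1" using i by (auto simp: vec_eq_iff axis_def)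
  then have "mi_order (a - axis i 1) = k" using assms mi_order_add_axis[of "a - axis i 1" i] by simp
  with e that show thesis by blast
qed

lemma mi_order_le_2:
  assumes "mi_order a \<le> 2"
  obtains "a = 0" | i where "a = axis i 1" | i j where "a = axis i 1 + axis j 1"
proof -
  have z: "b = 0" if "mi_order b = 0" for b using that by (simp add: mi_order_def vec_eq_iff)
  consider "mi_order a = 0" | "mi_order a = Suc 0" | "mi_order a = Suc (Suc 0)" using assms by linarith
  then show thesis
  proof cases
    case 1
    then show ?thesis using z that(1) by blast
  next
    case 2
    then obtain a' i where a: "a = a' + axis i 1" "mi_order a' = 0" by (rule mi_order_Suc)
    have "a' = 0" by (rule z[OF a(2)])
    with a(1) show ?thesis by (intro that(2)[of i]) simp
  next
    case 3
    then obtain a' i where 1: "a = a' + axis i 1" "mi_order a' = Suc 0" by (rule mi_order_Suc)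
    from 1(2) obtain a'' j where 2: "a' = a'' + axis j 1" "mi_order a'' = 0" by (rule mi_order_Suc)
    have "a'' = 0" by (rule z[OF 2(2)])
    with 1(1) 2(1) show ?thesis by (intro that(3)[of j i]) simp
  qed
qed

lemma H2_norm_interior:
  fixes W :: "real^3 \<Rightarrow> real^'n"
  assumes e: "e > 0" and W: "W \<in> HkN 3 (Om A)" and T: "T \<ge> 0"
    and b: "\<And>n. (LINT x|lebesgue_on (Om A). below A e x * (W x $ n)\<^sup>2) \<le> T\<^sup>2"
      "\<And>n i. (LINT x|lebesgue_on (Om A). below A e x * (D1 A (\<lambda>y. W y $ n) i x)\<^sup>2) \<le> T\<^sup>2"
      "\<And>n i j. (LINT x|lebesgue_on (Om A). below A e x * (D2 A (\<lambda>y. W y $ n) i j x)\<^sup>2) \<le> T\<^sup>2"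
  shows "HkN_norm 2 (Om_eps A e) W \<le> real CARD('n) * (real (card {a::nat^3. mi_order a \<le> 2}) * T)"
proof -
  note h = Hk3_derivs[OF HkN_nth[OF W]]
  have L: "L2_norm (Om_eps A e) f \<le> T" if "f \<in> L2 (Om A)" "(LINT x|lebesgue_on (Om A). below A e x * (f x)\<^sup>2) \<le> T\<^sup>2" for f
    using order_trans[OF L2_norm_Om_eps_le[OF e that(1)] that(2)] T by (rule power2_le_imp_le)
  have "L2_norm (Om_eps A e) (weak_deriv (Om_eps A e) a (\<lambda>x. W x $ n)) \<le> T" if "mi_order a \<le> 2" for a n
    using that
  proof (cases rule: mi_order_le_2)
    case 1
    have "(\<lambda>x. W x $ n) \<in> L2 (Om_eps A e)"
      by (rule L2_subset(1)[OF h(1) Om_eps_subset[OF e] Om_eps_lebesgue Om_lebesgue])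
    from L2_norm_weak_deriv_0[OF open_Om_eps this] show ?thesis using L[OF h(1) b(1)] 1 by simp
  next
    case (2 i)
    show ?thesis using L[OF h(2) b(2)[where n = n and i = i]] unfolding 2
      by (subst weak_deriv_Om_eps(2)[OF e HkN_nth[OF W]]) simp_all
  next
    case (3 i j)
    show ?thesis using L[OF h(3) b(3)[where n = n and i = i and j = j]] unfolding 3
      by (subst weak_deriv_Om_eps(2)[OF e HkN_nth[OF W]]) (simp_all add: mi_order_add_axis)
  qed
  then have "(\<Sum>a | mi_order a \<le> 2. L2_norm (Om_eps A e) (weak_deriv (Om_eps A e) a (\<lambda>x. W x $ n))) \<le> (\<Sum>a::nat^3 | mi_order a \<le> 2. T)" for n
    by (intro sum_mono) simp
  then have "Hk_norm 2 (Om_eps A e) (\<lambda>x. W x $ n) \<le> real (card {a::nat^3. mi_order a \<le> 2}) * T" for n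
    using order_trans[OF Hk_norm_le_sum] by simp
  then have "(\<Sum>n\<in>UNIV. Hk_norm 2 (Om_eps A e) (\<lambda>x. W x $ n)) \<le> (\<Sum>n\<in>(UNIV::'n set). real (card {a::nat^3. mi_order a \<le> 2}) * T)"
    by (intro sum_mono)
  then show ?thesis using order_trans[OF HkN_norm_le_sum] by simp
qed

section \<open>The reconstruction map\<close>

lemma is_weak_deriv_sum:
  assumes "finite I" "\<And>i. i \<in> I \<Longrightarrow> is_weak_deriv S a (u i) (w i)" "S \<in> sets lebesgue"
    "is_weak_deriv S a (\<lambda>x. 0) (\<lambda>x. 0)"
  shows "is_weak_deriv S a (\<lambda>x. \<Sum>i\<in>I. c i * u i x) (\<lambda>x. \<Sum>i\<in>I. c i * w i x)"
  using assms
proof (induction I rule: finite_induct)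
  case (insert i I)
  then have "is_weak_deriv S a (\<lambda>x. c i * u i x + 1 * (\<Sum>i\<in>I. c i * u i x)) (\<lambda>x. c i * w i x + 1 * (\<Sum>i\<in>I. c i * w i x))"
    by (intro is_weak_deriv_lincomb) auto
  with insert show ?case by simp
qed simp

lemma is_weak_deriv_zero: "is_weak_deriv S a (\<lambda>x. 0) (\<lambda>x. 0)"
  by (simp add: is_weak_deriv_def locally_integrable_def)

lemma Q_rec_AE:
  fixes U :: "real^3 \<Rightarrow> 'n::{finite,linorder} rvec"
  assumes U: "U \<in> HkN 3 (Om A)"
  shows "AE x in lebesgue_on (Om A). Q_rec A b d U x =
    (\<Sum>n\<in>UNIV. - Psi_ix d n 0 * laplacian A (\<lambda>y. U y $ n) x)
    + (\<Sum>n\<in>UNIV. \<Sum>j\<in>UNIV. (2 * Psi_ix d n 0 * ((x - source A b 0) $ j / (norm (x - source A b 0))\<^sup>2)) * D1 A (\<lambda>y. U y $ n) j x)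
    + (\<Sum>n\<in>UNIV. (- 4 * Psi_ix d n 0 / (norm (x - source A b 0))\<^sup>2) * U x $ n)"
proof -
  let ?u = "\<lambda>y. \<Sum>n\<in>UNIV. U y $ n * Psi_ix d n 0"
  have u: "?u = (\<lambda>y. \<Sum>n\<in>UNIV. Psi_ix d n 0 * U y $ n)" by (simp add: mult.commute)
  note h = Hk_weak_deriv(1)[OF open_Om HkN_nth[OF U]]
  have "AE x in lebesgue_on (Om A). \<forall>a\<in>{a. mi_order a \<le> 3}. weak_deriv (Om A) a ?u x = (\<Sum>n\<in>UNIV. Psi_ix d n 0 * weak_deriv (Om A) a (\<lambda>y. U y $ n) x)"
  proof (intro eventually_ball_finite finite_mi_order ballI)
    fix a :: "nat^3" assume "a \<in> {a. mi_order a \<le> 3}"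
    then have a: "mi_order a \<le> 3" by simp
    show "AE x in lebesgue_on (Om A). weak_deriv (Om A) a ?u x = (\<Sum>n\<in>UNIV. Psi_ix d n 0 * weak_deriv (Om A) a (\<lambda>y. U y $ n) x)"
      unfolding u by (intro weak_deriv_AE_eq open_Om is_weak_deriv_sum h a Om_lebesgue is_weak_deriv_zero) simp
  qed
  then show ?thesis
  proof eventually_elim
    case (elim x)
    let ?c = "\<lambda>n::'n. Psi_ix d n 0"
    have d1: "D1 A ?u j x = (\<Sum>n\<in>UNIV. ?c n * D1 A (\<lambda>y. U y $ n) j x)" for j
      by (rule elim[rule_format]) (simp add: mi_order_add_axis)
    have d2: "D2 A ?u i j x = (\<Sum>n\<in>UNIV. ?c n * D2 A (\<lambda>y. U y $ n) i j x)" for i j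
      by (rule elim[rule_format]) (simp add: mi_order_add_axis)
    define r q where "r = x - source A b 0" and "q = 1 / (norm r)\<^sup>2"
    have "Q_rec A b d U x = - (laplacian A ?u x - 2 * q * ((\<Sum>j\<in>UNIV. r $ j * D1 A ?u j x) - 2 * ?u x))"
      unfolding Q_rec_def Let_def weak_laplacian_eq r_def[symmetric] q_def
      by (simp add: weak_grad_def inner_vec_def)
    also have "\<dots> = (\<Sum>n\<in>UNIV. - ?c n * laplacian A (\<lambda>y. U y $ n) x)
       + (\<Sum>n\<in>UNIV. \<Sum>j\<in>UNIV. (2 * ?c n * (r $ j * q)) * D1 A (\<lambda>y. U y $ n) j x)
       + (\<Sum>n\<in>UNIV. (- 4 * ?c n * q) * U x $ n)"
    proof -
      have 1: "- laplacian A ?u x = (\<Sum>n\<in>UNIV. - ?c n * laplacian A (\<lambda>y. U y $ n) x)"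
        unfolding d2 by (simp add: sum.distrib[symmetric] sum_negf[symmetric] algebra_simps)
      have 2: "2 * q * (\<Sum>j\<in>UNIV. r $ j * D1 A ?u j x) = (\<Sum>n\<in>UNIV. \<Sum>j\<in>UNIV. (2 * ?c n * (r $ j * q)) * D1 A (\<lambda>y. U y $ n) j x)"
        unfolding d1 sum_distrib_left by (subst sum.swap) (simp add: mult_ac)
      have 3: "- (4 * q * ?u x) = (\<Sum>n\<in>UNIV. (- 4 * ?c n * q) * U x $ n)"
        by (simp add: sum_distrib_left sum_negf[symmetric] mult_ac)
      show ?thesis unfolding 1[symmetric] 2[symmetric] 3[symmetric] by (simp add: algebra_simps)
    qed
    finally show ?case unfolding q_def r_def by simp
  qed
qed

text \<open>On the cube the distance to the source is at least \<open>b\<close>, so the coefficients of the reconstruction map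
  are bounded.\<close>

lemma Q_rec_bound:
  assumes b: "b > 0"
  shows "\<exists>C>0. \<forall>e>0. \<forall>U\<in>HkN 3 (Om A). \<forall>V::real^3 \<Rightarrow> 'n::{finite,linorder} rvec \<in> HkN 3 (Om A).
    L2_norm (Om_eps A e) (\<lambda>x. Q_rec A b d U x - Q_rec A b d V x) \<le> C * HkN_norm 2 (Om_eps A e) (\<lambda>x. U x - V x)"
proof -
  let ?c = "\<lambda>n::'n. Psi_ix d n 0" and ?r = "\<lambda>x. x - source A b 0"
  define C where "C = 1 + (\<Sum>n\<in>UNIV. \<bar>?c n\<bar> * 3 + 3 * (2 * \<bar>?c n\<bar> / b) + 4 * \<bar>?c n\<bar> / b\<^sup>2)"
  have C: "C > 0" unfolding C_def using b by (intro add_pos_nonneg sum_nonneg) auto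
  show ?thesis
  proof (intro exI[of _ C] conjI C allI impI ballI)
    fix e :: real and U V :: "real^3 \<Rightarrow> 'n rvec"
    assume e: "e > 0" and U: "U \<in> HkN 3 (Om A)" and V: "V \<in> HkN 3 (Om A)"
    let ?S = "Om_eps A e"
    define E where "E x = U x - V x" for x
    have E3: "E \<in> HkN 3 (Om A)" unfolding E_def HkN_def using Hk_diff[OF Om_lebesgue HkN_nth[OF U] HkN_nth[OF V]] by simp
    let ?H = "HkN_norm 2 ?S E"
    note sub = Om_eps_subset[OF e, of A] Om_eps_lebesgue[of A e] Om_lebesgue[of A]
    note hE = Hk3_derivs[OF HkN_nth[OF E3]]
    define q1 q2 q3 where "q1 x = (\<Sum>n\<in>UNIV. - ?c n * laplacian A (\<lambda>y. E y $ n) x)"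
      and "q2 x = (\<Sum>n\<in>UNIV. \<Sum>j\<in>UNIV. (2 * ?c n * (?r x $ j / (norm (?r x))\<^sup>2)) * D1 A (\<lambda>y. E y $ n) j x)"
      and "q3 x = (\<Sum>n\<in>UNIV. (- 4 * ?c n / (norm (?r x))\<^sup>2) * E x $ n)" for x
    have "AE x in lebesgue_on (Om A). q1 x + q2 x + q3 x = Q_rec A b d U x - Q_rec A b d V x"
      using Q_rec_AE[OF U, of b d] Q_rec_AE[OF V, of b d] weak_deriv_lincomb_HkN_AE[OF U V, of "-1"]
    proof eventually_elim
      case (elim x)
      have d1: "D1 A (\<lambda>y. E y $ n) j x = D1 A (\<lambda>y. U y $ n) j x - D1 A (\<lambda>y. V y $ n) j x" for n j
        using elim(3)[rule_format, of "axis j 1" n] by (simp add: E_def)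
      have d2: "D2 A (\<lambda>y. E y $ n) i j x = D2 A (\<lambda>y. U y $ n) i j x - D2 A (\<lambda>y. V y $ n) i j x" for n i j
        using elim(3)[rule_format, of "axis i 1 + axis j 1" n] by (simp add: E_def mi_order_add_axis)
      have l: "laplacian A (\<lambda>y. E y $ n) x = laplacian A (\<lambda>y. U y $ n) x - laplacian A (\<lambda>y. V y $ n) x" for n
        unfolding d2 by simp
      have "E x $ n = U x $ n - V x $ n" for n by (simp add: E_def)
      then show ?case
        unfolding elim(1,2) q1_def q2_def q3_def l d1 by (simp only: right_diff_distrib sum_subtractf)
    qed
    then have ae: "AE x in lebesgue_on ?S. q1 x + q2 x + q3 x = Q_rec A b d U x - Q_rec A b d V x"
      by (rule AE_lebesgue_on_subset[OF sub(2,3,1)])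
    have dS: "D1 A (\<lambda>y. E y $ n) j \<in> L2 ?S" "D2 A (\<lambda>y. E y $ n) i j \<in> L2 ?S" "(\<lambda>y. E y $ n) \<in> L2 ?S" for n i j
      by (intro L2_subset(1)[OF _ sub] hE)+
    have nb: "L2_norm ?S (D1 A (\<lambda>y. E y $ n) j) \<le> ?H" "L2_norm ?S (D2 A (\<lambda>y. E y $ n) i j) \<le> ?H" "L2_norm ?S (\<lambda>y. E y $ n) \<le> ?H" for n i j
    proof -
      show "L2_norm ?S (D1 A (\<lambda>y. E y $ n) j) \<le> ?H"
        by (subst weak_deriv_Om_eps(2)[OF e HkN_nth[OF E3], symmetric], simp, rule L2_norm_le_HkN_norm, simp)
      show "L2_norm ?S (D2 A (\<lambda>y. E y $ n) i j) \<le> ?H"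
        by (subst weak_deriv_Om_eps(2)[OF e HkN_nth[OF E3], symmetric], simp add: mi_order_add_axis,
          rule L2_norm_le_HkN_norm, simp add: mi_order_add_axis)
      show "L2_norm ?S (\<lambda>y. E y $ n) \<le> ?H"
        unfolding L2_norm_weak_deriv_0[OF open_Om_eps dS(3), symmetric] by (rule L2_norm_le_HkN_norm) simp
    qed
    have rb: "\<bar>?r x $ j / (norm (?r x))\<^sup>2\<bar> \<le> 1 / b" "1 / (norm (?r x))\<^sup>2 \<le> 1 / b\<^sup>2" if "x \<in> ?S" for x j
    proof -
      have "b \<le> \<bar>?r x $ 3\<bar>" using that by (auto simp: Om_eps_def source_def)
      also have "\<dots> \<le> norm (?r x)" by (rule component_le_norm_cart)
      finally have bn: "b \<le> norm (?r x)" .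
      with b have np: "norm (?r x) > 0" by linarith
      show "1 / (norm (?r x))\<^sup>2 \<le> 1 / b\<^sup>2"
        using b bn np by (intro divide_left_mono power_mono mult_pos_pos zero_less_power) auto
      have "\<bar>?r x $ j / (norm (?r x))\<^sup>2\<bar> = \<bar>?r x $ j\<bar> / (norm (?r x))\<^sup>2" by simp
      also have "\<dots> \<le> norm (?r x) / (norm (?r x))\<^sup>2" by (intro divide_right_mono component_le_norm_cart) simp
      also have "\<dots> = 1 / norm (?r x)" by (simp add: power2_eq_square)
      also have "\<dots> \<le> 1 / b" using b bn np by (intro divide_left_mono mult_pos_pos) auto
      finally show "\<bar>?r x $ j / (norm (?r x))\<^sup>2\<bar> \<le> 1 / b" .
    qed
    have bm: "f \<in> borel_measurable (lebesgue_on ?S)" if "f \<in> borel_measurable borel" for f :: "real^3 \<Rightarrow> real"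
      by (intro measurable_restrict_space1 measurable_completion) (use that in simp)
    have m1: "(\<lambda>x. ?r x $ j) \<in> borel_measurable borel" for j
      by (intro borel_measurable_continuous_onI continuous_intros)
    have m2: "(\<lambda>x. (norm (?r x))\<^sup>2) \<in> borel_measurable borel"
      by (intro borel_measurable_continuous_onI continuous_intros)
    have rm: "(\<lambda>x. 2 * ?c n * (?r x $ j / (norm (?r x))\<^sup>2)) \<in> borel_measurable (lebesgue_on ?S)"
      "(\<lambda>x. - 4 * ?c n / (norm (?r x))\<^sup>2) \<in> borel_measurable (lebesgue_on ?S)" for n j
      using m1 m2 by (auto intro!: bm borel_measurable_times borel_measurable_divide)
    have g1: "\<bar>2 * ?c n * (?r x $ j / (norm (?r x))\<^sup>2)\<bar> \<le> 2 * \<bar>?c n\<bar> / b" if "x \<in> ?S" for n j x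
      using mult_left_mono[OF rb(1)[OF that, of j], of "2 * \<bar>?c n\<bar>"] by (simp add: abs_mult)
    have g2: "\<bar>- 4 * ?c n / (norm (?r x))\<^sup>2\<bar> \<le> 4 * \<bar>?c n\<bar> / b\<^sup>2" if "x \<in> ?S" for n x
      using mult_left_mono[OF rb(2)[OF that], of "4 * \<bar>?c n\<bar>"] by (simp add: abs_mult)
    note t2 = L2_mult_bounded[OF dS(1) rm(1) g1 sub(2)]
    note t3 = L2_mult_bounded[OF dS(3) rm(2) g2 sub(2)]
    have q1L: "q1 \<in> L2 ?S" unfolding q1_def[abs_def] by (intro L2_sum L2_cmult L2_add dS)
    have q2L: "q2 \<in> L2 ?S" unfolding q2_def[abs_def] by (intro L2_sum t2)
    have q3L: "q3 \<in> L2 ?S" unfolding q3_def[abs_def] by (intro L2_sum t3)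
    have H0: "?H \<ge> 0" by (rule HkN_norm_nonneg)
    have n1: "L2_norm ?S q1 \<le> (\<Sum>n\<in>UNIV. \<bar>?c n\<bar> * (3 * ?H))"
      unfolding q1_def[abs_def]
    proof (rule order_trans[OF L2_norm_sum_le sum_mono])
      fix n
      have "L2_norm ?S (\<lambda>x. laplacian A (\<lambda>y. E y $ n) x) \<le> ?H + ?H + ?H"
        by (intro order_trans[OF L2_norm_triangle] add_mono L2_add dS nb)
      then show "L2_norm ?S (\<lambda>x. - ?c n * laplacian A (\<lambda>y. E y $ n) x) \<le> \<bar>?c n\<bar> * (3 * ?H)"
        unfolding L2_norm_cmult by (simp add: mult_left_mono)
      show "(\<lambda>x. - ?c n * laplacian A (\<lambda>y. E y $ n) x) \<in> L2 ?S" by (intro L2_cmult L2_add dS)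
    qed simp
    have n2: "L2_norm ?S q2 \<le> (\<Sum>n\<in>UNIV. \<Sum>j\<in>(UNIV::3 set). 2 * \<bar>?c n\<bar> / b * ?H)"
      unfolding q2_def[abs_def]
    proof (rule order_trans[OF L2_norm_sum_le sum_mono])
      fix n
      show "(\<lambda>x. \<Sum>j\<in>UNIV. (2 * ?c n * (?r x $ j / (norm (?r x))\<^sup>2)) * D1 A (\<lambda>y. E y $ n) j x) \<in> L2 ?S" by (intro L2_sum t2)
      show "L2_norm ?S (\<lambda>x. \<Sum>j\<in>UNIV. (2 * ?c n * (?r x $ j / (norm (?r x))\<^sup>2)) * D1 A (\<lambda>y. E y $ n) j x)
          \<le> (\<Sum>j\<in>(UNIV::3 set). 2 * \<bar>?c n\<bar> / b * ?H)"
      proof (rule order_trans[OF L2_norm_sum_le sum_mono])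
        fix j
        have "L2_norm ?S (\<lambda>x. (2 * ?c n * (?r x $ j / (norm (?r x))\<^sup>2)) * D1 A (\<lambda>y. E y $ n) j x)
           \<le> 2 * \<bar>?c n\<bar> / b * L2_norm ?S (D1 A (\<lambda>y. E y $ n) j)"
          using b by (intro L2_norm_mult_bounded[OF dS(1) rm(1) g1 sub(2)]) auto
        also have "\<dots> \<le> 2 * \<bar>?c n\<bar> / b * ?H" using b by (intro mult_left_mono nb) auto
        finally show "L2_norm ?S (\<lambda>x. (2 * ?c n * (?r x $ j / (norm (?r x))\<^sup>2)) * D1 A (\<lambda>y. E y $ n) j x) \<le> 2 * \<bar>?c n\<bar> / b * ?H" .
      qed (rule finite, rule t2)
    qed simp
    have n3: "L2_norm ?S q3 \<le> (\<Sum>n\<in>UNIV. 4 * \<bar>?c n\<bar> / b\<^sup>2 * ?H)"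
      unfolding q3_def[abs_def]
    proof (rule order_trans[OF L2_norm_sum_le sum_mono])
      fix n
      have "L2_norm ?S (\<lambda>x. (- 4 * ?c n / (norm (?r x))\<^sup>2) * E x $ n) \<le> 4 * \<bar>?c n\<bar> / b\<^sup>2 * L2_norm ?S (\<lambda>x. E x $ n)"
        using b by (intro L2_norm_mult_bounded[OF dS(3) rm(2) g2 sub(2)]) auto
      also have "\<dots> \<le> 4 * \<bar>?c n\<bar> / b\<^sup>2 * ?H" using b by (intro mult_left_mono nb) auto
      finally show "L2_norm ?S (\<lambda>x. (- 4 * ?c n / (norm (?r x))\<^sup>2) * E x $ n) \<le> 4 * \<bar>?c n\<bar> / b\<^sup>2 * ?H" .
    qed (rule finite, rule t3)
    have "L2_norm ?S (\<lambda>x. Q_rec A b d U x - Q_rec A b d V x) = L2_norm ?S (\<lambda>x. q1 x + q2 x + q3 x)"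
      by (rule L2_norm_cong_AE_L2[OF _ ae sub(2), symmetric]) (intro L2_add q1L q2L q3L)
    also have "\<dots> \<le> L2_norm ?S q1 + L2_norm ?S q2 + L2_norm ?S q3"
      by (intro order_trans[OF L2_norm_triangle] add_mono L2_add q1L q2L q3L order_refl)
    also have "\<dots> \<le> (\<Sum>n\<in>UNIV. \<bar>?c n\<bar> * (3 * ?H)) + (\<Sum>n\<in>UNIV. \<Sum>j\<in>(UNIV::3 set). 2 * \<bar>?c n\<bar> / b * ?H) + (\<Sum>n\<in>UNIV. 4 * \<bar>?c n\<bar> / b\<^sup>2 * ?H)"
      by (intro add_mono n1 n2 n3)
    also have "\<dots> = (C - 1) * ?H"
    proof -
      have "(C - 1) * ?H = (\<Sum>n\<in>UNIV. (\<bar>?c n\<bar> * 3 + 3 * (2 * \<bar>?c n\<bar> / b) + 4 * \<bar>?c n\<bar> / b\<^sup>2) * ?H)"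
        unfolding C_def by (simp only: add_diff_cancel_left' sum_distrib_right)
      also have "\<dots> = (\<Sum>n\<in>UNIV. \<bar>?c n\<bar> * (3 * ?H) + (\<Sum>j\<in>(UNIV::3 set). 2 * \<bar>?c n\<bar> / b * ?H) + 4 * \<bar>?c n\<bar> / b\<^sup>2 * ?H)"
        by (intro sum.cong refl) (simp add: distrib_right)
      finally show ?thesis by (simp only: sum.distrib)
    qed
    also have "\<dots> \<le> C * ?H" using H0 by (simp add: algebra_simps)
    finally show "L2_norm ?S (\<lambda>x. Q_rec A b d U x - Q_rec A b d V x) \<le> C * HkN_norm 2 ?S (\<lambda>x. U x - V x)"
      unfolding E_def .
  qed
qed

section \<open>Boundary data\<close>

lemma boundary_data_diff:
  assumes A: "A > 0" and U: "U \<in> HkN 3 (Om A)" "boundary_data A p0 p1 U" and F: "F \<in> HkN 3 (Om A)" "boundary_data A p0 p1 F"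
  shows "(\<lambda>x. U x - F x) \<in> H3_0bscN A"
  unfolding H3_0bscN_def
proof safe
  fix n
  let ?u = "\<lambda>x. U x $ n" and ?f = "\<lambda>x. F x $ n"
  have u3: "?u \<in> Hk 3 (Om A)" and f3: "?f \<in> Hk 3 (Om A)" using U F by (auto intro: HkN_nth)
  have u1: "?u \<in> Hk 1 (Om A)" and f1: "?f \<in> Hk 1 (Om A)" using Hk_mono[OF _ u3, of 1] Hk_mono[OF _ f3, of 1] by simp_all
  have t: "has_trace A 3 (-1) (\<lambda>x. ?u x - ?f x) (\<lambda>x. 0)"
    using has_trace_lincomb[OF A, of 3 "-1" ?u "\<lambda>x. p0 x $ n" ?f "\<lambda>x. p0 x $ n" 1 "-1"] U(2) F(2)
    unfolding boundary_data_def by simp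
  have nd: "has_normal_deriv A i s (\<lambda>x. ?u x - ?f x) (\<lambda>x. 0)" if s: "s \<in> {-1, 1}" "(i, s) \<noteq> (3, 1)" for i s
  proof -
    have "\<exists>g. has_normal_deriv A i s ?u g \<and> has_normal_deriv A i s ?f g"
    proof (cases "i = 3")
      case True
      with s have "s = -1" by auto
      with True show ?thesis using U(2) F(2) unfolding boundary_data_def by blast
    next
      case False
      then have "i \<in> {1, 2}" using exhaust_3[of i] by auto
      then show ?thesis using U(2) F(2) s(1) unfolding boundary_data_def by blast
    qed
    then obtain g where "has_normal_deriv A i s ?u g" "has_normal_deriv A i s ?f g" by blast
    from has_normal_deriv_diff[OF A u1 this(1) f1 this(2)] show ?thesis by simp
  qed
  show "(\<lambda>x. (U x - F x) $ n) \<in> H3_0bsc A"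
    using Hk_diff[OF Om_lebesgue u3 f3] t nd by (auto simp: H3_0bsc_def)
qed

lemma H3_0bscN_diff:
  assumes A: "A > 0" and V: "V \<in> H3_0bscN A" and W: "W \<in> H3_0bscN A"
  shows "(\<lambda>x. V x - W x) \<in> H3_0bscN A"
  unfolding H3_0bscN_def
proof safe
  fix n
  let ?u = "\<lambda>x. V x $ n" and ?f = "\<lambda>x. W x $ n"
  have u: "?u \<in> H3_0bsc A" and f: "?f \<in> H3_0bsc A" using V W by (auto simp: H3_0bscN_def)
  then have u3: "?u \<in> Hk 3 (Om A)" and f3: "?f \<in> Hk 3 (Om A)" by (auto simp: H3_0bsc_def)
  have u1: "?u \<in> Hk 1 (Om A)" and f1: "?f \<in> Hk 1 (Om A)" using Hk_mono[OF _ u3, of 1] Hk_mono[OF _ f3, of 1] by simp_all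
  have t: "has_trace A 3 (-1) (\<lambda>x. ?u x - ?f x) (\<lambda>x. 0)"
    using has_trace_lincomb[OF A, of 3 "-1" ?u "\<lambda>x. 0" ?f "\<lambda>x. 0" 1 "-1"] u f by (simp add: H3_0bsc_def)
  have nd: "has_normal_deriv A i s (\<lambda>x. ?u x - ?f x) (\<lambda>x. 0)" if "s \<in> {-1, 1}" "(i, s) \<noteq> (3, 1)" for i s
    using has_normal_deriv_diff[OF A u1 _ f1, of i s "\<lambda>x. 0" "\<lambda>x. 0"] u f that by (auto simp: H3_0bsc_def)
  show "(\<lambda>x. (V x - W x) $ n) \<in> H3_0bsc A"
    using Hk_diff[OF Om_lebesgue u3 f3] t nd by (auto simp: H3_0bsc_def)
qed

section \<open>Convergence of the minimizers\<close>

text \<open>Stability in \<open>L\<^sub>2\<close> holds for \<open>W\<close> and its first derivatives with the squared norm of order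
  \<open>\<delta> powr \<beta>\<close>. The interpolation of the second derivatives takes a square root, and passing from
  squares to norms another one; this is where \<open>\<beta> / 4\<close> comes from.\<close>

lemma holder_stability:
  assumes A: "A > 0" and b: "b > 0" and R: "R > A" and e: "0 < e" and M: "M \<ge> 0" and K: "K \<ge> 0"
  shows "\<exists>\<beta> C \<delta>1. 0 < \<beta> \<and> \<beta> \<le> 1 \<and> C > 0 \<and> 0 < \<delta>1 \<and> \<delta>1 < 1 \<and>
    (\<forall>\<delta>. 0 < \<delta> \<longrightarrow> \<delta> < \<delta>1 \<longrightarrow> (\<forall>W::real^3 \<Rightarrow> 'n::{finite,linorder} rvec. W \<in> H3_0bscN A \<longrightarrow>
      HkN_norm 3 (Om A) W \<le> M \<longrightarrow> (LINT x|lebesgue_on (Om A). (norm (L_op A b d W x))\<^sup>2) \<le> K * \<delta>\<^sup>2 \<longrightarrow>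
      HkN_norm 2 (Om_eps A e) W \<le> C * \<delta> powr (\<beta> / 4)))"
proof -
  define a c where "a = 2 * (R + A)\<^sup>2" and "c = 2 * (R - A + e / 2)\<^sup>2 - 2 * (R - A + e / 4)\<^sup>2"
  have a: "a > 0" using A R by (simp add: a_def)
  have "(R - A + e / 4)\<^sup>2 < (R - A + e / 2)\<^sup>2" using R e by (intro power_strict_mono) auto
  then have c: "c > 0" by (simp add: c_def)
  obtain C1 l0 where C1: "C1 > 0" "l0 \<ge> 1" and stab: "\<And>l (W::real^3 \<Rightarrow> 'n rvec). l \<ge> l0 \<Longrightarrow> W \<in> H3_0bscN A \<Longrightarrow>
    (LINT x|lebesgue_on (Om A). below A (e / 2) x * first_order_sq A W x)
    \<le> C1 * (exp (l * a) * (LINT x|lebesgue_on (Om A). (norm (L_op A b d W x))\<^sup>2)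
      + l^3 * exp (- (l * c)) * (LINT x|lebesgue_on (Om A). first_order_sq A W x))"
    using conditional_stability[OF A b R e, of d, where 'n = 'n] unfolding a_def c_def by blast
  have NM: "0 \<le> 4 * real CARD('n) * M\<^sup>2" by simp
  obtain \<beta> C' \<delta>1 where \<beta>: "0 < \<beta>" "\<beta> \<le> 1" "C' > 0" "0 < \<delta>1" "\<delta>1 < 1"
    and trade: "\<And>\<delta>. 0 < \<delta> \<Longrightarrow> \<delta> < \<delta>1 \<Longrightarrow>
      \<exists>l\<ge>l0. C1 * (exp (l * a) * (K * \<delta>\<^sup>2) + l^3 * exp (- (l * c)) * (4 * real CARD('n) * M\<^sup>2)) \<le> C' * \<delta> powr \<beta>"
    using exp_power_tradeoff[OF a c C1 K NM] by metis
  obtain C2 where C2: "C2 > 0" and snd: "\<And>w i j. w \<in> H3_0bsc A \<Longrightarrow>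
    (LINT x|lebesgue_on (Om A). below A e x * (D2 A w i j x)\<^sup>2)
    \<le> C2 * (Hk_norm 3 (Om A) w * sqrt (LINT x|lebesgue_on (Om A). below A (e / 2) x * (D1 A w j x)\<^sup>2))"
    using second_derivative_bound[OF A e] by blast
  define c0 where "c0 = real CARD('n) * real (card {a::nat^3. mi_order a \<le> 2})"
  define T0 where "T0 = C' + C2 * (M * sqrt C')"
  have T0: "T0 > 0" using \<beta> C2 M by (auto simp: T0_def intro!: add_pos_nonneg)
  have c0: "c0 \<ge> 0" by (simp add: c0_def)
  have "HkN_norm 2 (Om_eps A e) W \<le> (c0 * sqrt T0 + 1) * \<delta> powr (\<beta> / 4)"
    if \<delta>: "0 < \<delta>" "\<delta> < \<delta>1" and W: "W \<in> H3_0bscN A" and WM: "HkN_norm 3 (Om A) W \<le> M"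
      and LW: "(LINT x|lebesgue_on (Om A). (norm (L_op A b d W x))\<^sup>2) \<le> K * \<delta>\<^sup>2"
    for \<delta> and W :: "real^3 \<Rightarrow> 'n rvec"
  proof -
    let ?I = "\<lambda>f. LINT x|lebesgue_on (Om A). f x"
    have W3: "W \<in> HkN 3 (Om A)" using W by (rule H3_0bscN_HkN)
    note h = Hk3_derivs[OF HkN_nth[OF W3]]
    define s where "s = C' * \<delta> powr \<beta>"
    have s0: "s > 0" using \<beta> \<delta> by (simp add: s_def)
    have Si: "integrable (lebesgue_on (Om A)) (first_order_sq A W)" by (rule first_order_sq_integral(1)[OF W3, of 1]) simp
    have SM: "?I (first_order_sq A W) \<le> 4 * real CARD('n) * M\<^sup>2"
    proof -
      have "?I (first_order_sq A W) \<le> 4 * real CARD('n) * (HkN_norm 3 (Om A) W)\<^sup>2"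
        using first_order_sq_integral(2)[OF W3, of 3] by simp
      also have "\<dots> \<le> 4 * real CARD('n) * M\<^sup>2" using WM HkN_norm_nonneg by (intro mult_left_mono power_mono) auto
      finally show ?thesis .
    qed
    obtain l where l: "l \<ge> l0" and
      tl: "C1 * (exp (l * a) * (K * \<delta>\<^sup>2) + l^3 * exp (- (l * c)) * (4 * real CARD('n) * M\<^sup>2)) \<le> C' * \<delta> powr \<beta>"
      using trade[OF \<delta>] by blast
    have "?I (\<lambda>x. below A (e / 2) x * first_order_sq A W x)
      \<le> C1 * (exp (l * a) * ?I (\<lambda>x. (norm (L_op A b d W x))\<^sup>2) + l^3 * exp (- (l * c)) * ?I (first_order_sq A W))"
      by (rule stab[OF l W])
    also have "\<dots> \<le> C1 * (exp (l * a) * (K * \<delta>\<^sup>2) + l^3 * exp (- (l * c)) * (4 * real CARD('n) * M\<^sup>2))"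
      using C1 l LW SM by (intro mult_left_mono add_mono mult_nonneg_nonneg) auto
    finally have S: "?I (\<lambda>x. below A (e / 2) x * first_order_sq A W x) \<le> s" using tl unfolding s_def by linarith
    have part: "?I (\<lambda>x. below A h x * (f x)\<^sup>2) \<le> s"
      if f: "f \<in> L2 (Om A)" "\<And>x. (f x)\<^sup>2 \<le> first_order_sq A W x" and h: "h = e \<or> h = e / 2" for f h
    proof -
      have "?I (\<lambda>x. below A h x * (f x)\<^sup>2) \<le> ?I (\<lambda>x. below A (e / 2) x * first_order_sq A W x)"
      proof (rule integral_mono)
        show "integrable (lebesgue_on (Om A)) (\<lambda>x. below A h x * (f x)\<^sup>2)" by (intro integrable_below L2_integrable_sq f)
        show "integrable (lebesgue_on (Om A)) (\<lambda>x. below A (e / 2) x * first_order_sq A W x)" by (intro integrable_below Si)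
        fix x
        have "below A h x \<le> below A (e / 2) x" using h e by (auto simp: below_def indicator_def)
        then show "below A h x * (f x)\<^sup>2 \<le> below A (e / 2) x * first_order_sq A W x"
          by (intro mult_mono f below_bounds) auto
      qed
      with S show ?thesis by simp
    qed
    have m: "(W x $ n)\<^sup>2 + grad_sq A (\<lambda>y. W y $ n) x \<le> first_order_sq A W x" for n x
      unfolding first_order_sq_def by (rule member_le_sum) auto
    have m0: "(W x $ n)\<^sup>2 \<le> first_order_sq A W x" for n x
      by (rule order_trans[OF _ m[of x n]]) simp
    have m1: "(D1 A (\<lambda>y. W y $ n) i x)\<^sup>2 \<le> first_order_sq A W x" for n i x
      by (rule order_trans[OF _ m[of x n]]) (use exhaust_3[of i] in auto)
    have p0: "?I (\<lambda>x. below A e x * (W x $ n)\<^sup>2) \<le> s" for n by (rule part[OF h(1) m0]) simp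
    have p1: "?I (\<lambda>x. below A e x * (D1 A (\<lambda>y. W y $ n) i x)\<^sup>2) \<le> s" for n i by (rule part[OF h(2) m1]) simp
    have p1': "?I (\<lambda>x. below A (e / 2) x * (D1 A (\<lambda>y. W y $ n) i x)\<^sup>2) \<le> s" for n i by (rule part[OF h(2) m1]) simp
    have p2: "?I (\<lambda>x. below A e x * (D2 A (\<lambda>y. W y $ n) i j x)\<^sup>2) \<le> C2 * (M * sqrt s)" for n i j
    proof -
      let ?t = "?I (\<lambda>x. below A (e / 2) x * (D1 A (\<lambda>y. W y $ n) j x)\<^sup>2)"
      have t: "?t \<le> s" by (rule p1')
      have "?I (\<lambda>x. below A e x * (D2 A (\<lambda>y. W y $ n) i j x)\<^sup>2) \<le> C2 * (Hk_norm 3 (Om A) (\<lambda>y. W y $ n) * sqrt ?t)"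
        using W by (intro snd) (simp add: H3_0bscN_def)
      also have "\<dots> \<le> C2 * (M * sqrt s)"
        using C2 M WM Hk_norm_le_HkN_norm[of 3 "Om A" W n] t s0
        by (intro mult_left_mono mult_mono real_sqrt_le_mono real_sqrt_ge_zero
          Bochner_Integration.integral_nonneg mult_nonneg_nonneg below_bounds(1) zero_le_power2) auto
      finally show ?thesis .
    qed
    define T where "T = sqrt (s + C2 * (M * sqrt s))"
    have T2: "T\<^sup>2 = s + C2 * (M * sqrt s)" using s0 C2 M by (simp add: T_def)
    have q: "0 \<le> C2 * (M * sqrt s)" using s0 C2 M by simp
    have TT: "T \<ge> 0" using s0 q by (simp add: T_def)
    have b1: "?I (\<lambda>x. below A e x * (W x $ n)\<^sup>2) \<le> T\<^sup>2" for n
      unfolding T2 by (rule order_trans[OF p0]) (use q in linarith)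
    have b2: "?I (\<lambda>x. below A e x * (D1 A (\<lambda>y. W y $ n) i x)\<^sup>2) \<le> T\<^sup>2" for n i
      unfolding T2 by (rule order_trans[OF p1]) (use q in linarith)
    have b3: "?I (\<lambda>x. below A e x * (D2 A (\<lambda>y. W y $ n) i j x)\<^sup>2) \<le> T\<^sup>2" for n i j
      unfolding T2 by (rule order_trans[OF p2]) (use s0 in linarith)
    have HT: "HkN_norm 2 (Om_eps A e) W \<le> c0 * T"
      using H2_norm_interior[OF e W3 TT b1 b2 b3] unfolding c0_def by (simp only: mult.assoc)
    have "s + C2 * (M * sqrt s) \<le> T0 * \<delta> powr (\<beta> / 2)"
    proof -
      have d1: "\<delta> \<le> 1" using \<delta> \<beta> by linarith
      have "s \<le> C' * \<delta> powr (\<beta> / 2)" unfolding s_def using \<beta> \<delta> d1 by (intro mult_left_mono powr_mono') auto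
      moreover have "sqrt s = sqrt C' * \<delta> powr (\<beta> / 2)"
        using \<delta> by (simp add: s_def real_sqrt_mult powr_half_sqrt[symmetric] powr_powr)
      ultimately show ?thesis by (simp add: T0_def algebra_simps)
    qed
    then have "T \<le> sqrt (T0 * \<delta> powr (\<beta> / 2))" unfolding T_def by (rule real_sqrt_le_mono)
    also have "\<dots> = sqrt T0 * \<delta> powr (\<beta> / 4)"
      using \<delta> by (simp add: real_sqrt_mult powr_half_sqrt[symmetric] powr_powr)
    finally have "c0 * T \<le> c0 * (sqrt T0 * \<delta> powr (\<beta> / 4))" using c0 by (rule mult_left_mono)
    also have "\<dots> \<le> (c0 * sqrt T0 + 1) * \<delta> powr (\<beta> / 4)" by (simp add: algebra_simps)
    finally show ?thesis using HT by linarith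
  qed
  moreover have "c0 * sqrt T0 + 1 > 0" using c0 T0 by (intro add_nonneg_pos mult_nonneg_nonneg) auto
  ultimately show ?thesis
    by (rule_tac exI[of _ \<beta>], rule_tac exI[of _ "c0 * sqrt T0 + 1"], rule_tac exI[of _ \<delta>1])
      (use \<beta> in blast)
qed

text \<open>The difference of the exact solution and its boundary lift is admissible in the minimization, and its
  functional is \<open>O(\<delta>\<^sup>2)\<close>. Hence so is the minimum, which bounds both the residual of the minimizer and
  its \<open>H\<^sup>3\<close> norm.\<close>

lemma minimizer_bounds:
  fixes U_ex F1_ex F1 V_min :: "real^3 \<Rightarrow> 'n::{finite,linorder} rvec"
  assumes A: "A > 0" and b: "b > 0" and K: "K \<ge> 0"
    and LK: "\<And>U::real^3 \<Rightarrow> 'n rvec. U \<in> HkN 3 (Om A) \<Longrightarrow>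
      (LINT x|lebesgue_on (Om A). (norm (L_op A b d U x))\<^sup>2) \<le> K * (HkN_norm 2 (Om A) U)\<^sup>2"
    and U: "U_ex \<in> HkN 3 (Om A)" "AE x in lebesgue_on (Om A). L_op A b d U_ex x = 0" "boundary_data A p0 p1 U_ex"
    and Fe: "F1_ex \<in> HkN 3 (Om A)" "boundary_data A p0 p1 F1_ex"
    and F: "F1 \<in> HkN 3 (Om A)" "HkN_norm 2 (Om A) (\<lambda>x. F1 x - F1_ex x) \<le> \<delta>" and \<delta>: "\<delta> > 0"
    and min: "is_arg_min (J_fun A b d \<delta> F1) (\<lambda>V. V \<in> H3_0bscN A) V_min"
  defines "m \<equiv> HkN_norm 3 (Om A) (\<lambda>x. U_ex x - F1_ex x)" and "W \<equiv> \<lambda>x. V_min x - (U_ex x - F1_ex x)"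
  shows "W \<in> H3_0bscN A" "HkN_norm 3 (Om A) W \<le> sqrt (K + m\<^sup>2) + m"
    "(LINT x|lebesgue_on (Om A). (norm (L_op A b d W x))\<^sup>2) \<le> 4 * (K + m\<^sup>2) * \<delta>\<^sup>2"
proof -
  let ?I = "\<lambda>f. LINT x|lebesgue_on (Om A). f x" and ?H = "HkN_norm 3 (Om A)"
  let ?V = "\<lambda>x. U_ex x - F1_ex x" and ?G = "\<lambda>x. F1 x - F1_ex x"
  have V: "?V \<in> H3_0bscN A" by (rule boundary_data_diff[OF A U(1,3) Fe])
  have Vm: "V_min \<in> H3_0bscN A" using min by (simp add: is_arg_min_def)
  show W: "W \<in> H3_0bscN A" unfolding W_def by (rule H3_0bscN_diff[OF A Vm V])
  have G: "?G \<in> HkN 3 (Om A)" unfolding HkN_def using Hk_diff[OF Om_lebesgue HkN_nth[OF F(1)] HkN_nth[OF Fe(1)]] by simp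
  have add: "(\<lambda>y. X y + Y y) \<in> HkN 3 (Om A)" if "X \<in> HkN 3 (Om A)" "Y \<in> HkN 3 (Om A)" for X Y :: "real^3 \<Rightarrow> 'n rvec"
    unfolding HkN_def using Hk_add[OF Om_lebesgue HkN_nth[OF that(1)] HkN_nth[OF that(2)]] by simp
  define X Y where "X y = V_min y + F1 y" and "Y y = ?V y + F1 y" for y
  have X3: "X \<in> HkN 3 (Om A)" unfolding X_def[abs_def] by (intro add H3_0bscN_HkN Vm F)
  have Y3: "Y \<in> HkN 3 (Om A)" unfolding Y_def[abs_def] by (intro add H3_0bscN_HkN V F)
  have Yeq: "Y = (\<lambda>y. U_ex y + 1 *\<^sub>R ?G y)" by (rule ext) (simp add: Y_def)
  have Ni: "integrable (lebesgue_on (Om A)) (\<lambda>x. (norm (L_op A b d U x))\<^sup>2)" if "U \<in> HkN 3 (Om A)" for U :: "real^3 \<Rightarrow> 'n rvec"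
    by (rule L_op_norm_sq_integrable[OF b that])
  have "AE x in lebesgue_on (Om A). L_op A b d Y x = L_op A b d ?G x"
    using L_op_lincomb_AE[OF U(1) G, of b d 1] U(2) unfolding Yeq by eventually_elim simp
  then have "AE x in lebesgue_on (Om A). (norm (L_op A b d Y x))\<^sup>2 = (norm (L_op A b d ?G x))\<^sup>2"
    by (rule eventually_mono) simp
  then have "?I (\<lambda>x. (norm (L_op A b d Y x))\<^sup>2) = ?I (\<lambda>x. (norm (L_op A b d ?G x))\<^sup>2)"
    using Ni[OF Y3] Ni[OF G] by (intro integral_cong_AE) auto
  also have "\<dots> \<le> K * (HkN_norm 2 (Om A) ?G)\<^sup>2" by (rule LK[OF G])
  also have "\<dots> \<le> K * \<delta>\<^sup>2" using F(2) K HkN_norm_nonneg by (intro mult_left_mono power_mono) auto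
  finally have LY: "?I (\<lambda>x. (norm (L_op A b d Y x))\<^sup>2) \<le> K * \<delta>\<^sup>2" .
  have "J_fun A b d \<delta> F1 V_min \<le> J_fun A b d \<delta> F1 ?V"
    using min V unfolding is_arg_min_def by (meson not_le)
  also have "\<dots> \<le> (K + m\<^sup>2) * \<delta>\<^sup>2"
    unfolding J_fun_def Y_def[abs_def, symmetric] m_def[symmetric] using LY by (simp add: algebra_simps)
  finally have J: "?I (\<lambda>x. (norm (L_op A b d X x))\<^sup>2) + \<delta>\<^sup>2 * (?H V_min)\<^sup>2 \<le> (K + m\<^sup>2) * \<delta>\<^sup>2"
    unfolding J_fun_def X_def[abs_def, symmetric] .
  have I0: "0 \<le> ?I (\<lambda>x. (norm (L_op A b d X x))\<^sup>2)" by simp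
  have d2: "\<delta>\<^sup>2 > 0" using \<delta> by simp
  have LX: "?I (\<lambda>x. (norm (L_op A b d X x))\<^sup>2) \<le> (K + m\<^sup>2) * \<delta>\<^sup>2"
    using J d2 by (smt (verit) mult_nonneg_nonneg zero_le_power2)
  have "\<delta>\<^sup>2 * (?H V_min)\<^sup>2 \<le> \<delta>\<^sup>2 * (K + m\<^sup>2)" using J I0 unfolding mult.commute[of "\<delta>\<^sup>2" "K + m\<^sup>2"] by linarith
  then have "(?H V_min)\<^sup>2 \<le> K + m\<^sup>2" using d2 by (rule mult_left_le_imp_le)
  then have Vn: "?H V_min \<le> sqrt (K + m\<^sup>2)" by (rule real_le_rsqrt)
  have "?H W \<le> ?H V_min + ?H ?V" unfolding W_def
    by (rule HkN_norm_triangle(2)[OF open_Om H3_0bscN_HkN[OF Vm] H3_0bscN_HkN[OF V]])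
  with Vn show "?H W \<le> sqrt (K + m\<^sup>2) + m" by (simp add: m_def)
  have Weq: "W = (\<lambda>y. X y + (-1) *\<^sub>R Y y)" by (rule ext) (simp add: W_def X_def Y_def)
  have "?I (\<lambda>x. (norm (L_op A b d W x))\<^sup>2) \<le> ?I (\<lambda>x. 2 * (norm (L_op A b d X x))\<^sup>2 + 2 * (norm (L_op A b d Y x))\<^sup>2)"
  proof (rule integral_mono_AE)
    show "integrable (lebesgue_on (Om A)) (\<lambda>x. (norm (L_op A b d W x))\<^sup>2)" by (rule Ni[OF H3_0bscN_HkN[OF W]])
    show "integrable (lebesgue_on (Om A)) (\<lambda>x. 2 * (norm (L_op A b d X x))\<^sup>2 + 2 * (norm (L_op A b d Y x))\<^sup>2)"
      by (intro Bochner_Integration.integrable_add integrable_mult_right Ni X3 Y3)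
    have "(norm (u - v))\<^sup>2 \<le> 2 * (norm u)\<^sup>2 + 2 * (norm v)\<^sup>2" for u v :: "'n rvec"
    proof -
      have "(norm (u - v))\<^sup>2 \<le> (norm u + norm v)\<^sup>2" by (intro power_mono norm_triangle_ineq4) simp
      also have "\<dots> \<le> 2 * (norm u)\<^sup>2 + 2 * (norm v)\<^sup>2"
        using zero_le_power2[of "norm u - norm v"] by (simp add: power2_eq_square algebra_simps)
      finally show ?thesis .
    qed
    then show "AE x in lebesgue_on (Om A). (norm (L_op A b d W x))\<^sup>2 \<le> 2 * (norm (L_op A b d X x))\<^sup>2 + 2 * (norm (L_op A b d Y x))\<^sup>2"
      using L_op_lincomb_AE[OF X3 Y3, of b d "-1"] unfolding Weq by (auto elim: eventually_mono)
  qed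
  also have "\<dots> = 2 * ?I (\<lambda>x. (norm (L_op A b d X x))\<^sup>2) + 2 * ?I (\<lambda>x. (norm (L_op A b d Y x))\<^sup>2)"
    using Ni[OF X3] Ni[OF Y3] by simp
  also have "\<dots> \<le> 2 * ((K + m\<^sup>2) * \<delta>\<^sup>2) + 2 * (K * \<delta>\<^sup>2)" using LX LY by linarith
  also have "\<dots> \<le> 4 * (K + m\<^sup>2) * \<delta>\<^sup>2" by (simp add: algebra_simps)
  finally show "?I (\<lambda>x. (norm (L_op A b d W x))\<^sup>2) \<le> 4 * (K + m\<^sup>2) * \<delta>\<^sup>2" .
qed

theorem theorem7p3:
  fixes A b d R :: real
  assumes "A > 0" "b > 0" "d > 0"
    and "CARD('n::{finite,linorder}) > 1"
    and "R > A"
  shows "\<exists>B>0. \<exists>B'>0. \<forall>\<epsilon>\<in>{0<..<A}.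
    \<forall>(U_ex :: real^3 \<Rightarrow> 'n rvec) F1_ex \<phi>0_ex \<phi>1_ex.
      U_ex \<in> HkN 3 (Om A) \<and>
      (AE x in lebesgue_on (Om A). L_op A b d U_ex x = 0) \<and>
      boundary_data A \<phi>0_ex \<phi>1_ex U_ex \<and>
      F1_ex \<in> HkN 3 (Om A) \<and>
      boundary_data A \<phi>0_ex \<phi>1_ex F1_ex \<longrightarrow>
      (\<exists>\<delta>0\<in>{0<..<1}. \<exists>\<alpha>\<in>{0<..<1/2}. \<forall>\<delta>\<in>{0<..<\<delta>0}.
        \<forall>(F1 :: real^3 \<Rightarrow> 'n rvec) \<phi>0 \<phi>1 V_min U_min.
          F1 \<in> HkN 3 (Om A) \<and>
          boundary_data A \<phi>0 \<phi>1 F1 \<and>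
          HkN_norm 2 (Om A) (\<lambda>x. F1 x - F1_ex x) \<le> \<delta> \<and>
          is_arg_min (J_fun A b d \<delta> F1) (\<lambda>V. V \<in> H3_0bscN A) V_min \<and>
          U_min = (\<lambda>x. V_min x + F1 x) \<longrightarrow>
          HkN_norm 2 (Om_eps A \<epsilon>) (\<lambda>x. U_min x - U_ex x)
            \<le> B * (1 + HkN_norm 3 (Om A) U_ex + HkN_norm 3 (Om A) F1_ex) * \<delta> powr \<alpha> \<and>
          L2_norm (Om_eps A \<epsilon>) (\<lambda>x. Q_rec A b d U_min x - Q_rec A b d U_ex x)
            \<le> B' * (1 + HkN_norm 3 (Om A) U_ex + HkN_norm 3 (Om A) F1_ex) * \<delta> powr \<alpha>)"
proof -
  note A = assms(1) and b = assms(2) and R = assms(5)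
  obtain K where K: "K > 0" and LK: "\<And>U::real^3 \<Rightarrow> 'n rvec. U \<in> HkN 3 (Om A) \<Longrightarrow>
      (LINT x|lebesgue_on (Om A). (norm (L_op A b d U x))\<^sup>2) \<le> K * (HkN_norm 2 (Om A) U)\<^sup>2"
    using L_op_bounds[OF b, of A d, where 'n = 'n] by blast
  obtain CQ where CQ: "CQ > 0" and Q: "\<And>e (U::real^3 \<Rightarrow> 'n rvec) V. e > 0 \<Longrightarrow> U \<in> HkN 3 (Om A) \<Longrightarrow> V \<in> HkN 3 (Om A) \<Longrightarrow>
    L2_norm (Om_eps A e) (\<lambda>x. Q_rec A b d U x - Q_rec A b d V x) \<le> CQ * HkN_norm 2 (Om_eps A e) (\<lambda>x. U x - V x)"
    using Q_rec_bound[OF b, where A = A and d = d and 'n = 'n] by blast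
  have key: "\<exists>\<delta>0\<in>{0<..<1}. \<exists>\<alpha>\<in>{0<..<1/2}. \<forall>\<delta>\<in>{0<..<\<delta>0}. \<forall>(F1 :: real^3 \<Rightarrow> 'n rvec) V_min.
      F1 \<in> HkN 3 (Om A) \<longrightarrow> HkN_norm 2 (Om A) (\<lambda>x. F1 x - F1_ex x) \<le> \<delta> \<longrightarrow>
      is_arg_min (J_fun A b d \<delta> F1) (\<lambda>V. V \<in> H3_0bscN A) V_min \<longrightarrow>
      HkN_norm 2 (Om_eps A e) (\<lambda>x. V_min x + F1 x - U_ex x) \<le> \<delta> powr \<alpha> \<and>
      L2_norm (Om_eps A e) (\<lambda>x. Q_rec A b d (\<lambda>x. V_min x + F1 x) x - Q_rec A b d U_ex x) \<le> \<delta> powr \<alpha>"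
    if e: "e > 0" and U: "U_ex \<in> HkN 3 (Om A)" "AE x in lebesgue_on (Om A). L_op A b d U_ex x = 0" "boundary_data A p0 p1 U_ex"
      and Fe: "F1_ex \<in> HkN 3 (Om A)" "boundary_data A p0 p1 F1_ex"
    for e p0 p1 and U_ex F1_ex :: "real^3 \<Rightarrow> 'n rvec"
  proof -
    define m where "m = HkN_norm 3 (Om A) (\<lambda>x. U_ex x - F1_ex x)"
    define M where "M = sqrt (K + m\<^sup>2) + m"
    have m0: "m \<ge> 0" by (simp add: m_def HkN_norm_nonneg)
    have M0: "M \<ge> 0" using K m0 by (simp add: M_def)
    have K4: "4 * (K + m\<^sup>2) \<ge> 0" using K by simp
    obtain \<beta> C \<delta>1 where \<beta>: "0 < \<beta>" "\<beta> \<le> 1" "C > 0" "0 < \<delta>1" "\<delta>1 < 1"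
      and H: "\<And>\<delta> (W::real^3 \<Rightarrow> 'n rvec). 0 < \<delta> \<Longrightarrow> \<delta> < \<delta>1 \<Longrightarrow> W \<in> H3_0bscN A \<Longrightarrow> HkN_norm 3 (Om A) W \<le> M \<Longrightarrow>
        (LINT x|lebesgue_on (Om A). (norm (L_op A b d W x))\<^sup>2) \<le> 4 * (K + m\<^sup>2) * \<delta>\<^sup>2 \<Longrightarrow>
        HkN_norm 2 (Om_eps A e) W \<le> C * \<delta> powr (\<beta> / 4)"
      using holder_stability[OF A b R e M0 K4, of d, where 'n = 'n] by blast
    define G where "G = (C + 1) * (1 + CQ)"
    have G: "G > 0" using \<beta> CQ by (simp add: G_def)
    \<comment> \<open>Half of the exponent is spent on making all constants equal to 1.\<close>
    define \<delta>0 where "\<delta>0 = min \<delta>1 ((1 / G) powr (8 / \<beta>))"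
    have \<delta>0: "0 < \<delta>0" "\<delta>0 < 1" using \<beta> G by (auto simp: \<delta>0_def)
    show ?thesis
    proof (rule bexI[of _ \<delta>0], rule bexI[of _ "\<beta> / 8"], intro ballI allI impI)
      fix \<delta> and F1 V_min :: "real^3 \<Rightarrow> 'n rvec"
      assume dd: "\<delta> \<in> {0<..<\<delta>0}" and F: "F1 \<in> HkN 3 (Om A)" "HkN_norm 2 (Om A) (\<lambda>x. F1 x - F1_ex x) \<le> \<delta>"
        and min: "is_arg_min (J_fun A b d \<delta> F1) (\<lambda>V. V \<in> H3_0bscN A) V_min"
      have \<delta>: "0 < \<delta>" "\<delta> < \<delta>1" "\<delta> \<le> (1 / G) powr (8 / \<beta>)" using dd by (auto simp: \<delta>0_def)
      define W where "W x = V_min x - (U_ex x - F1_ex x)" for x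
      note mb = minimizer_bounds[OF A b less_imp_le[OF K] LK U Fe F \<delta>(1) min, folded m_def M_def W_def]
      have W: "HkN_norm 2 (Om_eps A e) W \<le> C * \<delta> powr (\<beta> / 4)"
        by (rule H[OF \<delta>(1,2) mb(1) mb(2)[folded M_def] mb(3)])
      have Vm: "V_min \<in> HkN 3 (Om A)" using min by (intro H3_0bscN_HkN) (simp add: is_arg_min_def)
      have W3: "W \<in> HkN 3 (Om A)" using mb(1) by (rule H3_0bscN_HkN)
      let ?D = "\<lambda>x. F1 x - F1_ex x"
      have D3: "?D \<in> HkN 3 (Om A)" unfolding HkN_def using Hk_diff[OF Om_lebesgue HkN_nth[OF F(1)] HkN_nth[OF Fe(1)]] by simp
      have Um: "(\<lambda>x. V_min x + F1 x) \<in> HkN 3 (Om A)" unfolding HkN_def using Hk_add[OF Om_lebesgue HkN_nth[OF Vm] HkN_nth[OF F(1)]] by simp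
      have sub: "X \<in> HkN 2 (Om_eps A e)" if "X \<in> HkN 3 (Om A)" for X :: "real^3 \<Rightarrow> 'n rvec"
        using that Hk_subset[OF Hk_mono[of 2 3] Om_eps_subset[OF e] Om_eps_lebesgue Om_lebesgue] unfolding HkN_def by simp
      have D2: "?D \<in> HkN 2 (Om A)" using D3 Hk_mono[of 2 3] unfolding HkN_def by simp
      have eq: "(\<lambda>x. V_min x + F1 x - U_ex x) = (\<lambda>x. W x + ?D x)" by (rule ext) (simp add: W_def)
      have "HkN_norm 2 (Om_eps A e) (\<lambda>x. V_min x + F1 x - U_ex x) \<le> HkN_norm 2 (Om_eps A e) W + HkN_norm 2 (Om_eps A e) ?D"
        unfolding eq by (rule HkN_norm_triangle(1)[OF open_Om_eps sub[OF W3] sub[OF D3]])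
      also have "HkN_norm 2 (Om_eps A e) ?D \<le> \<delta>" using HkN_norm_Om_eps_mono[OF e D2] F(2) by simp
      also have "\<delta> \<le> \<delta> powr (\<beta> / 4)"
        using powr_mono'[of "\<beta> / 4" 1 \<delta>] \<delta> \<beta> by simp
      finally have 1: "HkN_norm 2 (Om_eps A e) (\<lambda>x. V_min x + F1 x - U_ex x) \<le> (C + 1) * \<delta> powr (\<beta> / 4)"
        using W by (simp add: algebra_simps)
      have "\<delta> powr (\<beta> / 8) \<le> ((1 / G) powr (8 / \<beta>)) powr (\<beta> / 8)" using \<delta> \<beta> by (intro powr_mono2) auto
      also have "\<dots> = 1 / G" using \<beta> G by (simp add: powr_powr)
      finally have 2: "G * \<delta> powr (\<beta> / 8) \<le> 1" using G by (simp add: field_simps)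
      have sq: "\<delta> powr (\<beta> / 4) = \<delta> powr (\<beta> / 8) * \<delta> powr (\<beta> / 8)" by (simp add: powr_add[symmetric])
      have small: "G * \<delta> powr (\<beta> / 4) \<le> \<delta> powr (\<beta> / 8)"
        using mult_right_mono[OF 2, of "\<delta> powr (\<beta> / 8)"] by (simp add: sq mult.assoc)
      have P: "\<delta> powr (\<beta> / 4) \<ge> 0" by simp
      show "HkN_norm 2 (Om_eps A e) (\<lambda>x. V_min x + F1 x - U_ex x) \<le> \<delta> powr (\<beta> / 8) \<and>
        L2_norm (Om_eps A e) (\<lambda>x. Q_rec A b d (\<lambda>x. V_min x + F1 x) x - Q_rec A b d U_ex x) \<le> \<delta> powr (\<beta> / 8)"
      proof
        have "(C + 1) * \<delta> powr (\<beta> / 4) \<le> G * \<delta> powr (\<beta> / 4)"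
          using \<beta> CQ P by (intro mult_right_mono) (simp_all add: G_def algebra_simps)
        with 1 small show "HkN_norm 2 (Om_eps A e) (\<lambda>x. V_min x + F1 x - U_ex x) \<le> \<delta> powr (\<beta> / 8)" by linarith
        have "L2_norm (Om_eps A e) (\<lambda>x. Q_rec A b d (\<lambda>x. V_min x + F1 x) x - Q_rec A b d U_ex x)
           \<le> CQ * HkN_norm 2 (Om_eps A e) (\<lambda>x. V_min x + F1 x - U_ex x)" by (rule Q[OF e Um U(1)])
        also have "\<dots> \<le> CQ * ((C + 1) * \<delta> powr (\<beta> / 4))" using 1 CQ by (intro mult_left_mono) auto
        also have "\<dots> = (CQ * (C + 1)) * \<delta> powr (\<beta> / 4)" by simp
        also have "\<dots> \<le> G * \<delta> powr (\<beta> / 4)"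
          using \<beta> CQ P by (intro mult_right_mono) (simp_all add: G_def algebra_simps)
        finally show "L2_norm (Om_eps A e) (\<lambda>x. Q_rec A b d (\<lambda>x. V_min x + F1 x) x - Q_rec A b d U_ex x) \<le> \<delta> powr (\<beta> / 8)"
          using small by linarith
      qed
    qed (use \<beta> \<delta>0 in auto)
  qed
  have one: "t \<le> \<delta> powr \<alpha> \<Longrightarrow> t \<le> 1 * (1 + HkN_norm 3 (Om A) X + HkN_norm 3 (Om A) Y) * \<delta> powr \<alpha>"
    for t \<delta> \<alpha> and X Y :: "real^3 \<Rightarrow> 'n rvec"
    using mult_right_mono[of 1 "1 + HkN_norm 3 (Om A) X + HkN_norm 3 (Om A) Y" "\<delta> powr \<alpha>"]
      HkN_norm_nonneg[of 3 "Om A" X] HkN_norm_nonneg[of 3 "Om A" Y] by simp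
  show ?thesis
  proof (rule exI[of _ 1], rule conjI[OF zero_less_one], rule exI[of _ 1], rule conjI[OF zero_less_one],
      intro ballI allI impI, elim conjE)
    fix \<epsilon> and U_ex F1_ex p0 p1 :: "real^3 \<Rightarrow> 'n rvec"
    assume e: "\<epsilon> \<in> {0<..<A}" and U: "U_ex \<in> HkN 3 (Om A)" "AE x in lebesgue_on (Om A). L_op A b d U_ex x = 0" "boundary_data A p0 p1 U_ex"
      and Fe: "F1_ex \<in> HkN 3 (Om A)" "boundary_data A p0 p1 F1_ex"
    from e have "\<epsilon> > 0" by simp
    from key[OF this U Fe] obtain \<delta>0 \<alpha> where da: "\<delta>0 \<in> {0<..<1}" "\<alpha> \<in> {0<..<1/2}"
      and k: "\<And>\<delta> (F1 :: real^3 \<Rightarrow> 'n rvec) V_min. \<delta> \<in> {0<..<\<delta>0} \<Longrightarrow>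
      F1 \<in> HkN 3 (Om A) \<Longrightarrow> HkN_norm 2 (Om A) (\<lambda>x. F1 x - F1_ex x) \<le> \<delta> \<Longrightarrow>
      is_arg_min (J_fun A b d \<delta> F1) (\<lambda>V. V \<in> H3_0bscN A) V_min \<Longrightarrow>
      HkN_norm 2 (Om_eps A \<epsilon>) (\<lambda>x. V_min x + F1 x - U_ex x) \<le> \<delta> powr \<alpha> \<and>
      L2_norm (Om_eps A \<epsilon>) (\<lambda>x. Q_rec A b d (\<lambda>x. V_min x + F1 x) x - Q_rec A b d U_ex x) \<le> \<delta> powr \<alpha>" by blast
    show "\<exists>\<delta>0\<in>{0<..<1}. \<exists>\<alpha>\<in>{0<..<1/2}. \<forall>\<delta>\<in>{0<..<\<delta>0}.
        \<forall>(F1 :: real^3 \<Rightarrow> 'n rvec) \<phi>0 \<phi>1 V_min U_min.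
          F1 \<in> HkN 3 (Om A) \<and>
          boundary_data A \<phi>0 \<phi>1 F1 \<and>
          HkN_norm 2 (Om A) (\<lambda>x. F1 x - F1_ex x) \<le> \<delta> \<and>
          is_arg_min (J_fun A b d \<delta> F1) (\<lambda>V. V \<in> H3_0bscN A) V_min \<and>
          U_min = (\<lambda>x. V_min x + F1 x) \<longrightarrow>
          HkN_norm 2 (Om_eps A \<epsilon>) (\<lambda>x. U_min x - U_ex x)
            \<le> 1 * (1 + HkN_norm 3 (Om A) U_ex + HkN_norm 3 (Om A) F1_ex) * \<delta> powr \<alpha> \<and>
          L2_norm (Om_eps A \<epsilon>) (\<lambda>x. Q_rec A b d U_min x - Q_rec A b d U_ex x)
            \<le> 1 * (1 + HkN_norm 3 (Om A) U_ex + HkN_norm 3 (Om A) F1_ex) * \<delta> powr \<alpha>"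
      by (rule bexI[OF _ da(1)], rule bexI[OF _ da(2)], intro ballI allI impI, elim conjE, hypsubst,
        intro conjI one k[THEN conjunct1] k[THEN conjunct2])
  qed
qed

end
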